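(* Let $M>0$, $s\ge 4$ and $1\le p,q\le\infty$. Consider spacetime functions $u:\mathbb{R}\times\mathbb{R}^2\to\mathbb{C}$ satisfying $$\|u(t)\|_{\dot H^1_x(\mathbb{R}^2)}\le 1\quad\text{and}\quad \|u(t)\|_{L^2_x(\mathbb{R}^2)}^2=M\qquad\text{for every }t\in\mathbb{R}.\tag{1}$$ If $$\frac{q'}{p}>1,\tag{2}$$ then every $u$ satisfying (1) obeys $$\bigl\||u|^s e^{4\pi|u|^2}\bigr\|_{L^p_tL^q_x(\mathbb{R}\times\mathbb{R}^2)}\lesssim_M \|u\|_{L^4_tH^{1,4}_x(\mathbb{R}\times\mathbb{R}^2)}^{4/p}.\tag{3}$$ Conversely, if (3) holds for all $u$ satisfying (1), then $p$ and $q$ must satisfy (2).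
   Context: $q'$ denotes the Hölder conjugate of $q$, and the condition $q'/p>1$ is equivalent to $\frac1p+\frac1q>1$. $\|f\|_{L^p_tL^q_x}=\left(\int_{\mathbb{R}}\|f(t)\|_{L^q_x(\mathbb{R}^2)}^p\,dt\right)^{1/p}$ with the usual modification for infinite exponents. $\|f\|_{\dot H^1_x}=\|\nabla f\|_{L^2_x}$ and $\|f\|_{H^{1,4}_x}=\|\langle\nabla\rangle f\|_{L^4_x}$, where $\langle\nabla\rangle$ is the Fourier multiplier with symbol $(1+|\xi|^2)^{1/2}$. $X\lesssim_M Y$ means $X\le CY$ with a constant $C$ depending on $M$ (and on the fixed exponents $s,p,q$) but not on $u$. *)

theory Defs
  imports "HOL-Analysis.Analysis" "HOL-Probability.Essential_Supremum"
begin

(* For a \<ge> 0; by convention x^0 = 1 for every x, including x = 0 and x = \<infinity>. *)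
definition ennreal_pow :: "ennreal \<Rightarrow> real \<Rightarrow> ennreal" where
  "ennreal_pow x a =
     (if a = 0 then 1 else if x = \<infinity> then \<infinity> else ennreal (enn2real x powr a))"

(* In ennreal, inverse 0 = \<infinity> and inverse \<infinity> = 0, so 1 and \<infinity> are conjugate to each other. *)
definition holder_conj :: "ennreal \<Rightarrow> ennreal" where
  "holder_conj q = inverse (1 - inverse q)"

definition Lp_norm :: "ennreal \<Rightarrow> 'a measure \<Rightarrow> ('a \<Rightarrow> ennreal) \<Rightarrow> ennreal" where
  "Lp_norm p N F =
     (if p = \<infinity> then esssup N F
      else ennreal_pow (\<integral>\<^sup>+ x. ennreal_pow (F x) (enn2real p) \<partial>N) (1 / enn2real p))"

abbreviation Lnorm :: "ennreal \<Rightarrow> ('a::euclidean_space \<Rightarrow> 'b::real_normed_vector) \<Rightarrow> ennreal" where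
  "Lnorm p f \<equiv> Lp_norm p lebesgue (\<lambda>x. ennreal (norm (f x)))"

definition mixed_norm ::
  "ennreal \<Rightarrow> ennreal \<Rightarrow> (real \<Rightarrow> 'a::euclidean_space \<Rightarrow> 'b::real_normed_vector) \<Rightarrow> ennreal" where
  "mixed_norm p q f = Lp_norm p lebesgue (\<lambda>t. Lnorm q (f t))"

definition partial :: "'n::finite \<Rightarrow> (real^'n \<Rightarrow> complex) \<Rightarrow> real^'n \<Rightarrow> complex" where
  "partial j \<phi> x = frechet_derivative \<phi> (at x) (axis j 1)"

definition schwartz :: "(real^'n::finite \<Rightarrow> complex) set" where
  "schwartz = {\<phi>. \<forall>js. (\<forall>x. foldr partial js \<phi> differentiable (at x)) \<and>
                      (\<forall>k::nat. bounded (range (\<lambda>x. norm x ^ k *\<^sub>R foldr partial js \<phi> x)))}"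

definition fourier :: "(real^'n::finite \<Rightarrow> complex) \<Rightarrow> real^'n \<Rightarrow> complex" where
  "fourier f \<xi> = (LINT x|lebesgue. cis (- (x \<bullet> \<xi>)) * f x)"

definition inv_fourier :: "(real^'n::finite \<Rightarrow> complex) \<Rightarrow> real^'n \<Rightarrow> complex" where
  "inv_fourier g x =
     complex_of_real (1 / (2 * pi) ^ CARD('n)) * (LINT \<xi>|lebesgue. cis (x \<bullet> \<xi>) * g \<xi>)"

(* The operator m(D) on Schwartz functions, D = -i \<nabla>. *)
definition mult_op ::
  "(real^'n::finite \<Rightarrow> complex) \<Rightarrow> (real^'n \<Rightarrow> complex) \<Rightarrow> real^'n \<Rightarrow> complex" where
  "mult_op m \<phi> = inv_fourier (\<lambda>\<xi>. m \<xi> * fourier \<phi> \<xi>)"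

(* S = T as tempered distributions, where S \<phi> = \<integral> g \<phi> and T \<phi> = \<integral> f (A \<phi>). Integrability is
   demanded because the Bochner integral of a non-integrable function is 0. *)
definition tempered_eq ::
  "(real^'n::finite \<Rightarrow> complex) \<Rightarrow> (real^'n \<Rightarrow> complex) \<Rightarrow>
   ((real^'n \<Rightarrow> complex) \<Rightarrow> real^'n \<Rightarrow> complex) \<Rightarrow> bool" where
  "tempered_eq g f A \<longleftrightarrow>
     (\<forall>\<phi>\<in>schwartz. integrable lebesgue (\<lambda>x. g x * \<phi> x) \<and>
                 integrable lebesgue (\<lambda>x. f x * A \<phi> x) \<and>
                 (LINT x|lebesgue. g x * \<phi> x) = (LINT x|lebesgue. f x * A \<phi> x))"

(* G = \<nabla>f in the sense of tempered distributions. *)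
definition is_gradient :: "(real^'n::finite \<Rightarrow> complex) \<Rightarrow> (real^'n \<Rightarrow> complex^'n) \<Rightarrow> bool" where
  "is_gradient f G \<longleftrightarrow> G \<in> borel_measurable lebesgue \<and>
     (\<forall>j. tempered_eq (\<lambda>x. G x $ j) f (\<lambda>\<phi> x. - partial j \<phi> x))"

(* g = m(D) f in the sense of tempered distributions; the transpose of m(D) is m(-D). *)
definition is_multiplier ::
  "(real^'n::finite \<Rightarrow> complex) \<Rightarrow> (real^'n \<Rightarrow> complex) \<Rightarrow> (real^'n \<Rightarrow> complex) \<Rightarrow> bool" where
  "is_multiplier m f g \<longleftrightarrow> g \<in> borel_measurable lebesgue \<and>
     tempered_eq g f (mult_op (\<lambda>\<xi>. m (- \<xi>)))"

definition bracket :: "real^'n::finite \<Rightarrow> complex" where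
  "bracket \<xi> = complex_of_real (sqrt (1 + (norm \<xi>)\<^sup>2))"

(* In the next two definitions the function over which the infimum is taken is unique almost
   everywhere if it exists; if it does not exist, the norm is Inf {} = \<infinity>. *)
definition H1dot_norm :: "(real^'n::finite \<Rightarrow> complex) \<Rightarrow> ennreal" where
  "H1dot_norm f = Inf {Lnorm 2 G | G. is_gradient f G}"

definition H1_norm :: "ennreal \<Rightarrow> (real^'n::finite \<Rightarrow> complex) \<Rightarrow> ennreal" where
  "H1_norm r f = Inf {Lnorm r g | g. is_multiplier bracket f g}"

definition admissible :: "real \<Rightarrow> (real \<Rightarrow> real^2 \<Rightarrow> complex) \<Rightarrow> bool" where
  "admissible M u \<longleftrightarrow>
     (\<lambda>(t, x). u t x) \<in> borel_measurable lebesgue \<and>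
     (\<forall>t. u t \<in> borel_measurable lebesgue \<and>
          H1dot_norm (u t) \<le> 1 \<and> (Lnorm 2 (u t))\<^sup>2 = ennreal M)"

end

theory Submission
 imports Defs "HOL-Probability.Probability"
begin

text \<open>
 For a fixed time, let \<open>f\<^sub>a\<close> be the heat evolution of \<open>f\<close> at time \<open>a\<close>. Duality with the resolvent
 of the Laplacian gives the sharp logarithmic bound
 \<open>4\<pi> |f\<^sub>a|\<^sup>2 \<le> (1 + \<delta>) (ln (1 + 1/2a) + C)\<close> and, tested against a level set instead of a point,
 the subcritical Moser-Trudinger tail \<open>exp (- 4\<pi> (1 - \<delta>) h\<^sup>2)\<close> for the measure of \<open>|f\<^sub>a| \<ge> h\<close>.
 Writing \<open>\<langle>\<xi>\<rangle>\<^sup>-\<^sup>1\<close> as a superposition of Gaussians gives \<open>|f\<^sub>a - f| \<le> C \<gamma> a\<^bsup>1/4\<^esup>\<close> with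
 \<open>\<gamma>\<close> the norm of \<open>f\<close> in \<open>H\<^bsup>1,4\<^esup>\<close>. At \<open>a = \<gamma>\<^bsup>-4\<^esup>\<close> the two bounds yield the Brezis-Gallouet type estimate
 \<open>exp (4\<pi> sup |f|\<^sup>2) \<le> C \<gamma>\<^bsup>4+\<delta>\<^esup>\<close>. Hence all but \<open>1 - \<delta>\<close> of the \<open>q\<close> exponentials in the
 \<open>L\<^sup>q\<close> norm cost \<open>\<gamma>\<^bsup>4(q-1+\<delta>)\<^esup>\<close> and the rest is integrable by the tail bound; this is
 at most \<open>\<gamma>\<^bsup>4q/p\<^esup>\<close> exactly when \<open>q - 1 < q/p\<close>. Conversely, mollified logarithmic (Moser) profiles
 concentrating at scale \<open>\<epsilon>\<close> for \<open>|t| \<le> 1\<close> and spreading out for large \<open>|t|\<close> violate the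
 estimate when \<open>1/p + 1/q \<le> 1\<close>.
\<close>

section \<open>Heat kernels on the plane\<close>

text \<open>The gradient and the bracket multiplier are given only as tempered distributions. For
  the direct estimate they are tested with translated heat kernels and first derivatives of such
  kernels alone, so all kernels are explicit Gaussians and all pairings between them have closed
  forms. The condition 1/p + 1/q > 1 is strict and leaves a margin \<delta>: the sharp constant
  4\<pi> is needed only up to a factor close to 1, so no critical Moser-Trudinger inequality enters.
  All bounds for the heat evolution are uniform in small times, and Fatou's lemma carries them to
  the function itself. The time variable is passive: for finite exponents the p-th power of the L^q
  norm at a fixed time is bounded by the fourth power of the H^{1,4} norm at that time, and this
  integrates.\<close>

lemma Fubini_swap:
 fixes f :: "'a \<Rightarrow> 'b \<Rightarrow> 'c::{banach, second_countable_topology}"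
 assumes "sigma_finite_measure M" "sigma_finite_measure N"
  and meas [measurable]: "case_prod f \<in> borel_measurable (M \<Otimes>\<^sub>M N)"
  and fin: "(\<integral>\<^sup>+x. \<integral>\<^sup>+y. ennreal (norm (f x y)) \<partial>N \<partial>M) < \<infinity>"
 shows Fubini_swap_eq: "(LINT x|M. LINT y|N. f x y) = (LINT y|N. LINT x|M. f x y)"
  and Fubini_swap_fst: "integrable M (\<lambda>x. LINT y|N. f x y)"
  and Fubini_swap_snd: "integrable N (\<lambda>y. LINT x|M. f x y)"
  and Fubini_swap_integrable: "integrable (M \<Otimes>\<^sub>M N) (case_prod f)"
  and Fubini_swap_pair: "(LINT z|(M \<Otimes>\<^sub>M N). case_prod f z) = (LINT x|M. LINT y|N. f x y)"
proof -
 interpret M: sigma_finite_measure M by fact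
 interpret N: sigma_finite_measure N by fact
 interpret P: pair_sigma_finite M N ..
 show int: "integrable (M \<Otimes>\<^sub>M N) (case_prod f)"
  using fin by (intro integrableI_bounded)
   (simp_all add: N.nn_integral_fst[symmetric] split_beta)
 show "(LINT x|M. LINT y|N. f x y) = (LINT y|N. LINT x|M. f x y)"
  using P.Fubini_integral[OF int] by simp
 show "integrable M (\<lambda>x. LINT y|N. f x y)" using P.integrable_fst[OF int] .
 show "integrable N (\<lambda>y. LINT x|M. f x y)" using P.integrable_snd[OF int] .
 show "(LINT z|(M \<Otimes>\<^sub>M N). case_prod f z) = (LINT x|M. LINT y|N. f x y)"
  using P.integral_fst[OF int] by simp
qed

lemma Basis_vec2: "(Basis :: (real^2) set) = {axis 1 1, axis 2 1}"
 by (auto simp: Basis_vec_def UNIV_2)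

lemma norm_vec2: "(norm (x::real^2))\<^sup>2 = (x $ 1)\<^sup>2 + (x $ 2)\<^sup>2"
 by (simp add: norm_vec_def L2_set_def sum_2)

lemma inner_vec2: "(x::real^2) \<bullet> y = x $ 1 * y $ 1 + x $ 2 * y $ 2"
 by (simp add: inner_vec_def sum_2)

lemma nn_integral_vec2_prod:
 fixes f g :: "real \<Rightarrow> ennreal"
 assumes [measurable]: "f \<in> borel_measurable borel" "g \<in> borel_measurable borel"
 shows "(\<integral>\<^sup>+x. f ((x::real^2) $ 1) * g (x $ 2) \<partial>lborel) = (\<integral>\<^sup>+x. f x \<partial>lborel) * (\<integral>\<^sup>+x. g x \<partial>lborel)"
proof -
 let ?h = "\<lambda>b::real^2. if b = axis 1 1 then f else g"
 have ne: "axis (1::2) (1::real) \<noteq> axis 2 1" by (simp add: axis_eq_axis)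
 have "(\<integral>\<^sup>+x. (\<Prod>b\<in>Basis. ?h b ((x::real^2) \<bullet> b)) \<partial>lborel) = (\<Prod>b\<in>(Basis::(real^2) set). (\<integral>\<^sup>+x. ?h b x \<partial>lborel))"
  by (rule nn_integral_lborel_prod) auto
 then show ?thesis using ne ne[symmetric] by (simp add: Basis_vec2 inner_axis)
qed

lemma integral_vec2_prod:
 fixes f g :: "real \<Rightarrow> 'c::{real_normed_field,banach,second_countable_topology}"
 assumes "integrable lborel f" "integrable lborel g"
 shows integral_vec2_prod_eq: "(LINT x|lborel. f ((x::real^2) $ 1) * g (x $ 2)) = (LINT x|lborel. f x) * (LINT x|lborel. g x)"
  and integrable_vec2_prod: "integrable lborel (\<lambda>x::real^2. f (x $ 1) * g (x $ 2))"
proof -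
 have [measurable]: "f \<in> borel_measurable borel" "g \<in> borel_measurable borel"
  using assms by (auto dest: borel_measurable_integrable)
 let ?h = "\<lambda>b::real^2. if b = axis 1 1 then f else g"
 have ne: "axis (1::2) (1::real) \<noteq> axis 2 1" by (simp add: axis_eq_axis)
 interpret sigma_finite_measure "lborel::real measure" by (rule sigma_finite_lborel)
 interpret P: product_sigma_finite "\<lambda>_::real^2. lborel::real measure" by standard
 have "(LINT x|lborel. f ((x::real^2) $ 1) * g (x $ 2)) =
  integral\<^sup>L (Pi\<^sub>M Basis (\<lambda>_. lborel)) (\<lambda>x. \<Prod>b\<in>(Basis::(real^2) set). ?h b (x b))"
  unfolding lborel_eq[where 'a="real^2"]
  using ne ne[symmetric] by (subst integral_distr) (auto simp: Basis_vec2 axis_def)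
 also have "... = (\<Prod>b\<in>(Basis::(real^2) set). (LINT x|lborel. ?h b x))"
  using assms by (intro P.product_integral_prod) auto
 finally show "(LINT x|lborel. f ((x::real^2) $ 1) * g (x $ 2)) = (LINT x|lborel. f x) * (LINT x|lborel. g x)"
  using ne ne[symmetric] by (simp add: Basis_vec2)
 show "integrable lborel (\<lambda>x::real^2. f (x $ 1) * g (x $ 2))"
 proof (rule integrableI_bounded)
  have "(\<integral>\<^sup>+x. ennreal (norm (f ((x::real^2) $ 1) * g (x $ 2))) \<partial>lborel) =
   (\<integral>\<^sup>+x. ennreal (norm (f x)) \<partial>lborel) * (\<integral>\<^sup>+x. ennreal (norm (g x)) \<partial>lborel)"
   by (subst nn_integral_vec2_prod[symmetric]) (auto simp: norm_mult ennreal_mult)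
  also have "... < \<infinity>" using assms by (simp add: integrable_iff_bounded ennreal_mult_less_top)
  finally show "(\<integral>\<^sup>+x. ennreal (norm (f ((x::real^2) $ 1) * g (x $ 2))) \<partial>lborel) < \<infinity>" .
 qed simp
qed

text \<open>The characteristic function of the standard normal law, rescaled by
  \<open>c = sqrt (2*a)\<close>: up to normalisation the weight is a normal density of variance
  \<open>2*a\<close>.\<close>

lemma gauss1_fourier:
 fixes a t :: real assumes a: "a > 0"
 shows "integrable lborel (\<lambda>x. cis (t * x) * of_real (exp (- x\<^sup>2 / (4*a))))"
  and "(LINT x|lborel. cis (t * x) * of_real (exp (- x\<^sup>2 / (4*a)))) = of_real (sqrt (4*pi*a) * exp (- a * t\<^sup>2))"
proof -
 define c where "c = sqrt (2*a)"
 have c: "c > 0" "c\<^sup>2 = 2*a" using a by (auto simp: c_def)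
 have char: "(LINT x|lborel. cis (s * x) * of_real (std_normal_density x)) = of_real (exp (- (s\<^sup>2) / 2))" for s
 proof -
  have "char std_normal_distribution s = (LINT x|std_normal_distribution. iexp (s * x))"
   by (simp add: char_def)
  also have "... = (LINT x|lborel. std_normal_density x *\<^sub>R iexp (s * x))"
   by (subst integral_density) (auto simp: normal_density_nonneg)
  finally show ?thesis
   by (simp add: char_std_normal_distribution scaleR_conv_of_real cis_conv_exp mult.commute)
 qed
 have eq: "cis (t * (0 + c * x)) * of_real (exp (- (0 + c*x)\<^sup>2 / (4*a)))
   = of_real (sqrt (2*pi)) * (cis ((t*c) * x) * of_real (std_normal_density x))" for x
  using a c by (simp add: std_normal_density_def power_mult_distrib mult_ac)
 have i0: "integrable lborel (\<lambda>x. cis ((t*c) * x) * of_real (std_normal_density x))"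
 proof (rule Bochner_Integration.integrable_bound)
  show "integrable lborel std_normal_density" by simp
  show "(\<lambda>x. cis ((t*c) * x) * of_real (std_normal_density x)) \<in> borel_measurable lborel"
   by (simp add: cis_conv_exp)
 qed (auto simp: norm_mult)
 show "integrable lborel (\<lambda>x. cis (t * x) * of_real (exp (- x\<^sup>2 / (4*a))))"
  by (subst lborel_integrable_real_affine_iff[symmetric, of c _ 0])
   (use c i0 in \<open>auto simp only: eq intro!: integrable_mult_right\<close>)
 show "(LINT x|lborel. cis (t * x) * of_real (exp (- x\<^sup>2 / (4*a)))) = of_real (sqrt (4*pi*a) * exp (- a * t\<^sup>2))"
 proof -
  have "(LINT x|lborel. cis (t * x) * of_real (exp (- x\<^sup>2 / (4*a)))) =
   c *\<^sub>R (LINT x|lborel. of_real (sqrt (2*pi)) * (cis ((t*c) * x) * of_real (std_normal_density x)))"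
   using c by (subst lborel_integral_real_affine[of c _ 0]) (simp_all only: eq, simp)
  also have "... = of_real (c * sqrt (2*pi) * exp (- ((t*c)\<^sup>2) / 2))"
   by (simp only: integral_mult_right_zero char) (simp add: scaleR_conv_of_real)
  also have "c * sqrt (2*pi) = sqrt (4*pi*a)" by (simp add: c_def real_sqrt_mult[symmetric] mult_ac)
  also have "(t*c)\<^sup>2 = 2 * (a * t\<^sup>2)" using c by (simp add: power_mult_distrib)
  finally show ?thesis by simp
 qed
qed

definition heat :: "real \<Rightarrow> real^2 \<Rightarrow> real" where
 "heat a x = exp (- (norm x)\<^sup>2 / (4 * a)) / (4 * pi * a)"

lemma measurable_cis [measurable]: "cis \<in> borel_measurable borel"
 by (rule borel_measurable_continuous_onI) (simp add: cis_conv_exp continuous_intros)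

lemma measurable_vec_nth [measurable]: "(\<lambda>x::real^'n. x $ i) \<in> borel_measurable borel"
 by (rule borel_measurable_continuous_onI) (intro continuous_intros)

lemma measurable_heat [measurable (raw)]:
 assumes [measurable]: "f \<in> borel_measurable M" "g \<in> borel_measurable M"
 shows "(\<lambda>z. heat (f z) (g z)) \<in> borel_measurable M"
 unfolding heat_def by measurable

lemma heat_nonneg: "a \<ge> 0 ==> heat a x \<ge> 0"
 by (simp add: heat_def)

lemma heat_minus [simp]: "heat a (- x) = heat a x"
 by (simp add: heat_def)

lemma heat_le: "a > 0 ==> heat a x \<le> 1 / (4 * pi * a)"
 by (simp add: heat_def divide_right_mono)

lemma heat_fourier:
 fixes \<xi> :: "real^2" assumes a: "a > 0"
 shows integrable_heat_cis: "integrable lborel (\<lambda>x. cis (x \<bullet> \<xi>) * of_real (heat a x))"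
  and integral_heat_cis: "(LINT x|lborel. cis (x \<bullet> \<xi>) * of_real (heat a x)) = of_real (exp (- a * (norm \<xi>)\<^sup>2))"
proof -
 let ?f = "\<lambda>t x. cis (t * x) * complex_of_real (exp (- x\<^sup>2 / (4*a)))"
 have eq: "cis (x \<bullet> \<xi>) * of_real (heat a x) = of_real (1 / (4*pi*a)) * (?f (\<xi>$1) (x$1) * ?f (\<xi>$2) (x$2))" for x
  using a by (simp add: heat_def norm_vec2 inner_vec2 cis_mult[symmetric] exp_add[symmetric]
    mult_ac add_divide_distrib diff_divide_distrib flip: of_real_mult)
 note i = integral_vec2_prod[OF gauss1_fourier(1)[OF a, of "\<xi>$1"] gauss1_fourier(1)[OF a, of "\<xi>$2"]]
 show "integrable lborel (\<lambda>x. cis (x \<bullet> \<xi>) * of_real (heat a x))"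
  unfolding eq by (intro integrable_mult_right i)
 have "(LINT x|lborel. cis (x \<bullet> \<xi>) * of_real (heat a x)) =
  of_real (1 / (4*pi*a)) * (of_real (sqrt (4*pi*a) * exp (- a * (\<xi>$1)\<^sup>2)) * of_real (sqrt (4*pi*a) * exp (- a * (\<xi>$2)\<^sup>2)))"
  unfolding eq integral_mult_right_zero i(1) gauss1_fourier(2)[OF a] ..
 also have "... = of_real ((sqrt (4*pi*a))\<^sup>2 / (4*pi*a) * (exp (- a * (\<xi>$1)\<^sup>2) * exp (- a * (\<xi>$2)\<^sup>2)))"
  by (simp only: power2_eq_square of_real_mult of_real_divide) (simp add: field_simps)
 also have "... = of_real (exp (- a * (norm \<xi>)\<^sup>2))"
  using a by (simp add: norm_vec2 algebra_simps flip: exp_add)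
 finally show "(LINT x|lborel. cis (x \<bullet> \<xi>) * of_real (heat a x)) = of_real (exp (- a * (norm \<xi>)\<^sup>2))" .
qed

lemma integrable_heat: "a > 0 ==> integrable lborel (heat a)"
 using integrable_heat_cis[of a 0] by (simp only: inner_zero_right cis_zero mult_1 complex_of_real_integrable_eq)

lemma integral_heat: "a > 0 ==> (LINT x|lborel. heat a x) = 1"
 using integral_heat_cis[of a 0] integral_complex_of_real[of lborel "heat a"] by simp

lemma nn_integral_heat: "a > 0 ==> (\<integral>\<^sup>+x. ennreal (heat a x) \<partial>lborel) = 1"
 using nn_integral_eq_integral[OF integrable_heat, of a] by (simp add: integral_heat heat_nonneg)

text \<open>A Gaussian in frequency is a multiple of the heat kernel at the reciprocal time
  \<open>1 / (4*b)\<close>. One transform formula therefore also serves as its own inversion, in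
  \<open>gauss_fourier\<close>.\<close>

lemma exp_eq_heat: "b > 0 ==> exp (- b * (norm x)\<^sup>2) = pi / b * heat (1 / (4*b)) x"
 by (simp add: heat_def field_simps)

lemma gauss_fourier:
 fixes x :: "real^2" assumes b: "b > 0"
 shows integrable_gauss_cis: "integrable lborel (\<lambda>\<xi>. cis (x \<bullet> \<xi>) * of_real (exp (- b * (norm \<xi>)\<^sup>2)))"
  and integral_gauss_cis: "(LINT \<xi>|lborel. cis (x \<bullet> \<xi>) * of_real (exp (- b * (norm \<xi>)\<^sup>2))) = of_real (4 * pi\<^sup>2 * heat b x)"
proof -
 have b': "1 / (4*b) > 0" using b by simp
 have eq: "cis (x \<bullet> \<xi>) * of_real (exp (- b * (norm \<xi>)\<^sup>2)) = of_real (pi / b) * (cis (\<xi> \<bullet> x) * of_real (heat (1/(4*b)) \<xi>))" for \<xi>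
  using b by (simp only: exp_eq_heat of_real_mult inner_commute) (simp add: mult_ac)
 show "integrable lborel (\<lambda>\<xi>. cis (x \<bullet> \<xi>) * of_real (exp (- b * (norm \<xi>)\<^sup>2)))"
  unfolding eq by (intro integrable_mult_right integrable_heat_cis[OF b'])
 show "(LINT \<xi>|lborel. cis (x \<bullet> \<xi>) * of_real (exp (- b * (norm \<xi>)\<^sup>2))) = of_real (4 * pi\<^sup>2 * heat b x)"
  unfolding eq integral_mult_right_zero integral_heat_cis[OF b'] using b
  by (simp add: heat_def power2_eq_square flip: of_real_mult)
qed

lemma integrable_gauss: "b > 0 ==> integrable lborel (\<lambda>\<xi>::real^2. exp (- b * (norm \<xi>)\<^sup>2))"
 using integrable_gauss_cis[of b 0] by (simp only: inner_zero_left cis_zero mult_1 complex_of_real_integrable_eq)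

lemma nn_integral_gauss: "b > 0 ==> (\<integral>\<^sup>+\<xi>. ennreal (exp (- b * (norm (\<xi>::real^2))\<^sup>2)) \<partial>lborel) = ennreal (pi / b)"
 by (simp only: exp_eq_heat) (simp add: nn_integral_heat nn_integral_cmult ennreal_mult'' heat_nonneg times_divide_eq_left[symmetric] del: times_divide_eq_left)

section \<open>Translation invariance and the semigroup law\<close>

lemma measurable_cnj [measurable]: "cnj \<in> borel_measurable borel"
 by (rule borel_measurable_continuous_onI) (intro continuous_intros)

lemma nn_integral_lborel_shift:
 fixes f :: "'a::euclidean_space \<Rightarrow> ennreal"
 assumes [measurable]: "f \<in> borel_measurable borel"
 shows "(\<integral>\<^sup>+x. f (c + x) \<partial>lborel) = (\<integral>\<^sup>+x. f x \<partial>lborel)"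
proof -
 have "(\<integral>\<^sup>+x. f x \<partial>lborel) = (\<integral>\<^sup>+x. f x \<partial>distr lborel borel ((+) c))"
  by (simp add: lborel_distr_plus)
 then show ?thesis by (simp add: nn_integral_distr)
qed

lemma lborel_distr_reflect: "distr lborel borel (\<lambda>x::'a::euclidean_space. c - x) = lborel"
 using lborel_affine[of "-1" c] by (simp add: density_1)

lemma nn_integral_lborel_reflect:
 fixes f :: "'a::euclidean_space \<Rightarrow> ennreal"
 assumes [measurable]: "f \<in> borel_measurable borel"
 shows "(\<integral>\<^sup>+x. f (c - x) \<partial>lborel) = (\<integral>\<^sup>+x. f x \<partial>lborel)"
proof -
 have "(\<integral>\<^sup>+x. f x \<partial>lborel) = (\<integral>\<^sup>+x. f x \<partial>distr lborel borel (\<lambda>x. c - x))"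
  by (simp add: lborel_distr_reflect)
 then show ?thesis by (simp add: nn_integral_distr)
qed

lemma nn_integral_lborel_diff:
 fixes f :: "'a::euclidean_space \<Rightarrow> ennreal"
 assumes [measurable]: "f \<in> borel_measurable borel"
 shows "(\<integral>\<^sup>+x. f (x - c) \<partial>lborel) = (\<integral>\<^sup>+x. f x \<partial>lborel)"
 using nn_integral_lborel_shift[of f "-c"] by simp

lemma lborel_integral_shift:
 fixes f :: "'a::euclidean_space \<Rightarrow> 'b::{banach, second_countable_topology}"
 assumes [measurable]: "f \<in> borel_measurable borel"
 shows "(LINT x|lborel. f (c + x)) = (LINT x|lborel. f x)"
  and "integrable lborel (\<lambda>x. f (c + x)) \<longleftrightarrow> integrable lborel f"
  and "(LINT x|lborel. f (x - c)) = (LINT x|lborel. f x)"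
  and "integrable lborel (\<lambda>x. f (x - c)) \<longleftrightarrow> integrable lborel f"
proof -
 have *: "(LINT x|lborel. f (c + x)) = (LINT x|lborel. f x)" "integrable lborel (\<lambda>x. f (c + x)) \<longleftrightarrow> integrable lborel f" for c
  using integral_distr[of "(+) c" lborel borel f] integrable_distr_eq[of "(+) c" lborel borel f]
  by (simp_all add: lborel_distr_plus)
 show "(LINT x|lborel. f (c + x)) = (LINT x|lborel. f x)"
  "integrable lborel (\<lambda>x. f (c + x)) \<longleftrightarrow> integrable lborel f"
  "(LINT x|lborel. f (x - c)) = (LINT x|lborel. f x)"
  "integrable lborel (\<lambda>x. f (x - c)) \<longleftrightarrow> integrable lborel f"
  using *[of c] *[of "-c"] by simp_all
qed

lemma lborel_integral_reflect:
 fixes f :: "'a::euclidean_space \<Rightarrow> 'b::{banach, second_countable_topology}"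
 assumes [measurable]: "f \<in> borel_measurable borel"
 shows "(LINT x|lborel. f (c - x)) = (LINT x|lborel. f x)"
  and "integrable lborel (\<lambda>x. f (c - x)) \<longleftrightarrow> integrable lborel f"
 using integral_distr[of "(-) c" lborel borel f] integrable_distr_eq[of "(-) c" lborel borel f]
 by (simp_all add: lborel_distr_reflect)

lemma norm_integral_le_nn_integral:
 fixes f :: "'a \<Rightarrow> 'b::{banach, second_countable_topology}"
 shows "ennreal (norm (integral\<^sup>L M f)) \<le> (\<integral>\<^sup>+x. ennreal (norm (f x)) \<partial>M)"
 by (cases "integrable M f") (auto simp: integral_norm_bound_ennreal not_integrable_integral_eq)

text \<open>Completing the square in each coordinate: a product of two Gaussians in \<open>y\<close>
  is one Gaussian about the weighted mean of the centres, times a factor in the distance of the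
  centres. The semigroup law and the Gram matrix of the derivatives are both read off from
  this.\<close>

lemma heat_mult:
 assumes b: "b > 0" and c: "c > 0"
 shows "heat b (y - x) * heat c (y - x') =
  heat (b + c) (x - x') * heat (b * c / (b + c)) (y - ((c / (b + c)) *\<^sub>R x + (b / (b + c)) *\<^sub>R x'))"
proof -
 have bc: "b + c > 0" using b c by simp
 have alg: "(y1 - x1)\<^sup>2 / b + (y1 - x1')\<^sup>2 / c =
  (x1 - x1')\<^sup>2 / (b + c) + (y1 - (c / (b + c) * x1 + b / (b + c) * x1'))\<^sup>2 / (b * c / (b + c))" for y1 x1 x1' :: real
 proof -
  have "(y1 - (c / (b + c) * x1 + b / (b + c) * x1')) = ((b+c) * y1 - (c * x1 + b * x1')) / (b + c)"
   using bc by (simp add: diff_divide_distrib add_divide_distrib)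
  moreover have "b + c \<noteq> 0" using bc by simp
  ultimately show ?thesis using b c by (simp add: divide_simps) (simp add: algebra_simps power2_eq_square)
 qed
 have "(norm (y - x))\<^sup>2 / b + (norm (y - x'))\<^sup>2 / c = (norm (x - x'))\<^sup>2 / (b + c) +
  (norm (y - ((c / (b + c)) *\<^sub>R x + (b / (b + c)) *\<^sub>R x')))\<^sup>2 / (b * c / (b + c))"
  unfolding norm_vec2 using alg[of "y$1" "x$1" "x'$1"] alg[of "y$2" "x$2" "x'$2"]
  by (simp only: vector_minus_component vector_add_component vector_scaleR_component add_divide_distrib real_scaleR_def)
 then have *: "- (norm (y - x))\<^sup>2 / (4*b) + - (norm (y - x'))\<^sup>2 / (4*c) = - (norm (x - x'))\<^sup>2 / (4*(b + c)) +
  - (norm (y - ((c / (b + c)) *\<^sub>R x + (b / (b + c)) *\<^sub>R x')))\<^sup>2 / (4*(b * c / (b + c)))"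
 proof -
  have q: "- A / (4 * k) = - (A / k) / 4" for A k :: real by simp
  assume "(norm (y - x))\<^sup>2 / b + (norm (y - x'))\<^sup>2 / c = (norm (x - x'))\<^sup>2 / (b + c) +
  (norm (y - ((c / (b + c)) *\<^sub>R x + (b / (b + c)) *\<^sub>R x')))\<^sup>2 / (b * c / (b + c))"
  moreover have "X + Y = P + Q ==> - X / 4 + - Y / 4 = - P / 4 + - Q / 4" for X Y P Q :: real by simp
  ultimately show ?thesis unfolding q by blast
 qed
 have "heat b (y - x) * heat c (y - x') =
  exp (- (norm (y - x))\<^sup>2 / (4*b) + - (norm (y - x'))\<^sup>2 / (4*c)) / (4*pi*b*(4*pi*c))"
  by (simp only: exp_add) (simp add: heat_def)
 also have "... = heat (b + c) (x - x') * heat (b * c / (b + c)) (y - ((c / (b + c)) *\<^sub>R x + (b / (b + c)) *\<^sub>R x'))"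
  unfolding * exp_add heat_def using b c bc by simp
 finally show ?thesis .
qed

lemma heat_conv:
 assumes b: "b > 0" and c: "c > 0"
 shows integrable_heat_heat: "integrable lborel (\<lambda>y. heat b (y - x) * heat c (y - x'))"
  and integral_heat_heat: "(LINT y|lborel. heat b (y - x) * heat c (y - x')) = heat (b + c) (x - x')"
proof -
 have d: "b * c / (b + c) > 0" using b c by simp
 show "integrable lborel (\<lambda>y. heat b (y - x) * heat c (y - x'))"
  unfolding heat_mult[OF b c] by (intro integrable_mult_right) (simp add: lborel_integral_shift integrable_heat[OF d])
 show "(LINT y|lborel. heat b (y - x) * heat c (y - x')) = heat (b + c) (x - x')"
  unfolding heat_mult[OF b c] by (simp add: lborel_integral_shift integral_heat[OF d])
qed

lemma heat_sq: "b > 0 ==> (\<integral>\<^sup>+y. ennreal ((heat b (y - x))\<^sup>2) \<partial>lborel) = ennreal (1 / (8 * pi * b))"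
 using nn_integral_eq_integral[OF integrable_heat_heat[of b b x x]]
 by (simp add: integral_heat_heat power2_eq_square heat_nonneg) (simp add: heat_def)

text \<open>Absorbs a polynomial factor into a Gaussian at the price of halving its exponent; for
  heat kernels this means doubling the time.\<close>

lemma exp_sq_le: "t \<ge> 0 ==> t * exp (- t) \<le> 2 * exp (- t / 2)" for t :: real
proof -
 assume "t \<ge> 0"
 have "t \<le> 2 * exp (t / 2)" using exp_ge_add_one_self[of "t/2"] by linarith
 then have "t * exp (-t) \<le> 2 * exp (t/2) * exp (-t)" by (intro mult_right_mono) auto
 then show ?thesis by (simp add: mult.assoc flip: exp_add)
qed

lemma heat_norm_sq_le: "a > 0 ==> (norm z)\<^sup>2 / (4*a) * heat a z \<le> 4 * heat (2*a) z"
 using exp_sq_le[of "(norm z)\<^sup>2 / (4*a)"] by (simp add: heat_def field_simps)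

lemma heat_le_double: "a > 0 ==> heat a z \<le> 2 * heat (2*a) z"
 by (simp add: heat_def field_simps)

text \<open>The derivative of \<open>heat a\<close> along coordinate \<open>j\<close> in closed
  form; \<open>heat_schwartz\<close> makes the identification.\<close>

definition dheat :: "2 \<Rightarrow> real \<Rightarrow> real^2 \<Rightarrow> real" where
 "dheat j a z = - (z $ j / (2 * a)) * heat a z"

text \<open>The Laplacian of \<open>heat a\<close> on the plane, which by the heat equation is also
  its derivative in \<open>a\<close>.\<close>

definition lheat :: "real \<Rightarrow> real^2 \<Rightarrow> real" where
 "lheat a z = ((norm z)\<^sup>2 / (4 * a\<^sup>2) - 1 / a) * heat a z"

lemma measurable_dheat [measurable (raw)]:
 assumes [measurable]: "f \<in> borel_measurable M" "g \<in> borel_measurable M"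
 shows "(\<lambda>z. dheat j (f z) (g z)) \<in> borel_measurable M"
 unfolding dheat_def by measurable

lemma measurable_lheat [measurable (raw)]:
 assumes [measurable]: "f \<in> borel_measurable M" "g \<in> borel_measurable M"
 shows "(\<lambda>z. lheat (f z) (g z)) \<in> borel_measurable M"
 unfolding lheat_def by measurable

text \<open>\<open>heat a\<close> is a product of two centred normal densities of variance
  \<open>2*a\<close>, so the second moment is that of the normal law; the first moment vanishes by
  reflection.\<close>

lemma heat_moments:
 assumes a: "a > 0"
 shows "integrable lborel (\<lambda>z. (norm z)\<^sup>2 * heat a z)"
  and "(LINT z|lborel. (norm z)\<^sup>2 * heat a z) = 4 * a"
  and "integrable lborel (\<lambda>z. z $ j * heat a z)"
  and "(LINT z|lborel. z $ j * heat a z) = 0"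
proof -
 define \<sigma> where "\<sigma> = sqrt (2*a)"
 have \<sigma>: "\<sigma> > 0" "\<sigma>\<^sup>2 = 2*a" using a by (auto simp: \<sigma>_def)
 let ?n = "normal_density 0 \<sigma>"
 have eq: "heat a z = ?n (z$1) * ?n (z$2)" for z
 proof -
  have "?n (z$1) * ?n (z$2) = exp (- (z$1)\<^sup>2 / (4*a) + - (z$2)\<^sup>2 / (4*a)) / (sqrt (4*pi*a) * sqrt (4*pi*a))"
   using a \<sigma> by (simp only: exp_add) (simp add: normal_density_def mult_ac)
  also have "- (z$1)\<^sup>2 / (4*a) + - (z$2)\<^sup>2 / (4*a) = - (norm z)\<^sup>2 / (4*a)"
   by (simp add: norm_vec2 add_divide_distrib diff_divide_distrib)
  finally show ?thesis using a by (simp add: heat_def)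
 qed
 have m2: "integrable lborel (\<lambda>x. ?n x * x\<^sup>2)" "(LINT x|lborel. ?n x * x\<^sup>2) = 2 * a"
  using normal_moment_even[of \<sigma> 0 1] \<sigma> by (auto simp: has_bochner_integral_iff)
 have m0: "integrable lborel ?n" "(LINT x|lborel. ?n x) = 1" using \<sigma> by auto
 have e2: "(norm z)\<^sup>2 * heat a z = (?n (z$1) * (z$1)\<^sup>2) * ?n (z$2) + ?n (z$1) * (?n (z$2) * (z$2)\<^sup>2)" for z
  unfolding eq norm_vec2 by (simp add: algebra_simps)
 note i1 = integral_vec2_prod[OF m2(1) m0(1)] and i2 = integral_vec2_prod[OF m0(1) m2(1)]
 show i: "integrable lborel (\<lambda>z. (norm z)\<^sup>2 * heat a z)"
  unfolding e2 by (intro Bochner_Integration.integrable_add i1 i2)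
 show "(LINT z|lborel. (norm z)\<^sup>2 * heat a z) = 4 * a"
  unfolding e2 using i1 i2 m0 m2 by simp
 show "integrable lborel (\<lambda>z. z $ j * heat a z)"
 proof (rule Bochner_Integration.integrable_bound)
  show "integrable lborel (\<lambda>z. heat a z + (norm z)\<^sup>2 * heat a z)"
   by (intro Bochner_Integration.integrable_add i integrable_heat a)
  show "AE z in lborel. norm (z $ j * heat a z) \<le> norm (heat a z + (norm z)\<^sup>2 * heat a z)"
  proof (intro always_eventually allI)
   fix z :: "real^2"
   have "\<bar>z $ j\<bar> \<le> norm z" by (rule component_le_norm_cart)
   also have "... \<le> 1 + (norm z)\<^sup>2" using zero_le_power2[of "norm z - 1/2"]
    by (simp add: power2_eq_square algebra_simps)
   finally have "\<bar>z $ j\<bar> * heat a z \<le> (1 + (norm z)\<^sup>2) * heat a z"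
    using a by (intro mult_right_mono) (auto intro: heat_nonneg)
   then show "norm (z $ j * heat a z) \<le> norm (heat a z + (norm z)\<^sup>2 * heat a z)"
    using heat_nonneg[of a z] a by (simp add: abs_mult algebra_simps)
  qed
 qed simp
 have "(LINT z|lborel. z $ j * heat a z) = (LINT z|lborel. (0 - z) $ j * heat a (0 - z))"
  by (rule lborel_integral_reflect(1)[symmetric, where c=0]) simp
 then show "(LINT z|lborel. z $ j * heat a z) = 0" by simp
qed

text \<open>Formally an integration by parts: two gradients pair to minus the Laplacian of the
  kernel at the summed time. The proof evaluates Gaussian moments after \<open>heat_mult\<close>
  instead, which yields integrability at once.\<close>

lemma dheat_gram:
 assumes b: "b > 0" and c: "c > 0"
 shows "integrable lborel (\<lambda>y. \<Sum>j\<in>UNIV. dheat j b (y - x) * dheat j c (y - x'))"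
  and "(LINT y|lborel. (\<Sum>j\<in>UNIV. dheat j b (y - x) * dheat j c (y - x'))) = - lheat (b + c) (x - x')"
proof -
 define \<beta> where "\<beta> = b * c / (b + c)"
 define m where "m = (c / (b + c)) *\<^sub>R x + (b / (b + c)) *\<^sub>R x'"
 define w where "w = x - x'"
 define K where "K = heat (b + c) w"
 have bc: "b + c > 0" "b * c > 0" using b c by auto
 have \<beta>: "\<beta> > 0" using b c by (simp add: \<beta>_def)
 have xm: "y - x = (y - m) - (b / (b + c)) *\<^sub>R w" "y - x' = (y - m) + (c / (b + c)) *\<^sub>R w" for y
 proof -
  have 1: "x = m + (b / (b + c)) *\<^sub>R w" "x' = m - (c / (b + c)) *\<^sub>R w"
  proof -
   have *: "b / (b + c) = 1 - c / (b + c)" using bc by (simp add: field_simps)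
   show "x = m + (b / (b + c)) *\<^sub>R w" "x' = m - (c / (b + c)) *\<^sub>R w"
    unfolding m_def w_def * by (simp_all only: vec_eq_iff vector_minus_component vector_add_component vector_scaleR_component) (simp_all add: algebra_simps)
  qed
  show "y - x = (y - m) - (b / (b + c)) *\<^sub>R w" by (subst 1(1)) simp
  show "y - x' = (y - m) + (c / (b + c)) *\<^sub>R w" by (subst 1(2)) simp
 qed
 \<comment> \<open>The Gram integrand in the variable centred at \<open>m\<close>: a quadratic
   polynomial times a single Gaussian. Its linear part integrates to zero.\<close>
 define F where "F z = K / (4 * (b * c)) * ((norm z)\<^sup>2 * heat \<beta> z)
  + (K * ((c - b) / (b + c)) / (4 * (b * c))) * (\<Sum>j\<in>UNIV. w $ j * (z $ j * heat \<beta> z))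
  - (K * (norm w)\<^sup>2 / (4 * (b + c)\<^sup>2)) * heat \<beta> z" for z
 have eq: "(\<Sum>j\<in>UNIV. dheat j b (y - x) * dheat j c (y - x')) = F (y - m)" for y
 proof -
  have "(\<Sum>j\<in>UNIV. dheat j b (y - x) * dheat j c (y - x')) =
   (heat b (y - x) * heat c (y - x')) * ((\<Sum>j\<in>UNIV. (y - x) $ j * (y - x') $ j) / (4 * (b * c)))"
   using b c by (simp add: dheat_def sum_2 field_simps)
  also have "heat b (y - x) * heat c (y - x') = K * heat \<beta> (y - m)"
   unfolding K_def \<beta>_def m_def w_def by (rule heat_mult[OF b c])
  also have "(\<Sum>j\<in>UNIV. (y - x) $ j * (y - x') $ j) =
   (norm (y - m))\<^sup>2 + ((c - b) / (b + c)) * (\<Sum>j\<in>UNIV. w $ j * (y - m) $ j) - (b * c) / (b + c)\<^sup>2 * (norm w)\<^sup>2"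
  proof -
   define p where "p = b / (b + c)"
   define q where "q = c / (b + c)"
   have "(c - b) / (b + c) = c / (b + c) - b / (b + c)" by (simp add: diff_divide_distrib)
   moreover have "(b * c) / (b + c)\<^sup>2 = (b / (b + c)) * (c / (b + c))" by (simp add: power2_eq_square)
   ultimately show ?thesis
    unfolding xm sum_2 norm_vec2 vector_minus_component vector_add_component vector_scaleR_component
    by (simp only:) (simp only: power2_eq_square p_def[symmetric] q_def[symmetric], simp add: algebra_simps)
  qed
  also have "K * heat \<beta> (y - m) * (((norm (y - m))\<^sup>2 + ((c - b) / (b + c)) * (\<Sum>j\<in>UNIV. w $ j * (y - m) $ j) - (b * c) / (b + c)\<^sup>2 * (norm w)\<^sup>2) / (4 * (b * c))) = F (y - m)"
   unfolding F_def sum_2 using b c bc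
   by (simp add: algebra_simps add_divide_distrib diff_divide_distrib)
  finally show ?thesis .
 qed
 have F_meas: "F \<in> borel_measurable borel" unfolding F_def by measurable
 note mom = heat_moments[OF \<beta>]
 have iF: "integrable lborel F"
  unfolding F_def by (intro Bochner_Integration.integrable_add Bochner_Integration.integrable_diff integrable_mult_right Bochner_Integration.integrable_sum mom integrable_heat \<beta>)
 show "integrable lborel (\<lambda>y. \<Sum>j\<in>UNIV. dheat j b (y - x) * dheat j c (y - x'))"
  unfolding eq lborel_integral_shift(4)[OF F_meas] by (rule iF)
 have "(LINT y|lborel. F (y - m)) = (LINT y|lborel. F y)" by (rule lborel_integral_shift(3)[OF F_meas])
 also have "... = K / (4 * (b * c)) * (4 * \<beta>) + (K * ((c - b) / (b + c)) / (4 * (b * c))) * (\<Sum>j\<in>UNIV. w $ j * 0)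
  - (K * (norm w)\<^sup>2 / (4 * (b + c)\<^sup>2)) * 1"
  unfolding F_def
  by (subst Bochner_Integration.integral_diff Bochner_Integration.integral_add Bochner_Integration.integral_sum;
   (intro Bochner_Integration.integrable_add Bochner_Integration.integrable_diff integrable_mult_right Bochner_Integration.integrable_sum mom integrable_heat \<beta>)?)+
  (simp add: mom integral_heat[OF \<beta>])
 also have "... = - lheat (b + c) (x - x')"
  unfolding lheat_def K_def[symmetric] w_def[symmetric]
 proof -
  have "K / (4 * (b * c)) * (4 * \<beta>) = K / (b + c)" using b c by (simp add: \<beta>_def)
  then show "K / (4 * (b * c)) * (4 * \<beta>) + K * ((c - b) / (b + c)) / (4 * (b * c)) * (\<Sum>j\<in>UNIV. w $ j * 0) -
   K * (norm w)\<^sup>2 / (4 * (b + c)\<^sup>2) * 1 = - (((norm w)\<^sup>2 / (4 * (b + c)\<^sup>2) - 1 / (b + c)) * K)"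
   by (simp add: algebra_simps)
 qed
 finally show "(LINT y|lborel. (\<Sum>j\<in>UNIV. dheat j b (y - x) * dheat j c (y - x'))) = - lheat (b + c) (x - x')"
  unfolding eq .
qed

text \<open>Only the upper bound in Plancherel's identity is needed. The weight
  \<open>exp (- \<delta> * (norm x)\<^sup>2)\<close> makes Fubini applicable and turns the square
  into a double integral of \<open>H\<close> against a multiple of the heat kernel at time \<delta>.
  That kernel has mass one, so the inequality between geometric and quadratic means gives a bound
  free of \<delta>, and Fatou's lemma removes the weight.\<close>

lemma plancherel_le:
 fixes H :: "real^2 \<Rightarrow> complex"
 assumes H: "integrable lborel H"
 defines "h \<equiv> \<lambda>x. (LINT \<xi>|lborel. cis (x \<bullet> \<xi>) * H \<xi>)"
 shows "(\<integral>\<^sup>+x. ennreal ((norm (h x))\<^sup>2) \<partial>lborel) \<le> ennreal (4 * pi\<^sup>2) * (\<integral>\<^sup>+\<xi>. ennreal ((norm (H \<xi>))\<^sup>2) \<partial>lborel)"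
proof -
 have [measurable]: "H \<in> borel_measurable borel" using H by (auto dest: borel_measurable_integrable)
 have [measurable]: "h \<in> borel_measurable borel"
  unfolding h_def by measurable
 define N where "N = (\<integral>\<^sup>+\<xi>. ennreal (norm (H \<xi>)) \<partial>lborel)"
 have N: "N < \<infinity>" using H by (simp add: N_def integrable_iff_bounded)
 have hb: "ennreal (norm (h x)) \<le> N" for x
  unfolding h_def N_def by (rule order_trans[OF norm_integral_le_nn_integral]) (simp add: norm_mult)
 let ?P = "(\<integral>\<^sup>+\<xi>. ennreal ((norm (H \<xi>))\<^sup>2) \<partial>lborel)"
 have main: "(\<integral>\<^sup>+x. ennreal ((norm (h x))\<^sup>2 * exp (- \<delta> * (norm x)\<^sup>2)) \<partial>lborel) \<le> ennreal (4 * pi\<^sup>2) * ?P"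
  if \<delta>: "\<delta> > 0" for \<delta>
 proof -
  let ?W = "\<lambda>x::real^2. exp (- \<delta> * (norm x)\<^sup>2)"
  have W: "(\<integral>\<^sup>+x. ennreal (?W x) \<partial>lborel) = ennreal (pi / \<delta>)" by (rule nn_integral_gauss[OF \<delta>])
  have fin0: "(\<integral>\<^sup>+x. ennreal ((norm (h x))\<^sup>2 * ?W x) \<partial>lborel) < \<infinity>"
  proof -
   have "(\<integral>\<^sup>+x. ennreal ((norm (h x))\<^sup>2 * ?W x) \<partial>lborel) \<le> (\<integral>\<^sup>+x. N * N * ennreal (?W x) \<partial>lborel)"
    using hb by (intro nn_integral_mono) (simp add: ennreal_mult' power2_eq_square ennreal_mult mult_mono)
   also have "... < \<infinity>" using N W by (simp add: nn_integral_cmult ennreal_mult_less_top)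
   finally show ?thesis .
  qed
  have fin1: "(\<integral>\<^sup>+x. \<integral>\<^sup>+\<xi>. ennreal (norm (of_real (?W x) * cnj (h x) * (cis (x \<bullet> \<xi>) * H \<xi>))) \<partial>lborel \<partial>lborel) < \<infinity>"
  proof -
   have "(\<integral>\<^sup>+x. \<integral>\<^sup>+\<xi>. ennreal (norm (of_real (?W x) * cnj (h x) * (cis (x \<bullet> \<xi>) * H \<xi>))) \<partial>lborel \<partial>lborel)
    = (\<integral>\<^sup>+x. \<integral>\<^sup>+\<xi>. (ennreal (norm (h x)) * ennreal (?W x)) * ennreal (norm (H \<xi>)) \<partial>lborel \<partial>lborel)"
    by (simp add: norm_mult ennreal_mult mult_ac)
   also have "... = (\<integral>\<^sup>+x. ennreal (norm (h x)) * N * ennreal (?W x) \<partial>lborel)"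
    unfolding N_def by (subst nn_integral_cmult) (auto simp: mult_ac)
   also have "... \<le> (\<integral>\<^sup>+x. N * N * ennreal (?W x) \<partial>lborel)"
    using hb by (intro nn_integral_mono mult_right_mono) auto
   also have "... < \<infinity>" using N W by (simp add: nn_integral_cmult ennreal_mult_less_top)
   finally show ?thesis .
  qed
  have fin2: "(\<integral>\<^sup>+x. \<integral>\<^sup>+\<eta>. ennreal (norm (of_real (?W x) * cis (x \<bullet> \<xi>) * (cis (- (x \<bullet> \<eta>)) * cnj (H \<eta>)))) \<partial>lborel \<partial>lborel) < \<infinity>" for \<xi>
  proof -
   have "(\<integral>\<^sup>+x. \<integral>\<^sup>+\<eta>. ennreal (norm (of_real (?W x) * cis (x \<bullet> \<xi>) * (cis (- (x \<bullet> \<eta>)) * cnj (H \<eta>)))) \<partial>lborel \<partial>lborel)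
    = (\<integral>\<^sup>+x. \<integral>\<^sup>+\<eta>. ennreal (?W x) * ennreal (norm (H \<eta>)) \<partial>lborel \<partial>lborel)"
    by (simp add: norm_mult ennreal_mult mult_ac)
   also have "... = (\<integral>\<^sup>+x. N * ennreal (?W x) \<partial>lborel)"
    unfolding N_def by (subst nn_integral_cmult) (auto simp: mult_ac)
   also have "... < \<infinity>" using N W by (simp add: nn_integral_cmult ennreal_mult_less_top)
   finally show ?thesis .
  qed
  have inner: "(LINT x|lborel. of_real (?W x) * cnj (h x) * cis (x \<bullet> \<xi>)) = (LINT \<eta>|lborel. cnj (H \<eta>) * of_real (4 * pi\<^sup>2 * heat \<delta> (\<xi> - \<eta>)))" for \<xi>
  proof -
   have c: "cnj (h x) = (LINT \<eta>|lborel. cis (- (x \<bullet> \<eta>)) * cnj (H \<eta>))" for x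
    unfolding h_def by (subst Bochner_Integration.integral_cnj[symmetric]) (simp add: cis_cnj)
   have "(LINT x|lborel. of_real (?W x) * cnj (h x) * cis (x \<bullet> \<xi>)) =
    (LINT x|lborel. LINT \<eta>|lborel. of_real (?W x) * cis (x \<bullet> \<xi>) * (cis (- (x \<bullet> \<eta>)) * cnj (H \<eta>)))"
    unfolding c by (simp add: mult_ac flip: integral_mult_right_zero)
   also have "... = (LINT \<eta>|lborel. LINT x|lborel. of_real (?W x) * cis (x \<bullet> \<xi>) * (cis (- (x \<bullet> \<eta>)) * cnj (H \<eta>)))"
    by (rule Fubini_swap_eq[OF sigma_finite_lborel sigma_finite_lborel _ fin2]) measurable
   also have "... = (LINT \<eta>|lborel. LINT x|lborel. cnj (H \<eta>) * (cis ((\<xi> - \<eta>) \<bullet> x) * of_real (?W x)))"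
   proof (intro Bochner_Integration.integral_cong refl)
    fix \<eta> x :: "real^2"
    have "cis ((\<xi> - \<eta>) \<bullet> x) = cis (x \<bullet> \<xi>) * cis (- (x \<bullet> \<eta>))"
     by (simp add: cis_mult inner_diff_left inner_commute[of x])
    then show "of_real (?W x) * cis (x \<bullet> \<xi>) * (cis (- (x \<bullet> \<eta>)) * cnj (H \<eta>)) = cnj (H \<eta>) * (cis ((\<xi> - \<eta>) \<bullet> x) * of_real (?W x))"
     by (simp add: mult_ac)
   qed
   also have "... = (LINT \<eta>|lborel. cnj (H \<eta>) * of_real (4 * pi\<^sup>2 * heat \<delta> (\<xi> - \<eta>)))"
    unfolding integral_mult_right_zero integral_gauss_cis[OF \<delta>] ..
   finally show ?thesis .
  qed
  have "(LINT x|lborel. of_real ((norm (h x))\<^sup>2 * ?W x)) = (LINT x|lborel. LINT \<xi>|lborel. of_real (?W x) * cnj (h x) * (cis (x \<bullet> \<xi>) * H \<xi>))"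
   unfolding integral_mult_right_zero
  proof (intro Bochner_Integration.integral_cong refl)
   fix x
   have hx: "(LINT \<xi>|lborel. cis (x \<bullet> \<xi>) * H \<xi>) = h x" by (simp add: h_def)
   show "complex_of_real ((norm (h x))\<^sup>2 * ?W x) = of_real (?W x) * cnj (h x) * (LINT \<xi>|lborel. cis (x \<bullet> \<xi>) * H \<xi>)"
    unfolding hx by (simp add: complex_norm_square mult_ac del: of_real_power)
  qed
  also have "... = (LINT \<xi>|lborel. LINT x|lborel. of_real (?W x) * cnj (h x) * (cis (x \<bullet> \<xi>) * H \<xi>))"
   by (rule Fubini_swap_eq[OF _ _ _ fin1]) (auto intro: sigma_finite_lborel)
  also have "... = (LINT \<xi>|lborel. LINT x|lborel. H \<xi> * (of_real (?W x) * cnj (h x) * cis (x \<bullet> \<xi>)))"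
   by (simp add: mult_ac)
  also have "... = (LINT \<xi>|lborel. H \<xi> * (LINT \<eta>|lborel. cnj (H \<eta>) * of_real (4 * pi\<^sup>2 * heat \<delta> (\<xi> - \<eta>))))"
   unfolding integral_mult_right_zero inner ..
  finally have id: "complex_of_real (LINT x|lborel. (norm (h x))\<^sup>2 * ?W x) = ..."
   by (simp only: integral_complex_of_real)
  have nn: "(LINT x|lborel. (norm (h x))\<^sup>2 * ?W x) \<ge> 0" by (intro integral_nonneg_AE) auto
  have "(\<integral>\<^sup>+x. ennreal ((norm (h x))\<^sup>2 * ?W x) \<partial>lborel) = ennreal (LINT x|lborel. (norm (h x))\<^sup>2 * ?W x)"
   using fin0 by (intro nn_integral_eq_integral integrableI_bounded) auto
  also have "... = ennreal (norm (complex_of_real (LINT x|lborel. (norm (h x))\<^sup>2 * ?W x)))"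
   using nn by (simp del: integral_complex_of_real)
  also have "... \<le> (\<integral>\<^sup>+\<xi>. ennreal (norm (H \<xi> * (LINT \<eta>|lborel. cnj (H \<eta>) * of_real (4 * pi\<^sup>2 * heat \<delta> (\<xi> - \<eta>))))) \<partial>lborel)"
   unfolding id by (rule norm_integral_le_nn_integral)
  also have "... \<le> (\<integral>\<^sup>+\<xi>. ennreal (norm (H \<xi>)) * (\<integral>\<^sup>+\<eta>. ennreal (norm (cnj (H \<eta>) * of_real (4 * pi\<^sup>2 * heat \<delta> (\<xi> - \<eta>)))) \<partial>lborel) \<partial>lborel)"
  proof -
   have *: "ennreal (norm (z * I)) \<le> ennreal (norm z) * J" if "ennreal (norm I) \<le> J" for z I :: complex and J
    using that by (auto simp: norm_mult ennreal_mult intro: mult_left_mono)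
   show ?thesis by (intro nn_integral_mono * norm_integral_le_nn_integral)
  qed
  also have "... \<le> (\<integral>\<^sup>+\<xi>. \<integral>\<^sup>+\<eta>. ennreal (2 * pi\<^sup>2) * (ennreal ((norm (H \<xi>))\<^sup>2) * ennreal (heat \<delta> (\<xi> - \<eta>)) + ennreal ((norm (H \<eta>))\<^sup>2) * ennreal (heat \<delta> (\<xi> - \<eta>))) \<partial>lborel \<partial>lborel)"
  proof (subst nn_integral_cmult[symmetric], simp, intro nn_integral_mono)
   fix \<xi> \<eta> :: "real^2"
   have hn: "heat \<delta> (\<xi> - \<eta>) \<ge> 0" using \<delta> by (intro heat_nonneg) simp
   have "2 * (norm (H \<xi>) * norm (H \<eta>)) \<le> (norm (H \<xi>))\<^sup>2 + (norm (H \<eta>))\<^sup>2"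
    using sum_squares_bound[of "norm (H \<xi>)" "norm (H \<eta>)"] by simp
   then have "(2 * (norm (H \<xi>) * norm (H \<eta>))) * (2 * pi\<^sup>2 * heat \<delta> (\<xi> - \<eta>)) \<le> ((norm (H \<xi>))\<^sup>2 + (norm (H \<eta>))\<^sup>2) * (2 * pi\<^sup>2 * heat \<delta> (\<xi> - \<eta>))"
    using hn by (intro mult_right_mono) auto
   then have "norm (H \<xi>) * norm (cnj (H \<eta>) * of_real (4 * pi\<^sup>2 * heat \<delta> (\<xi> - \<eta>))) \<le>
    (2 * pi\<^sup>2) * ((norm (H \<xi>))\<^sup>2 * heat \<delta> (\<xi> - \<eta>) + (norm (H \<eta>))\<^sup>2 * heat \<delta> (\<xi> - \<eta>))"
    using hn by (simp add: norm_mult norm_power algebra_simps)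
   then show "ennreal (norm (H \<xi>)) * ennreal (norm (cnj (H \<eta>) * of_real (4 * pi\<^sup>2 * heat \<delta> (\<xi> - \<eta>)))) \<le>
    ennreal (2 * pi\<^sup>2) * (ennreal ((norm (H \<xi>))\<^sup>2) * ennreal (heat \<delta> (\<xi> - \<eta>)) + ennreal ((norm (H \<eta>))\<^sup>2) * ennreal (heat \<delta> (\<xi> - \<eta>)))"
    using hn by (simp add: ennreal_leI flip: ennreal_mult ennreal_plus)
  qed
  also have "... = ennreal (2 * pi\<^sup>2) * ((\<integral>\<^sup>+\<xi>. \<integral>\<^sup>+\<eta>. ennreal ((norm (H \<xi>))\<^sup>2) * ennreal (heat \<delta> (\<xi> - \<eta>)) \<partial>lborel \<partial>lborel) +
   (\<integral>\<^sup>+\<xi>. \<integral>\<^sup>+\<eta>. ennreal ((norm (H \<eta>))\<^sup>2) * ennreal (heat \<delta> (\<xi> - \<eta>)) \<partial>lborel \<partial>lborel))"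
   by (simp add: nn_integral_cmult nn_integral_add)
  also have "(\<integral>\<^sup>+\<xi>. \<integral>\<^sup>+\<eta>. ennreal ((norm (H \<eta>))\<^sup>2) * ennreal (heat \<delta> (\<xi> - \<eta>)) \<partial>lborel \<partial>lborel) =
   (\<integral>\<^sup>+\<eta>. \<integral>\<^sup>+\<xi>. ennreal ((norm (H \<eta>))\<^sup>2) * ennreal (heat \<delta> (\<xi> - \<eta>)) \<partial>lborel \<partial>lborel)"
   by (rule lborel_pair.Fubini') measurable
  also have "... = ?P"
   by (simp add: nn_integral_cmult nn_integral_lborel_diff[of "\<lambda>x. ennreal (heat \<delta> x)"] nn_integral_heat[OF \<delta>])
  also have "(\<integral>\<^sup>+\<xi>. \<integral>\<^sup>+\<eta>. ennreal ((norm (H \<xi>))\<^sup>2) * ennreal (heat \<delta> (\<xi> - \<eta>)) \<partial>lborel \<partial>lborel) = ?P"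
   by (simp add: nn_integral_cmult nn_integral_lborel_reflect[of "\<lambda>x. ennreal (heat \<delta> x)"] nn_integral_heat[OF \<delta>])
  also have "ennreal (2 * pi\<^sup>2) * (?P + ?P) = ennreal (4 * pi\<^sup>2) * ?P"
   by (simp add: distrib_left flip: distrib_right ennreal_plus)
  finally show ?thesis .
 qed
 have "(\<integral>\<^sup>+x. ennreal ((norm (h x))\<^sup>2) \<partial>lborel) =
  (\<integral>\<^sup>+x. liminf (\<lambda>n. ennreal ((norm (h x))\<^sup>2 * exp (- (1 / real (Suc n)) * (norm x)\<^sup>2))) \<partial>lborel)"
 proof (intro nn_integral_cong)
  fix x :: "real^2"
  have "(\<lambda>n. (norm (h x))\<^sup>2 * exp (- (1 / real (Suc n)) * (norm x)\<^sup>2)) \<longlonglongrightarrow> (norm (h x))\<^sup>2 * exp (- 0 * (norm x)\<^sup>2)"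
   using LIMSEQ_inverse_real_of_nat by (intro tendsto_intros) (simp add: inverse_eq_divide)
  then have "(\<lambda>n. ennreal ((norm (h x))\<^sup>2 * exp (- (1 / real (Suc n)) * (norm x)\<^sup>2))) \<longlonglongrightarrow> ennreal ((norm (h x))\<^sup>2)"
   by (intro tendsto_ennrealI) simp
  then show "ennreal ((norm (h x))\<^sup>2) = liminf (\<lambda>n. ennreal ((norm (h x))\<^sup>2 * exp (- (1 / real (Suc n)) * (norm x)\<^sup>2)))"
   by (intro lim_imp_Liminf[symmetric]) auto
 qed
 also have "... \<le> liminf (\<lambda>n. (\<integral>\<^sup>+x. ennreal ((norm (h x))\<^sup>2 * exp (- (1 / real (Suc n)) * (norm x)\<^sup>2)) \<partial>lborel))"
  by (rule nn_integral_liminf) measurable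
 also have "... \<le> ennreal (4 * pi\<^sup>2) * ?P"
  by (intro Liminf_le always_eventually allI main) simp_all
 finally show ?thesis .
qed

section \<open>Schwartz functions and the Fourier transform\<close>

lemma schwartz_partial: "\<phi> \<in> schwartz ==> partial j \<phi> \<in> schwartz"
 unfolding schwartz_def
proof (intro CollectI allI)
 fix js assume "\<phi> \<in> {\<phi>. \<forall>js. (\<forall>x. foldr partial js \<phi> differentiable at x) \<and>
           (\<forall>k. bounded (range (\<lambda>x. norm x ^ k *\<^sub>R foldr partial js \<phi> x)))}"
 then show "(\<forall>x. foldr partial js (partial j \<phi>) differentiable at x) \<and>
   (\<forall>k. bounded (range (\<lambda>x. norm x ^ k *\<^sub>R foldr partial js (partial j \<phi>) x)))"
  by (auto dest: spec[of _ "js @ [j]"])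
qed

lemma schwartz_partial_funpow: "\<phi> \<in> schwartz ==> (partial j ^^ n) \<phi> \<in> schwartz"
 by (induction n) (auto intro: schwartz_partial)

lemma schwartz_derivative:
 "\<phi> \<in> schwartz ==> (\<phi> has_derivative frechet_derivative \<phi> (at x)) (at x)"
 unfolding schwartz_def by (auto dest!: spec[of _ "[]"] simp: frechet_derivative_works)

lemma schwartz_continuous: "\<phi> \<in> schwartz ==> continuous_on UNIV \<phi>"
 using schwartz_derivative[of \<phi>] by (meson continuous_at_imp_continuous_on has_derivative_continuous)

lemma schwartz_borel: "\<phi> \<in> schwartz ==> \<phi> \<in> borel_measurable borel"
 by (intro borel_measurable_continuous_onI schwartz_continuous)

lemma schwartz_bound:
 assumes "\<phi> \<in> schwartz"
 obtains B where "B > 0" "\<And>x. norm x ^ k * norm (\<phi> x) \<le> B"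
proof -
 have "bounded (range (\<lambda>x. norm x ^ k *\<^sub>R \<phi> x))"
  using assms unfolding schwartz_def by (auto dest!: spec[of _ "[]"])
 then obtain B where "B > 0" "\<forall>y\<in>range (\<lambda>x. norm x ^ k *\<^sub>R \<phi> x). norm y \<le> B"
  unfolding bounded_pos by blast
 then show ?thesis by (intro that[of B]) auto
qed

text \<open>An integrable weight on the plane whose square root lies in L^2 and so can be paired
  with a function in L^2.\<close>

definition decay :: "real^2 \<Rightarrow> real" where
 "decay x = 1 / (1 + (norm x)\<^sup>2)\<^sup>2"

lemma decay_pos: "decay x > 0"
proof -
 have "1 + (norm x)\<^sup>2 > 0" by (rule add_pos_nonneg) auto
 then show ?thesis by (simp add: decay_def)
qed

lemma measurable_decay [measurable]: "decay \<in> borel_measurable borel"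
 unfolding decay_def by measurable

text \<open>Comparison with a product of two Cauchy densities, one in each coordinate.\<close>

lemma integrable_decay: "integrable lborel decay"
proof -
 have 1: "integrable lborel (\<lambda>x::real. inverse (1 + x\<^sup>2))"
  using integrable_inverse_1_plus_square by (simp add: set_integrable_def)
 show ?thesis
 proof (rule Bochner_Integration.integrable_bound[OF integrable_vec2_prod[OF 1 1]])
  show "AE x in lborel. norm (decay x) \<le> norm (inverse (1 + (x$1)\<^sup>2) * inverse (1 + (x$2)\<^sup>2))"
  proof (intro always_eventually allI)
   fix x :: "real^2"
   have "(1 + a) * (1 + b) \<le> (1 + (a + b))\<^sup>2" if "a \<ge> 0" "b \<ge> 0" for a b :: real
   proof -
    have "0 \<le> a + b + a * a + a * b + b * b" using that by (intro add_nonneg_nonneg mult_nonneg_nonneg)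
    then show ?thesis by (simp add: power2_eq_square algebra_simps)
   qed
   then have "(1 + (x$1)\<^sup>2) * (1 + (x$2)\<^sup>2) \<le> (1 + (norm x)\<^sup>2)\<^sup>2"
    unfolding norm_vec2 by simp
   moreover have "(1 + (x$1)\<^sup>2) * (1 + (x$2)\<^sup>2) > 0" by (intro mult_pos_pos) (auto intro: add_pos_nonneg)
   ultimately have "1 / (1 + (norm x)\<^sup>2)\<^sup>2 \<le> 1 / ((1 + (x$1)\<^sup>2) * (1 + (x$2)\<^sup>2))"
    by (intro divide_left_mono) (auto intro!: mult_pos_pos add_pos_nonneg)
   then show "norm (decay x) \<le> norm (inverse (1 + (x$1)\<^sup>2) * inverse (1 + (x$2)\<^sup>2))"
    by (simp add: decay_def inverse_eq_divide abs_mult)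
  qed
 qed simp
qed

lemma schwartz_decay:
 fixes \<phi> :: "real^2 \<Rightarrow> complex"
 assumes "\<phi> \<in> schwartz"
 obtains B where "B > 0" "\<And>x. norm (\<phi> x) \<le> B * decay x"
proof -
 obtain B0 where B0: "B0 > 0" "\<And>x. norm x ^ 0 * norm (\<phi> x) \<le> B0" using schwartz_bound[OF assms, of 0] by blast
 obtain B4 where B4: "B4 > 0" "\<And>x. norm x ^ 4 * norm (\<phi> x) \<le> B4" using schwartz_bound[OF assms, of 4] by blast
 show ?thesis
 proof (rule that[of "2 * B0 + 2 * B4"])
  fix x :: "real^2"
  have "(1 + (norm x)\<^sup>2)\<^sup>2 \<le> 2 + 2 * norm x ^ 4"
   using zero_le_power2[of "1 - (norm x)\<^sup>2"] by (simp add: power2_eq_square power4_eq_xxxx algebra_simps)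
  then have "(1 + (norm x)\<^sup>2)\<^sup>2 * norm (\<phi> x) \<le> (2 + 2 * norm x ^ 4) * norm (\<phi> x)"
   by (rule mult_right_mono) simp
  also have "... \<le> 2 * B0 + 2 * B4" using B0(2)[of x] B4(2)[of x] by (simp add: algebra_simps)
  finally show "norm (\<phi> x) \<le> (2 * B0 + 2 * B4) * decay x"
  proof -
   assume *: "(1 + (norm x)\<^sup>2)\<^sup>2 * norm (\<phi> x) \<le> 2 * B0 + 2 * B4"
   have "(1 + (norm x)\<^sup>2)\<^sup>2 > 0" by (intro zero_less_power add_pos_nonneg) auto
   then show ?thesis using * by (simp add: decay_def pos_le_divide_eq mult.commute)
  qed
 qed (use B0 B4 in simp)
qed

lemma schwartz_integrable:
 fixes \<phi> :: "real^2 \<Rightarrow> complex"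
 assumes "\<phi> \<in> schwartz"
 shows "integrable lborel \<phi>"
proof -
 obtain B where "B > 0" "\<And>x. norm (\<phi> x) \<le> B * decay x" using schwartz_decay[OF assms] by blast
 then show ?thesis using schwartz_borel[OF assms]
  by (intro Bochner_Integration.integrable_bound[OF integrable_mult_right[OF integrable_decay, of B]])
   (auto intro!: always_eventually intro: order_trans abs_ge_self)
qed

text \<open>The increment of \<open>h\<close> along a unit vector integrates to zero by translation invariance.\<close>

lemma integral_partial_zero:
 fixes h d :: "real^2 \<Rightarrow> complex"
 assumes h': "\<And>x. (h has_derivative D x) (at x)" and d: "\<And>x. d x = D x (axis j 1)"
  and cont: "continuous_on UNIV d" and ih: "integrable lborel h" and id: "integrable lborel d"
 shows "(LINT x|lborel. d x) = 0"
proof -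
 let ?e = "axis j 1 :: real^2"
 have [measurable]: "d \<in> borel_measurable borel" "h \<in> borel_measurable borel"
  using ih id by (auto dest: borel_measurable_integrable)
 have FTC: "(LINT t|lborel. indicator {0..1} t *\<^sub>R d (t *\<^sub>R ?e + x)) = h (1 *\<^sub>R ?e + x) - h (0 *\<^sub>R ?e + x)" for x
 proof (rule integral_FTC_atLeastAtMost)
  fix t :: real
  have D: "(h has_derivative D (t *\<^sub>R ?e + x)) (at (t *\<^sub>R ?e + x))" by (rule h')
  have "((\<lambda>t. h (t *\<^sub>R ?e + x)) has_derivative (\<lambda>s. D (t *\<^sub>R ?e + x) (s *\<^sub>R ?e))) (at t within {0..1})"
   by (rule has_derivative_compose[where f="\<lambda>t. t *\<^sub>R ?e + x" and g=h, OF _ D]) (auto intro!: derivative_eq_intros)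
  moreover have "D (t *\<^sub>R ?e + x) (s *\<^sub>R ?e) = s *\<^sub>R d (t *\<^sub>R ?e + x)" for s
   using has_derivative_linear[OF D] by (simp add: d linear_scale)
  ultimately show "((\<lambda>t. h (t *\<^sub>R ?e + x)) has_vector_derivative d (t *\<^sub>R ?e + x)) (at t within {0..1})"
   by (simp add: has_vector_derivative_def)
 next
  show "continuous_on {0..1} (\<lambda>t. d (t *\<^sub>R ?e + x))"
   by (intro continuous_on_compose2[OF cont] continuous_intros) auto
 qed simp
 have inner: "(LINT x|lborel. indicator {0..1} t *\<^sub>R d (t *\<^sub>R ?e + x)) = indicator {0..1} t *\<^sub>R (LINT x|lborel. d x)" for t :: real
  using lborel_integral_shift(1)[of d "t *\<^sub>R ?e"] by simp
 have fin: "(\<integral>\<^sup>+t. \<integral>\<^sup>+x. ennreal (norm (indicator {0..1::real} t *\<^sub>R d (t *\<^sub>R ?e + x))) \<partial>lborel \<partial>lborel) < \<infinity>"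
 proof -
  have "(\<integral>\<^sup>+x. ennreal (norm (indicator {0..1::real} t *\<^sub>R d (t *\<^sub>R ?e + x))) \<partial>lborel) =
   (\<integral>\<^sup>+x. ennreal (norm (d x)) \<partial>lborel) * indicator {0..1} t" for t :: real
   using nn_integral_lborel_shift[of "\<lambda>x. ennreal (norm (d x))" "t *\<^sub>R ?e"] by (auto split: split_indicator)
  then have "(\<integral>\<^sup>+t. \<integral>\<^sup>+x. ennreal (norm (indicator {0..1::real} t *\<^sub>R d (t *\<^sub>R ?e + x))) \<partial>lborel \<partial>lborel) =
   (\<integral>\<^sup>+x. ennreal (norm (d x)) \<partial>lborel)"
   by (simp add: nn_integral_cmult_indicator)
  then show ?thesis using id by (simp add: integrable_iff_bounded)
 qed
 have "(LINT x|lborel. d x) = (LINT t|lborel. indicator {0..1::real} t *\<^sub>R (LINT x|lborel. d x))"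
  by (simp add: Bochner_Integration.integral_scaleR_left)
 also have "... = (LINT t|lborel. LINT x|lborel. indicator {0..1::real} t *\<^sub>R d (t *\<^sub>R ?e + x))"
  by (simp only: inner)
 also have "... = (LINT x|lborel. LINT t|lborel. indicator {0..1::real} t *\<^sub>R d (t *\<^sub>R ?e + x))"
  by (rule Fubini_swap_eq[OF sigma_finite_lborel sigma_finite_lborel _ fin]) measurable
 also have "... = (LINT x|lborel. h (?e + x) - h x)" unfolding FTC by simp
 also have "... = 0"
  using ih lborel_integral_shift[of h ?e] by simp
 finally show ?thesis .
qed

lemma schwartz_bounded_mult_integrable:
 fixes \<phi> E :: "real^2 \<Rightarrow> complex"
 assumes "\<phi> \<in> schwartz" and [measurable]: "E \<in> borel_measurable borel" and "\<And>x. norm (E x) \<le> B"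
 shows "integrable lborel (\<lambda>x. E x * \<phi> x)"
proof (rule Bochner_Integration.integrable_bound[OF integrable_mult_right[OF integrable_norm[OF schwartz_integrable[OF assms(1)]], of B]])
 have [measurable]: "\<phi> \<in> borel_measurable borel" using assms(1) by (rule schwartz_borel)
 show "(\<lambda>x. E x * \<phi> x) \<in> borel_measurable lborel" by measurable
 have "B \<ge> 0" using assms(3)[of 0] norm_ge_zero order_trans by blast
 then show "AE x in lborel. norm (E x * \<phi> x) \<le> norm (B * norm (\<phi> x))"
  using assms(3) by (auto simp: norm_mult abs_mult intro!: mult_right_mono)
qed

text \<open>Boundedness of \<open>E\<close> and of its derivative is enough because \<phi> supplies
  the decay. This covers the oscillating exponentials of the Fourier transform as well as the heat
  kernel.\<close>

lemma schwartz_integral_by_parts: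
 fixes \<phi> E d :: "real^2 \<Rightarrow> complex"
 assumes \<phi>: "\<phi> \<in> schwartz"
  and E': "\<And>x. (E has_derivative D x) (at x)" and d: "\<And>x. d x = D x (axis j 1)"
  and cont: "continuous_on UNIV d" and B: "\<And>x. norm (E x) \<le> B" "\<And>x. norm (d x) \<le> B'"
 shows "(LINT x|lborel. d x * \<phi> x) = - (LINT x|lborel. E x * partial j \<phi> x)"
proof -
 have contE: "continuous_on UNIV E"
  using E' by (meson continuous_at_imp_continuous_on has_derivative_continuous)
 have [measurable]: "E \<in> borel_measurable borel" "d \<in> borel_measurable borel"
  by (auto intro!: borel_measurable_continuous_onI contE cont)
 note p = schwartz_partial[OF \<phi>, of j]
 note i1 = schwartz_bounded_mult_integrable[OF \<phi> _ B(2)] and i2 = schwartz_bounded_mult_integrable[OF p _ B(1)]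
 have "(LINT x|lborel. E x * partial j \<phi> x + d x * \<phi> x) = 0"
 proof (rule integral_partial_zero[where h="\<lambda>x. E x * \<phi> x" and j=j])
  show "((\<lambda>x. E x * \<phi> x) has_derivative (\<lambda>h. E x * frechet_derivative \<phi> (at x) h + D x h * \<phi> x)) (at x)" for x
   by (rule has_derivative_mult[OF E' schwartz_derivative[OF \<phi>]])
  show "E x * partial j \<phi> x + d x * \<phi> x = E x * frechet_derivative \<phi> (at x) (axis j 1) + D x (axis j 1) * \<phi> x" for x
   by (simp add: partial_def d)
  show "continuous_on UNIV (\<lambda>x. E x * partial j \<phi> x + d x * \<phi> x)"
   by (intro continuous_intros contE cont schwartz_continuous[OF \<phi>] schwartz_continuous[OF p])
  show "integrable lborel (\<lambda>x. E x * \<phi> x)" by (rule schwartz_bounded_mult_integrable[OF \<phi> _ B(1)]) simp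
  show "integrable lborel (\<lambda>x. E x * partial j \<phi> x + d x * \<phi> x)" using i1 i2 by simp
 qed
 then show ?thesis using i1 i2 by (simp add: add_eq_0_iff)
qed

lemma fourier_lborel: "\<phi> \<in> borel_measurable borel ==> fourier \<phi> \<xi> = (LINT x|lborel. cis (- (x \<bullet> \<xi>)) * \<phi> x)"
 unfolding fourier_def by (rule integral_completion) simp

lemma measurable_fourier [measurable]:
 assumes "\<phi> \<in> borel_measurable borel"
 shows "fourier \<phi> \<in> borel_measurable borel"
proof -
 have [measurable]: "\<phi> \<in> borel_measurable borel" by fact
 have "fourier \<phi> = (\<lambda>\<xi>. LINT x|lborel. cis (- (x \<bullet> \<xi>)) * \<phi> x)" using assms by (auto simp: fourier_lborel)
 then show ?thesis by simp
qed

lemma fourier_partial: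
 fixes \<phi> :: "real^2 \<Rightarrow> complex"
 assumes \<phi>: "\<phi> \<in> schwartz"
 shows "fourier (partial j \<phi>) \<xi> = \<i> * of_real (\<xi> $ j) * fourier \<phi> \<xi>"
proof -
 let ?E = "\<lambda>x. cis (- (x \<bullet> \<xi>))"
 let ?d = "\<lambda>x. - (\<i> * of_real (\<xi> $ j)) * cis (- (x \<bullet> \<xi>))"
 have "(LINT x|lborel. ?d x * \<phi> x) = - (LINT x|lborel. ?E x * partial j \<phi> x)"
 proof (rule schwartz_integral_by_parts[OF \<phi>, where D="\<lambda>x h. - (\<i> * of_real (h \<bullet> \<xi>)) * cis (- (x \<bullet> \<xi>))"])
  fix x :: "real^2"
  show "(?E has_derivative (\<lambda>h. - (\<i> * of_real (h \<bullet> \<xi>)) * cis (- (x \<bullet> \<xi>)))) (at x)"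
  proof -
   have 1: "((\<lambda>x. \<i> * of_real (- (x \<bullet> \<xi>))) has_derivative (\<lambda>h. \<i> * of_real (- (h \<bullet> \<xi>)))) (at x)"
    by (auto intro!: derivative_eq_intros)
   show ?thesis unfolding cis_conv_exp
    using has_derivative_compose[OF 1 DERIV_exp[unfolded has_field_derivative_def]] by (simp add: mult_ac)
  qed
  show "?d x = - (\<i> * of_real (axis j 1 \<bullet> \<xi>)) * cis (- (x \<bullet> \<xi>))"
   by (simp add: inner_axis')
  show "continuous_on UNIV ?d" unfolding cis_conv_exp by (intro continuous_intros)
  show "norm (?E x) \<le> 1" by simp
  show "norm (?d x) \<le> \<bar>\<xi> $ j\<bar>" by (simp add: norm_mult)
 qed
 moreover have "(LINT x|lborel. ?d x * \<phi> x) = - (\<i> * of_real (\<xi> $ j)) * (LINT x|lborel. cis (- (x \<bullet> \<xi>)) * \<phi> x)"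
  by (subst integral_mult_right_zero[symmetric]) (simp add: mult_ac)
 ultimately show ?thesis
  using schwartz_borel[OF \<phi>] schwartz_borel[OF schwartz_partial[OF \<phi>]] by (simp add: fourier_lborel)
qed

lemma fourier_partial_funpow:
 fixes \<phi> :: "real^2 \<Rightarrow> complex"
 assumes \<phi>: "\<phi> \<in> schwartz"
 shows "fourier ((partial j ^^ n) \<phi>) \<xi> = (\<i> * of_real (\<xi> $ j)) ^ n * fourier \<phi> \<xi>"
 by (induction n) (simp_all add: fourier_partial schwartz_partial_funpow[OF \<phi>] mult_ac)

lemma fourier_le: "\<phi> \<in> borel_measurable borel ==> norm (fourier \<phi> \<xi>) \<le> (LINT x|lborel. norm (\<phi> x))"
 by (simp only: fourier_lborel) (rule order_trans[OF integral_norm_bound], simp add: norm_mult)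

text \<open>Six derivatives in each coordinate control the third power of
  \<open>1 + (norm \<xi>)\<^sup>2\<close>. Two of the three powers form \<open>decay\<close>; the
  spare one dominates \<open>bracket\<close>.\<close>

lemma schwartz_fourier_decay:
 fixes \<phi> :: "real^2 \<Rightarrow> complex"
 assumes \<phi>: "\<phi> \<in> schwartz"
 obtains B where "B > 0" "\<And>\<xi>. (1 + (norm \<xi>)\<^sup>2) * norm (fourier \<phi> \<xi>) \<le> B * decay \<xi>"
proof -
 define I where "I j n = (LINT x|lborel. norm ((partial j ^^ n) \<phi> x))" for j :: 2 and n :: nat
 have I: "\<bar>\<xi> $ j\<bar> ^ n * norm (fourier \<phi> \<xi>) \<le> I j n" for j n \<xi>
  using fourier_le[OF schwartz_borel[OF schwartz_partial_funpow[OF \<phi>, of n j]], of \<xi>]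
  by (simp add: fourier_partial_funpow[OF \<phi>] norm_mult norm_power I_def)
 have I0: "I j n \<ge> 0" for j n by (simp add: I_def)
 define B where "B = 9 * (I 1 0 + I 1 6 + I 2 6) + 1"
 show ?thesis
 proof (rule that[of B])
  fix \<xi> :: "real^2"
  define x y where "x = (\<xi> $ 1)\<^sup>2" and "y = (\<xi> $ 2)\<^sup>2"
  have xy: "x \<ge> 0" "y \<ge> 0" by (auto simp: x_def y_def)
  \<comment> \<open>The power mean inequality for the three numbers 1, \<open>x\<close> and
    \<open>y\<close>, whence the factor 9.\<close>
  have cube: "(1 + x + y) ^ 3 \<le> 9 * (1 + x ^ 3 + y ^ 3)"
  proof -
   have "2 * (a ^ 3 + b ^ 3) \<ge> (a + b) * (2 * a * b)" if "a \<ge> 0" "b \<ge> 0" for a b :: real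
   proof -
    have "0 \<le> 2 * (a + b) * (a - b)\<^sup>2" using that by simp
    then show ?thesis by (simp add: power2_eq_square power3_eq_cube algebra_simps)
   qed
   from this[of 1 x] this[of 1 y] this[OF xy]
   have A: "x + x\<^sup>2 \<le> 1 + x ^ 3" "y + y\<^sup>2 \<le> 1 + y ^ 3" "x\<^sup>2 * y + x * y\<^sup>2 \<le> x ^ 3 + y ^ 3"
    using xy by (simp_all add: power2_eq_square algebra_simps)
   have c6: "6 * (x * y) \<le> 2 * (1 + x ^ 3 + y ^ 3)"
   proof -
    have "0 \<le> (x - y)\<^sup>2" by simp
    then have "6 * (x * y) \<le> 3 * x\<^sup>2 + 3 * y\<^sup>2" by (simp add: power2_eq_square algebra_simps)
    moreover have "3 * z\<^sup>2 \<le> 1 + 2 * z ^ 3" if "z \<ge> 0" for z :: real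
    proof -
     have "0 \<le> (2 * z + 1) * (z - 1)\<^sup>2" using that by simp
     then show ?thesis by (simp add: power2_eq_square power3_eq_cube algebra_simps)
    qed
    ultimately show ?thesis using xy by (smt (verit, best))
   qed
   have "(1 + x + y) ^ 3 = 1 + x ^ 3 + y ^ 3 + 3 * (x + x\<^sup>2) + 3 * (y + y\<^sup>2) + 3 * (x\<^sup>2 * y + x * y\<^sup>2) + 6 * (x * y)"
    by (simp add: power2_eq_square power3_eq_cube algebra_simps)
   also have "... \<le> 9 * (1 + x ^ 3 + y ^ 3)" using A c6 by (simp only: distrib_left)
   finally show ?thesis .
  qed
  have p6: "\<bar>\<xi> $ 1\<bar> ^ 6 = x ^ 3" "\<bar>\<xi> $ 2\<bar> ^ 6 = y ^ 3"
   using power_mult[of "\<bar>\<xi> $ 1\<bar>" 2 3] power_mult[of "\<bar>\<xi> $ 2\<bar>" 2 3] by (simp_all add: x_def y_def)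
  have "(1 + (norm \<xi>)\<^sup>2) ^ 3 * norm (fourier \<phi> \<xi>) \<le> 9 * (1 + x ^ 3 + y ^ 3) * norm (fourier \<phi> \<xi>)"
   using cube by (intro mult_right_mono) (auto simp: norm_vec2 x_def y_def add.assoc)
  also have "... \<le> B"
   using I[where j=1 and n=0 and \<xi>=\<xi>] I[where j=1 and n=6 and \<xi>=\<xi>] I[where j=2 and n=6 and \<xi>=\<xi>] by (simp add: p6 algebra_simps B_def)
  finally have "(1 + (norm \<xi>)\<^sup>2)\<^sup>2 * ((1 + (norm \<xi>)\<^sup>2) * norm (fourier \<phi> \<xi>)) \<le> B"
   by (simp add: power3_eq_cube power2_eq_square mult_ac)
  moreover have "(1 + (norm \<xi>)\<^sup>2)\<^sup>2 > 0" by (intro zero_less_power add_pos_nonneg) auto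
  ultimately show "(1 + (norm \<xi>)\<^sup>2) * norm (fourier \<phi> \<xi>) \<le> B * decay \<xi>"
   by (simp add: decay_def pos_le_divide_eq mult.commute)
 qed (use I0 in \<open>simp add: B_def add_nonneg_pos\<close>)
qed

section \<open>Gaussians times polynomials as Schwartz functions\<close>

lemmas has_derivative_vec_nth' [derivative_intros] = bounded_linear.has_derivative[OF bounded_linear_vec_nth]

text \<open>Polynomials times a fixed Gaussian centred at \<open>p\<close>. The inductive form makes
  closure under partial derivatives and Gaussian decay plain inductions, without any handling of
  monomials.\<close>

inductive_set gauss_poly :: "real \<Rightarrow> real^2 \<Rightarrow> (real^2 \<Rightarrow> complex) set" for \<kappa> p where
 base: "(\<lambda>x. of_real (exp (- \<kappa> * (norm (x - p))\<^sup>2))) \<in> gauss_poly \<kappa> p"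
| coord: "h \<in> gauss_poly \<kappa> p ==> (\<lambda>x. of_real ((x - p) $ j) * h x) \<in> gauss_poly \<kappa> p"
| scale: "h \<in> gauss_poly \<kappa> p ==> (\<lambda>x. c * h x) \<in> gauss_poly \<kappa> p"
| add: "h \<in> gauss_poly \<kappa> p ==> k \<in> gauss_poly \<kappa> p ==> (\<lambda>x. h x + k x) \<in> gauss_poly \<kappa> p"

lemma partial_eqI: "(\<And>x. (h has_derivative D x) (at x)) ==> partial j h = (\<lambda>x. D x (axis j 1))"
 unfolding partial_def by (metis frechet_derivative_at)

lemma gauss_poly_derivative:
 assumes "h \<in> gauss_poly \<kappa> p"
 shows "\<exists>D. (\<forall>x. (h has_derivative D x) (at x)) \<and> (\<forall>j. (\<lambda>x. D x (axis j 1)) \<in> gauss_poly \<kappa> p)"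
 using assms
proof induction
 case base
 let ?b = "\<lambda>x. complex_of_real (exp (- \<kappa> * (norm (x - p))\<^sup>2))"
 let ?D = "\<lambda>x h. of_real (- 2 * \<kappa> * ((x - p) \<bullet> h)) * ?b x"
 have "(?b has_derivative ?D x) (at x)" for x
  unfolding power2_norm_eq_inner
  by (auto intro!: derivative_eq_intros simp: fun_eq_iff inner_commute algebra_simps)
 moreover have "(\<lambda>x. ?D x (axis j 1)) \<in> gauss_poly \<kappa> p" for j
 proof -
  have "(\<lambda>x. ?D x (axis j 1)) = (\<lambda>x. of_real (- 2 * \<kappa>) * (of_real ((x - p) $ j) * ?b x))"
   by (simp add: fun_eq_iff inner_axis)
  then show ?thesis by (simp only: gauss_poly.scale gauss_poly.coord gauss_poly.base)
 qed
 ultimately show ?case by (intro exI[of _ ?D]) auto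
next
 case (coord h i)
 then obtain D where D: "\<And>x. (h has_derivative D x) (at x)" "\<And>j. (\<lambda>x. D x (axis j 1)) \<in> gauss_poly \<kappa> p" by blast
 let ?D = "\<lambda>x v. of_real ((x - p) $ i) * D x v + of_real (v $ i) * h x"
 have "((\<lambda>x. of_real ((x - p) $ i) * h x) has_derivative ?D x) (at x)" for x
  by (rule has_derivative_mult[OF _ D(1)]) (auto intro!: derivative_eq_intros)
 moreover have "(\<lambda>x. ?D x (axis j 1)) \<in> gauss_poly \<kappa> p" for j
  by (intro gauss_poly.add gauss_poly.coord D(2) gauss_poly.scale coord)
 ultimately show ?case by (intro exI[of _ ?D]) auto
next
 case (scale h c)
 then obtain D where D: "\<And>x. (h has_derivative D x) (at x)" "\<And>j. (\<lambda>x. D x (axis j 1)) \<in> gauss_poly \<kappa> p" by blast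
 show ?case
  by (intro exI[of _ "\<lambda>x v. c * D x v"] conjI allI gauss_poly.scale D(2) has_derivative_mult_right D(1))
next
 case (add h k)
 then obtain D D' where D: "\<And>x. (h has_derivative D x) (at x)" "\<And>j. (\<lambda>x. D x (axis j 1)) \<in> gauss_poly \<kappa> p"
  "\<And>x. (k has_derivative D' x) (at x)" "\<And>j. (\<lambda>x. D' x (axis j 1)) \<in> gauss_poly \<kappa> p" by blast
 show ?case
  by (intro exI[of _ "\<lambda>x v. D x v + D' x v"] conjI allI gauss_poly.add D has_derivative_add)
qed

lemma mult_exp_neg_sq_le: "r * exp (- \<eta> * r\<^sup>2) \<le> 1 / (2 * \<eta>) + 1" if "\<eta> > 0" "r \<ge> 0" for r \<eta> :: real
proof -
 have "r * exp (- \<eta> * r\<^sup>2) * (2 * \<eta>) \<le> (1 + 2 * \<eta>)"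
 proof -
  have "2 * \<eta> * r \<le> (1 + 2 * \<eta>) * (1 + \<eta> * r\<^sup>2)"
  proof -
   define z u where "z = \<eta> * r" and "u = \<eta> * r\<^sup>2"
   have "2 * r \<le> 1 + r\<^sup>2" using zero_le_power2[of "r - 1"] by (simp add: power2_eq_square algebra_simps)
   then have "\<eta> * (2 * r) \<le> \<eta> * (1 + r\<^sup>2)" using that by (intro mult_left_mono) auto
   then have 1: "2 * z \<le> \<eta> + u" by (simp add: z_def u_def algebra_simps)
   have 2: "0 \<le> \<eta> * u" using that by (simp add: u_def)
   have "2 * \<eta> * r = 2 * z" by (simp add: z_def)
   also have "... \<le> 1 + 2 * \<eta> + u + 2 * (\<eta> * u)" using 1 2 that by linarith
   also have "... = (1 + 2 * \<eta>) * (1 + u)" by (simp add: algebra_simps)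
   finally show ?thesis by (simp add: u_def)
  qed
  also have "... \<le> (1 + 2 * \<eta>) * exp (\<eta> * r\<^sup>2)" using that by (intro mult_left_mono exp_ge_add_one_self) auto
  finally have "2 * \<eta> * r * exp (- \<eta> * r\<^sup>2) \<le> (1 + 2 * \<eta>) * exp (\<eta> * r\<^sup>2) * exp (- \<eta> * r\<^sup>2)"
   by (intro mult_right_mono) auto
  then show ?thesis by (simp add: mult_ac flip: exp_add)
 qed
 then show ?thesis using that by (simp add: field_simps)
qed

lemma gauss_poly_bound:
 assumes "h \<in> gauss_poly \<kappa> p" "\<kappa>' < \<kappa>"
 shows "\<exists>C\<ge>0. \<forall>x. norm (h x) \<le> C * exp (- \<kappa>' * (norm (x - p))\<^sup>2)"
 using assms
proof (induction arbitrary: \<kappa>')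
 case base
 then show ?case by (intro exI[of _ 1]) (auto intro!: mult_right_mono)
next
 case (coord h i)
 \<comment> \<open>Half of the gap between \<open>\<kappa>'\<close> and \<open>\<kappa>\<close> pays
   for the coordinate factor; the other half is left to the induction hypothesis.\<close>
 define \<mu> where "\<mu> = (\<kappa>' + \<kappa>) / 2"
 have \<mu>: "\<kappa>' < \<mu>" "\<mu> < \<kappa>" using coord.prems by (auto simp: \<mu>_def)
 obtain C where C: "C \<ge> 0" "\<And>x. norm (h x) \<le> C * exp (- \<mu> * (norm (x - p))\<^sup>2)" using coord.IH[OF \<mu>(2)] by blast
 let ?K = "1 / (2 * (\<mu> - \<kappa>')) + 1"
 show ?case
 proof (intro exI[of _ "?K * C"] conjI allI)
  fix x
  have "norm (of_real ((x - p) $ i) * h x) \<le> norm (x - p) * (C * exp (- \<mu> * (norm (x - p))\<^sup>2))"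
   unfolding norm_mult norm_of_real by (intro mult_mono C component_le_norm_cart) auto
  also have "... = C * (norm (x - p) * exp (- (\<mu> - \<kappa>') * (norm (x - p))\<^sup>2)) * exp (- \<kappa>' * (norm (x - p))\<^sup>2)"
   by (simp add: mult.assoc algebra_simps flip: exp_add)
  also have "... \<le> C * ?K * exp (- \<kappa>' * (norm (x - p))\<^sup>2)"
   using C(1) \<mu> by (intro mult_right_mono mult_left_mono mult_exp_neg_sq_le) auto
  finally show "norm (of_real ((x - p) $ i) * h x) \<le> ?K * C * exp (- \<kappa>' * (norm (x - p))\<^sup>2)"
   by (simp add: mult_ac)
 qed (use C \<mu> in auto)
next
 case (scale h c)
 then obtain C where C: "C \<ge> 0" "\<And>x. norm (h x) \<le> C * exp (- \<kappa>' * (norm (x - p))\<^sup>2)" by blast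
 then show ?case
  by (intro exI[of _ "norm c * C"]) (auto simp: norm_mult mult.assoc intro!: mult_left_mono)
next
 case (add h k)
 then obtain C C' where C: "C \<ge> 0" "\<And>x. norm (h x) \<le> C * exp (- \<kappa>' * (norm (x - p))\<^sup>2)"
  "C' \<ge> 0" "\<And>x. norm (k x) \<le> C' * exp (- \<kappa>' * (norm (x - p))\<^sup>2)" by blast
 show ?case
 proof (intro exI[of _ "C + C'"] conjI allI)
  fix x show "norm (h x + k x) \<le> (C + C') * exp (- \<kappa>' * (norm (x - p))\<^sup>2)"
   using norm_triangle_ineq[of "h x" "k x"] C(2)[of x] C(4)[of x] by (simp add: distrib_right)
 qed (use C in auto)
qed

lemma power_le_fact_exp: "t ^ k \<le> fact k * exp t" if "t \<ge> 0" for t :: real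
proof (induction k)
 case 0 then show ?case using that by simp
next
 case (Suc k)
 have "t ^ n / fact n \<le> exp t" for n
 proof -
  have "(\<Sum>i\<in>{n}. t ^ i /\<^sub>R fact i) \<le> (\<Sum>i. t ^ i /\<^sub>R fact i)"
   using that by (intro sum_le_suminf summable_exp_generic) auto
  then show ?thesis by (simp add: exp_def divide_inverse mult.commute)
 qed
 from this[of "Suc k"] show ?case by (simp add: pos_divide_le_eq mult.commute del: fact_Suc power_Suc)
qed

text \<open>Iterated derivatives stay in the class, so it is enough to bound one member. The weight
  \<open>norm x ^ k\<close> is dominated by an exponential of \<open>norm (x - p)\<close>, and
  completing the square absorbs that into the Gaussian.\<close>

lemma gauss_poly_schwartz:
 assumes "h \<in> gauss_poly \<kappa> p" "\<kappa> > 0"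
 shows "h \<in> schwartz"
proof -
 have "foldr partial js h \<in> gauss_poly \<kappa> p" for js
 proof (induction js)
  case (Cons j js)
  obtain D where D: "\<And>x. (foldr partial js h has_derivative D x) (at x)" "\<And>j. (\<lambda>x. D x (axis j 1)) \<in> gauss_poly \<kappa> p"
   using gauss_poly_derivative[OF Cons] by blast
  show ?case using D(2)[of j] by (simp add: partial_eqI[OF D(1)])
 qed (use assms in simp)
 moreover have "(\<forall>x. g differentiable at x) \<and> (\<forall>k. bounded (range (\<lambda>x. norm x ^ k *\<^sub>R g x)))"
  if g: "g \<in> gauss_poly \<kappa> p" for g
 proof (intro conjI allI)
  show "g differentiable at x" for x using gauss_poly_derivative[OF g] by (auto simp: differentiable_def)
  fix k :: nat
  obtain C where C: "C \<ge> 0" "\<And>x. norm (g x) \<le> C * exp (- (\<kappa>/2) * (norm (x - p))\<^sup>2)"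
   using gauss_poly_bound[OF g, of "\<kappa>/2"] assms(2) by auto
  show "bounded (range (\<lambda>x. norm x ^ k *\<^sub>R g x))"
  proof (rule boundedI, safe)
   fix x
   define r where "r = norm (x - p)"
   have "norm x \<le> r + norm p" unfolding r_def using norm_triangle_ineq[of "x - p" p] by simp
   then have "norm x ^ k \<le> (r + norm p) ^ k" by (intro power_mono) auto
   also have "... \<le> fact k * exp (r + norm p)" by (intro power_le_fact_exp) (auto simp: r_def)
   finally have "norm (norm x ^ k *\<^sub>R g x) \<le> fact k * exp (r + norm p) * (C * exp (- (\<kappa>/2) * r\<^sup>2))"
    unfolding norm_scaleR r_def using C by (intro mult_mono) auto
   also have "... = fact k * C * exp (norm p + (r - (\<kappa>/2) * r\<^sup>2))" by (simp add: exp_add algebra_simps flip: exp_add)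
   also have "... \<le> fact k * C * exp (norm p + 1 / (2 * \<kappa>))"
   proof (intro mult_left_mono)
    have "0 \<le> (\<kappa> * r - 1)\<^sup>2" by simp
    then have "r - (\<kappa>/2) * r\<^sup>2 \<le> 1 / (2 * \<kappa>)" using assms(2) by (simp add: field_simps power2_eq_square)
    then show "exp (norm p + (r - (\<kappa>/2) * r\<^sup>2)) \<le> exp (norm p + 1 / (2 * \<kappa>))" by simp
   qed (use C in auto)
   finally show "norm (norm x ^ k *\<^sub>R g x) \<le> fact k * C * exp (norm p + 1 / (2 * \<kappa>))" .
  qed
 qed
 ultimately show ?thesis by (simp add: schwartz_def)
qed

text \<open>These translates are the only test functions used for the direct estimate. The last
  identity computes the divergence of the gradient of the kernel.\<close>

lemma heat_schwartz:
 assumes a: "a > 0"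
 shows "(\<lambda>y. complex_of_real (heat a (y - x))) \<in> schwartz"
  and "(\<lambda>y. complex_of_real (dheat j a (y - x))) \<in> schwartz"
  and "partial j (\<lambda>y. complex_of_real (heat a (y - x))) = (\<lambda>y. complex_of_real (dheat j a (y - x)))"
  and "(\<Sum>j\<in>UNIV. partial j (\<lambda>y. complex_of_real (dheat j a (y - x))) y) = complex_of_real (lheat a (y - x))"
proof -
 have a': "1 / (4*a) > 0" using a by simp
 have g1: "(\<lambda>y. complex_of_real (heat a (y - x))) \<in> gauss_poly (1/(4*a)) x"
  using gauss_poly.scale[OF gauss_poly.base[of "1/(4*a)" x], of "of_real (1 / (4*pi*a))"] by (simp add: heat_def)
 show "(\<lambda>y. complex_of_real (heat a (y - x))) \<in> schwartz" by (rule gauss_poly_schwartz[OF g1 a'])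
 have "(\<lambda>y. complex_of_real (dheat j a (y - x))) \<in> gauss_poly (1/(4*a)) x"
  using gauss_poly.scale[OF gauss_poly.coord[OF g1, of j], of "of_real (- 1 / (2*a))"] by (simp add: dheat_def mult_ac)
 then show "(\<lambda>y. complex_of_real (dheat j a (y - x))) \<in> schwartz" by (rule gauss_poly_schwartz[OF _ a'])
 have D1: "((\<lambda>y. heat a (y - x)) has_derivative (\<lambda>v. - ((y - x) \<bullet> v / (2*a)) * heat a (y - x))) (at y)" for y
  unfolding heat_def power2_norm_eq_inner using a
  by (auto intro!: derivative_eq_intros simp: fun_eq_iff inner_commute field_simps)
 have "((\<lambda>y. complex_of_real (heat a (y - x))) has_derivative (\<lambda>v. of_real (- ((y - x) \<bullet> v / (2*a)) * heat a (y - x)))) (at y)" for y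
  by (rule has_derivative_of_real[OF D1])
 from partial_eqI[OF this] show "partial j (\<lambda>y. complex_of_real (heat a (y - x))) = (\<lambda>y. complex_of_real (dheat j a (y - x)))"
  by (simp add: dheat_def inner_axis)
 have D2: "((\<lambda>y. dheat j a (y - x)) has_derivative (\<lambda>v. - ((y - x) $ j / (2*a)) * (- ((y - x) \<bullet> v / (2*a)) * heat a (y - x)) + - (v $ j / (2*a)) * heat a (y - x))) (at y)" for y j
  unfolding dheat_def using a
  by (intro has_derivative_mult[OF _ D1]) (auto intro!: derivative_eq_intros)
 have "((\<lambda>y. complex_of_real (dheat j a (y - x))) has_derivative (\<lambda>v. of_real (- ((y - x) $ j / (2*a)) * (- ((y - x) \<bullet> v / (2*a)) * heat a (y - x)) + - (v $ j / (2*a)) * heat a (y - x)))) (at y)" for y j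
  by (rule has_derivative_of_real[OF D2])
 note p2 = partial_eqI[OF this]
 have "(\<Sum>j\<in>UNIV. partial j (\<lambda>y. complex_of_real (dheat j a (y - x))) y) =
  of_real (\<Sum>j\<in>UNIV. - ((y - x) $ j / (2*a)) * (- ((y - x) \<bullet> axis j 1 / (2*a)) * heat a (y - x)) + - (axis j 1 $ j / (2*a)) * heat a (y - x))"
  unfolding p2 of_real_sum ..
 also have "... = complex_of_real (lheat a (y - x))"
  unfolding lheat_def norm_vec2 sum_2 using a by (simp add: inner_axis field_simps power2_eq_square)
 finally show "(\<Sum>j\<in>UNIV. partial j (\<lambda>y. complex_of_real (dheat j a (y - x))) y) = complex_of_real (lheat a (y - x))" .
qed

section \<open>Superpositions of heat kernels\<close>

lemma nn_integral_product_le: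
 fixes h k :: "'a \<Rightarrow> real"
 assumes [measurable]: "h \<in> borel_measurable M" "k \<in> borel_measurable M"
 shows "(\<integral>\<^sup>+y. ennreal \<bar>h y * k y\<bar> \<partial>M) \<le> (\<integral>\<^sup>+y. ennreal ((h y)\<^sup>2) \<partial>M) + (\<integral>\<^sup>+y. ennreal ((k y)\<^sup>2) \<partial>M)"
proof -
 have "(\<integral>\<^sup>+y. ennreal \<bar>h y * k y\<bar> \<partial>M) \<le> (\<integral>\<^sup>+y. ennreal ((h y)\<^sup>2) + ennreal ((k y)\<^sup>2) \<partial>M)"
 proof (intro nn_integral_mono)
  fix y
  have "0 \<le> (\<bar>h y\<bar> - \<bar>k y\<bar>)\<^sup>2" by simp
  then have "\<bar>h y * k y\<bar> * 2 \<le> (h y)\<^sup>2 + (k y)\<^sup>2" by (simp add: power2_eq_square algebra_simps abs_mult)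
  then have "\<bar>h y * k y\<bar> \<le> (h y)\<^sup>2 + (k y)\<^sup>2" by (smt (verit) abs_ge_zero)
  then show "ennreal \<bar>h y * k y\<bar> \<le> ennreal ((h y)\<^sup>2) + ennreal ((k y)\<^sup>2)"
   by (simp flip: ennreal_plus)
 qed
 then show ?thesis by (simp add: nn_integral_add)
qed

text \<open>Superpositions \<open>y \<mapsto> \<integral> k \<omega> y d\<nu>(\<omega>)\<close> of a family that is bounded in \<open>L\<^sup>2\<close>.\<close>

locale L2_family = finite_measure \<nu> for \<nu> :: "'w measure" +
 fixes k :: "'w \<Rightarrow> 'b::euclidean_space \<Rightarrow> real" and B :: ennreal
 assumes k_meas [measurable]: "case_prod k \<in> borel_measurable (\<nu> \<Otimes>\<^sub>M borel)"
  and B: "B < \<infinity>" "AE w in \<nu>. (\<integral>\<^sup>+y. ennreal ((k w y)\<^sup>2) \<partial>lborel) \<le> B"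
begin

definition mix :: "'b \<Rightarrow> real" where "mix y = (LINT w|\<nu>. k w y)"

lemma k_meas' [measurable]: "case_prod k \<in> borel_measurable (\<nu> \<Otimes>\<^sub>M lborel)"
 using k_meas by (simp cong: measurable_cong_sets sets_pair_measure_cong)

lemma mix_meas [measurable]: "mix \<in> borel_measurable borel"
proof -
 have [measurable]: "(\<lambda>(y, w). k w y) \<in> borel_measurable (borel \<Otimes>\<^sub>M \<nu>)"
  using measurable_compose[OF measurable_pair_swap' k_meas] by (simp add: comp_def split_beta')
 show ?thesis unfolding mix_def by measurable
qed

lemma pairing_finite:
 assumes [measurable]: "h \<in> borel_measurable borel" and h: "(\<integral>\<^sup>+y. ennreal ((h y)\<^sup>2) \<partial>lborel) < \<infinity>"
 shows "(\<integral>\<^sup>+w. \<integral>\<^sup>+y. ennreal (norm (h y * k w y)) \<partial>lborel \<partial>\<nu>) < \<infinity>"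
proof -
 have "(\<integral>\<^sup>+w. \<integral>\<^sup>+y. ennreal (norm (h y * k w y)) \<partial>lborel \<partial>\<nu>) \<le> (\<integral>\<^sup>+w. (\<integral>\<^sup>+y. ennreal ((h y)\<^sup>2) \<partial>lborel) + B \<partial>\<nu>)"
 proof (rule nn_integral_mono_AE)
  show "AE w in \<nu>. (\<integral>\<^sup>+y. ennreal (norm (h y * k w y)) \<partial>lborel) \<le> (\<integral>\<^sup>+y. ennreal ((h y)\<^sup>2) \<partial>lborel) + B"
   using B(2) AE_space
  proof eventually_elim
   case (elim w)
   then have "k w \<in> borel_measurable lborel" by simp
   then have "(\<integral>\<^sup>+y. ennreal \<bar>h y * k w y\<bar> \<partial>lborel) \<le> (\<integral>\<^sup>+y. ennreal ((h y)\<^sup>2) \<partial>lborel) + (\<integral>\<^sup>+y. ennreal ((k w y)\<^sup>2) \<partial>lborel)"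
    by (intro nn_integral_product_le) simp_all
   also have "... \<le> (\<integral>\<^sup>+y. ennreal ((h y)\<^sup>2) \<partial>lborel) + B" using elim by (intro add_left_mono)
   finally show ?case by simp
  qed
 qed
 also have "... < \<infinity>" using h B(1) emeasure_finite[of "space \<nu>", unfolded less_top] by (simp add: ennreal_mult_less_top)
 finally show ?thesis .
qed

lemma pairing:
 assumes h_meas [measurable]: "h \<in> borel_measurable borel" and h: "(\<integral>\<^sup>+y. ennreal ((h y)\<^sup>2) \<partial>lborel) < \<infinity>"
 shows pairing_eq: "(LINT w|\<nu>. LINT y|lborel. h y * k w y) = (LINT y|lborel. h y * mix y)"
  and pairing_integrable: "integrable lborel (\<lambda>y. h y * mix y)"
  and pairing_integrable': "integrable \<nu> (\<lambda>w. LINT y|lborel. h y * k w y)"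
proof -
 have 1: "sigma_finite_measure \<nu>" by unfold_locales
 have m: "(\<lambda>(w, y). h y * k w y) \<in> borel_measurable (\<nu> \<Otimes>\<^sub>M lborel)"
  by measurable
 note F = Fubini_swap[OF 1 sigma_finite_lborel m pairing_finite[OF assms]]
 show "(LINT w|\<nu>. LINT y|lborel. h y * k w y) = (LINT y|lborel. h y * mix y)"
  using F(1) by (simp add: mix_def)
 show "integrable lborel (\<lambda>y. h y * mix y)"
  using F(3) by (simp add: mix_def)
 show "integrable \<nu> (\<lambda>w. LINT y|lborel. h y * k w y)" by (rule F(2))
qed

text \<open>Cauchy-Schwarz against the constant one on the finite measure \<nu>, then
  Fubini.\<close>

lemma mix_L2: "(\<integral>\<^sup>+y. ennreal ((mix y)\<^sup>2) \<partial>lborel) < \<infinity>"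
proof -
 have "ennreal ((mix y)\<^sup>2) \<le> emeasure \<nu> (space \<nu>) * (\<integral>\<^sup>+w. ennreal ((k w y)\<^sup>2) \<partial>\<nu>)" for y
 proof -
  have [measurable]: "(\<lambda>w. k w y) \<in> borel_measurable \<nu>"
   using measurable_compose[OF measurable_Pair2' k_meas, of y] by simp
  have "ennreal \<bar>mix y\<bar> \<le> (\<integral>\<^sup>+w. ennreal \<bar>k w y\<bar> * 1 \<partial>\<nu>)"
   using norm_integral_le_nn_integral[of \<nu> "\<lambda>w. k w y"] by (simp add: mix_def)
  then have "(ennreal \<bar>mix y\<bar>)\<^sup>2 \<le> (\<integral>\<^sup>+w. ennreal \<bar>k w y\<bar> * 1 \<partial>\<nu>)\<^sup>2" by (intro power_mono) auto
  also have "... \<le> (\<integral>\<^sup>+w. (ennreal \<bar>k w y\<bar>)\<^sup>2 \<partial>\<nu>) * (\<integral>\<^sup>+w. 1\<^sup>2 \<partial>\<nu>)"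
   by (intro Cauchy_Schwarz_nn_integral) auto
  finally show ?thesis by (simp add: ennreal_power mult.commute)
 qed
 then have "(\<integral>\<^sup>+y. ennreal ((mix y)\<^sup>2) \<partial>lborel) \<le> (\<integral>\<^sup>+y. emeasure \<nu> (space \<nu>) * (\<integral>\<^sup>+w. ennreal ((k w y)\<^sup>2) \<partial>\<nu>) \<partial>lborel)"
  by (intro nn_integral_mono)
 also have "... = emeasure \<nu> (space \<nu>) * (\<integral>\<^sup>+y. \<integral>\<^sup>+w. ennreal ((k w y)\<^sup>2) \<partial>\<nu> \<partial>lborel)"
 proof (rule nn_integral_cmult)
  have [measurable]: "(\<lambda>(y, w). k w y) \<in> borel_measurable (lborel \<Otimes>\<^sub>M \<nu>)"
   using measurable_compose[OF measurable_pair_swap' k_meas'] by (simp add: comp_def split_beta')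
  show "(\<lambda>y. \<integral>\<^sup>+w. ennreal ((k w y)\<^sup>2) \<partial>\<nu>) \<in> borel_measurable lborel" by measurable
 qed
 also have "(\<integral>\<^sup>+y. \<integral>\<^sup>+w. ennreal ((k w y)\<^sup>2) \<partial>\<nu> \<partial>lborel) = (\<integral>\<^sup>+w. \<integral>\<^sup>+y. ennreal ((k w y)\<^sup>2) \<partial>lborel \<partial>\<nu>)"
 proof -
  have "sigma_finite_measure \<nu>" by unfold_locales
  then interpret P: pair_sigma_finite \<nu> "lborel :: 'b measure"
   by (intro pair_sigma_finite.intro sigma_finite_lborel)
  show ?thesis by (rule P.Fubini') measurable
 qed
 also have "... \<le> (\<integral>\<^sup>+w. B \<partial>\<nu>)" by (rule nn_integral_mono_AE[OF B(2)])
 finally have "(\<integral>\<^sup>+y. ennreal ((mix y)\<^sup>2) \<partial>lborel) \<le> emeasure \<nu> (space \<nu>) * (B * emeasure \<nu> (space \<nu>))"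
  by (simp add: mult_left_mono)
 also have "... < \<infinity>" using B(1) emeasure_finite[of "space \<nu>", unfolded less_top] by (simp add: ennreal_mult_less_top)
 finally show ?thesis .
qed

text \<open>The pairing formula is used twice: with \<open>mix\<close> itself as the partner of the
  family, and then with a single member \<open>k w\<close>.\<close>

lemma mix_gram:
 "(LINT y|lborel. (mix y)\<^sup>2) = (LINT w|\<nu>. LINT w'|\<nu>. LINT y|lborel. k w y * k w' y)"
proof -
 have "(LINT y|lborel. (mix y)\<^sup>2) = (LINT w|\<nu>. LINT y|lborel. mix y * k w y)"
  by (simp add: pairing_eq[OF mix_meas mix_L2] power2_eq_square)
 also have "... = (LINT w|\<nu>. LINT w'|\<nu>. LINT y|lborel. k w y * k w' y)"
 proof (rule integral_cong_AE)
  show "AE w in \<nu>. (LINT y|lborel. mix y * k w y) = (LINT w'|\<nu>. LINT y|lborel. k w y * k w' y)"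
   using B(2) AE_space
  proof eventually_elim
   case (elim w)
   then show ?case using pairing_eq[of "k w"] B(1) by (simp add: mult.commute le_less_trans)
  qed
 qed measurable
 finally show ?thesis .
qed

lemma mix_gram_integrable: "integrable \<nu> (\<lambda>w. LINT w'|\<nu>. LINT y|lborel. k w y * k w' y)"
proof -
 have "AE w in \<nu>. (LINT y|lborel. mix y * k w y) = (LINT w'|\<nu>. LINT y|lborel. k w y * k w' y)"
  using B(2) AE_space
 proof eventually_elim
  case (elim w)
  then show ?case using pairing_eq[of "k w"] B(1) by (simp add: mult.commute le_less_trans)
 qed
 then show ?thesis
  using pairing_integrable'[OF mix_meas mix_L2] by (subst integrable_cong_AE[symmetric]) auto
qed

lemma mix_nn_integral: "(\<integral>\<^sup>+y. ennreal ((mix y)\<^sup>2) \<partial>lborel) = ennreal (LINT y|lborel. (mix y)\<^sup>2)"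
 using mix_L2 by (intro nn_integral_eq_integral integrableI_bounded) auto

end

text \<open>The diagonal of the Gram identity, keeping one of the two coordinates.\<close>

lemma dheat_sq:
 assumes "b > 0"
 shows "(\<integral>\<^sup>+y. ennreal ((dheat j b (y - x))\<^sup>2) \<partial>lborel) \<le> ennreal (1 / (16 * pi * b\<^sup>2))"
proof -
 have i: "integrable lborel (\<lambda>y. \<Sum>j\<in>UNIV. dheat j b (y - x) * dheat j b (y - x))"
  and v: "(LINT y|lborel. (\<Sum>j\<in>UNIV. dheat j b (y - x) * dheat j b (y - x))) = - lheat (b + b) (x - x)"
  using dheat_gram[OF assms assms] by auto
 have "(\<integral>\<^sup>+y. ennreal ((dheat j b (y - x))\<^sup>2) \<partial>lborel) \<le> (\<integral>\<^sup>+y. ennreal (\<Sum>j\<in>UNIV. dheat j b (y - x) * dheat j b (y - x)) \<partial>lborel)"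
  by (intro nn_integral_mono ennreal_leI order_trans[OF _ member_le_sum[of j]]) (auto simp: power2_eq_square)
 also have "... = ennreal (- lheat (b + b) (x - x))"
  unfolding v[symmetric] by (intro nn_integral_eq_integral i always_eventually allI sum_nonneg) auto
 also have "- lheat (b + b) (x - x) = 1 / (16 * pi * b\<^sup>2)"
  using assms by (simp add: lheat_def heat_def power2_eq_square)
 finally show ?thesis .
qed

text \<open>The functions of the converse direction: averages of heat kernels over times bounded
  below by \<open>l\<close>. The lower bound keeps all kernels bounded, and mass and gradient energy
  become double integrals over \<open>N\<close> of explicit functions of
  \<open>a + b\<close>.\<close>

locale heat_mixture = finite_measure N for N :: "real measure" +
 fixes l :: real
 assumes sets_N [measurable_cong]: "sets N = sets borel" and l: "l > 0" and supp: "AE a in N. l \<le> a"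
begin

definition prof :: "real^2 \<Rightarrow> real" where "prof x = (LINT a|N. heat a x)"
definition dprof :: "2 \<Rightarrow> real^2 \<Rightarrow> real" where "dprof j x = (LINT a|N. dheat j a x)"
definition sym :: "real^2 \<Rightarrow> real" where "sym \<xi> = (LINT a|N. exp (- a * (norm \<xi>)\<^sup>2))"
text \<open>The inverse Fourier integral of \<open>bracket\<close> times \<open>sym\<close>, the
  transform of \<open>prof\<close>; hence the image of \<open>prof\<close> under the bracket
  multiplier, as \<open>prof_multiplier\<close> verifies in the sense of distributions.\<close>

definition br :: "real^2 \<Rightarrow> complex" where
 "br x = of_real (1 / (2*pi)^2) * (LINT \<xi>|lborel. cis (x \<bullet> \<xi>) * (bracket \<xi> * of_real (sym \<xi>)))"

lemma space_N [simp]: "space N = UNIV" using sets_N sets_eq_imp_space_eq by fastforce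

lemma prof_meas [measurable]: "prof \<in> borel_measurable borel" unfolding prof_def by measurable
lemma dprof_meas [measurable]: "dprof j \<in> borel_measurable borel" unfolding dprof_def by measurable
lemma sym_meas [measurable]: "sym \<in> borel_measurable borel" unfolding sym_def by measurable

lemma mass_finite: "emeasure N UNIV < \<infinity>" using emeasure_finite[of UNIV, unfolded less_top] by simp

lemma AE_heat_bounds: "AE a in N. 0 \<le> heat a x \<and> heat a x \<le> 1 / (4 * pi * l)"
 using supp
proof eventually_elim
 case (elim a)
 then have "heat a x \<le> 1 / (4 * pi * a)" using l by (intro heat_le) simp
 also have "... \<le> 1 / (4 * pi * l)" using elim l by (intro divide_left_mono) auto
 finally show ?case using elim l by (simp add: heat_nonneg)
qed

lemma integrable_heat_time: "integrable N (\<lambda>a. heat a x)"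
 using AE_heat_bounds[of x] by (intro integrable_const_bound[where B="1 / (4*pi*l)"]) auto

lemma prof_nonneg: "prof x \<ge> 0"
 unfolding prof_def using AE_heat_bounds[of x] by (intro integral_nonneg_AE) auto

lemma prof_le: "prof x \<le> measure N UNIV / (4 * pi * l)"
proof -
 have "prof x \<le> (LINT a|N. 1 / (4 * pi * l))"
  unfolding prof_def using AE_heat_bounds[of x] by (intro integral_mono_AE integrable_heat_time) auto
 then show ?thesis by simp
qed

lemma prof_fourier:
 "(LINT x|lborel. cis (x \<bullet> \<xi>) * of_real (prof x)) = of_real (sym \<xi>)" "integrable lborel prof"
proof -
 have sf: "sigma_finite_measure N" by unfold_locales
 have fin: "(\<integral>\<^sup>+a. \<integral>\<^sup>+x. ennreal (norm (cis (x \<bullet> \<xi>) * complex_of_real (heat a x))) \<partial>lborel \<partial>N) < \<infinity>" for \<xi>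
 proof -
  have "(\<integral>\<^sup>+a. \<integral>\<^sup>+x. ennreal (norm (cis (x \<bullet> \<xi>) * complex_of_real (heat a x))) \<partial>lborel \<partial>N) \<le> (\<integral>\<^sup>+a. 1 \<partial>N)"
  proof (rule nn_integral_mono_AE)
   show "AE a in N. (\<integral>\<^sup>+x. ennreal (norm (cis (x \<bullet> \<xi>) * complex_of_real (heat a x))) \<partial>lborel) \<le> 1"
    using supp
   proof eventually_elim
    case (elim a) then show ?case using l nn_integral_heat[of a] by (simp add: norm_mult heat_nonneg)
   qed
  qed
  also have "... < \<infinity>" using mass_finite by simp
  finally show ?thesis .
 qed
 note F = Fubini_swap[OF sf sigma_finite_lborel _ fin]
 have "(LINT x|lborel. cis (x \<bullet> \<xi>) * of_real (prof x)) = (LINT x|lborel. LINT a|N. cis (x \<bullet> \<xi>) * of_real (heat a x))"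
  by (simp add: prof_def)
 also have "... = (LINT a|N. LINT x|lborel. cis (x \<bullet> \<xi>) * of_real (heat a x))"
  by (rule F(1)[symmetric]) measurable
 also have "... = (LINT a|N. of_real (exp (- a * (norm \<xi>)\<^sup>2)))"
 proof (rule integral_cong_AE)
  show "AE a in N. (LINT x|lborel. cis (x \<bullet> \<xi>) * of_real (heat a x)) = complex_of_real (exp (- a * (norm \<xi>)\<^sup>2))"
   using supp by eventually_elim (use l in \<open>simp only: integral_heat_cis\<close>)
 qed measurable
 finally show "(LINT x|lborel. cis (x \<bullet> \<xi>) * of_real (prof x)) = of_real (sym \<xi>)" by (simp only: sym_def integral_complex_of_real)
 have "integrable lborel (\<lambda>x. LINT a|N. cis (x \<bullet> 0) * complex_of_real (heat a x))"
  by (rule F(3)) measurable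
 then show "integrable lborel prof" by (simp add: prof_def[abs_def] complex_of_real_integrable_eq)
qed

lemma dprof_family: "L2_family N (\<lambda>a y. dheat j a y) (ennreal (1 / (16 * pi * l\<^sup>2)))"
proof (unfold_locales)
 show "AE a in N. (\<integral>\<^sup>+y. ennreal ((dheat j a y)\<^sup>2) \<partial>lborel) \<le> ennreal (1 / (16 * pi * l\<^sup>2))"
  using supp
 proof eventually_elim
  case (elim a)
  have "(\<integral>\<^sup>+y. ennreal ((dheat j a y)\<^sup>2) \<partial>lborel) \<le> ennreal (1 / (16 * pi * a\<^sup>2))"
   using dheat_sq[of a j 0] elim l by simp
  also have "... \<le> ennreal (1 / (16 * pi * l\<^sup>2))" using elim l
   by (intro ennreal_leI divide_left_mono mult_left_mono power_mono) auto
  finally show ?case .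
 qed
next
 show "(\<lambda>(a, y). dheat j a y) \<in> borel_measurable (N \<Otimes>\<^sub>M borel)" by measurable
 show "ennreal (1 / (16 * pi * l\<^sup>2)) < \<infinity>" by simp
qed

lemma prof_family: "L2_family N (\<lambda>a y. heat a y) (ennreal (1 / (8 * pi * l)))"
proof (unfold_locales)
 show "AE a in N. (\<integral>\<^sup>+y. ennreal ((heat a y)\<^sup>2) \<partial>lborel) \<le> ennreal (1 / (8 * pi * l))"
  using supp
 proof eventually_elim
  case (elim a)
  have "(\<integral>\<^sup>+y. ennreal ((heat a y)\<^sup>2) \<partial>lborel) = ennreal (1 / (8 * pi * a))"
   using heat_sq[of a 0] elim l by simp
  also have "... \<le> ennreal (1 / (8 * pi * l))" using elim l
   by (intro ennreal_leI divide_left_mono mult_left_mono) auto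
  finally show ?case .
 qed
next
 show "(\<lambda>(a, y). heat a y) \<in> borel_measurable (N \<Otimes>\<^sub>M borel)" by measurable
 show "ennreal (1 / (8 * pi * l)) < \<infinity>" by simp
qed

text \<open>The Gram entries are heat kernels at the summed time, evaluated at the origin.\<close>

lemma prof_mass:
 "(\<integral>\<^sup>+x. ennreal ((prof x)\<^sup>2) \<partial>lborel) = ennreal (LINT a|N. LINT b|N. 1 / (4 * pi * (a + b)))"
proof -
 interpret F: L2_family N "\<lambda>a y. heat a y" "ennreal (1 / (8 * pi * l))" by (rule prof_family)
 have [simp]: "F.mix = prof" by (simp add: F.mix_def prof_def fun_eq_iff)
 have "(LINT y|lborel. (prof y)\<^sup>2) = (LINT a|N. LINT b|N. LINT y|lborel. heat a y * heat b y)"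
  using F.mix_gram by simp
 also have "... = (LINT a|N. LINT b|N. 1 / (4 * pi * (a + b)))"
 proof (rule integral_cong_AE)
  show "AE a in N. (LINT b|N. LINT y|lborel. heat a y * heat b y) = (LINT b|N. 1 / (4 * pi * (a + b)))"
   using supp
  proof eventually_elim
   case (elim a)
   show ?case
   proof (rule integral_cong_AE)
    show "AE b in N. (LINT y|lborel. heat a y * heat b y) = 1 / (4 * pi * (a + b))"
     using supp
    proof eventually_elim
     case (elim b)
     then show ?case using integral_heat_heat[of a b 0 0] l \<open>l \<le> a\<close> by (simp add: heat_def)
    qed
   qed measurable
  qed
 qed measurable
 finally show ?thesis using F.mix_nn_integral by simp
qed

text \<open>The closed form \<open>- lheat (a + b) 0\<close> belongs to the sum of the Gram entries
  over the two coordinates, so the sum is moved inside both integrals before the evaluation.\<close>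

lemma dprof_energy:
 "(\<integral>\<^sup>+x. ennreal (\<Sum>j\<in>UNIV. (dprof j x)\<^sup>2) \<partial>lborel) = ennreal (LINT a|N. LINT b|N. 1 / (4 * pi * (a + b)\<^sup>2))"
proof -
 have fam: "L2_family N (\<lambda>a y. dheat j a y) (ennreal (1 / (16 * pi * l\<^sup>2)))" for j by (rule dprof_family)
 have mix: "L2_family.mix N (\<lambda>a y. dheat j a y) = dprof j" for j
  using L2_family.mix_def[OF fam] by (simp add: dprof_def fun_eq_iff)
 let ?G = "\<lambda>j a b. LINT y|lborel. dheat j a y * dheat j b y"
 have gi: "integrable N (\<lambda>a. LINT b|N. ?G j a b)" for j using L2_family.mix_gram_integrable[OF fam] .
 have nn: "(\<integral>\<^sup>+x. ennreal ((dprof j x)\<^sup>2) \<partial>lborel) = ennreal (LINT a|N. LINT b|N. ?G j a b)" for j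
  using L2_family.mix_nn_integral[OF fam] L2_family.mix_gram[OF fam] by (simp add: mix)
 have g0: "(LINT a|N. LINT b|N. ?G j a b) \<ge> 0" for j
  using L2_family.mix_gram[OF fam, of j, symmetric] by simp
 have "(\<integral>\<^sup>+x. ennreal (\<Sum>j\<in>UNIV. (dprof j x)\<^sup>2) \<partial>lborel) = (\<Sum>j\<in>UNIV. (\<integral>\<^sup>+x. ennreal ((dprof j x)\<^sup>2) \<partial>lborel))"
  by (simp add: nn_integral_sum flip: sum_ennreal)
 also have "... = ennreal (\<Sum>j\<in>UNIV. (LINT a|N. LINT b|N. ?G j a b))"
  unfolding nn using g0 by (simp add: sum_ennreal)
 also have "(\<Sum>j\<in>UNIV. (LINT a|N. LINT b|N. ?G j a b)) = (LINT a|N. (\<Sum>j\<in>UNIV. LINT b|N. ?G j a b))"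
  using gi by (subst Bochner_Integration.integral_sum) auto
 also have "... = (LINT a|N. LINT b|N. 1 / (4 * pi * (a + b)\<^sup>2))"
 proof (rule integral_cong_AE)
  show "AE a in N. (\<Sum>j\<in>UNIV. LINT b|N. ?G j a b) = (LINT b|N. 1 / (4 * pi * (a + b)\<^sup>2))"
   using supp
  proof eventually_elim
   case (elim a)
   then have a: "a > 0" using l by simp
   have d2: "(\<integral>\<^sup>+y. ennreal ((dheat j a y)\<^sup>2) \<partial>lborel) < \<infinity>" for j
    using dheat_sq[of a j 0] a by (simp add: le_less_trans)
   have "integrable N (\<lambda>b. ?G j a b)" for j
    using L2_family.pairing_integrable'[OF fam _ d2] by simp
   then have "(\<Sum>j\<in>UNIV. LINT b|N. ?G j a b) = (LINT b|N. (\<Sum>j\<in>UNIV. ?G j a b))"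
    by (subst Bochner_Integration.integral_sum) auto
   also have "... = (LINT b|N. 1 / (4 * pi * (a + b)\<^sup>2))"
   proof (rule integral_cong_AE)
    show "AE b in N. (\<Sum>j\<in>UNIV. ?G j a b) = 1 / (4 * pi * (a + b)\<^sup>2)"
     using supp
    proof eventually_elim
     case (elim b)
     then have b: "b > 0" using l by simp
     have i: "integrable lborel (\<lambda>y. dheat j a y * dheat j b y)" for j
     proof (rule integrableI_bounded)
      have "(\<integral>\<^sup>+y. ennreal \<bar>dheat j a y * dheat j b y\<bar> \<partial>lborel) \<le>
       (\<integral>\<^sup>+y. ennreal ((dheat j a y)\<^sup>2) \<partial>lborel) + (\<integral>\<^sup>+y. ennreal ((dheat j b y)\<^sup>2) \<partial>lborel)"
       by (intro nn_integral_product_le) measurable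
      also have "... < \<infinity>" using dheat_sq[of a j 0] dheat_sq[of b j 0] a b by (auto simp: less_top[symmetric] top_unique)
      finally show "(\<integral>\<^sup>+y. ennreal (norm (dheat j a y * dheat j b y)) \<partial>lborel) < \<infinity>" by simp
     qed measurable
     have "(\<Sum>j\<in>UNIV. ?G j a b) = (LINT y|lborel. (\<Sum>j\<in>UNIV. dheat j a y * dheat j b y))"
      using i by (subst Bochner_Integration.integral_sum) auto
     also have "... = - lheat (a + b) 0" using dheat_gram(2)[OF a b, of 0 0] by simp
     also have "... = 1 / (4 * pi * (a + b)\<^sup>2)" by (simp add: lheat_def heat_def power2_eq_square)
     finally show ?case .
    qed
   qed measurable
   finally show ?case .
  qed
 qed measurable
 finally show ?thesis .
qed

end

section \<open>Distributional gradient and bracket multiplier of a superposition\<close>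

lemma integrable_lebesgue_iff:
 fixes f :: "'a::euclidean_space \<Rightarrow> 'b::{banach, second_countable_topology}"
 shows "f \<in> borel_measurable borel ==> integrable lebesgue f \<longleftrightarrow> integrable lborel f"
 by (rule integrable_completion) simp

lemma integral_lebesgue_eq:
 fixes f :: "'a::euclidean_space \<Rightarrow> 'b::{banach, second_countable_topology}"
 shows "f \<in> borel_measurable borel ==> (LINT x|lebesgue. f x) = (LINT x|lborel. f x)"
 by (rule integral_completion) simp

lemma borel_imp_lebesgue: "f \<in> borel_measurable borel ==> f \<in> borel_measurable lebesgue"
 by (rule measurable_completion) simp

lemma measurable_bracket [measurable]: "(bracket :: real^2 \<Rightarrow> complex) \<in> borel_measurable borel"
 unfolding bracket_def by measurable

lemma bracket_minus [simp]: "bracket (- \<xi>) = bracket \<xi>"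
 by (simp add: bracket_def)

lemma norm_bracket: "norm (bracket \<xi>) = sqrt (1 + (norm \<xi>)\<^sup>2)"
 by (simp add: bracket_def)

lemma norm_bracket_le: "norm (bracket \<xi>) \<le> 1 + (norm \<xi>)\<^sup>2" "norm (bracket \<xi>) \<le> 1 + norm \<xi>"
proof -
 show "norm (bracket \<xi>) \<le> 1 + (norm \<xi>)\<^sup>2" "norm (bracket \<xi>) \<le> 1 + norm \<xi>"
  unfolding norm_bracket by (auto intro!: real_le_lsqrt simp: power2_eq_square algebra_simps)
qed

lemma integrable_bracket_fourier:
 fixes \<phi> :: "real^2 \<Rightarrow> complex"
 assumes \<phi>: "\<phi> \<in> schwartz"
 shows "integrable lborel (\<lambda>\<xi>. bracket \<xi> * fourier \<phi> \<xi>)"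
proof -
 obtain B where B: "B > 0" "\<And>\<xi>. (1 + (norm \<xi>)\<^sup>2) * norm (fourier \<phi> \<xi>) \<le> B * decay \<xi>"
  using schwartz_fourier_decay[OF \<phi>] by blast
 have [measurable]: "fourier \<phi> \<in> borel_measurable borel"
  using schwartz_borel[OF \<phi>] by (rule measurable_fourier)
 show ?thesis
 proof (rule Bochner_Integration.integrable_bound[OF integrable_mult_right[OF integrable_decay, of B]])
  show "AE \<xi> in lborel. norm (bracket \<xi> * fourier \<phi> \<xi>) \<le> norm (B * decay \<xi>)"
  proof (intro always_eventually allI)
   fix \<xi> :: "real^2"
   have "norm (bracket \<xi> * fourier \<phi> \<xi>) \<le> (1 + (norm \<xi>)\<^sup>2) * norm (fourier \<phi> \<xi>)"
    unfolding norm_mult by (intro mult_right_mono norm_bracket_le) auto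
   then show "norm (bracket \<xi> * fourier \<phi> \<xi>) \<le> norm (B * decay \<xi>)"
    using B(2)[of \<xi>] by simp
  qed
 qed measurable
qed

lemma mult_op_bracket:
 fixes \<phi> :: "real^2 \<Rightarrow> complex"
 assumes \<phi>: "\<phi> \<in> schwartz"
 shows "mult_op (\<lambda>\<xi>. bracket (- \<xi>)) \<phi> = (\<lambda>x. of_real (1 / (2*pi)^2) * (LINT \<xi>|lborel. cis (x \<bullet> \<xi>) * (bracket \<xi> * fourier \<phi> \<xi>)))"
proof -
 have [measurable]: "fourier \<phi> \<in> borel_measurable borel"
  using schwartz_borel[OF \<phi>] by (rule measurable_fourier)
 show ?thesis unfolding mult_op_def inv_fourier_def by (simp add: fun_eq_iff integral_lebesgue_eq)
qed

lemma integral_norm_sq_gauss: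
 assumes c: "c > 0"
 shows "(\<integral>\<^sup>+\<xi>. ennreal ((norm (\<xi>::real^2))\<^sup>2 * exp (- c * (norm \<xi>)\<^sup>2)) \<partial>lborel) = ennreal (pi / c\<^sup>2)"
proof -
 have c': "1 / (4 * c) > 0" using c by simp
 have "(\<integral>\<^sup>+\<xi>. ennreal ((norm (\<xi>::real^2))\<^sup>2 * exp (- c * (norm \<xi>)\<^sup>2)) \<partial>lborel) =
  (\<integral>\<^sup>+\<xi>. ennreal (pi / c * ((norm (\<xi>::real^2))\<^sup>2 * heat (1 / (4 * c)) \<xi>)) \<partial>lborel)"
  by (simp only: exp_eq_heat[OF c]) (simp add: mult_ac)
 also have "... = ennreal (LINT \<xi>|lborel. pi / c * ((norm (\<xi>::real^2))\<^sup>2 * heat (1 / (4 * c)) \<xi>))"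
  using c by (intro nn_integral_eq_integral integrable_mult_right heat_moments(1) c') (auto intro!: heat_nonneg mult_nonneg_nonneg divide_nonneg_pos)
 also have "(LINT \<xi>|lborel. pi / c * ((norm (\<xi>::real^2))\<^sup>2 * heat (1 / (4 * c)) \<xi>)) = pi / c * (4 * (1 / (4 * c)))"
  by (simp only: integral_mult_right_zero heat_moments(2)[OF c'])
 also have "... = pi / c\<^sup>2" using c by (simp add: power2_eq_square)
 finally show ?thesis .
qed

lemma dheat_le:
 assumes "0 < l" "l \<le> a"
 shows "\<bar>dheat j a z\<bar> \<le> 1 / (2 * l) * (1 / (4 * pi * l) + 1)"
proof -
 have a: "a > 0" using assms by simp
 have h: "heat a z \<le> 1 / (4 * pi * l)"
  using heat_le[OF a, of z] assms by (elim order_trans) (intro divide_left_mono mult_left_mono, auto)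
 have "(norm z)\<^sup>2 * heat a z = 4 * a * ((norm z)\<^sup>2 / (4 * a) * heat a z)" using a by simp
 also have "... \<le> 4 * a * (4 * heat (2 * a) z)" using a heat_norm_sq_le[OF a] by (intro mult_left_mono) auto
 also have "... \<le> 4 * a * (4 * (1 / (4 * pi * (2 * a))))" using a by (intro mult_left_mono heat_le) auto
 also have "... = 2 / pi" using a by simp
 also have "... \<le> 1" using pi_ge_two by simp
 finally have n2: "(norm z)\<^sup>2 * heat a z \<le> 1" .
 have "\<bar>z $ j\<bar> \<le> norm z" by (rule component_le_norm_cart)
 also have "... \<le> 1 + (norm z)\<^sup>2" using zero_le_power2[of "norm z - 1/2"] by (simp add: power2_eq_square algebra_simps)
 finally have "\<bar>z $ j\<bar> * heat a z \<le> (1 + (norm z)\<^sup>2) * heat a z" using a by (intro mult_right_mono heat_nonneg) auto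
 also have "... \<le> 1 / (4 * pi * l) + 1" using h n2 by (simp add: distrib_right)
 finally have z: "\<bar>z $ j\<bar> * heat a z \<le> 1 / (4 * pi * l) + 1" .
 have "\<bar>dheat j a z\<bar> = 1 / (2 * a) * (\<bar>z $ j\<bar> * heat a z)"
  using a by (simp add: dheat_def abs_mult heat_nonneg)
 also have "... \<le> 1 / (2 * l) * (1 / (4 * pi * l) + 1)"
  using z assms a by (intro mult_mono divide_left_mono) (auto intro!: mult_nonneg_nonneg heat_nonneg)
 finally show ?thesis .
qed

lemma heat_integral_by_parts:
 assumes \<phi>: "\<phi> \<in> schwartz" and a: "a > 0"
 shows "(LINT x|lborel. of_real (dheat j a x) * \<phi> x) = - (LINT x|lborel. of_real (heat a x) * partial j \<phi> x)"
proof -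
 note hs = heat_schwartz(1)[OF a, of 0, unfolded diff_0_right] heat_schwartz(2)[OF a, of j 0, unfolded diff_0_right]
  heat_schwartz(3)[OF a, of j 0, unfolded diff_0_right]
 show ?thesis
 proof (rule schwartz_integral_by_parts[OF \<phi> schwartz_derivative[OF hs(1)]])
  show "complex_of_real (dheat j a x) = frechet_derivative (\<lambda>y. complex_of_real (heat a y)) (at x) (axis j 1)" for x
   using fun_cong[OF hs(3), of x] by (simp add: partial_def)
  show "continuous_on UNIV (\<lambda>x. complex_of_real (dheat j a x))" by (rule schwartz_continuous[OF hs(2)])
  show "norm (complex_of_real (heat a x)) \<le> 1 / (4 * pi * a)" for x using heat_le[OF a] a by (simp add: heat_nonneg)
  show "norm (complex_of_real (dheat j a x)) \<le> 1 / (2 * a) * (1 / (4 * pi * a) + 1)" for x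
   using dheat_le[OF a order_refl] by simp
 qed
qed

context heat_mixture
begin

lemma dprof_le: "\<bar>dprof j x\<bar> \<le> measure N UNIV * (1 / (2 * l) * (1 / (4 * pi * l) + 1))"
proof -
 have b: "AE a in N. norm (dheat j a x) \<le> 1 / (2 * l) * (1 / (4 * pi * l) + 1)"
  using supp by eventually_elim (use dheat_le[OF l] in simp)
 have "norm (dprof j x) \<le> (LINT a|N. norm (dheat j a x))" unfolding dprof_def by (rule integral_norm_bound)
 also have "... \<le> (LINT a|N. 1 / (2 * l) * (1 / (4 * pi * l) + 1))"
  using b by (intro integral_mono_AE integrable_const_bound[where B="1 / (2 * l) * (1 / (4 * pi * l) + 1)"]) auto
 finally show ?thesis by simp
qed

lemma mixture_Fubini:
 fixes \<phi> :: "real^2 \<Rightarrow> complex"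
 assumes [measurable]: "case_prod k \<in> borel_measurable (borel \<Otimes>\<^sub>M borel)"
  and b: "\<And>a x. l \<le> a ==> \<bar>k a x\<bar> \<le> C" and \<phi>: "\<phi> \<in> schwartz"
 shows "(LINT a|N. LINT x|lborel. of_real (k a x) * \<phi> x) = (LINT x|lborel. of_real (LINT a|N. k a x) * \<phi> x)"
proof -
 have [measurable]: "\<phi> \<in> borel_measurable borel" by (rule schwartz_borel[OF \<phi>])
 have sf: "sigma_finite_measure N" by unfold_locales
 let ?I = "\<integral>\<^sup>+x. ennreal (norm (\<phi> x)) \<partial>lborel"
 have C: "C \<ge> 0" using b[of l 0] by (smt (verit) order_refl)
 have m: "case_prod k \<in> borel_measurable (N \<Otimes>\<^sub>M lborel)"
  by measurable
 have "(\<integral>\<^sup>+a. \<integral>\<^sup>+x. ennreal (norm (of_real (k a x) * \<phi> x)) \<partial>lborel \<partial>N) \<le> (\<integral>\<^sup>+a. ennreal C * ?I \<partial>N)"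
 proof (rule nn_integral_mono_AE)
  show "AE a in N. (\<integral>\<^sup>+x. ennreal (norm (of_real (k a x) * \<phi> x)) \<partial>lborel) \<le> ennreal C * ?I"
   using supp
  proof eventually_elim
   case (elim a)
   have "(\<integral>\<^sup>+x. ennreal (norm (of_real (k a x) * \<phi> x)) \<partial>lborel) \<le> (\<integral>\<^sup>+x. ennreal C * ennreal (norm (\<phi> x)) \<partial>lborel)"
    using b[OF elim] C by (intro nn_integral_mono) (simp add: norm_mult mult_right_mono flip: ennreal_mult)
   then show ?case by (simp add: nn_integral_cmult)
  qed
 qed
 also have "... < \<infinity>"
  using schwartz_integrable[OF \<phi>] mass_finite by (simp add: integrable_iff_bounded ennreal_mult_less_top)
 finally have fin: "(\<integral>\<^sup>+a. \<integral>\<^sup>+x. ennreal (norm (of_real (k a x) * \<phi> x)) \<partial>lborel \<partial>N) < \<infinity>" .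
 have "(LINT a|N. LINT x|lborel. of_real (k a x) * \<phi> x) = (LINT x|lborel. LINT a|N. of_real (k a x) * \<phi> x)"
  by (rule Fubini_swap_eq[OF sf sigma_finite_lborel _ fin]) (use m in measurable)
 then show ?thesis by simp
qed

text \<open>Integration by parts holds for each heat kernel separately;
  \<open>mixture_Fubini\<close> carries it through the average over \<open>N\<close>.\<close>

lemma prof_gradient: "is_gradient (\<lambda>x. complex_of_real (prof x)) (\<lambda>x. \<chi> j. complex_of_real (dprof j x))"
 unfolding is_gradient_def tempered_eq_def
proof (intro conjI allI ballI)
 have "(\<lambda>x. \<chi> j. complex_of_real (dprof j x)) \<in> borel_measurable borel"
 proof (rule borel_measurable_euclidean_space[THEN iffD2], intro ballI)
  fix b :: "complex^2" assume "b \<in> Basis"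
  then obtain i u where b: "b = axis i u" by (auto simp: Basis_vec_def)
  show "(\<lambda>x. (\<chi> j. complex_of_real (dprof j x)) \<bullet> b) \<in> borel_measurable borel"
   unfolding b inner_axis by (simp add: inner_complex_def)
 qed
 then show "(\<lambda>x. \<chi> j. complex_of_real (dprof j x)) \<in> borel_measurable lebesgue" by (rule borel_imp_lebesgue)
next
 fix j :: 2 and \<phi> :: "real^2 \<Rightarrow> complex" assume \<phi>: "\<phi> \<in> schwartz"
 note p = schwartz_partial[OF \<phi>, of j]
 have [measurable]: "\<phi> \<in> borel_measurable borel" "partial j \<phi> \<in> borel_measurable borel"
  using schwartz_borel \<phi> p by auto
 have i1: "integrable lborel (\<lambda>x. complex_of_real (dprof j x) * \<phi> x)"
  by (rule schwartz_bounded_mult_integrable[OF \<phi>]) (use dprof_le in auto)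
 have i2: "integrable lborel (\<lambda>x. complex_of_real (prof x) * partial j \<phi> x)"
  by (rule schwartz_bounded_mult_integrable[OF p]) (use prof_le prof_nonneg in auto)
 show "integrable lebesgue (\<lambda>x. (\<chi> j. complex_of_real (dprof j x)) $ j * \<phi> x)"
  using i1 by (subst integrable_lebesgue_iff) auto
 show "integrable lebesgue (\<lambda>x. complex_of_real (prof x) * - partial j \<phi> x)"
  using i2 by (subst integrable_lebesgue_iff) auto
 have hb: "l \<le> a ==> \<bar>heat a x\<bar> \<le> 1 / (4 * pi * l)" for a x
  using heat_le[of a x] heat_nonneg[of a x] l
  by (simp add: order_trans[OF _ divide_left_mono[of "4*pi*l" "4*pi*a" 1]])
 have "(LINT x|lborel. complex_of_real (dprof j x) * \<phi> x) = (LINT a|N. LINT x|lborel. of_real (dheat j a x) * \<phi> x)"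
  unfolding dprof_def by (rule mixture_Fubini[OF _ dheat_le[OF l] \<phi>, symmetric]) measurable
 also have "... = (LINT a|N. - (LINT x|lborel. of_real (heat a x) * partial j \<phi> x))"
 proof (rule integral_cong_AE)
  show "AE a in N. (LINT x|lborel. of_real (dheat j a x) * \<phi> x) = - (LINT x|lborel. of_real (heat a x) * partial j \<phi> x)"
   using supp by eventually_elim (use l heat_integral_by_parts[OF \<phi>] in auto)
 qed measurable
 also have "... = - (LINT x|lborel. complex_of_real (prof x) * partial j \<phi> x)"
  unfolding prof_def by (simp add: mixture_Fubini[OF _ hb p, symmetric])
 finally show "(LINT x|lebesgue. (\<chi> j. complex_of_real (dprof j x)) $ j * \<phi> x) = (LINT x|lebesgue. complex_of_real (prof x) * - partial j \<phi> x)"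
  by (simp add: integral_lebesgue_eq)
qed

lemma sym_nonneg: "sym \<xi> \<ge> 0"
 unfolding sym_def by simp

lemma sym_nn: "ennreal (sym \<xi>) = (\<integral>\<^sup>+a. ennreal (exp (- a * (norm \<xi>)\<^sup>2)) \<partial>N)"
proof -
 have "AE a in N. norm (exp (- a * (norm \<xi>)\<^sup>2)) \<le> 1"
  using supp by eventually_elim (use l in auto)
 then have "integrable N (\<lambda>a. exp (- a * (norm \<xi>)\<^sup>2))" by (intro integrable_const_bound[where B=1]) auto
 then show ?thesis unfolding sym_def by (intro nn_integral_eq_integral[symmetric]) auto
qed

lemma N_lborel_swap:
 assumes [measurable]: "case_prod F \<in> borel_measurable (borel \<Otimes>\<^sub>M (borel :: (real^2) measure))"
 shows "(\<integral>\<^sup>+\<xi>. \<integral>\<^sup>+a. F a \<xi> \<partial>N \<partial>lborel) = (\<integral>\<^sup>+a. \<integral>\<^sup>+\<xi>. F a \<xi> \<partial>lborel \<partial>N)"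
proof -
 have "sigma_finite_measure N" by unfold_locales
 then interpret P: pair_sigma_finite N "lborel :: (real^2) measure"
  by (intro pair_sigma_finite.intro sigma_finite_lborel)
 show ?thesis by (rule P.Fubini') measurable
qed

text \<open>Estimating the bracket by \<open>1 + norm \<xi>\<close> rather than by
  \<open>1 + (norm \<xi>)\<^sup>2\<close> limits the blow-up at small \<open>a\<close> to the power
  -3/2 instead of -2. The converse depends on it: this exponent decides the power of \<epsilon> in
  \<open>concentrating_family\<close>.\<close>

lemma bracket_gauss_le:
 assumes a: "a > 0"
 shows "(\<integral>\<^sup>+\<xi>. ennreal (norm (bracket (\<xi>::real^2)) * exp (- a * (norm \<xi>)\<^sup>2)) \<partial>lborel) \<le> ennreal (pi / a + 2 * pi / (a * sqrt a))"
proof -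
 have "(\<integral>\<^sup>+\<xi>. ennreal (norm (bracket (\<xi>::real^2)) * exp (- a * (norm \<xi>)\<^sup>2)) \<partial>lborel) \<le>
  (\<integral>\<^sup>+\<xi>. ennreal (exp (- a * (norm (\<xi>::real^2))\<^sup>2)) + ennreal (1 / sqrt a) * ennreal (exp (- (a / 2) * (norm \<xi>)\<^sup>2)) \<partial>lborel)"
 proof (intro nn_integral_mono)
  fix \<xi> :: "real^2"
  define t where "t = sqrt a * norm \<xi>"
  have t: "t\<^sup>2 = a * (norm \<xi>)\<^sup>2" "t \<ge> 0" using a by (auto simp: t_def power_mult_distrib)
  have "t \<le> 1 + t\<^sup>2 / 2" using zero_le_power2[of "t - 1"] by (simp add: power2_eq_square algebra_simps)
  also have "... \<le> exp (t\<^sup>2 / 2)" by (rule exp_ge_add_one_self)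
  finally have "t * exp (- t\<^sup>2) \<le> exp (t\<^sup>2 / 2) * exp (- t\<^sup>2)" by (intro mult_right_mono) auto
  also have "... = exp (- (t\<^sup>2) / 2)" by (simp flip: exp_add)
  finally have "1 / sqrt a * (t * exp (- t\<^sup>2)) \<le> 1 / sqrt a * exp (- (t\<^sup>2) / 2)" using a by (intro mult_left_mono) auto
  then have n: "norm \<xi> * exp (- a * (norm \<xi>)\<^sup>2) \<le> 1 / sqrt a * exp (- (a / 2) * (norm \<xi>)\<^sup>2)"
   using a unfolding t by (simp add: t_def)
  have "norm (bracket \<xi>) * exp (- a * (norm \<xi>)\<^sup>2) \<le> (1 + norm \<xi>) * exp (- a * (norm \<xi>)\<^sup>2)"
   by (intro mult_right_mono norm_bracket_le) auto
  also have "... \<le> exp (- a * (norm \<xi>)\<^sup>2) + 1 / sqrt a * exp (- (a / 2) * (norm \<xi>)\<^sup>2)"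
   using n by (simp add: distrib_right)
  finally show "ennreal (norm (bracket \<xi>) * exp (- a * (norm \<xi>)\<^sup>2)) \<le> ennreal (exp (- a * (norm \<xi>)\<^sup>2)) + ennreal (1 / sqrt a) * ennreal (exp (- (a / 2) * (norm \<xi>)\<^sup>2))"
   using a by (simp add: ennreal_leI flip: ennreal_mult ennreal_plus)
 qed
 also have "... = ennreal (pi / a) + ennreal (1 / sqrt a) * ennreal (pi / (a / 2))"
  using a nn_integral_gauss[of a] nn_integral_gauss[of "a/2"] by (simp add: nn_integral_add nn_integral_cmult)
 also have "... = ennreal (pi / a + 2 * pi / (a * sqrt a))"
  using a by (simp add: mult_ac flip: ennreal_mult ennreal_plus)
 finally show ?thesis .
qed

lemma bracket_sym_le:
 "(\<integral>\<^sup>+\<xi>. ennreal (norm (bracket \<xi> * of_real (sym \<xi>))) \<partial>lborel) \<le> (\<integral>\<^sup>+a. ennreal (pi / a + 2 * pi / (a * sqrt a)) \<partial>N)"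
proof -
 have "(\<integral>\<^sup>+\<xi>. ennreal (norm (bracket \<xi> * of_real (sym \<xi>))) \<partial>lborel) =
  (\<integral>\<^sup>+\<xi>. \<integral>\<^sup>+a. ennreal (norm (bracket (\<xi>::real^2)) * exp (- a * (norm \<xi>)\<^sup>2)) \<partial>N \<partial>lborel)"
 proof (intro nn_integral_cong)
  fix \<xi> :: "real^2"
  have "ennreal (norm (bracket \<xi> * of_real (sym \<xi>))) = ennreal (norm (bracket \<xi>)) * ennreal (sym \<xi>)"
   using sym_nonneg[of \<xi>] by (simp only: norm_mult norm_of_real abs_of_nonneg ennreal_mult norm_ge_zero)
  also have "... = (\<integral>\<^sup>+a. ennreal (norm (bracket \<xi>)) * ennreal (exp (- a * (norm \<xi>)\<^sup>2)) \<partial>N)"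
   unfolding sym_nn by (rule nn_integral_cmult[symmetric]) measurable
  also have "... = (\<integral>\<^sup>+a. ennreal (norm (bracket \<xi>) * exp (- a * (norm \<xi>)\<^sup>2)) \<partial>N)"
   by (simp only: ennreal_mult norm_ge_zero exp_ge_zero)
  finally show "ennreal (norm (bracket \<xi> * of_real (sym \<xi>))) = (\<integral>\<^sup>+a. ennreal (norm (bracket \<xi>) * exp (- a * (norm \<xi>)\<^sup>2)) \<partial>N)" .
 qed
 also have "... = (\<integral>\<^sup>+a. \<integral>\<^sup>+\<xi>. ennreal (norm (bracket (\<xi>::real^2)) * exp (- a * (norm \<xi>)\<^sup>2)) \<partial>lborel \<partial>N)"
  by (rule N_lborel_swap) measurable
 also have "... \<le> (\<integral>\<^sup>+a. ennreal (pi / a + 2 * pi / (a * sqrt a)) \<partial>N)"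
 proof (rule nn_integral_mono_AE)
  show "AE a in N. (\<integral>\<^sup>+\<xi>. ennreal (norm (bracket (\<xi>::real^2)) * exp (- a * (norm \<xi>)\<^sup>2)) \<partial>lborel) \<le> ennreal (pi / a + 2 * pi / (a * sqrt a))"
   using supp by eventually_elim (use l in \<open>intro bracket_gauss_le; simp\<close>)
 qed
 finally show ?thesis .
qed

lemma integrable_bracket_sym: "integrable lborel (\<lambda>\<xi>. bracket \<xi> * of_real (sym \<xi>))"
proof (rule integrableI_bounded)
 have "(\<integral>\<^sup>+a. ennreal (pi / a + 2 * pi / (a * sqrt a)) \<partial>N) \<le> (\<integral>\<^sup>+a. ennreal (pi / l + 2 * pi / (l * sqrt l)) \<partial>N)"
 proof (rule nn_integral_mono_AE)
  show "AE a in N. ennreal (pi / a + 2 * pi / (a * sqrt a)) \<le> ennreal (pi / l + 2 * pi / (l * sqrt l))"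
   using supp
  proof eventually_elim
   case (elim a)
   then show ?case using l by (intro ennreal_leI add_mono divide_left_mono mult_mono) auto
  qed
 qed
 also have "... < \<infinity>" using mass_finite by (simp add: ennreal_mult_less_top)
 finally show "(\<integral>\<^sup>+\<xi>. ennreal (norm (bracket \<xi> * of_real (sym \<xi>))) \<partial>lborel) < \<infinity>"
  using bracket_sym_le by (rule le_less_trans[rotated])
qed measurable

lemma br_meas [measurable]: "br \<in> borel_measurable borel" unfolding br_def by measurable

lemma br_sup: "ennreal (norm (br x)) \<le> ennreal (1 / (2 * pi)^2) * (\<integral>\<^sup>+a. ennreal (pi / a + 2 * pi / (a * sqrt a)) \<partial>N)"
proof -
 have "ennreal (norm (br x)) = ennreal (1 / (2 * pi)^2) * ennreal (norm (LINT \<xi>|lborel. cis (x \<bullet> \<xi>) * (bracket \<xi> * of_real (sym \<xi>))))"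
  by (simp only: br_def norm_mult norm_of_real) (simp flip: ennreal_mult)
 also have "... \<le> ennreal (1 / (2 * pi)^2) * (\<integral>\<^sup>+\<xi>. ennreal (norm (bracket \<xi> * of_real (sym \<xi>))) \<partial>lborel)"
  by (intro mult_left_mono order_trans[OF norm_integral_le_nn_integral]) (auto simp: norm_mult)
 also have "... \<le> ennreal (1 / (2 * pi)^2) * (\<integral>\<^sup>+a. ennreal (pi / a + 2 * pi / (a * sqrt a)) \<partial>N)"
  by (intro mult_left_mono bracket_sym_le) auto
 finally show ?thesis .
qed

text \<open>By Plancherel the bracket enters through its square
  \<open>1 + (norm \<xi>)\<^sup>2\<close>; the two terms produce exactly the kernels of the mass and
  of the gradient energy, which \<open>br_L2_nn\<close> records.\<close>

lemma br_L2:
 "(\<integral>\<^sup>+x. ennreal ((norm (br x))\<^sup>2) \<partial>lborel) \<le> (\<integral>\<^sup>+a. \<integral>\<^sup>+b. ennreal (1 / (4 * pi * (a + b)) + 1 / (4 * pi * (a + b)\<^sup>2)) \<partial>N \<partial>N)"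
proof -
 have sq: "ennreal ((norm (bracket \<xi> * of_real (sym \<xi>)))\<^sup>2) =
  (\<integral>\<^sup>+a. \<integral>\<^sup>+b. ennreal ((1 + (norm \<xi>)\<^sup>2) * exp (- (a + b) * (norm \<xi>)\<^sup>2)) \<partial>N \<partial>N)" for \<xi>
 proof -
  have "ennreal ((norm (bracket \<xi> * of_real (sym \<xi>)))\<^sup>2) = ennreal (1 + (norm \<xi>)\<^sup>2) * (ennreal (sym \<xi>) * ennreal (sym \<xi>))"
  proof -
   have A: "(norm (bracket \<xi> * of_real (sym \<xi>)))\<^sup>2 = (1 + (norm \<xi>)\<^sup>2) * (sym \<xi> * sym \<xi>)"
    by (simp add: norm_mult power_mult_distrib norm_bracket power2_eq_square[of "sym \<xi>"])
   have "0 \<le> 1 + (norm \<xi>)\<^sup>2" "0 \<le> sym \<xi> * sym \<xi>" using sym_nonneg[of \<xi>] by simp_all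
   then show ?thesis unfolding A using sym_nonneg[of \<xi>] by (simp only: ennreal_mult)
  qed
  also have "... = (\<integral>\<^sup>+a. ennreal (1 + (norm \<xi>)\<^sup>2) * (ennreal (exp (- a * (norm \<xi>)\<^sup>2)) * (\<integral>\<^sup>+b. ennreal (exp (- b * (norm \<xi>)\<^sup>2)) \<partial>N)) \<partial>N)"
   by (simp add: sym_nn nn_integral_cmult nn_integral_multc)
  also have "... = (\<integral>\<^sup>+a. \<integral>\<^sup>+b. ennreal (1 + (norm \<xi>)\<^sup>2) * (ennreal (exp (- a * (norm \<xi>)\<^sup>2)) * ennreal (exp (- b * (norm \<xi>)\<^sup>2))) \<partial>N \<partial>N)"
   by (simp add: nn_integral_cmult)
  also have "... = (\<integral>\<^sup>+a. \<integral>\<^sup>+b. ennreal ((1 + (norm \<xi>)\<^sup>2) * exp (- (a + b) * (norm \<xi>)\<^sup>2)) \<partial>N \<partial>N)"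
  proof -
   have "ennreal ((1 + (norm \<xi>)\<^sup>2) * exp (- (a + b) * (norm \<xi>)\<^sup>2)) =
    ennreal (1 + (norm \<xi>)\<^sup>2) * (ennreal (exp (- a * (norm \<xi>)\<^sup>2)) * ennreal (exp (- b * (norm \<xi>)\<^sup>2)))" for a b
   proof -
    have "- (a + b) * (norm \<xi>)\<^sup>2 = - a * (norm \<xi>)\<^sup>2 + - b * (norm \<xi>)\<^sup>2" by (simp add: algebra_simps)
    moreover have "0 \<le> 1 + (norm \<xi>)\<^sup>2" by simp
    ultimately show ?thesis by (simp only: exp_add ennreal_mult exp_ge_zero mult_nonneg_nonneg)
   qed
   then show ?thesis by simp
  qed
  finally show ?thesis .
 qed
 have i: "(\<integral>\<^sup>+\<xi>. ennreal ((1 + (norm (\<xi>::real^2))\<^sup>2) * exp (- c * (norm \<xi>)\<^sup>2)) \<partial>lborel) = ennreal (pi / c + pi / c\<^sup>2)" if c: "c > 0" for c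
 proof -
  have "(\<integral>\<^sup>+\<xi>. ennreal ((1 + (norm (\<xi>::real^2))\<^sup>2) * exp (- c * (norm \<xi>)\<^sup>2)) \<partial>lborel) =
   (\<integral>\<^sup>+\<xi>. ennreal (exp (- c * (norm (\<xi>::real^2))\<^sup>2)) + ennreal ((norm \<xi>)\<^sup>2 * exp (- c * (norm \<xi>)\<^sup>2)) \<partial>lborel)"
   by (simp add: distrib_right)
  also have "... = ennreal (pi / c) + ennreal (pi / c\<^sup>2)"
   using nn_integral_gauss[OF c] integral_norm_sq_gauss[OF c] by (simp add: nn_integral_add)
  finally show ?thesis using c by simp
 qed
 have "(\<integral>\<^sup>+x. ennreal ((norm (br x))\<^sup>2) \<partial>lborel) =
  ennreal ((1 / (2 * pi)^2)\<^sup>2) * (\<integral>\<^sup>+x. ennreal ((norm (LINT \<xi>|lborel. cis (x \<bullet> \<xi>) * (bracket \<xi> * of_real (sym \<xi>))))\<^sup>2) \<partial>lborel)"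
  by (subst nn_integral_cmult[symmetric]) (simp_all only: br_def norm_mult norm_of_real power_mult_distrib, measurable, simp add: ennreal_mult)
 also have "... \<le> ennreal ((1 / (2 * pi)^2)\<^sup>2) * (ennreal (4 * pi\<^sup>2) * (\<integral>\<^sup>+\<xi>. ennreal ((norm (bracket \<xi> * of_real (sym \<xi>)))\<^sup>2) \<partial>lborel))"
  by (intro mult_left_mono plancherel_le integrable_bracket_sym) auto
 also have "... = ennreal (1 / (4 * pi\<^sup>2)) * (\<integral>\<^sup>+\<xi>. ennreal ((norm (bracket \<xi> * of_real (sym \<xi>)))\<^sup>2) \<partial>lborel)"
 proof -
  have c: "(1 / (2 * pi)^2)\<^sup>2 * (4 * pi\<^sup>2) = 1 / (4 * pi\<^sup>2)" by (simp add: power2_eq_square)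
  have "ennreal A * (ennreal B * X) = ennreal (A * B) * X" if "A \<ge> 0" "B \<ge> 0" for A B X
   using that by (simp add: ennreal_mult mult.assoc)
  from this[of "(1 / (2 * pi)^2)\<^sup>2" "4 * pi\<^sup>2"] show ?thesis unfolding c by simp
 qed
 also have "(\<integral>\<^sup>+\<xi>. ennreal ((norm (bracket \<xi> * of_real (sym \<xi>)))\<^sup>2) \<partial>lborel) =
  (\<integral>\<^sup>+a. \<integral>\<^sup>+\<xi>. \<integral>\<^sup>+b. ennreal ((1 + (norm (\<xi>::real^2))\<^sup>2) * exp (- (a + b) * (norm \<xi>)\<^sup>2)) \<partial>N \<partial>lborel \<partial>N)"
  unfolding sq by (rule N_lborel_swap) measurable
 also have "... = (\<integral>\<^sup>+a. \<integral>\<^sup>+b. \<integral>\<^sup>+\<xi>. ennreal ((1 + (norm (\<xi>::real^2))\<^sup>2) * exp (- (a + b) * (norm \<xi>)\<^sup>2)) \<partial>lborel \<partial>N \<partial>N)"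
  by (intro nn_integral_cong N_lborel_swap) measurable
 also have "... = (\<integral>\<^sup>+a. \<integral>\<^sup>+b. ennreal (pi / (a + b) + pi / (a + b)\<^sup>2) \<partial>N \<partial>N)"
 proof (rule nn_integral_cong_AE)
  show "AE a in N. (\<integral>\<^sup>+b. \<integral>\<^sup>+\<xi>. ennreal ((1 + (norm (\<xi>::real^2))\<^sup>2) * exp (- (a + b) * (norm \<xi>)\<^sup>2)) \<partial>lborel \<partial>N) = (\<integral>\<^sup>+b. ennreal (pi / (a + b) + pi / (a + b)\<^sup>2) \<partial>N)"
   using supp
  proof eventually_elim
   case (elim a)
   show ?case
   proof (rule nn_integral_cong_AE)
    show "AE b in N. (\<integral>\<^sup>+\<xi>. ennreal ((1 + (norm (\<xi>::real^2))\<^sup>2) * exp (- (a + b) * (norm \<xi>)\<^sup>2)) \<partial>lborel) = ennreal (pi / (a + b) + pi / (a + b)\<^sup>2)"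
     using supp by eventually_elim (use elim l in \<open>intro i; simp\<close>)
   qed
  qed
 qed
 also have "ennreal (1 / (4 * pi\<^sup>2)) * ... = (\<integral>\<^sup>+a. \<integral>\<^sup>+b. ennreal (1 / (4 * pi\<^sup>2)) * ennreal (pi / (a + b) + pi / (a + b)\<^sup>2) \<partial>N \<partial>N)"
  by (simp add: nn_integral_cmult)
 also have "... = (\<integral>\<^sup>+a. \<integral>\<^sup>+b. ennreal (1 / (4 * pi * (a + b)) + 1 / (4 * pi * (a + b)\<^sup>2)) \<partial>N \<partial>N)"
 proof -
  have "ennreal (1 / (4 * pi\<^sup>2)) * ennreal (pi / c + pi / c\<^sup>2) = ennreal (1 / (4 * pi * c) + 1 / (4 * pi * c\<^sup>2))" for c
  proof -
   have "1 / (4 * pi\<^sup>2) * (pi / c + pi / c\<^sup>2) = 1 / (4 * pi * c) + 1 / (4 * pi * c\<^sup>2)"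
    by (simp add: power2_eq_square distrib_left)
   then show ?thesis by (simp only: ennreal_mult'[symmetric] zero_le_divide_1_iff mult_nonneg_nonneg zero_le_numeral zero_le_power2)
  qed
  then show ?thesis by simp
 qed
 finally show ?thesis .
qed

text \<open>Two applications of Fubini move the multiplier from the test function to
  \<open>prof\<close>; both sides become one integral over frequencies. The reflection of \<xi> that
  this requires is harmless because \<open>bracket\<close> and \<open>sym\<close> are even.\<close>

lemma prof_multiplier: "is_multiplier bracket (\<lambda>x. complex_of_real (prof x)) br"
 unfolding is_multiplier_def tempered_eq_def
proof (intro conjI ballI)
 show "br \<in> borel_measurable lebesgue" by (rule borel_imp_lebesgue[OF br_meas])
next
 fix \<phi> :: "real^2 \<Rightarrow> complex" assume \<phi>: "\<phi> \<in> schwartz"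
 have [measurable]: "\<phi> \<in> borel_measurable borel" "fourier \<phi> \<in> borel_measurable borel"
  using schwartz_borel[OF \<phi>] by auto
 let ?c = "complex_of_real (1 / (2*pi)^2)"
 let ?H = "\<lambda>\<xi>. bracket \<xi> * fourier \<phi> \<xi>" and ?S = "\<lambda>\<xi>. bracket \<xi> * complex_of_real (sym \<xi>)"
 let ?T = "\<lambda>x. ?c * (LINT \<xi>|lborel. cis (x \<bullet> \<xi>) * ?H \<xi>)"
 have finH: "(\<integral>\<^sup>+\<xi>. ennreal (norm (?H \<xi>)) \<partial>lborel) < \<infinity>" and finS: "(\<integral>\<^sup>+\<xi>. ennreal (norm (?S \<xi>)) \<partial>lborel) < \<infinity>"
  and fin\<phi>: "(\<integral>\<^sup>+x. ennreal (norm (\<phi> x)) \<partial>lborel) < \<infinity>" and finp: "(\<integral>\<^sup>+x. ennreal (norm (complex_of_real (prof x))) \<partial>lborel) < \<infinity>"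
  using integrable_bracket_fourier[OF \<phi>] integrable_bracket_sym schwartz_integrable[OF \<phi>] prof_fourier(2)
  by (auto simp: integrable_iff_bounded)
 have fin: "(\<integral>\<^sup>+x. \<integral>\<^sup>+\<xi>. ennreal (norm (u x * (cis (x \<bullet> \<xi>) * v \<xi>))) \<partial>lborel \<partial>lborel) < \<infinity>"
  if [measurable]: "u \<in> borel_measurable borel" "v \<in> borel_measurable borel"
   and "(\<integral>\<^sup>+x. ennreal (norm (u x)) \<partial>lborel) < \<infinity>" "(\<integral>\<^sup>+\<xi>. ennreal (norm (v \<xi>)) \<partial>lborel) < \<infinity>"
  for u v :: "real^2 \<Rightarrow> complex"
 proof -
  have "(\<integral>\<^sup>+x. \<integral>\<^sup>+\<xi>. ennreal (norm (u x * (cis (x \<bullet> \<xi>) * v \<xi>))) \<partial>lborel \<partial>lborel) =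
   (\<integral>\<^sup>+x. \<integral>\<^sup>+\<xi>. ennreal (norm (u x)) * ennreal (norm (v \<xi>)) \<partial>lborel \<partial>lborel)"
   by (simp add: norm_mult ennreal_mult)
  also have "... = (\<integral>\<^sup>+x. ennreal (norm (u x)) \<partial>lborel) * (\<integral>\<^sup>+\<xi>. ennreal (norm (v \<xi>)) \<partial>lborel)"
   by (simp add: nn_integral_cmult nn_integral_multc)
  finally show ?thesis using that by (simp add: ennreal_mult_less_top)
 qed
 note F1 = Fubini_swap[OF sigma_finite_lborel sigma_finite_lborel _ fin[OF _ _ fin\<phi> finS]]
 note F2 = Fubini_swap[OF sigma_finite_lborel sigma_finite_lborel _ fin[OF _ _ finp finH]]
 have eq1: "br x * \<phi> x = ?c * (LINT \<xi>|lborel. \<phi> x * (cis (x \<bullet> \<xi>) * ?S \<xi>))" for x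
 proof -
  have "(a * b) * c = a * (c * b)" for a b c :: complex by (simp add: mult_ac)
  then show ?thesis unfolding integral_mult_right_zero br_def .
 qed
 have eq2: "complex_of_real (prof x) * ?T x = ?c * (LINT \<xi>|lborel. complex_of_real (prof x) * (cis (x \<bullet> \<xi>) * ?H \<xi>))" for x
  unfolding integral_mult_right_zero by (rule mult.left_commute)
 have i1: "integrable lborel (\<lambda>x. br x * \<phi> x)"
 proof -
  have "integrable lborel (\<lambda>x. ?c * (LINT \<xi>|lborel. \<phi> x * (cis (x \<bullet> \<xi>) * ?S \<xi>)))"
   by (intro integrable_mult_right F1(2)) measurable
  then show ?thesis unfolding eq1 .
 qed
 have i2: "integrable lborel (\<lambda>x. complex_of_real (prof x) * ?T x)"
 proof -
  have "integrable lborel (\<lambda>x. ?c * (LINT \<xi>|lborel. complex_of_real (prof x) * (cis (x \<bullet> \<xi>) * ?H \<xi>)))"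
   by (intro integrable_mult_right F2(2)) measurable
  then show ?thesis unfolding eq2 .
 qed
 show "integrable lebesgue (\<lambda>x. br x * \<phi> x)"
  using i1 by (subst integrable_lebesgue_iff) auto
 show "integrable lebesgue (\<lambda>x. complex_of_real (prof x) * mult_op (\<lambda>\<xi>. bracket (- \<xi>)) \<phi> x)"
  unfolding mult_op_bracket[OF \<phi>] using i2 by (subst integrable_lebesgue_iff) auto
 have "(LINT x|lborel. br x * \<phi> x) = ?c * (LINT x|lborel. LINT \<xi>|lborel. \<phi> x * (cis (x \<bullet> \<xi>) * ?S \<xi>))"
  unfolding eq1 by (rule integral_mult_right_zero)
 also have "(LINT x|lborel. LINT \<xi>|lborel. \<phi> x * (cis (x \<bullet> \<xi>) * ?S \<xi>)) = (LINT \<xi>|lborel. LINT x|lborel. \<phi> x * (cis (x \<bullet> \<xi>) * ?S \<xi>))"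
  by (rule F1(1)) measurable
 also have "... = (LINT \<xi>|lborel. ?S \<xi> * fourier \<phi> (- \<xi>))"
 proof (intro Bochner_Integration.integral_cong refl)
  fix \<xi>
  have "(LINT x|lborel. \<phi> x * (cis (x \<bullet> \<xi>) * ?S \<xi>)) = (LINT x|lborel. ?S \<xi> * (cis (- (x \<bullet> - \<xi>)) * \<phi> x))"
   by (simp add: mult_ac)
  also have "... = ?S \<xi> * fourier \<phi> (- \<xi>)"
   unfolding integral_mult_right_zero by (simp add: fourier_lborel)
  finally show "(LINT x|lborel. \<phi> x * (cis (x \<bullet> \<xi>) * ?S \<xi>)) = ?S \<xi> * fourier \<phi> (- \<xi>)" .
 qed
 also have "... = (LINT \<xi>|lborel. ?S (0 - \<xi>) * fourier \<phi> (- (0 - \<xi>)))"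
  by (rule lborel_integral_reflect(1)[symmetric, where c=0]) measurable
 also have "... = (LINT \<xi>|lborel. LINT x|lborel. complex_of_real (prof x) * (cis (x \<bullet> \<xi>) * ?H \<xi>))"
 proof (intro Bochner_Integration.integral_cong refl)
  fix \<xi> :: "real^2"
  have "(LINT x|lborel. complex_of_real (prof x) * (cis (x \<bullet> \<xi>) * ?H \<xi>)) = (LINT x|lborel. ?H \<xi> * (cis (x \<bullet> \<xi>) * of_real (prof x)))"
   by (simp add: mult_ac)
  also have "... = ?H \<xi> * of_real (sym \<xi>)" unfolding integral_mult_right_zero prof_fourier(1) ..
  finally have *: "(LINT x|lborel. complex_of_real (prof x) * (cis (x \<bullet> \<xi>) * ?H \<xi>)) = ?H \<xi> * of_real (sym \<xi>)" .
  have "sym (0 - \<xi>) = sym \<xi>" by (simp add: sym_def)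
  then show "?S (0 - \<xi>) * fourier \<phi> (- (0 - \<xi>)) = (LINT x|lborel. complex_of_real (prof x) * (cis (x \<bullet> \<xi>) * ?H \<xi>))"
   unfolding * by (simp add: mult_ac)
 qed
 also have "... = (LINT x|lborel. LINT \<xi>|lborel. complex_of_real (prof x) * (cis (x \<bullet> \<xi>) * ?H \<xi>))"
  by (rule F2(1)[symmetric]) measurable
 also have "?c * ... = (LINT x|lborel. complex_of_real (prof x) * ?T x)"
  unfolding eq2 by (rule integral_mult_right_zero[symmetric])
 finally show "(LINT x|lebesgue. br x * \<phi> x) = (LINT x|lebesgue. complex_of_real (prof x) * mult_op (\<lambda>\<xi>. bracket (- \<xi>)) \<phi> x)"
  unfolding mult_op_bracket[OF \<phi>] by (simp add: integral_lebesgue_eq)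
qed

end

context heat_mixture
begin

lemma double_nn:
 assumes [measurable]: "case_prod q \<in> borel_measurable (borel \<Otimes>\<^sub>M borel)"
  and q: "\<And>a b. l \<le> a ==> l \<le> b ==> 0 \<le> q a b \<and> q a b \<le> C"
 shows "(\<integral>\<^sup>+a. \<integral>\<^sup>+b. ennreal (q a b) \<partial>N \<partial>N) = ennreal (LINT a|N. LINT b|N. q a b)"
proof -
 have i: "integrable N (q a)" if "l \<le> a" for a
  using supp by (intro integrable_const_bound[where B=C]) (auto elim!: eventually_mono simp: q that)
 have b: "0 \<le> (LINT b|N. q a b)" "(LINT b|N. q a b) \<le> measure N UNIV * C" if "l \<le> a" for a
 proof -
  show "0 \<le> (LINT b|N. q a b)"
   using supp by (intro integral_nonneg_AE) (auto elim!: eventually_mono simp: q that)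
  have "(LINT b|N. q a b) \<le> (LINT b|N. C)"
   using supp by (intro integral_mono_AE i that) (auto elim!: eventually_mono simp: q that)
  then show "(LINT b|N. q a b) \<le> measure N UNIV * C" by simp
 qed
 have "(\<integral>\<^sup>+a. \<integral>\<^sup>+b. ennreal (q a b) \<partial>N \<partial>N) = (\<integral>\<^sup>+a. ennreal (LINT b|N. q a b) \<partial>N)"
 proof (rule nn_integral_cong_AE)
  show "AE a in N. (\<integral>\<^sup>+b. ennreal (q a b) \<partial>N) = ennreal (LINT b|N. q a b)"
   using supp
  proof eventually_elim
   case (elim a)
   show ?case using supp by (intro nn_integral_eq_integral i elim) (auto elim!: eventually_mono simp: q elim)
  qed
 qed
 also have "... = ennreal (LINT a|N. LINT b|N. q a b)"
  using supp by (intro nn_integral_eq_integral integrable_const_bound[where B="measure N UNIV * C"])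
   (auto elim!: eventually_mono simp: b)
 finally show ?thesis .
qed

lemma inverse_bounds:
 assumes "l \<le> a" "l \<le> b"
 shows "0 \<le> 1 / (4 * pi * (a + b)) \<and> 1 / (4 * pi * (a + b)) \<le> 1 / (4 * pi * (l + l))"
  and "0 \<le> 1 / (4 * pi * (a + b)\<^sup>2) \<and> 1 / (4 * pi * (a + b)\<^sup>2) \<le> 1 / (4 * pi * (l + l)\<^sup>2)"
proof -
 have "l + l \<le> a + b" "0 < a + b" "0 < l + l" using assms l by auto
 then show "0 \<le> 1 / (4 * pi * (a + b)) \<and> 1 / (4 * pi * (a + b)) \<le> 1 / (4 * pi * (l + l))"
  "0 \<le> 1 / (4 * pi * (a + b)\<^sup>2) \<and> 1 / (4 * pi * (a + b)\<^sup>2) \<le> 1 / (4 * pi * (l + l)\<^sup>2)"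
  by (intro conjI divide_left_mono mult_left_mono power_mono mult_pos_pos zero_less_power divide_nonneg_nonneg mult_nonneg_nonneg; simp)+
qed

lemma prof_mass_nn:
 "(\<integral>\<^sup>+x. ennreal ((prof x)\<^sup>2) \<partial>lborel) = (\<integral>\<^sup>+a. \<integral>\<^sup>+b. ennreal (1 / (4 * pi * (a + b))) \<partial>N \<partial>N)"
 unfolding prof_mass by (rule double_nn[symmetric, OF _ inverse_bounds(1)]) measurable

lemma dprof_energy_nn:
 "(\<integral>\<^sup>+x. ennreal (\<Sum>j\<in>UNIV. (dprof j x)\<^sup>2) \<partial>lborel) = (\<integral>\<^sup>+a. \<integral>\<^sup>+b. ennreal (1 / (4 * pi * (a + b)\<^sup>2)) \<partial>N \<partial>N)"
 unfolding dprof_energy by (rule double_nn[symmetric, OF _ inverse_bounds(2)]) measurable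

lemma br_L2_nn:
 "(\<integral>\<^sup>+x. ennreal ((norm (br x))\<^sup>2) \<partial>lborel) \<le> (\<integral>\<^sup>+x. ennreal ((prof x)\<^sup>2) \<partial>lborel) + (\<integral>\<^sup>+x. ennreal (\<Sum>j\<in>UNIV. (dprof j x)\<^sup>2) \<partial>lborel)"
proof -
 have "(\<integral>\<^sup>+a. \<integral>\<^sup>+b. ennreal (1 / (4 * pi * (a + b)) + 1 / (4 * pi * (a + b)\<^sup>2)) \<partial>N \<partial>N) =
  (\<integral>\<^sup>+a. \<integral>\<^sup>+b. (ennreal (1 / (4 * pi * (a + b))) + ennreal (1 / (4 * pi * (a + b)\<^sup>2))) \<partial>N \<partial>N)"
 proof (rule nn_integral_cong_AE)
  show "AE a in N. (\<integral>\<^sup>+b. ennreal (1 / (4 * pi * (a + b)) + 1 / (4 * pi * (a + b)\<^sup>2)) \<partial>N) =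
   (\<integral>\<^sup>+b. (ennreal (1 / (4 * pi * (a + b))) + ennreal (1 / (4 * pi * (a + b)\<^sup>2))) \<partial>N)"
   using supp
  proof eventually_elim
   case (elim a)
   show ?case
   proof (rule nn_integral_cong_AE)
    show "AE b in N. ennreal (1 / (4 * pi * (a + b)) + 1 / (4 * pi * (a + b)\<^sup>2)) = ennreal (1 / (4 * pi * (a + b))) + ennreal (1 / (4 * pi * (a + b)\<^sup>2))"
     using supp by eventually_elim (use elim inverse_bounds in \<open>intro ennreal_plus; blast\<close>)
   qed
  qed
 qed
 then show ?thesis using br_L2 unfolding prof_mass_nn dprof_energy_nn by (simp add: nn_integral_add)
qed

end

section \<open>Logarithmic profiles from a window of heat times\<close>

definition bump_measure :: "real \<Rightarrow> real \<Rightarrow> real \<Rightarrow> real measure" where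
 "bump_measure A l h = density lborel (\<lambda>a. ennreal (4 * pi * A) * indicator {l..h} a)"

lemma nn_integral_bump:
 assumes [measurable]: "f \<in> borel_measurable borel"
 shows "(\<integral>\<^sup>+a. f a \<partial>bump_measure A l h) = ennreal (4 * pi * A) * (\<integral>\<^sup>+a. f a * indicator {l..h} a \<partial>lborel)"
proof -
 have "(\<integral>\<^sup>+a. f a \<partial>bump_measure A l h) = (\<integral>\<^sup>+a. ennreal (4 * pi * A) * indicator {l..h} a * f a \<partial>lborel)"
  unfolding bump_measure_def by (rule nn_integral_density) measurable
 also have "... = (\<integral>\<^sup>+a. ennreal (4 * pi * A) * (f a * indicator {l..h} a) \<partial>lborel)"
  by (simp only: mult_ac)
 also have "... = ennreal (4 * pi * A) * (\<integral>\<^sup>+a. f a * indicator {l..h} a \<partial>lborel)"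
  by (rule nn_integral_cmult) measurable
 finally show ?thesis .
qed

lemma heat_mixture_bump:
 assumes "A \<ge> 0" "0 < l"
 shows "heat_mixture (bump_measure A l h) l"
proof -
 have "emeasure (bump_measure A l h) UNIV = ennreal (4 * pi * A) * emeasure lborel {l..h}"
  unfolding bump_measure_def by (simp add: emeasure_density nn_integral_cmult)
 also have "... \<noteq> \<infinity>" by (cases "l \<le> h") (auto simp: ennreal_mult_eq_top_iff)
 finally have f: "emeasure (bump_measure A l h) UNIV \<noteq> \<infinity>" .
 have [simp]: "space (bump_measure A l h) = UNIV" "sets (bump_measure A l h) = sets borel"
  unfolding bump_measure_def by auto
 show ?thesis
 proof (intro heat_mixture.intro heat_mixture_axioms.intro finite_measureI)
  show "emeasure (bump_measure A l h) (space (bump_measure A l h)) \<noteq> \<infinity>" using f by simp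
  show "sets (bump_measure A l h) = sets borel" by simp
  show "AE a in bump_measure A l h. l \<le> a"
   unfolding bump_measure_def by (subst AE_density) (auto split: split_indicator)
 qed fact
qed

text \<open>For \<open>norm x\<close> far below \<open>sqrt l\<close> the kernels are close to
  \<open>1 / (4 * pi * a)\<close>, so the profile has height about \<open>A * ln (h / l)\<close>. It
  is a smoothed form of Moser's truncated logarithm, with inner radius of order
  \<open>sqrt l\<close> and outer radius of order \<open>sqrt h\<close>.\<close>

definition bump :: "real \<Rightarrow> real \<Rightarrow> real \<Rightarrow> real^2 \<Rightarrow> real" where
 "bump A l h x = (LINT a|lborel. (4 * pi * A) * indicator {l..h} a * heat a x)"

lemma bump_eq:
 assumes "A \<ge> 0" "0 < l"
 shows "heat_mixture.prof (bump_measure A l h) = bump A l h"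
proof
 fix x
 interpret heat_mixture "bump_measure A l h" l by (rule heat_mixture_bump[OF assms])
 have "prof x = (LINT a|density lborel (\<lambda>a. ennreal (4 * pi * A * indicator {l..h} a)). heat a x)"
 proof -
  have "(\<lambda>a. ennreal (4 * pi * A) * indicator {l..h} a) = (\<lambda>a. ennreal (4 * pi * A * indicator {l..h} a))"
   by (auto simp: fun_eq_iff indicator_def)
  then show ?thesis unfolding prof_def unfolding bump_measure_def by (simp only:)
 qed
 also have "... = bump A l h x"
  unfolding bump_def using assms(1) by (subst integral_density) auto
 finally show "prof x = bump A l h x" .
qed

text \<open>The inequality \<open>1 - t \<le> exp (- t)\<close> replaces the Gaussian by a function
  with an elementary primitive; the correction is at most 1/4 because
  \<open>(norm x)\<^sup>2 \<le> l\<close>.\<close>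

lemma bump_ge:
 assumes "A \<ge> 0" "0 < l" "l \<le> h" "(norm x)\<^sup>2 \<le> l"
 shows "A * (ln (h / l) - 1 / 4) \<le> bump A l h x"
proof -
 define r where "r = (norm x)\<^sup>2"
 have r: "0 \<le> r" "r \<le> l" using assms(4) by (auto simp: r_def)
 let ?F = "\<lambda>a. ln a + r / (4 * a)" and ?f = "\<lambda>a. 1 / a - r / (4 * a\<^sup>2)"
 have cont: "continuous_on {l..h} ?f" using assms by (intro continuous_intros) auto
 have FTC: "(LINT a|lborel. indicator {l..h} a *\<^sub>R ?f a) = ?F h - ?F l"
 proof (rule integral_FTC_atLeastAtMost[OF assms(3) _ cont])
  fix a assume a: "l \<le> a" "a \<le> h"
  then have "(?F has_real_derivative ?f a) (at a)" using assms
   by (auto intro!: derivative_eq_intros simp: power2_eq_square field_simps)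
  then show "(?F has_vector_derivative ?f a) (at a within {l..h})"
   by (simp add: has_real_derivative_iff_has_vector_derivative has_vector_derivative_at_within)
 qed
 have i1: "integrable lborel (\<lambda>a. indicator {l..h} a *\<^sub>R ?f a)"
  using borel_integrable_compact[OF compact_Icc cont] by (simp add: mult.commute)
 have cont2: "continuous_on {l..h} (\<lambda>a. heat a x)" unfolding heat_def using assms by (intro continuous_intros) auto
 have i2: "integrable lborel (\<lambda>a. indicator {l..h} a *\<^sub>R heat a x)"
  using borel_integrable_compact[OF compact_Icc cont2] by (simp add: mult.commute)
 have "A * (ln (h / l) - 1 / 4) \<le> A * (?F h - ?F l)"
 proof -
  have "r / (4 * l) \<le> 1 / 4" using r assms by (simp add: field_simps)
  moreover have "0 \<le> r / (4 * h)" using r assms by simp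
  moreover have "ln (h / l) = ln h - ln l" using assms by (simp add: ln_div)
  ultimately have "ln (h / l) - 1 / 4 \<le> ?F h - ?F l" by linarith
  then show ?thesis using assms(1) by (intro mult_left_mono)
 qed
 also have "... = (LINT a|lborel. A * (indicator {l..h} a *\<^sub>R ?f a))" unfolding FTC[symmetric] by simp
 also have "... \<le> (LINT a|lborel. 4 * pi * A * (indicator {l..h} a *\<^sub>R heat a x))"
 proof (rule integral_mono[OF integrable_mult_right[OF i1] integrable_mult_right[OF i2]])
  fix a
  show "A * (indicator {l..h} a *\<^sub>R ?f a) \<le> 4 * pi * A * (indicator {l..h} a *\<^sub>R heat a x)"
  proof (cases "a \<in> {l..h}")
   case True
   then have a: "a > 0" using assms by simp
   have "1 - r / (4 * a) \<le> exp (- r / (4 * a))" using exp_ge_add_one_self[of "- r / (4*a)"] by simp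
   then have "(1 - r / (4 * a)) / a \<le> exp (- r / (4 * a)) / a" using a by (intro divide_right_mono) auto
   moreover have "(1 - r / (4 * a)) / a = ?f a" using a by (simp add: field_simps power2_eq_square)
   moreover have "4 * pi * heat a x = exp (- r / (4 * a)) / a" using a by (simp add: heat_def r_def)
   ultimately have "?f a \<le> 4 * pi * heat a x" by simp
   then have "A * ?f a \<le> A * (4 * pi * heat a x)" using assms(1) by (rule mult_left_mono)
   then show ?thesis using True by (simp add: mult_ac)
  qed simp
 qed
 also have "... = bump A l h x" by (simp add: bump_def mult_ac)
 finally show ?thesis .
qed

lemma nn_integral_inverse:
 assumes "0 < l" "l \<le> h"
 shows "(\<integral>\<^sup>+a. ennreal (1 / a) * indicator {l..h} a \<partial>lborel) = ennreal (ln (h / l))"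
proof -
 have "(\<integral>\<^sup>+a. ennreal (1 / a) * indicator {l..h} a \<partial>lborel) = ennreal (ln h - ln l)"
  using assms by (intro nn_integral_FTC_Icc) (auto intro!: derivative_eq_intros)
 then show ?thesis using assms by (simp add: ln_div)
qed

lemma nn_integral_inverse_sq:
 assumes "0 < l" "l \<le> h" "0 \<le> a"
 shows "(\<integral>\<^sup>+b. ennreal (1 / (a + b)\<^sup>2) * indicator {l..h} b \<partial>lborel) = ennreal (1 / (a + l) - 1 / (a + h))"
proof -
 have "(\<integral>\<^sup>+b. ennreal (1 / (a + b)\<^sup>2) * indicator {l..h} b \<partial>lborel) = ennreal (- 1 / (a + h) - - 1 / (a + l))"
  using assms by (intro nn_integral_FTC_Icc) (auto intro!: derivative_eq_intros simp: power2_eq_square)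
 then show ?thesis by simp
qed

lemma nn_integral_inverse_sqrt:
 assumes "0 < l" "l \<le> h"
 shows "(\<integral>\<^sup>+a. ennreal (1 / (a * sqrt a)) * indicator {l..h} a \<partial>lborel) = ennreal (2 / sqrt l - 2 / sqrt h)"
proof -
 have "(\<integral>\<^sup>+a. ennreal (1 / (a * sqrt a)) * indicator {l..h} a \<partial>lborel) = ennreal (- 2 / sqrt h - - 2 / sqrt l)"
 proof -
  have "((\<lambda>a. - 2 / sqrt a) has_real_derivative 1 / (x * sqrt x)) (at x)" if "l \<le> x" for x
  proof -
   have "x > 0" using that assms by simp
   then show ?thesis by (auto intro!: derivative_eq_intros simp: field_simps)
  qed
  then show ?thesis using assms
   by (intro nn_integral_FTC_Icc) (auto intro: has_field_derivative_at_within)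
 qed
 then show ?thesis by simp
qed

text \<open>The leading constant must not be lost. The inner integral is at most
  \<open>A / a\<close>, whose integral is a logarithm. With
  \<open>A\<^sup>2 = 1 / (4 * pi * ln (h / l))\<close> the bound equals one, while the squared
  height is about \<open>ln (h / l) / (4 * pi)\<close>: the critical value for an exponential with
  constant 4\<pi>.\<close>

lemma bump_energy:
 assumes "A \<ge> 0" "0 < l" "l \<le> h"
 shows "(\<integral>\<^sup>+a. \<integral>\<^sup>+b. ennreal (1 / (4 * pi * (a + b)\<^sup>2)) \<partial>bump_measure A l h \<partial>bump_measure A l h) \<le> ennreal (4 * pi * A\<^sup>2 * ln (h / l))"
proof -
 have L: "ln (h / l) \<ge> 0" using assms by simp
 have c: "4 * pi * A \<ge> 0" using assms by simp
 have inner: "(\<integral>\<^sup>+b. ennreal (1 / (4 * pi * (a + b)\<^sup>2)) \<partial>bump_measure A l h) * indicator {l..h} a \<le> ennreal A * (ennreal (1 / a) * indicator {l..h} a)" for a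
 proof (cases "a \<in> {l..h}")
  case True
  then have a: "a > 0" using assms by simp
  have "(\<integral>\<^sup>+b. ennreal (1 / (4 * pi * (a + b)\<^sup>2)) \<partial>bump_measure A l h) =
   ennreal (4 * pi * A) * (\<integral>\<^sup>+b. ennreal (1 / (4 * pi)) * (ennreal (1 / (a + b)\<^sup>2) * indicator {l..h} b) \<partial>lborel)"
   by (subst nn_integral_bump) (auto simp: mult.assoc[symmetric] simp flip: ennreal_mult')
  also have "... = ennreal (4 * pi * A) * (ennreal (1 / (4 * pi)) * ennreal (1 / (a + l) - 1 / (a + h)))"
   using nn_integral_inverse_sq[OF assms(2,3), of a] a by (simp add: nn_integral_cmult)
  also have "... = ennreal (A * (1 / (a + l) - 1 / (a + h)))"
   using c by (simp add: mult.assoc[symmetric] flip: ennreal_mult')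
  also have "... \<le> ennreal (A * (1 / a))"
  proof (intro ennreal_leI mult_left_mono assms)
   have "1 / (a + l) \<le> 1 / a" using a assms by (intro divide_left_mono) auto
   moreover have "0 \<le> 1 / (a + h)" using a assms by simp
   ultimately show "1 / (a + l) - 1 / (a + h) \<le> 1 / a" by linarith
  qed
  also have "... = ennreal A * ennreal (1 / a)" by (rule ennreal_mult'[OF assms(1)])
  finally show ?thesis using True by simp
 qed simp
 interpret heat_mixture "bump_measure A l h" l by (rule heat_mixture_bump[OF assms(1,2)])
 have "(\<integral>\<^sup>+a. \<integral>\<^sup>+b. ennreal (1 / (4 * pi * (a + b)\<^sup>2)) \<partial>bump_measure A l h \<partial>bump_measure A l h) =
  ennreal (4 * pi * A) * (\<integral>\<^sup>+a. (\<integral>\<^sup>+b. ennreal (1 / (4 * pi * (a + b)\<^sup>2)) \<partial>bump_measure A l h) * indicator {l..h} a \<partial>lborel)"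
  by (rule nn_integral_bump) measurable
 also have "... \<le> ennreal (4 * pi * A) * (\<integral>\<^sup>+a. ennreal A * (ennreal (1 / a) * indicator {l..h} a) \<partial>lborel)"
  by (intro mult_left_mono nn_integral_mono inner) auto
 also have "... = ennreal (4 * pi * A) * (ennreal A * ennreal (ln (h / l)))"
  using nn_integral_inverse[OF assms(2,3)] by (simp add: nn_integral_cmult)
 also have "... = ennreal (4 * pi * A\<^sup>2 * ln (h / l))"
  using assms L c by (simp add: power2_eq_square mult_ac flip: ennreal_mult)
 finally show ?thesis .
qed

text \<open>The mass integral of a profile with times between \<epsilon> and 1, stripped of
  amplitude and constants. It is never evaluated; it is divided out when the mass is
  normalised.\<close>

definition bump_mass :: "real \<Rightarrow> ennreal" where
 "bump_mass \<epsilon> = (\<integral>\<^sup>+a. \<integral>\<^sup>+b. ennreal (1 / (a + b)) * indicator {\<epsilon>..1} b * indicator {\<epsilon>..1} a \<partial>lborel \<partial>lborel)"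

text \<open>Substitution in both times. The mass is linear in \<rho>, whereas the energy bound
  depends only on the ratio of the end times, so \<rho> is free to prescribe the mass.\<close>

lemma bump_mass_scale:
 assumes "A \<ge> 0" "0 < \<epsilon>" "0 < \<rho>"
 shows "(\<integral>\<^sup>+a. \<integral>\<^sup>+b. ennreal (1 / (4 * pi * (a + b))) \<partial>bump_measure A (\<epsilon> * \<rho>) \<rho> \<partial>bump_measure A (\<epsilon> * \<rho>) \<rho>) = ennreal (4 * pi * A\<^sup>2 * \<rho>) * bump_mass \<epsilon>"
proof -
 interpret heat_mixture "bump_measure A (\<epsilon> * \<rho>) \<rho>" "\<epsilon> * \<rho>" using assms by (intro heat_mixture_bump) auto
 have ind: "indicator {\<epsilon> * \<rho>..\<rho>} (0 + \<rho> * t) = (indicator {\<epsilon>..1} t :: ennreal)" for t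
  using assms by (auto simp: indicator_def mult.commute)
 have inner: "(\<integral>\<^sup>+b. ennreal (1 / (4 * pi * (\<rho> * a + b))) \<partial>bump_measure A (\<epsilon> * \<rho>) \<rho>) * indicator {\<epsilon>..1} a =
  ennreal A * (\<integral>\<^sup>+b. ennreal (1 / (a + b)) * indicator {\<epsilon>..1} b * indicator {\<epsilon>..1} a \<partial>lborel)" for a
 proof (cases "a \<in> {\<epsilon>..1}")
  case True
  have "(\<integral>\<^sup>+b. ennreal (1 / (4 * pi * (\<rho> * a + b))) \<partial>bump_measure A (\<epsilon> * \<rho>) \<rho>) =
   ennreal (4 * pi * A) * (\<integral>\<^sup>+b. ennreal (1 / (4 * pi * (\<rho> * a + b))) * indicator {\<epsilon> * \<rho>..\<rho>} b \<partial>lborel)"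
   by (rule nn_integral_bump) measurable
  also have "(\<integral>\<^sup>+b. ennreal (1 / (4 * pi * (\<rho> * a + b))) * indicator {\<epsilon> * \<rho>..\<rho>} b \<partial>lborel) =
   ennreal \<rho> * (\<integral>\<^sup>+b. ennreal (1 / (4 * pi * (\<rho> * a + (0 + \<rho> * b)))) * indicator {\<epsilon> * \<rho>..\<rho>} (0 + \<rho> * b) \<partial>lborel)"
   using assms by (subst nn_integral_real_affine[of _ \<rho> 0]) auto
  also have "(\<integral>\<^sup>+b. ennreal (1 / (4 * pi * (\<rho> * a + (0 + \<rho> * b)))) * indicator {\<epsilon> * \<rho>..\<rho>} (0 + \<rho> * b) \<partial>lborel) =
   (\<integral>\<^sup>+b. ennreal (1 / (4 * pi * \<rho>)) * (ennreal (1 / (a + b)) * indicator {\<epsilon>..1} b) \<partial>lborel)"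
  proof (intro nn_integral_cong)
   fix b
   have "1 / (4 * pi * (\<rho> * a + (0 + \<rho> * b))) = 1 / (4 * pi * \<rho>) * (1 / (a + b))"
    by (simp add: distrib_left[symmetric] mult_ac)
   then have "ennreal (1 / (4 * pi * (\<rho> * a + (0 + \<rho> * b)))) = ennreal (1 / (4 * pi * \<rho>)) * ennreal (1 / (a + b))"
    using assms by (simp only:) (intro ennreal_mult', simp)
   then show "ennreal (1 / (4 * pi * (\<rho> * a + (0 + \<rho> * b)))) * indicator {\<epsilon> * \<rho>..\<rho>} (0 + \<rho> * b) =
    ennreal (1 / (4 * pi * \<rho>)) * (ennreal (1 / (a + b)) * indicator {\<epsilon>..1} b)"
    by (simp only: ind mult.assoc)
  qed
  also have "... = ennreal (1 / (4 * pi * \<rho>)) * (\<integral>\<^sup>+b. ennreal (1 / (a + b)) * indicator {\<epsilon>..1} b \<partial>lborel)"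
   by (rule nn_integral_cmult) measurable
  also have "ennreal (4 * pi * A) * (ennreal \<rho> * (ennreal (1 / (4 * pi * \<rho>)) * (\<integral>\<^sup>+b. ennreal (1 / (a + b)) * indicator {\<epsilon>..1} b \<partial>lborel))) =
   ennreal (4 * pi * A * (\<rho> * (1 / (4 * pi * \<rho>)))) * (\<integral>\<^sup>+b. ennreal (1 / (a + b)) * indicator {\<epsilon>..1} b \<partial>lborel)"
  proof -
   have "ennreal x * (ennreal y * (ennreal z * X)) = ennreal (x * (y * z)) * X" if "x \<ge> 0" "y \<ge> 0" "z \<ge> 0" for x y z X
    using that by (simp add: ennreal_mult mult.assoc)
   then show ?thesis using assms by simp
  qed
  also have "4 * pi * A * (\<rho> * (1 / (4 * pi * \<rho>))) = A" using assms by simp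
  finally show ?thesis using True by simp
 qed simp
 have "(\<integral>\<^sup>+a. \<integral>\<^sup>+b. ennreal (1 / (4 * pi * (a + b))) \<partial>bump_measure A (\<epsilon> * \<rho>) \<rho> \<partial>bump_measure A (\<epsilon> * \<rho>) \<rho>) =
  ennreal (4 * pi * A) * (\<integral>\<^sup>+a. (\<integral>\<^sup>+b. ennreal (1 / (4 * pi * (a + b))) \<partial>bump_measure A (\<epsilon> * \<rho>) \<rho>) * indicator {\<epsilon> * \<rho>..\<rho>} a \<partial>lborel)"
  by (rule nn_integral_bump) measurable
 also have "(\<integral>\<^sup>+a. (\<integral>\<^sup>+b. ennreal (1 / (4 * pi * (a + b))) \<partial>bump_measure A (\<epsilon> * \<rho>) \<rho>) * indicator {\<epsilon> * \<rho>..\<rho>} a \<partial>lborel) =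
  ennreal \<rho> * (\<integral>\<^sup>+a. (\<integral>\<^sup>+b. ennreal (1 / (4 * pi * ((0 + \<rho> * a) + b))) \<partial>bump_measure A (\<epsilon> * \<rho>) \<rho>) * indicator {\<epsilon> * \<rho>..\<rho>} (0 + \<rho> * a) \<partial>lborel)"
  using assms by (subst nn_integral_real_affine[of _ \<rho> 0]) auto
 also have "... = ennreal \<rho> * (\<integral>\<^sup>+a. ennreal A * (\<integral>\<^sup>+b. ennreal (1 / (a + b)) * indicator {\<epsilon>..1} b * indicator {\<epsilon>..1} a \<partial>lborel) \<partial>lborel)"
  unfolding ind by (simp only: add_0 inner)
 also have "... = ennreal \<rho> * (ennreal A * bump_mass \<epsilon>)"
  unfolding bump_mass_def by (subst nn_integral_cmult) auto
 also have "ennreal (4 * pi * A) * (ennreal \<rho> * (ennreal A * bump_mass \<epsilon>)) = ennreal (4 * pi * A\<^sup>2 * \<rho>) * bump_mass \<epsilon>"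
 proof -
  have "ennreal x * (ennreal y * (ennreal z * X)) = ennreal (x * (y * z)) * X" if "x \<ge> 0" "y \<ge> 0" "z \<ge> 0" for x y z X
   using that by (simp add: ennreal_mult mult.assoc)
  from this[of "4 * pi * A" \<rho> A "bump_mass \<epsilon>"] show ?thesis using assms by (simp add: power2_eq_square mult_ac)
 qed
 finally show ?thesis .
qed

text \<open>Positivity permits the division in the normalisation of the mass; the upper bound keeps
  the resulting outer time above \<open>M\<close>.\<close>

lemma bump_mass_bounds:
 assumes "0 < \<epsilon>" "\<epsilon> < 1"
 shows "bump_mass \<epsilon> \<le> ennreal (ln (1 / \<epsilon>))" "bump_mass \<epsilon> > 0"
proof -
 have "bump_mass \<epsilon> \<le> (\<integral>\<^sup>+a. ennreal (1 / a) * indicator {\<epsilon>..1} a \<partial>lborel)"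
  unfolding bump_mass_def
 proof (intro nn_integral_mono)
  fix a :: real
  show "(\<integral>\<^sup>+b. ennreal (1 / (a + b)) * indicator {\<epsilon>..1} b * indicator {\<epsilon>..1} a \<partial>lborel) \<le> ennreal (1 / a) * indicator {\<epsilon>..1} a"
  proof (cases "a \<in> {\<epsilon>..1}")
   case True
   have "(\<integral>\<^sup>+b. ennreal (1 / (a + b)) * indicator {\<epsilon>..1} b * indicator {\<epsilon>..1} a \<partial>lborel) \<le> (\<integral>\<^sup>+b. ennreal (1 / a) * indicator {\<epsilon>..1} b \<partial>lborel)"
    using True assms by (intro nn_integral_mono) (auto split: split_indicator intro!: ennreal_leI divide_left_mono)
   also have "... = ennreal (1 / a) * ennreal (1 - \<epsilon>)" using assms by (simp add: nn_integral_cmult)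
   also have "... \<le> ennreal (1 / a) * 1" using assms by (intro mult_left_mono) auto
   finally show ?thesis using True by simp
  qed simp
 qed
 then show "bump_mass \<epsilon> \<le> ennreal (ln (1 / \<epsilon>))" using nn_integral_inverse[of \<epsilon> 1] assms by simp
 have "0 < ennreal (1 / 2) * ennreal (1 - \<epsilon>) * ennreal (1 - \<epsilon>)"
 proof -
  have "0 < ennreal (1 / 2 * (1 - \<epsilon>) * (1 - \<epsilon>))" using assms by simp
  also have "... = ennreal (1 / 2) * ennreal (1 - \<epsilon>) * ennreal (1 - \<epsilon>)"
   using assms by (subst ennreal_mult, simp, simp, subst ennreal_mult) auto
  finally show ?thesis .
 qed
 also have "... = (\<integral>\<^sup>+a. \<integral>\<^sup>+b. ennreal (1 / 2) * indicator {\<epsilon>..1} b * indicator {\<epsilon>..1} a \<partial>lborel \<partial>lborel)"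
  using assms by (simp add: nn_integral_cmult nn_integral_multc)
 also have "... \<le> bump_mass \<epsilon>"
  unfolding bump_mass_def
 proof (intro nn_integral_mono)
  fix a b :: real
  have "ennreal (1 / 2) \<le> ennreal (1 / (a + b))" if "a \<in> {\<epsilon>..1}" "b \<in> {\<epsilon>..1}"
   using that assms by (intro ennreal_leI divide_left_mono) auto
  then show "ennreal (1 / 2) * indicator {\<epsilon>..1} b * indicator {\<epsilon>..1} a \<le> ennreal (1 / (a + b)) * indicator {\<epsilon>..1} b * indicator {\<epsilon>..1} a"
   by (cases "a \<in> {\<epsilon>..1}"; cases "b \<in> {\<epsilon>..1}") (simp_all only: indicator_simps simp_thms mult_1_right mult_zero_right mult_zero_left order_refl)
 qed
 finally show "bump_mass \<epsilon> > 0" .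
qed

text \<open>The term \<open>4 / sqrt l\<close> is the integral of the power -3/2 that
  \<open>bracket_gauss_le\<close> leaves.\<close>

lemma bump_bracket_sup:
 assumes "A \<ge> 0" "0 < l" "l \<le> h"
 shows "norm (heat_mixture.br (bump_measure A l h) x) \<le> A * (ln (h / l) + 4 / sqrt l)"
proof -
 interpret heat_mixture "bump_measure A l h" l by (rule heat_mixture_bump[OF assms(1,2)])
 have L: "ln (h / l) \<ge> 0" using assms by simp
 have hl: "2 / sqrt h \<le> 2 / sqrt l" using assms by (intro divide_left_mono) auto
 have "(\<integral>\<^sup>+a. ennreal (pi / a + 2 * pi / (a * sqrt a)) * indicator {l..h} a \<partial>lborel) =
  (\<integral>\<^sup>+a. ennreal pi * (ennreal (1 / a) * indicator {l..h} a) + ennreal (2 * pi) * (ennreal (1 / (a * sqrt a)) * indicator {l..h} a) \<partial>lborel)"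
  using assms by (intro nn_integral_cong) (auto split: split_indicator simp flip: ennreal_mult' ennreal_plus)
 also have "... = ennreal pi * ennreal (ln (h / l)) + ennreal (2 * pi) * ennreal (2 / sqrt l - 2 / sqrt h)"
  using nn_integral_inverse[OF assms(2,3)] nn_integral_inverse_sqrt[OF assms(2,3)]
  by (simp add: nn_integral_add nn_integral_cmult)
 also have "... = ennreal (pi * ln (h / l) + 2 * pi * (2 / sqrt l - 2 / sqrt h))"
  using L hl by (simp flip: ennreal_mult ennreal_plus)
 finally have I: "(\<integral>\<^sup>+a. ennreal (pi / a + 2 * pi / (a * sqrt a)) * indicator {l..h} a \<partial>lborel) = ennreal (pi * ln (h / l) + 2 * pi * (2 / sqrt l - 2 / sqrt h))" .
 have "ennreal (norm (br x)) \<le> ennreal (1 / (2 * pi)^2) * (ennreal (4 * pi * A) * ennreal (pi * ln (h / l) + 2 * pi * (2 / sqrt l - 2 / sqrt h)))"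
  unfolding I[symmetric] using br_sup[of x] by (subst (asm) nn_integral_bump) auto
 also have "... = ennreal (1 / (2 * pi)^2 * (4 * pi * A * (pi * ln (h / l) + 2 * pi * (2 / sqrt l - 2 / sqrt h))))"
  using assms by (simp only: ennreal_mult'[symmetric] zero_le_divide_1_iff zero_le_power2 mult_nonneg_nonneg pi_ge_zero zero_le_numeral)
 finally have "norm (br x) \<le> 1 / (2 * pi)^2 * (4 * pi * A * (pi * ln (h / l) + 2 * pi * (2 / sqrt l - 2 / sqrt h)))"
  using assms L hl by (subst (asm) ennreal_le_iff) (auto intro!: mult_nonneg_nonneg add_nonneg_nonneg)
 also have "... = A * (ln (h / l) + 2 * (2 / sqrt l - 2 / sqrt h))" by (simp add: power2_eq_square field_simps)
 also have "... \<le> A * (ln (h / l) + 4 / sqrt l)" using assms by (intro mult_left_mono) auto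
 finally show ?thesis .
qed

section \<open>Mixed norms and the concentrating family\<close>

lemma ennreal_pow_ennreal: "0 \<le> x ==> a \<noteq> 0 ==> ennreal_pow (ennreal x) a = ennreal (x powr a)"
 by (simp add: ennreal_pow_def)

lemma ennreal_pow_zero_exp [simp]: "ennreal_pow x 0 = 1"
 by (simp add: ennreal_pow_def)

lemma ennreal_pow_one_exp [simp]: "ennreal_pow x 1 = x"
 by (cases x) (auto simp: ennreal_pow_def)

lemma ennreal_pow_mono: "x \<le> y ==> 0 \<le> a ==> ennreal_pow x a \<le> ennreal_pow y a"
 unfolding ennreal_pow_def
 by (cases x; cases y) (auto simp: top_unique intro!: ennreal_leI powr_mono2)

lemma ennreal_pow_pow: "0 < a ==> 0 \<le> b ==> ennreal_pow (ennreal_pow x a) b = ennreal_pow x (a * b)"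
 by (cases x) (auto simp: ennreal_pow_def powr_powr)

lemma ennreal_pow_cmult: "0 < c ==> 0 < a ==> ennreal_pow (ennreal c * x) a = ennreal (c powr a) * ennreal_pow x a"
 by (cases x) (auto simp: ennreal_pow_def ennreal_mult_top powr_mult enn2real_mult ennreal_mult'[symmetric] ennreal_mult_eq_top_iff)

lemma ennreal_pow_numeral: "ennreal_pow x (numeral n) = x ^ numeral n"
proof (cases x)
 case (real r)
 then show ?thesis by (simp add: ennreal_pow_def ennreal_power powr_numeral)
qed (simp add: ennreal_pow_def top_power_ennreal)

lemma ennreal_ge_one_cases:
 fixes p :: ennreal
 assumes "1 \<le> p"
 obtains (top) "p = \<infinity>" | (real) P where "1 \<le> P" "p = ennreal P" "enn2real p = P" "inverse p = ennreal (1 / P)"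
proof (cases p)
 case (real P)
 then have "1 \<le> P" using assms by (simp flip: ennreal_1 add: ennreal_le_iff)
 then show ?thesis using real by (intro that(2)[of P]) (auto simp: inverse_ennreal divide_inverse)
qed (use that in auto)

lemma Lp_norm_pow: "0 < P ==> ennreal_pow (Lp_norm (ennreal P) N F) P = (\<integral>\<^sup>+x. ennreal_pow (F x) P \<partial>N)"
 by (simp add: Lp_norm_def ennreal_pow_pow)

text \<open>Chebyshev's bound in one form for all exponents: at \<open>p = \<infinity>\<close> the
  factor \<open>m powr 0\<close> is one. It asks only for a pointwise lower bound, so it can be
  applied to the inner norm as a function of time.\<close>

lemma Lp_norm_ge:
 assumes "1 \<le> p" and S: "S \<in> sets N" "emeasure N S = ennreal m" "m > 0"
  and c: "c > 0" "\<And>x. x \<in> S ==> ennreal c \<le> F x"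
 shows "ennreal (c * m powr enn2real (inverse p)) \<le> Lp_norm p N F"
 using assms(1)
proof (cases p rule: ennreal_ge_one_cases)
 case top
 \<comment> \<open>By convention the essential supremum of a non-measurable function is
   \<open>\<infinity>\<close>, which settles that case.\<close>
 have "ennreal c \<le> esssup N F"
 proof (cases "F \<in> borel_measurable N")
  case True
  have "\<exists>x\<in>S. F x \<le> esssup N F"
  proof (rule ccontr)
   assume "\<not> ?thesis"
   then have "AE x in N. x \<notin> S" using esssup_AE[of F N] by (auto elim!: eventually_mono)
   then have "emeasure N S = 0" using S(1) by (simp add: AE_iff_measurable[OF S(1)] sets.sets_into_space[THEN subsetD] Collect_conj_eq Int_absorb1 subset_eq)
   then show False using S by simp
  qed
  then show ?thesis using c by (meson order_trans)
 qed (simp add: esssup_non_measurable)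
 then show ?thesis using top S(3) by (simp add: Lp_norm_def)
next
 case (real P)
 have "ennreal (c powr P * m) = (\<integral>\<^sup>+x. ennreal (c powr P) * indicator S x \<partial>N)"
  using S by (simp add: nn_integral_cmult_indicator ennreal_mult)
 also have "... \<le> (\<integral>\<^sup>+x. ennreal_pow (F x) P \<partial>N)"
 proof (intro nn_integral_mono)
  fix x
  have "x \<in> S ==> ennreal_pow (ennreal c) P \<le> ennreal_pow (F x) P"
   using c real by (intro ennreal_pow_mono) auto
  then show "ennreal (c powr P) * indicator S x \<le> ennreal_pow (F x) P"
   using c real by (auto simp: ennreal_pow_ennreal split: split_indicator)
 qed
 finally have "ennreal_pow (ennreal (c powr P * m)) (1 / P) \<le> ennreal_pow (\<integral>\<^sup>+x. ennreal_pow (F x) P \<partial>N) (1 / P)"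
  using real by (intro ennreal_pow_mono) auto
 moreover have "ennreal_pow (ennreal (c powr P * m)) (1 / P) = ennreal (c * m powr (1 / P))"
  using real c S by (simp add: ennreal_pow_ennreal powr_mult powr_powr)
 ultimately show ?thesis using real by (simp add: Lp_norm_def)
qed

text \<open>A case analysis on the extended values. For \<open>p = \<infinity>\<close> the quotient
  is 0, even if \<open>q = 1\<close>, because \<open>\<infinity> * 0 = 0\<close>; for
  \<open>q = 1\<close> and finite \<open>p\<close> it is \<open>\<infinity>\<close>.\<close>

lemma holder_conj_iff:
 assumes "1 \<le> p" "1 \<le> q"
 shows "holder_conj q / p > 1 \<longleftrightarrow> enn2real (inverse p) + enn2real (inverse q) > 1"
 using assms(2)
proof (cases q rule: ennreal_ge_one_cases)
 case top
 then have hc: "holder_conj q = 1" by (simp add: holder_conj_def)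
 show ?thesis using assms(1)
 proof (cases p rule: ennreal_ge_one_cases)
  case (real P)
  then have "holder_conj q / p = ennreal (1 / P)" using hc by (simp add: divide_ennreal_def)
  moreover have "\<not> 1 < ennreal (1 / P)" "\<not> 1 < 1 / P" using real by (simp_all add: not_less)
  ultimately show ?thesis using top real by simp
 qed (use hc top in simp)
next
 case (real Q)
 show ?thesis using assms(1)
 proof (cases p rule: ennreal_ge_one_cases)
  case top
  then show ?thesis using real by (simp add: divide_ennreal_def)
 next
  case P: (real P)
  show ?thesis
  proof (cases "Q = 1")
   case True
   then have "holder_conj q = \<infinity>" using real by (simp add: holder_conj_def)
   moreover have "\<infinity> / p = \<infinity>" using P by (simp add: divide_ennreal_def ennreal_mult_eq_top_iff ennreal_top_mult)
   ultimately show ?thesis using P real True by simp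
  next
   case False
   then have Q: "Q > 1" using real by simp
   have "1 - inverse q = ennreal (1 - 1 / Q)"
    using real Q by (simp add: ennreal_minus flip: ennreal_1)
   moreover have "1 - 1 / Q > 0" using Q by simp
   ultimately have "holder_conj q / p = ennreal (1 / (1 - 1 / Q) / P)"
    unfolding holder_conj_def using P by (simp add: inverse_ennreal divide_ennreal inverse_eq_divide)
   moreover have "1 / (1 - 1 / Q) / P > 1 \<longleftrightarrow> 1 / P + 1 / Q > 1"
   proof -
    have "1 / (1 - 1 / Q) / P > 1 \<longleftrightarrow> 1 / P > 1 - 1 / Q"
    proof -
     have "1 / D / P > 1 \<longleftrightarrow> 1 / P > D" if "D > 0" for D using that P by (simp add: field_simps)
     then show ?thesis using \<open>1 - 1 / Q > 0\<close> by blast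
    qed
    then show ?thesis by linarith
   qed
   ultimately show ?thesis using P real by (simp flip: ennreal_1 add: ennreal_less_iff)
  qed
 qed
qed

section \<open>Norms of the logarithmic profiles\<close>

lemma nn_integral_lebesgue: "(\<integral>\<^sup>+x. f x \<partial>lebesgue) = (\<integral>\<^sup>+x. f x \<partial>lborel)"
 by (rule nn_integral_completion)

lemma Lnorm_numeral_pow: "(Lnorm (numeral n) f) ^ numeral n = (\<integral>\<^sup>+x. ennreal (norm (f x) ^ numeral n) \<partial>lborel)"
proof -
 have "(Lnorm (numeral n) f) ^ numeral n = ennreal_pow (Lnorm (ennreal (numeral n)) f) (numeral n)"
  by (simp add: ennreal_pow_numeral)
 also have "... = (\<integral>\<^sup>+x. ennreal_pow (ennreal (norm (f x))) (numeral n) \<partial>lebesgue)"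
  by (rule Lp_norm_pow) simp
 finally show ?thesis by (simp add: ennreal_pow_numeral ennreal_power nn_integral_lebesgue)
qed

lemma ennreal_power_le_one_iff: "x ^ Suc n \<le> (1::ennreal) ==> x \<le> 1"
proof (cases x)
 case (real r)
 assume "x ^ Suc n \<le> 1"
 then have "r ^ Suc n \<le> 1" using real by (simp add: ennreal_power del: power_Suc flip: ennreal_1)
 then have "r \<le> 1" using real one_less_power[of r "Suc n"] by fastforce
 then show ?thesis using real by simp
qed (simp add: ennreal_top_mult)

text \<open>Amplitude and end times will depend on time, and \<open>admissible\<close> includes
  joint measurability in space and time.\<close>

lemma bump_measurable:
 assumes [measurable]: "A \<in> borel_measurable borel" "l \<in> borel_measurable borel" "h \<in> borel_measurable borel"
 shows "(\<lambda>(t, x). bump (A t) (l t) (h t) x) \<in> borel_measurable (borel \<Otimes>\<^sub>M borel)"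
 unfolding bump_def indicator_def atLeastAtMost_iff by measurable

text \<open>The L^4 norm of \<open>br\<close> is interpolated between the sup bound and the L^2
  norm; the square of the latter is at most mass plus energy, hence at most
  \<open>M + 1\<close>.\<close>

lemma bump_norms:
 assumes A: "A > 0" and l: "0 < l" and lh: "l \<le> h" and E: "4 * pi * A\<^sup>2 * ln (h / l) \<le> 1"
  and m: "(\<integral>\<^sup>+a. \<integral>\<^sup>+b. ennreal (1 / (4 * pi * (a + b))) \<partial>bump_measure A l h \<partial>bump_measure A l h) = ennreal M"
  and M: "M \<ge> 0"
 defines "f \<equiv> \<lambda>x. complex_of_real (bump A l h x)"
 shows "H1dot_norm f \<le> 1" "(Lnorm 2 f)\<^sup>2 = ennreal M"
  "(H1_norm 4 f) ^ 4 \<le> ennreal ((A * (ln (h / l) + 4 / sqrt l))\<^sup>2 * (M + 1))"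
proof -
 have A0: "A \<ge> 0" using A by simp
 interpret heat_mixture "bump_measure A l h" l by (rule heat_mixture_bump[OF A0 l])
 have f: "f = (\<lambda>x. complex_of_real (prof x))" by (simp add: f_def bump_eq[OF A0 l])
 have en: "(\<integral>\<^sup>+x. ennreal (\<Sum>j\<in>UNIV. (dprof j x)\<^sup>2) \<partial>lborel) \<le> 1"
  unfolding dprof_energy_nn using bump_energy[OF A0 l lh] E by (simp add: order_trans)
 let ?G = "\<lambda>x. \<chi> j. complex_of_real (dprof j x)"
 have "(Lnorm 2 ?G)\<^sup>2 = (\<integral>\<^sup>+x. ennreal ((norm (?G x))\<^sup>2) \<partial>lborel)" by (rule Lnorm_numeral_pow)
 also have "... \<le> 1" using en by (simp add: norm_vec_def L2_set_def sum_nonneg)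
 finally have "Lnorm 2 ?G \<le> 1" using ennreal_power_le_one_iff[of "Lnorm 2 ?G" 1] by (simp add: power2_eq_square)
 moreover have "H1dot_norm f \<le> Lnorm 2 ?G"
  unfolding H1dot_norm_def f by (rule Inf_lower, simp, rule exI[of _ ?G], intro conjI refl prof_gradient)
 ultimately show "H1dot_norm f \<le> 1" by (rule order_trans[rotated])
 have mass: "(\<integral>\<^sup>+x. ennreal ((prof x)\<^sup>2) \<partial>lborel) = ennreal M" unfolding prof_mass_nn m ..
 then show "(Lnorm 2 f)\<^sup>2 = ennreal M" unfolding Lnorm_numeral_pow f by simp
 define S where "S = A * (ln (h / l) + 4 / sqrt l)"
 have S: "S \<ge> 0" using A l lh by (simp add: S_def)
 have "H1_norm 4 f \<le> Lnorm 4 br"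
  unfolding H1_norm_def f by (rule Inf_lower, simp, rule exI[of _ br], intro conjI refl prof_multiplier)
 then have "(H1_norm 4 f) ^ 4 \<le> (Lnorm 4 br) ^ 4" by (rule power_mono) simp
 also have "... = (\<integral>\<^sup>+x. ennreal (norm (br x) ^ 4) \<partial>lborel)" by (rule Lnorm_numeral_pow)
 also have "... \<le> (\<integral>\<^sup>+x. ennreal (S\<^sup>2) * ennreal ((norm (br x))\<^sup>2) \<partial>lborel)"
 proof (intro nn_integral_mono)
  fix x
  have "norm (br x) \<le> S" unfolding S_def by (rule bump_bracket_sup[OF A0 l lh])
  then have "(norm (br x))\<^sup>2 * (norm (br x))\<^sup>2 \<le> S\<^sup>2 * (norm (br x))\<^sup>2" by (intro mult_right_mono power_mono) auto
  then show "ennreal (norm (br x) ^ 4) \<le> ennreal (S\<^sup>2) * ennreal ((norm (br x))\<^sup>2)"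
   by (simp add: ennreal_leI flip: ennreal_mult power_add)
 qed
 also have "... = ennreal (S\<^sup>2) * (\<integral>\<^sup>+x. ennreal ((norm (br x))\<^sup>2) \<partial>lborel)" by (rule nn_integral_cmult) measurable
 also have "... \<le> ennreal (S\<^sup>2) * (ennreal M + 1)"
  using br_L2_nn en mass by (intro mult_left_mono) (auto intro: order_trans add_left_mono)
 also have "... = ennreal (S\<^sup>2 * (M + 1))" using M by (simp add: ennreal_mult flip: ennreal_1)
 finally show "(H1_norm 4 f) ^ 4 \<le> ennreal ((A * (ln (h / l) + 4 / sqrt l))\<^sup>2 * (M + 1))" by (simp add: S_def)
qed

text \<open>Mass \<open>M\<close> is demanded at every time, so the concentrated profile cannot
  simply be switched off. At large times it is dilated: the mass is preserved, while the fourth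
  power of the H^{1,4} norm decays quadratically and is integrable in time.\<close>

lemma concentrating_family:
 assumes M: "M > 0"
 obtains K where "K > 0"
  "\<And>\<epsilon>. 0 < \<epsilon> ==> \<epsilon> \<le> exp (-1) ==> \<exists>u. admissible M u \<and>
    (\<integral>\<^sup>+t. (H1_norm 4 (u t)) ^ 4 \<partial>lebesgue) \<le> ennreal (K / \<epsilon>) \<and>
    (\<forall>t x. \<bar>t\<bar> \<le> 1 --> (norm x)\<^sup>2 \<le> \<epsilon> * M --> (ln (1 / \<epsilon>) - 1 / 4) / sqrt (4 * pi * ln (1 / \<epsilon>)) \<le> norm (u t x))"
proof -
 define K0 where "K0 = (M + 1) * (1 + 16 / M)"
 define I0 where "I0 = (LINT t|lborel. inverse (1 + t\<^sup>2 :: real))"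
 have I: "integrable lborel (\<lambda>t::real. inverse (1 + t\<^sup>2))"
  using integrable_inverse_1_plus_square by (simp add: set_integrable_def)
 have I0: "I0 \<ge> 0" unfolding I0_def by (intro integral_nonneg_AE) (auto intro!: always_eventually add_nonneg_nonneg)
 have K0: "K0 > 0" using M by (simp add: K0_def add_pos_nonneg)
 show ?thesis
 proof (rule that[of "2 * K0 * I0 + 1"])
  show "2 * K0 * I0 + 1 > 0" using I0 K0 by (simp add: add_nonneg_pos)
  fix \<epsilon> :: real assume e: "0 < \<epsilon>" "\<epsilon> \<le> exp (-1)"
  define L where "L = ln (1 / \<epsilon>)"
  have e1: "\<epsilon> < 1" using e by (metis exp_less_one_iff less_minus_one_simps(1) order_le_less_trans)
  have L: "L \<ge> 1"
  proof -
   have "ln \<epsilon> \<le> ln (exp (-1))" using e by (subst ln_le_cancel_iff) auto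
   then show ?thesis using e by (simp add: L_def ln_div)
  qed
  \<comment> \<open>The amplitude for which the energy bound \<open>4 * pi * A\<^sup>2 * L\<close>
    equals one.\<close>
  define A where "A = 1 / sqrt (4 * pi * L)"
  have A: "A > 0" "4 * pi * A\<^sup>2 * L = 1" using L by (auto simp: A_def power_divide)
  obtain J where J: "bump_mass \<epsilon> = ennreal J" "0 < J" "J \<le> L"
  proof (cases "bump_mass \<epsilon>")
   case (real J)
   then show ?thesis using bump_mass_bounds[OF e(1) e1] L by (intro that[of J]) (auto simp: L_def[symmetric])
  next
   case top
   then show ?thesis using bump_mass_bounds(1)[OF e(1) e1] by (simp add: top_unique)
  qed
  \<comment> \<open>The solution of \<open>4 * pi * A\<^sup>2 * \<rho> * J = M\<close>;
    \<open>J \<le> L\<close> makes it at least \<open>M\<close>.\<close>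
  define \<rho> where "\<rho> = M * L / J"
  have \<rho>: "\<rho> \<ge> M" using J M L by (simp add: \<rho>_def field_simps)
  \<comment> \<open>The dilation factor. Dividing the amplitude by it and multiplying both end times
    by its square keeps the mass and divides the energy bound by
    \<open>(\<sigma> t)\<^sup>2\<close>.\<close>
  define \<sigma> where "\<sigma> t = max 1 \<bar>t\<bar>" for t :: real
  have lam: "\<sigma> t \<ge> 1" for t by (simp add: \<sigma>_def)
  have lam2: "(\<sigma> t)\<^sup>2 \<ge> 1" for t using lam[of t] by (simp add: one_le_power)
  define u where "u t x = complex_of_real (bump (A / \<sigma> t) (\<epsilon> * (\<rho> * (\<sigma> t)\<^sup>2)) (\<rho> * (\<sigma> t)\<^sup>2) x)" for t and x :: "real^2"
  have norms: "H1dot_norm (u t) \<le> 1" "(Lnorm 2 (u t))\<^sup>2 = ennreal M" "(H1_norm 4 (u t)) ^ 4 \<le> ennreal (K0 / \<epsilon> * (1 / (\<sigma> t)\<^sup>2))" for t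
  proof -
   define h where "h = \<rho> * (\<sigma> t)\<^sup>2"
   define B where "B = A / \<sigma> t"
   have h: "h \<ge> M" using \<rho> lam2[of t] M mult_mono[of M \<rho> 1 "(\<sigma> t)\<^sup>2"] by (simp add: h_def)
   then have h0: "h > 0" using M by simp
   have B: "B > 0" using A lam[of t] by (simp add: B_def)
   have l: "0 < \<epsilon> * h" "\<epsilon> * h \<le> h" using e e1 h0 by auto
   have q: "h / (\<epsilon> * h) = 1 / \<epsilon>" using h0 e by simp
   have B2: "B\<^sup>2 = A\<^sup>2 / (\<sigma> t)\<^sup>2" by (simp add: B_def power_divide)
   have E: "4 * pi * B\<^sup>2 * L = 1 / (\<sigma> t)\<^sup>2" using A(2) unfolding B2 by (simp add: field_simps)
   have "1 / y \<le> 1" if "y \<ge> 1" for y :: real using that by (simp add: divide_le_eq_1)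
   then have E1: "4 * pi * B\<^sup>2 * ln (h / (\<epsilon> * h)) \<le> 1" unfolding q L_def[symmetric] E using lam2[of t] by blast
   have "4 * pi * B\<^sup>2 * h * J = M"
   proof -
    have "4 * pi * B\<^sup>2 * h * J = (4 * pi * A\<^sup>2 * L) * M"
     unfolding B2 h_def \<rho>_def using J lam[of t] by simp
    then show ?thesis using A by simp
   qed
   then have m: "(\<integral>\<^sup>+a. \<integral>\<^sup>+b. ennreal (1 / (4 * pi * (a + b))) \<partial>bump_measure B (\<epsilon> * h) h \<partial>bump_measure B (\<epsilon> * h) h) = ennreal M"
    using bump_mass_scale[of B \<epsilon> h] B e h0 J by (simp flip: ennreal_mult)
   note n = bump_norms[OF B l E1 m less_imp_le[OF M]]
   have ueq: "u t = (\<lambda>x. complex_of_real (bump B (\<epsilon> * h) h x))" by (simp add: u_def h_def B_def fun_eq_iff)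
   show "H1dot_norm (u t) \<le> 1" "(Lnorm 2 (u t))\<^sup>2 = ennreal M" using n unfolding ueq by auto
   \<comment> \<open>\<open>B\<^sup>2 * L\<close> supplies the decay in time and consumes one
     logarithm; a second one is absorbed by \<open>L \<le> 1 / \<epsilon>\<close>. The result is of
     order \<open>1 / \<epsilon>\<close> without a logarithm.\<close>
   have "(B * (L + 4 / sqrt (\<epsilon> * h)))\<^sup>2 * (M + 1) \<le> K0 / \<epsilon> * (1 / (\<sigma> t)\<^sup>2)"
   proof -
    have "(L + 4 / sqrt (\<epsilon> * h))\<^sup>2 \<le> 2 * L\<^sup>2 + 2 * (4 / sqrt (\<epsilon> * h))\<^sup>2"
     using zero_le_power2[of "L - 4 / sqrt (\<epsilon> * h)"] by (simp add: power2_eq_square algebra_simps)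
    also have "(4 / sqrt (\<epsilon> * h))\<^sup>2 = 16 / (\<epsilon> * h)" using l by (simp add: power_divide)
    also have "16 / (\<epsilon> * h) \<le> 16 / (\<epsilon> * M)" using h e M by (intro divide_left_mono mult_left_mono) auto
    finally have s1: "(L + 4 / sqrt (\<epsilon> * h))\<^sup>2 \<le> 2 * L\<^sup>2 + 2 * (16 / (\<epsilon> * M))" by simp
    have Le: "L \<le> 1 / \<epsilon>" unfolding L_def using ln_le_minus_one[of "1/\<epsilon>"] e by simp
    have "2 * L\<^sup>2 + 2 * (16 / (\<epsilon> * M)) \<le> 2 * L * (1 / \<epsilon> * (1 + 16 / M))"
    proof -
     have "L * L \<le> L * (1 / \<epsilon>)" using Le L by (intro mult_left_mono) auto
     moreover have "1 * (16 / (\<epsilon> * M)) \<le> L * (16 / (\<epsilon> * M))" using L e M by (intro mult_right_mono) auto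
     ultimately have "2 * L\<^sup>2 + 2 * (16 / (\<epsilon> * M)) \<le> 2 * (L * (1 / \<epsilon>)) + 2 * (L * (16 / (\<epsilon> * M)))"
      by (simp only: power2_eq_square)
     also have "... = 2 * L * (1 / \<epsilon> * (1 + 16 / M))" using e M by (simp add: field_simps)
     finally show ?thesis .
    qed
    with s1 have "B\<^sup>2 * (L + 4 / sqrt (\<epsilon> * h))\<^sup>2 \<le> B\<^sup>2 * (2 * L * (1 / \<epsilon> * (1 + 16 / M)))"
     by (intro mult_left_mono) auto
    also have "... = (4 * pi * B\<^sup>2 * L) * (1 / \<epsilon> * (1 + 16 / M)) / (2 * pi)" by simp
    also have "... = (1 / (\<sigma> t)\<^sup>2) * (1 / \<epsilon> * (1 + 16 / M)) / (2 * pi)" unfolding E ..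
    also have "... \<le> (1 / (\<sigma> t)\<^sup>2) * (1 / \<epsilon> * (1 + 16 / M)) / 1"
     using e M pi_ge_two by (intro divide_left_mono mult_nonneg_nonneg) auto
    finally have "B\<^sup>2 * (L + 4 / sqrt (\<epsilon> * h))\<^sup>2 * (M + 1) \<le> (1 / (\<sigma> t)\<^sup>2) * (1 / \<epsilon> * (1 + 16 / M)) / 1 * (M + 1)"
     using M by (intro mult_right_mono) auto
    then show ?thesis by (simp add: K0_def power_mult_distrib mult_ac)
   qed
   then show "(H1_norm 4 (u t)) ^ 4 \<le> ennreal (K0 / \<epsilon> * (1 / (\<sigma> t)\<^sup>2))"
    using n(3) unfolding ueq q L_def[symmetric] by (meson ennreal_leI order_trans)
  qed
  have lm [measurable]: "\<sigma> \<in> borel_measurable borel" unfolding \<sigma>_def by measurable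
  have jm: "(\<lambda>(t, x). u t x) \<in> borel_measurable (borel \<Otimes>\<^sub>M borel)"
   unfolding u_def split_beta'
   using bump_measurable[of "\<lambda>t. A / \<sigma> t" "\<lambda>t. \<epsilon> * (\<rho> * (\<sigma> t)\<^sup>2)" "\<lambda>t. \<rho> * (\<sigma> t)\<^sup>2"]
   by (simp add: split_beta' borel_measurable_of_real)
  have adm: "admissible M u"
   unfolding admissible_def
  proof (intro conjI allI norms)
   show "(\<lambda>(t, x). u t x) \<in> borel_measurable lebesgue"
    using jm by (intro borel_imp_lebesgue) (simp add: borel_prod)
   show "u t \<in> borel_measurable lebesgue" for t
    using measurable_compose[OF measurable_Pair1' jm, of t] by (intro borel_imp_lebesgue) simp
  qed
  have "(\<integral>\<^sup>+t. (H1_norm 4 (u t)) ^ 4 \<partial>lebesgue) \<le> (\<integral>\<^sup>+t. ennreal (2 * K0 / \<epsilon> * inverse (1 + t\<^sup>2)) \<partial>lborel)"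
   unfolding nn_integral_lebesgue
  proof (intro nn_integral_mono order_trans[OF norms(3)] ennreal_leI)
   fix t :: real
   have "1 + t\<^sup>2 \<le> 2 * (\<sigma> t)\<^sup>2"
   proof -
    have "t\<^sup>2 \<le> (\<sigma> t)\<^sup>2" unfolding \<sigma>_def by (intro abs_le_square_iff[THEN iffD1]) auto
    then show ?thesis using lam2[of t] by linarith
   qed
   then have "1 / (\<sigma> t)\<^sup>2 \<le> 2 * inverse (1 + t\<^sup>2)"
   proof -
    have "1 / y \<le> 2 * inverse z" if "z \<le> 2 * y" "y \<ge> 1" "z > 0" for y z :: real
     using that by (simp add: field_simps)
    then show ?thesis using \<open>1 + t\<^sup>2 \<le> 2 * (\<sigma> t)\<^sup>2\<close> lam2[of t] by (simp add: add_pos_nonneg)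
   qed
   then have "K0 / \<epsilon> * (1 / (\<sigma> t)\<^sup>2) \<le> K0 / \<epsilon> * (2 * inverse (1 + t\<^sup>2))"
    using K0 e by (intro mult_left_mono) auto
   then show "K0 / \<epsilon> * (1 / (\<sigma> t)\<^sup>2) \<le> 2 * K0 / \<epsilon> * inverse (1 + t\<^sup>2)" by (simp add: mult_ac)
  qed
  also have "... = ennreal (LINT t|lborel. 2 * K0 / \<epsilon> * inverse (1 + t\<^sup>2))"
   using K0 e by (intro nn_integral_eq_integral integrable_mult_right I always_eventually allI mult_nonneg_nonneg) (auto intro: add_nonneg_nonneg)
  also have "(LINT t|lborel. 2 * K0 / \<epsilon> * inverse (1 + t\<^sup>2)) = 2 * K0 * I0 / \<epsilon>"
   by (simp only: integral_mult_right_zero I0_def) simp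
  also have "ennreal (2 * K0 * I0 / \<epsilon>) \<le> ennreal ((2 * K0 * I0 + 1) / \<epsilon>)"
   using e by (intro ennreal_leI divide_right_mono) auto
  finally have int: "(\<integral>\<^sup>+t. (H1_norm 4 (u t)) ^ 4 \<partial>lebesgue) \<le> ennreal ((2 * K0 * I0 + 1) / \<epsilon>)" .
  have low: "(L - 1 / 4) / sqrt (4 * pi * L) \<le> norm (u t x)" if "\<bar>t\<bar> \<le> 1" "(norm x)\<^sup>2 \<le> \<epsilon> * M" for t x
  proof -
   have [simp]: "\<sigma> t = 1" using that by (simp add: \<sigma>_def)
   have "\<epsilon> * M \<le> \<epsilon> * \<rho>" using \<rho> e by (intro mult_left_mono) auto
   then have "(norm x)\<^sup>2 \<le> \<epsilon> * \<rho>" using that(2) by simp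
   then have "A * (ln (\<rho> / (\<epsilon> * \<rho>)) - 1 / 4) \<le> bump A (\<epsilon> * \<rho>) \<rho> x"
    using A e e1 \<rho> M by (intro bump_ge) auto
   moreover have "\<rho> / (\<epsilon> * \<rho>) = 1 / \<epsilon>" using \<rho> M by simp
   ultimately have "A * (L - 1 / 4) \<le> bump A (\<epsilon> * \<rho>) \<rho> x" by (simp add: L_def)
   also have "... \<le> norm (u t x)" by (simp add: u_def)
   finally show ?thesis by (simp add: A_def)
  qed
  show "\<exists>u. admissible M u \<and>
    (\<integral>\<^sup>+t. (H1_norm 4 (u t)) ^ 4 \<partial>lebesgue) \<le> ennreal ((2 * K0 * I0 + 1) / \<epsilon>) \<and>
    (\<forall>t x. \<bar>t\<bar> \<le> 1 --> (norm x)\<^sup>2 \<le> \<epsilon> * M --> (ln (1 / \<epsilon>) - 1 / 4) / sqrt (4 * pi * ln (1 / \<epsilon>)) \<le> norm (u t x))"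
   using adm int low by (intro exI[of _ u]) (auto simp: L_def)
 qed
qed

text \<open>With \<open>\<epsilon> = exp (- L)\<close>, the profile has full height for times in an
  interval of length 2 and on a disc of area \<open>pi * (\<epsilon> * M)\<close>. Up to constants
  the left side is at least \<open>R powr s * \<epsilon> powr (iq - 1)\<close> and the right side at
  most \<open>\<epsilon> powr (- ip)\<close>. If \<open>ip + iq \<le> 1\<close> the powers of
  \<epsilon> cannot save the inequality, and what remains bounds \<open>(c1 * sqrt L) powr s\<close>
  uniformly in \<open>L\<close>.\<close>

lemma estimate_fails:
 fixes M s C :: real and p q :: ennreal
 assumes M: "M > 0" and s: "s > 0" and p: "1 \<le> p" and q: "1 \<le> q" and C: "C > 0"
  and le: "enn2real (inverse p) + enn2real (inverse q) \<le> 1"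
  and bound: "\<And>u. admissible M u ==>
       mixed_norm p q (\<lambda>t x. norm (u t x) powr s * exp (4 * pi * (norm (u t x))\<^sup>2))
        \<le> ennreal C * ennreal_pow (Lp_norm 4 lebesgue (\<lambda>t::real. H1_norm 4 (u t))) (enn2real (4 / p))"
 shows False
proof -
 obtain K where K: "K > 0" and fam: "\<And>\<epsilon>. 0 < \<epsilon> ==> \<epsilon> \<le> exp (-1) ==> \<exists>u. admissible M u \<and>
    (\<integral>\<^sup>+t. (H1_norm 4 (u t)) ^ 4 \<partial>lebesgue) \<le> ennreal (K / \<epsilon>) \<and>
    (\<forall>t x. \<bar>t\<bar> \<le> 1 --> (norm x)\<^sup>2 \<le> \<epsilon> * M --> (ln (1 / \<epsilon>) - 1 / 4) / sqrt (4 * pi * ln (1 / \<epsilon>)) \<le> norm (u t x))"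
  using concentrating_family[OF M] by blast
 define ip iq where "ip = enn2real (inverse p)" and "iq = enn2real (inverse q)"
 have ipq: "ip \<ge> 0" "iq \<ge> 0" "ip + iq \<le> 1" using le by (auto simp: ip_def iq_def)
 have e4: "enn2real (4 / p) = 4 * ip"
  using p by (cases p rule: ennreal_ge_one_cases) (auto simp: ip_def divide_ennreal_def enn2real_mult)
 \<comment> \<open>The factor 3/4 comes from \<open>L - 1/4 \<ge> 3/4 * L\<close> for
   \<open>L \<ge> 1\<close>.\<close>
 define c1 where "c1 = 3 / 4 / sqrt (4 * pi)"
 have c1: "c1 > 0" by (simp add: c1_def)
 define D where "D = C * K powr ip * exp (1 / 2) / (pi * M) powr iq"
 have D: "D > 0" using C K M by (simp add: D_def)
 have key: "(c1 * sqrt L) powr s \<le> D" if L: "L \<ge> 1" for L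
 proof -
  define \<epsilon> where "\<epsilon> = exp (- L)"
  have e: "0 < \<epsilon>" "\<epsilon> \<le> exp (-1)" "\<epsilon> \<le> 1" using L by (auto simp: \<epsilon>_def)
  have lnL: "ln (1 / \<epsilon>) = L" by (simp add: \<epsilon>_def ln_div)
  obtain u where u: "admissible M u" "(\<integral>\<^sup>+t. (H1_norm 4 (u t)) ^ 4 \<partial>lebesgue) \<le> ennreal (K / \<epsilon>)"
   "\<And>t x. \<bar>t\<bar> \<le> 1 ==> (norm x)\<^sup>2 \<le> \<epsilon> * M ==> (L - 1 / 4) / sqrt (4 * pi * L) \<le> norm (u t x)"
   using fam[OF e(1,2)] unfolding lnL by blast
  define R where "R = (L - 1 / 4) / sqrt (4 * pi * L)"
  have R0: "R > 0" using L by (simp add: R_def)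
  have R1: "R \<ge> c1 * sqrt L"
  proof -
   have "sqrt (4 * pi * L) = sqrt (4 * pi) * sqrt L" by (simp add: real_sqrt_mult)
   moreover have "c1 * sqrt L * (sqrt (4 * pi) * sqrt L) = 3 / 4 * L"
    using L by (simp add: c1_def)
   moreover have "3 / 4 * L \<le> L - 1 / 4" using L by simp
   moreover have "sqrt (4 * pi) * sqrt L > 0" using L by simp
   ultimately show ?thesis by (simp add: R_def pos_le_divide_eq)
  qed
  \<comment> \<open>The squared height falls short of \<open>L / (4 * pi)\<close> by a bounded
    amount only, so its exponential is still of order \<open>1 / \<epsilon>\<close>.\<close>
  have R2: "4 * pi * R\<^sup>2 \<ge> L - 1 / 2"
  proof -
   have "4 * pi * R\<^sup>2 = (L - 1 / 4)\<^sup>2 / L" using L by (simp add: R_def power_divide)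
   moreover have "(L - 1 / 2) * L \<le> (L - 1 / 4)\<^sup>2" by (simp add: power2_eq_square algebra_simps)
   ultimately show ?thesis using L by (simp add: pos_le_divide_eq)
  qed
  define c0 where "c0 = R powr s * exp (L - 1 / 2)"
  have c0: "c0 > 0" using R0 by (simp add: c0_def)
  let ?F = "\<lambda>t x. norm (u t x) powr s * exp (4 * pi * (norm (u t x))\<^sup>2)"
  have F: "c0 \<le> ?F t x" if "\<bar>t\<bar> \<le> 1" "(norm x)\<^sup>2 \<le> \<epsilon> * M" for t x
  proof -
   have n: "R \<le> norm (u t x)" using u(3)[OF that] by (simp add: R_def)
   have "L - 1 / 2 \<le> 4 * pi * R\<^sup>2" by (rule R2)
   also have "... \<le> 4 * pi * (norm (u t x))\<^sup>2" using n R0 by (intro mult_left_mono power_mono) auto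
   finally show ?thesis unfolding c0_def using n R0 s by (intro mult_mono powr_mono2) auto
  qed
  let ?S = "cball (0::real^2) (sqrt (\<epsilon> * M))"
  define m where "m = pi * (\<epsilon> * M)"
  have m: "m > 0" using e M by (simp add: m_def)
  have "emeasure lborel ?S = ennreal m"
   using e M by (subst emeasure_cball) (auto simp: m_def unit_ball_vol_2)
  then have emS: "emeasure lebesgue ?S = ennreal m" by simp
  have inS: "(norm x)\<^sup>2 \<le> \<epsilon> * M" if "x \<in> ?S" for x
   using that e M real_le_rsqrt by (simp add: real_sqrt_ge_abs1) (metis abs_norm_cancel real_sqrt_abs real_sqrt_le_iff)
  have inner: "ennreal (c0 * m powr iq) \<le> Lnorm q (?F t)" if "t \<in> {-1..1}" for t
   unfolding iq_def
  proof (rule Lp_norm_ge[OF q _ emS m c0])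
   fix x assume "x \<in> ?S"
   then have "c0 \<le> ?F t x" using that by (intro F inS) auto
   then show "ennreal c0 \<le> ennreal (norm (?F t x))" by (intro ennreal_leI) auto
  qed auto
  have "ennreal (c0 * m powr iq * 2 powr ip) \<le> mixed_norm p q ?F"
   unfolding mixed_norm_def ip_def
  proof (rule Lp_norm_ge[OF p])
   show "{-1..1::real} \<in> sets lebesgue" by simp
   show "emeasure lebesgue {-1..1::real} = ennreal 2" by simp
   show "0 < c0 * m powr iq" using c0 m by simp
  qed (use inner in auto)
  also have "... \<le> ennreal C * ennreal_pow (Lp_norm 4 lebesgue (\<lambda>t. H1_norm 4 (u t))) (4 * ip)"
   using bound[OF u(1)] unfolding e4 .
  also have "... \<le> ennreal C * ennreal ((K / \<epsilon>) powr ip)"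
  proof (intro mult_left_mono)
   have "Lp_norm 4 lebesgue (\<lambda>t. H1_norm 4 (u t)) = ennreal_pow (\<integral>\<^sup>+t. (H1_norm 4 (u t)) ^ 4 \<partial>lebesgue) (1 / 4)"
    by (simp add: Lp_norm_def ennreal_pow_numeral)
   also have "... \<le> ennreal_pow (ennreal (K / \<epsilon>)) (1 / 4)"
    by (intro ennreal_pow_mono u(2)) simp
   also have "... = ennreal ((K / \<epsilon>) powr (1 / 4))"
    using K e by (intro ennreal_pow_ennreal) auto
   finally have "ennreal_pow (Lp_norm 4 lebesgue (\<lambda>t. H1_norm 4 (u t))) (4 * ip) \<le> ennreal_pow (ennreal ((K / \<epsilon>) powr (1 / 4))) (4 * ip)"
    using ipq by (intro ennreal_pow_mono) auto
   also have "... = ennreal ((K / \<epsilon>) powr ip)"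
    using K e by (cases "ip = 0") (auto simp: ennreal_pow_ennreal powr_powr)
   finally show "ennreal_pow (Lp_norm 4 lebesgue (\<lambda>t. H1_norm 4 (u t))) (4 * ip) \<le> ennreal ((K / \<epsilon>) powr ip)" .
  qed simp
  also have "... = ennreal (C * (K / \<epsilon>) powr ip)" using C by (simp add: ennreal_mult)
  finally have main: "c0 * m powr iq * 2 powr ip \<le> C * (K / \<epsilon>) powr ip"
   using C K e by (subst (asm) ennreal_le_iff) auto
  have "c0 * m powr iq * 1 \<le> c0 * m powr iq * 2 powr ip"
   using c0 m ipq by (intro mult_left_mono ge_one_powr_ge_zero) auto
  with main have m1: "c0 * m powr iq \<le> C * (K / \<epsilon>) powr ip" by simp
  have "(c1 * sqrt L) powr s * exp (L - 1 / 2) \<le> c0"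
   unfolding c0_def using R1 c1 L s by (intro mult_right_mono powr_mono2) auto
  then have "(c1 * sqrt L) powr s * exp (L - 1 / 2) * m powr iq \<le> c0 * m powr iq" by (intro mult_right_mono) auto
  with m1 have m2: "(c1 * sqrt L) powr s * exp (L - 1 / 2) * m powr iq \<le> C * (K / \<epsilon>) powr ip" by linarith
  have mp: "m powr iq = (pi * M) powr iq * \<epsilon> powr iq"
   using M e by (simp add: m_def powr_mult mult_ac)
  have Kp: "(K / \<epsilon>) powr ip = K powr ip / \<epsilon> powr ip" using K e by (simp add: powr_divide)
  have ex: "exp (L - 1 / 2) = exp (- (1 / 2)) * (1 / \<epsilon>)"
  proof -
   have "L - 1 / 2 = - (1 / 2) + L" by simp
   moreover have "exp L = 1 / \<epsilon>" by (simp add: \<epsilon>_def exp_minus inverse_eq_divide)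
   ultimately show ?thesis by (simp only: exp_add)
  qed
  define X where "X = (c1 * sqrt L) powr s"
  have X: "X \<ge> 0" by (simp add: X_def)
  have pw: "\<epsilon> powr iq * \<epsilon> powr ip \<ge> \<epsilon>"
  proof -
   have "\<epsilon> powr 1 \<le> \<epsilon> powr (iq + ip)" using e ipq by (intro powr_mono') auto
   then show ?thesis using e by (simp add: powr_add)
  qed
  have pos: "\<epsilon> powr ip > 0" "(pi * M) powr iq > 0" using e M by auto
  have "X * exp (- (1 / 2)) * (1 / \<epsilon>) * ((pi * M) powr iq * \<epsilon> powr iq) \<le> C * (K powr ip / \<epsilon> powr ip)"
   using m2 unfolding mp Kp ex X_def by (simp add: mult.assoc)
  then have "X * exp (- (1 / 2)) * (1 / \<epsilon>) * ((pi * M) powr iq * \<epsilon> powr iq) * \<epsilon> powr ip \<le> C * K powr ip"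
   using pos by (simp add: pos_le_divide_eq)
  moreover have "X * exp (- (1 / 2)) * (pi * M) powr iq * ((1 / \<epsilon>) * \<epsilon>) \<le> X * exp (- (1 / 2)) * (pi * M) powr iq * ((1 / \<epsilon>) * (\<epsilon> powr iq * \<epsilon> powr ip))"
   using X pw e by (intro mult_left_mono) auto
  ultimately have "X * exp (- (1 / 2)) * (pi * M) powr iq \<le> C * K powr ip"
   using e by (simp add: mult_ac)
  then have "X * (pi * M) powr iq \<le> C * K powr ip * exp (1 / 2)"
   by (simp add: exp_minus field_simps)
  then show ?thesis using pos by (simp add: X_def D_def pos_le_divide_eq)
 qed
 \<comment> \<open>Chosen so that \<open>Y powr s = D + 1\<close>; the value
   \<open>(Y / c1)\<^sup>2 + 1\<close> for \<open>L\<close> in \<open>key\<close> then gives the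
   contradiction.\<close>
 define Y where "Y = (D + 1) powr (1 / s)"
 have Y: "Y > 0" using D by (simp add: Y_def)
 have "(c1 * sqrt ((Y / c1)\<^sup>2 + 1)) powr s \<le> D" by (rule key) simp
 moreover have "Y \<le> c1 * sqrt ((Y / c1)\<^sup>2 + 1)"
 proof -
  have "Y / c1 \<le> sqrt ((Y / c1)\<^sup>2 + 1)" by (rule real_le_rsqrt) simp
  then show ?thesis using c1 by (simp add: pos_divide_le_eq mult.commute)
 qed
 then have "Y powr s \<le> (c1 * sqrt ((Y / c1)\<^sup>2 + 1)) powr s" using Y s by (intro powr_mono2) auto
 moreover have "Y powr s = D + 1" using D s by (simp add: Y_def powr_powr)
 ultimately show False by simp
qed

section \<open>Pointwise and level set bounds for the heat evolution\<close>

lemma bounded_pair_integral: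
 fixes k :: "'a \<Rightarrow> 'b \<Rightarrow> real"
 assumes "finite_measure M" "finite_measure N"
  and [measurable]: "case_prod k \<in> borel_measurable (M \<Otimes>\<^sub>M N)" and C: "\<And>x y. \<bar>k x y\<bar> \<le> C"
 shows "(LINT w|(M \<Otimes>\<^sub>M N). k (fst w) (snd w)) = (LINT x|M. LINT y|N. k x y)"
  and "integrable (M \<Otimes>\<^sub>M N) (\<lambda>w. k (fst w) (snd w))"
  and "integrable M (\<lambda>x. LINT y|N. k x y)"
proof -
 interpret M: finite_measure M by fact
 interpret N: finite_measure N by fact
 have "(\<integral>\<^sup>+x. \<integral>\<^sup>+y. ennreal (norm (k x y)) \<partial>N \<partial>M) \<le> (\<integral>\<^sup>+x. \<integral>\<^sup>+y. ennreal C \<partial>N \<partial>M)"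
  using C by (intro nn_integral_mono ennreal_leI) simp
 also have "... < \<infinity>"
  using M.emeasure_finite[of "space M", unfolded less_top] N.emeasure_finite[of "space N", unfolded less_top]
  by (simp add: ennreal_mult_less_top)
 finally have fin: "(\<integral>\<^sup>+x. \<integral>\<^sup>+y. ennreal (norm (k x y)) \<partial>N \<partial>M) < \<infinity>" .
 note F = Fubini_swap[OF M.sigma_finite_measure_axioms N.sigma_finite_measure_axioms assms(3) fin]
 show "(LINT w|(M \<Otimes>\<^sub>M N). k (fst w) (snd w)) = (LINT x|M. LINT y|N. k x y)"
  "integrable (M \<Otimes>\<^sub>M N) (\<lambda>w. k (fst w) (snd w))" "integrable M (\<lambda>x. LINT y|N. k x y)"
  using F(2,4,5) by (simp_all add: split_beta')
qed

text \<open>The quadratic factor is absorbed by doubling the time, so that a Laplacian is controlled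
  by a positive kernel.\<close>

lemma lheat_abs_le: "b > 0 ==> \<bar>lheat b z\<bar> \<le> 6 / b * heat (2 * b) z"
proof -
 assume b: "b > 0"
 define P Q where "P = (norm z)\<^sup>2 / (4 * b\<^sup>2)" and "Q = 1 / b"
 have PQ: "P \<ge> 0" "Q \<ge> 0" using b by (auto simp: P_def Q_def)
 have "\<bar>lheat b z\<bar> = \<bar>P - Q\<bar> * heat b z"
  using b by (simp add: lheat_def abs_mult heat_nonneg P_def Q_def)
 also have "... \<le> (P + Q) * heat b z" using PQ b by (intro mult_right_mono heat_nonneg) auto
 also have "... = (1 / b) * ((norm z)\<^sup>2 / (4 * b) * heat b z) + 1 / b * heat b z"
  using b by (simp add: P_def Q_def power2_eq_square distrib_right)
 also have "... \<le> (1 / b) * (4 * heat (2 * b) z) + 1 / b * (2 * heat (2 * b) z)"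
  using b by (intro add_mono mult_left_mono heat_norm_sq_le heat_le_double) auto
 also have "... = 6 / b * heat (2 * b) z" by (simp add: field_simps)
 finally show ?thesis .
qed

lemma lheat_bound: "0 < a ==> a \<le> b ==> \<bar>lheat b z\<bar> \<le> 1 / a\<^sup>2"
proof -
 assume a: "0 < a" "a \<le> b"
 have "\<bar>lheat b z\<bar> \<le> 6 / b * heat (2 * b) z" using a by (intro lheat_abs_le) simp
 also have "... \<le> 6 / b * (1 / (4 * pi * (2 * b)))" using a by (intro mult_left_mono heat_le) auto
 also have "... = (3 / (4 * pi)) / b\<^sup>2" using a by (simp add: power2_eq_square)
 also have "... \<le> 1 / a\<^sup>2" using a pi_ge_two by (intro frac_le power_mono) auto
 finally show ?thesis .
qed

lemma heat_bound: "0 < a ==> a \<le> b ==> \<bar>heat b z\<bar> \<le> 1 / (4 * pi * a)"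
proof -
 assume a: "0 < a" "a \<le> b"
 have "heat b z \<le> 1 / (4 * pi * b)" using a by (intro heat_le) simp
 also have "... \<le> 1 / (4 * pi * a)" using a by (intro divide_left_mono) auto
 finally show ?thesis using a heat_nonneg[of b z] by simp
qed

lemma heat_sq_le: "0 < a ==> a \<le> b ==> (\<integral>\<^sup>+y. ennreal ((heat b (y - x))\<^sup>2) \<partial>lborel) \<le> ennreal (1 / (8 * pi * a))"
 by (subst heat_sq) (auto intro!: ennreal_leI divide_left_mono)

lemma dheat_sq_le: "0 < a ==> a \<le> b ==> (\<integral>\<^sup>+y. ennreal ((dheat j b (y - x))\<^sup>2) \<partial>lborel) \<le> ennreal (1 / (16 * pi * a\<^sup>2))"
 by (rule order_trans[OF dheat_sq]) (auto intro!: ennreal_leI divide_left_mono power_mono)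

lemma lheat_sq_le:
 assumes "0 < a" "a \<le> b"
 shows "(\<integral>\<^sup>+y. ennreal ((lheat b (y - x))\<^sup>2) \<partial>lborel) \<le> ennreal ((6 / a)\<^sup>2 * (1 / (8 * pi * (2 * a))))"
proof -
 have "(\<integral>\<^sup>+y. ennreal ((lheat b (y - x))\<^sup>2) \<partial>lborel) \<le> (\<integral>\<^sup>+y. ennreal ((6 / a)\<^sup>2) * ennreal ((heat (2 * b) (y - x))\<^sup>2) \<partial>lborel)"
 proof (intro nn_integral_mono)
  fix y
  have "\<bar>lheat b (y - x)\<bar> \<le> 6 / b * heat (2 * b) (y - x)" using assms by (intro lheat_abs_le) simp
  also have "... \<le> 6 / a * heat (2 * b) (y - x)" using assms by (intro mult_right_mono divide_left_mono heat_nonneg) auto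
  finally have "(lheat b (y - x))\<^sup>2 \<le> (6 / a * heat (2 * b) (y - x))\<^sup>2"
   by (rule power2_le_iff_abs_le[THEN iffD2, rotated]) (use assms in \<open>auto intro!: mult_nonneg_nonneg divide_nonneg_pos heat_nonneg\<close>)
  then show "ennreal ((lheat b (y - x))\<^sup>2) \<le> ennreal ((6 / a)\<^sup>2) * ennreal ((heat (2 * b) (y - x))\<^sup>2)"
   by (simp only: power_mult_distrib ennreal_mult'[symmetric] zero_le_power2 ennreal_leI)
 qed
 also have "... = ennreal ((6 / a)\<^sup>2) * (\<integral>\<^sup>+y. ennreal ((heat (2 * b) (y - x))\<^sup>2) \<partial>lborel)"
  by (rule nn_integral_cmult) measurable
 also have "... \<le> ennreal ((6 / a)\<^sup>2) * ennreal (1 / (8 * pi * (2 * a)))"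
  using assms by (intro mult_left_mono heat_sq_le) auto
 finally show ?thesis by (simp only: ennreal_mult'[symmetric] zero_le_power2)
qed

section \<open>The resolvent as an average of heat kernels\<close>

lemma heat_time_derivative:
 assumes "b > 0"
 shows "((\<lambda>b. heat b z) has_real_derivative lheat b z) (at b)"
 unfolding heat_def lheat_def using assms
 by (auto intro!: derivative_eq_intros simp: field_simps power2_eq_square)

text \<open>Averaging the heat flow against this weight on the half line produces the inverse of
  \<mu>^2 - \<Delta>.\<close>

definition exp_time :: "real \<Rightarrow> real measure" where
 "exp_time \<mu> = density lborel (\<lambda>s. ennreal (indicator {0..} s * exp (- \<mu>\<^sup>2 * s)))"

lemma exp_time_sets [measurable_cong, simp]: "sets (exp_time \<mu>) = sets borel" and exp_time_space [simp]: "space (exp_time \<mu>) = UNIV"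
 unfolding exp_time_def by auto

lemma nn_integral_exp_time:
 "f \<in> borel_measurable borel ==> (\<integral>\<^sup>+s. f s \<partial>exp_time \<mu>) = (\<integral>\<^sup>+s. ennreal (indicator {0..} s * exp (- \<mu>\<^sup>2 * s)) * f s \<partial>lborel)"
 unfolding exp_time_def by (rule nn_integral_density) auto

lemma integral_exp_time:
 fixes f :: "real \<Rightarrow> real"
 assumes "f \<in> borel_measurable borel"
 shows "(LINT s|exp_time \<mu>. f s) = (LINT s|lborel. (indicator {0..} s * exp (- \<mu>\<^sup>2 * s)) * f s)"
 unfolding exp_time_def using assms by (subst integral_density) auto

lemma nn_integral_exp_halfline:
 fixes \<mu> :: real
 assumes "\<mu> > 0"
 shows "(\<integral>\<^sup>+s. ennreal (indicator {0..} s * exp (- \<mu>\<^sup>2 * s)) \<partial>lborel) = ennreal (1 / \<mu>\<^sup>2)"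
proof -
 have "(\<integral>\<^sup>+s. ennreal (exp (- \<mu>\<^sup>2 * s)) * indicator {0..} s \<partial>lborel) = 0 - (- exp (- \<mu>\<^sup>2 * 0) / \<mu>\<^sup>2)"
 proof (rule nn_integral_FTC_atLeast)
  show "((\<lambda>s. - exp (- \<mu>\<^sup>2 * s) / \<mu>\<^sup>2) has_real_derivative exp (- \<mu>\<^sup>2 * x)) (at x)" for x
   using assms by (auto intro!: derivative_eq_intros simp: power2_eq_square power4_eq_xxxx)
  have "((\<lambda>s. exp (- \<mu>\<^sup>2 * s)) \<longlongrightarrow> 0) at_top"
  proof (rule filterlim_compose[OF exp_at_bot])
   have "filterlim (\<lambda>s. \<mu>\<^sup>2 * s) at_top at_top"
    by (rule filterlim_tendsto_pos_mult_at_top[OF tendsto_const]) (use assms in \<open>auto simp: filterlim_ident\<close>)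
   then show "filterlim (\<lambda>s. - \<mu>\<^sup>2 * s) at_bot at_top" by (simp add: filterlim_uminus_at_top)
  qed
  then have "((\<lambda>s. - exp (- \<mu>\<^sup>2 * s) / \<mu>\<^sup>2) \<longlongrightarrow> - 0 / \<mu>\<^sup>2) at_top"
   using assms by (intro tendsto_intros) auto
  then show "((\<lambda>s. - exp (- \<mu>\<^sup>2 * s) / \<mu>\<^sup>2) \<longlongrightarrow> 0) at_top" by simp
 qed auto
 moreover have "(\<integral>\<^sup>+s. ennreal (indicator {0..} s * exp (- \<mu>\<^sup>2 * s)) \<partial>lborel) = (\<integral>\<^sup>+s. ennreal (exp (- \<mu>\<^sup>2 * s)) * indicator {0..} s \<partial>lborel)"
  by (intro nn_integral_cong) (auto split: split_indicator)
 ultimately show ?thesis by simp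
qed

lemma finite_exp_time: "\<mu> > 0 ==> finite_measure (exp_time \<mu>)"
proof (rule finite_measureI)
 assume m: "\<mu> > 0"
 have "emeasure (exp_time \<mu>) UNIV = (\<integral>\<^sup>+s. 1 \<partial>exp_time \<mu>)" by simp
 also have "... = ennreal (1 / \<mu>\<^sup>2)" using nn_integral_exp_halfline[OF m] by (subst nn_integral_exp_time) auto
 finally show "emeasure (exp_time \<mu>) (space (exp_time \<mu>)) \<noteq> \<infinity>" by simp
qed

text \<open>The resolvent identity \<open>\<integral> e\<^bsup>-\<mu>\<^sup>2 s\<^esup> (\<mu>\<^sup>2 - \<Delta>) K\<^bsub>b+s\<^esub> ds = K\<^sub>b\<close>; the absolute value only
 serves to have bounds that hold for all \<open>s\<close>.\<close>

lemma resolvent_heat: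
 assumes \<mu>: "\<mu> > 0" and b: "b > 0"
 shows "(LINT s|exp_time \<mu>. \<mu>\<^sup>2 * heat (b + \<bar>s\<bar>) z - lheat (b + \<bar>s\<bar>) z) = heat b z"
proof -
 let ?g = "\<lambda>s. exp (- \<mu>\<^sup>2 * s) * (\<mu>\<^sup>2 * heat (b + s) z - lheat (b + s) z)"
 let ?F = "\<lambda>s. - (exp (- \<mu>\<^sup>2 * s) * heat (b + s) z)"
 define C where "C = \<mu>\<^sup>2 * (1 / (4 * pi * b)) + 1 / b\<^sup>2"
 have C: "\<bar>\<mu>\<^sup>2 * heat (b + s) z - lheat (b + s) z\<bar> \<le> C" if "s \<ge> 0" for s
 proof -
  have "\<bar>\<mu>\<^sup>2 * heat (b + s) z - lheat (b + s) z\<bar> \<le> \<bar>\<mu>\<^sup>2 * heat (b + s) z\<bar> + \<bar>lheat (b + s) z\<bar>" by (rule abs_triangle_ineq4)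
  also have "... \<le> C" unfolding C_def abs_mult using that b
   by (intro add_mono lheat_bound mult_mono heat_bound) auto
  finally show ?thesis .
 qed
 have dF: "(?F has_real_derivative ?g s) (at s)" if "s \<ge> 0" for s
 proof -
  have h: "((\<lambda>s. heat (b + s) z) has_real_derivative lheat (b + s) z * 1) (at s)"
   by (rule DERIV_chain2[OF heat_time_derivative]) (use that b in \<open>auto intro!: derivative_eq_intros\<close>)
  have e: "((\<lambda>s. exp (- \<mu>\<^sup>2 * s)) has_real_derivative exp (- \<mu>\<^sup>2 * s) * - \<mu>\<^sup>2) (at s)"
   by (auto intro!: derivative_eq_intros)
  show ?thesis using DERIV_minus[OF DERIV_mult[OF e h]] by (simp add: algebra_simps)
 qed
 have fin: "(LINT s|lborel. indicator {0..real n} s *\<^sub>R ?g s) = ?F (real n) - ?F 0" for n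
 proof (rule integral_FTC_atLeastAtMost)
  show "(?F has_vector_derivative ?g s) (at s within {0..real n})" if "0 \<le> s" for s
   using dF[OF that] by (simp add: has_real_derivative_iff_has_vector_derivative has_vector_derivative_at_within)
  have "continuous_on {0..real n} (\<lambda>s. ((norm z)\<^sup>2 / (4 * (b + s)\<^sup>2) - 1 / (b + s)) * heat (b + s) z)"
   unfolding heat_def using b by (intro continuous_intros) auto
  moreover have "continuous_on {0..real n} (\<lambda>s. heat (b + s) z)"
   unfolding heat_def using b by (intro continuous_intros) auto
  ultimately show "continuous_on {0..real n} ?g"
   unfolding lheat_def using b by (intro continuous_intros) auto
 qed simp
 have i: "integrable lborel (\<lambda>s. indicator {0..} s * exp (- \<mu>\<^sup>2 * s))"
 proof (rule integrableI_bounded)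
  show "(\<integral>\<^sup>+s. ennreal (norm (indicator {0..} s * exp (- \<mu>\<^sup>2 * s))) \<partial>lborel) < \<infinity>"
   using nn_integral_exp_halfline[OF \<mu>] by simp
 qed measurable
 have lim1: "(\<lambda>n. LINT s|lborel. indicator {0..real n} s *\<^sub>R ?g s) \<longlonglongrightarrow> (LINT s|lborel. indicator {0..} s * ?g s)"
 proof (rule integral_dominated_convergence[where w="\<lambda>s. C * (indicator {0..} s * exp (- \<mu>\<^sup>2 * s))"])
  show "integrable lborel (\<lambda>s. C * (indicator {0..} s * exp (- \<mu>\<^sup>2 * s)))" by (intro integrable_mult_right i)
  show "AE s in lborel. (\<lambda>n. indicator {0..real n} s *\<^sub>R ?g s) \<longlonglongrightarrow> indicator {0..} s * ?g s"
  proof (intro always_eventually allI)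
   fix s :: real
   obtain N where "s \<le> real N" using real_arch_simple by blast
   then have "eventually (\<lambda>n. indicator {0..real n} s *\<^sub>R ?g s = indicator {0..} s * ?g s) sequentially"
    by (intro eventually_sequentiallyI[of N]) (auto split: split_indicator)
   then show "(\<lambda>n. indicator {0..real n} s *\<^sub>R ?g s) \<longlonglongrightarrow> indicator {0..} s * ?g s"
    by (rule tendsto_eventually)
  qed
  show "AE s in lborel. norm (indicator {0..real n} s *\<^sub>R ?g s) \<le> C * (indicator {0..} s * exp (- \<mu>\<^sup>2 * s))" for n
  proof (intro always_eventually allI)
   fix s :: real
   have C0: "C \<ge> 0" using C[of 0] abs_ge_zero order_trans by blast
   have "s \<ge> 0 ==> \<bar>?g s\<bar> \<le> exp (- \<mu>\<^sup>2 * s) * C"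
    unfolding abs_mult by (intro mult_mono C) auto
   then show "norm (indicator {0..real n} s *\<^sub>R ?g s) \<le> C * (indicator {0..} s * exp (- \<mu>\<^sup>2 * s))"
    using C0 by (auto split: split_indicator simp: mult.commute)
  qed
 qed (unfold heat_def lheat_def, measurable)
 have lim2: "(\<lambda>n. ?F (real n) - ?F 0) \<longlonglongrightarrow> 0 - ?F 0"
 proof (intro tendsto_diff tendsto_const)
  have b0: "\<bar>heat (b + real n) z\<bar> \<le> 1 / (4 * pi * b)" for n using b by (intro heat_bound) auto
  have "(\<lambda>n. exp (- \<mu>\<^sup>2 * real n)) \<longlonglongrightarrow> 0"
  proof (rule filterlim_compose[OF exp_at_bot])
   have "filterlim (\<lambda>n. \<mu>\<^sup>2 * real n) at_top sequentially"
    by (rule filterlim_tendsto_pos_mult_at_top[OF tendsto_const]) (use \<mu> in \<open>auto simp: filterlim_real_sequentially\<close>)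
   then show "filterlim (\<lambda>n. - \<mu>\<^sup>2 * real n) at_bot sequentially" by (simp add: filterlim_uminus_at_top)
  qed
  then have "(\<lambda>n. exp (- \<mu>\<^sup>2 * real n) * (1 / (4 * pi * b))) \<longlonglongrightarrow> 0 * (1 / (4 * pi * b))" by (intro tendsto_intros)
  then have l0: "(\<lambda>n. exp (- \<mu>\<^sup>2 * real n) * (1 / (4 * pi * b))) \<longlonglongrightarrow> 0" by simp
  show "(\<lambda>n. ?F (real n)) \<longlonglongrightarrow> 0"
  proof (rule Lim_null_comparison[OF _ l0], intro always_eventually allI)
   fix n
   have "norm (?F (real n)) = exp (- \<mu>\<^sup>2 * real n) * \<bar>heat (b + real n) z\<bar>" by (simp add: abs_mult)
   also have "... \<le> exp (- \<mu>\<^sup>2 * real n) * (1 / (4 * pi * b))" by (intro mult_left_mono b0) auto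
   finally show "norm (?F (real n)) \<le> exp (- \<mu>\<^sup>2 * real n) * (1 / (4 * pi * b))" .
  qed
 qed
 have "(LINT s|exp_time \<mu>. \<mu>\<^sup>2 * heat (b + \<bar>s\<bar>) z - lheat (b + \<bar>s\<bar>) z) =
  (LINT s|lborel. (indicator {0..} s * exp (- \<mu>\<^sup>2 * s)) * (\<mu>\<^sup>2 * heat (b + \<bar>s\<bar>) z - lheat (b + \<bar>s\<bar>) z))"
  by (rule integral_exp_time) measurable
 also have "... = (LINT s|lborel. indicator {0..} s * ?g s)"
  by (intro Bochner_Integration.integral_cong) (auto split: split_indicator)
 also have "... = 0 - ?F 0" using LIMSEQ_unique[OF lim1] lim2 unfolding fin by blast
 finally show ?thesis by simp
qed

lemma discriminant_le:
 fixes S T Q :: real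
 assumes "\<And>\<tau>. 0 \<le> S - 2 * \<tau> * T + \<tau>\<^sup>2 * Q" "0 \<le> Q"
 shows "T\<^sup>2 \<le> S * Q"
proof (cases "Q = 0")
 case True
 have "T = 0"
 proof (rule ccontr)
  assume "T \<noteq> 0"
  then show False using assms(1)[of "(S + 1) / (2 * T)"] True by simp
 qed
 then show ?thesis using True by simp
next
 case False
 then have "Q > 0" using assms(2) by simp
 then show ?thesis using assms(1)[of "T / Q"] by (simp add: field_simps power2_eq_square)
qed

lemma L2_product_integrable:
 fixes h k :: "'a \<Rightarrow> real"
 assumes [measurable]: "h \<in> borel_measurable M" "k \<in> borel_measurable M"
  and "(\<integral>\<^sup>+y. ennreal ((h y)\<^sup>2) \<partial>M) < \<infinity>" "(\<integral>\<^sup>+y. ennreal ((k y)\<^sup>2) \<partial>M) < \<infinity>"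
 shows "integrable M (\<lambda>y. h y * k y)"
proof (rule integrableI_bounded)
 have "(\<integral>\<^sup>+y. ennreal \<bar>h y * k y\<bar> \<partial>M) \<le> (\<integral>\<^sup>+y. ennreal ((h y)\<^sup>2) \<partial>M) + (\<integral>\<^sup>+y. ennreal ((k y)\<^sup>2) \<partial>M)"
  by (rule nn_integral_product_le) measurable
 also have "... < \<infinity>" using assms by simp
 finally show "(\<integral>\<^sup>+y. ennreal (norm (h y * k y)) \<partial>M) < \<infinity>" by simp
qed measurable

lemma L2_sq_integrable:
 fixes h :: "'a \<Rightarrow> real"
 assumes "h \<in> borel_measurable M" "(\<integral>\<^sup>+y. ennreal ((h y)\<^sup>2) \<partial>M) < \<infinity>"
 shows "integrable M (\<lambda>y. (h y)\<^sup>2)"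
 using L2_product_integrable[OF assms(1,1,2,2)] by (simp add: power2_eq_square)

text \<open>Duality for the energy form. The resolvent writes \<open>heat a (y - x)\<close> as an
  average over later times of (\<mu>^2 - \<Delta>) applied to heat kernels, and the weak gradient
  turns the pairing with \<open>f\<close> into the energy inner product with a potential of
  components \<open>\<Psi>0\<close> and \<open>\<Psi> j\<close>. Cauchy-Schwarz leaves the energy of
  the potential; there the resolvent identity applies a second time and collapses one of the two
  time integrals. A general \<rho> serves both a point mass and a level set.\<close>

lemma energy_pairing:
 fixes f :: "real^2 \<Rightarrow> real" and G :: "2 \<Rightarrow> real^2 \<Rightarrow> real" and \<rho> :: "(real^2) measure"
 assumes f [measurable]: "f \<in> borel_measurable borel" and f2: "(\<integral>\<^sup>+y. ennreal ((f y)\<^sup>2) \<partial>lborel) < \<infinity>"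
  and G [measurable]: "\<And>j. G j \<in> borel_measurable borel" and G2: "\<And>j. (\<integral>\<^sup>+y. ennreal ((G j y)\<^sup>2) \<partial>lborel) < \<infinity>"
  and weak: "\<And>b x. b > 0 ==> (\<Sum>j\<in>UNIV. LINT y|lborel. G j y * dheat j b (y - x)) = - (LINT y|lborel. f y * lheat b (y - x))"
  and fin: "finite_measure \<rho>" and sets [measurable_cong]: "sets \<rho> = sets borel" and \<mu>: "\<mu> > 0" and a: "a > 0"
 shows "(LINT x|\<rho>. LINT y|lborel. f y * heat a (y - x))\<^sup>2 \<le>
  (\<mu>\<^sup>2 * (LINT y|lborel. (f y)\<^sup>2) + (\<Sum>j\<in>UNIV. LINT y|lborel. (G j y)\<^sup>2)) *
  (LINT x|\<rho>. LINT s|exp_time \<mu>. LINT x'|\<rho>. heat (2 * a + \<bar>s\<bar>) (x - x'))"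
proof -
 interpret T: finite_measure "exp_time \<mu>" by (rule finite_exp_time[OF \<mu>])
 interpret R: finite_measure \<rho> by (rule fin)
 define \<nu> where "\<nu> = \<rho> \<Otimes>\<^sub>M exp_time \<mu>"
 have fin\<nu>: "finite_measure \<nu>" unfolding \<nu>_def by (intro finite_measure_pair_measure fin T.finite_measure_axioms)
 have sets\<nu> [measurable_cong]: "sets \<nu> = sets (borel \<Otimes>\<^sub>M borel)"
  unfolding \<nu>_def by (intro sets_pair_measure_cong sets exp_time_sets)
 have bb: "a \<le> a + \<bar>s\<bar>" for s by simp
 \<comment> \<open>Kernels indexed by a point and a time: the component of order zero, the first
   derivatives, and the full resolvent integrand.\<close>
 let ?k0 = "\<lambda>w y. \<mu> * heat (a + \<bar>snd w\<bar>) (y - fst w)"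
 let ?kj = "\<lambda>j w y. dheat j (a + \<bar>snd w\<bar>) (y - fst w)"
 let ?kl = "\<lambda>w y. \<mu>\<^sup>2 * heat (a + \<bar>snd w\<bar>) (y - fst w) - lheat (a + \<bar>snd w\<bar>) (y - fst w)"
 have hs: "(\<integral>\<^sup>+y. ennreal ((heat (a + \<bar>s\<bar>) (y - x))\<^sup>2) \<partial>lborel) < \<infinity>" for s x
  using heat_sq_le[OF a bb] by (rule le_less_trans) simp
 have ls: "(\<integral>\<^sup>+y. ennreal ((lheat (a + \<bar>s\<bar>) (y - x))\<^sup>2) \<partial>lborel) < \<infinity>" for s x
  using lheat_sq_le[OF a bb] by (rule le_less_trans) simp
 have ds: "(\<integral>\<^sup>+y. ennreal ((dheat j (a + \<bar>s\<bar>) (y - x))\<^sup>2) \<partial>lborel) < \<infinity>" for s x j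
  using dheat_sq_le[OF a bb] by (rule le_less_trans) simp
 have F0: "L2_family \<nu> ?k0 (ennreal (\<mu>\<^sup>2) * ennreal (1 / (8 * pi * a)))"
 proof (intro L2_family.intro L2_family_axioms.intro fin\<nu>)
  show "AE w in \<nu>. (\<integral>\<^sup>+y. ennreal ((?k0 w y)\<^sup>2) \<partial>lborel) \<le> ennreal (\<mu>\<^sup>2) * ennreal (1 / (8 * pi * a))"
  proof (intro always_eventually allI)
   fix w
   have "(\<integral>\<^sup>+y. ennreal ((?k0 w y)\<^sup>2) \<partial>lborel) = ennreal (\<mu>\<^sup>2) * (\<integral>\<^sup>+y. ennreal ((heat (a + \<bar>snd w\<bar>) (y - fst w))\<^sup>2) \<partial>lborel)"
    by (subst nn_integral_cmult[symmetric]) (auto simp: power_mult_distrib ennreal_mult)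
   then show "(\<integral>\<^sup>+y. ennreal ((?k0 w y)\<^sup>2) \<partial>lborel) \<le> ennreal (\<mu>\<^sup>2) * ennreal (1 / (8 * pi * a))"
    using heat_sq_le[OF a bb] by (simp only: mult_left_mono zero_le)
  qed
  show "case_prod ?k0 \<in> borel_measurable (\<nu> \<Otimes>\<^sub>M borel)" by measurable
  show "ennreal (\<mu>\<^sup>2) * ennreal (1 / (8 * pi * a)) < \<infinity>" by (simp add: ennreal_mult_less_top)
 qed
 have Fj: "L2_family \<nu> (?kj j) (ennreal (1 / (16 * pi * a\<^sup>2)))" for j
 proof (intro L2_family.intro L2_family_axioms.intro fin\<nu>)
  show "AE w in \<nu>. (\<integral>\<^sup>+y. ennreal ((?kj j w y)\<^sup>2) \<partial>lborel) \<le> ennreal (1 / (16 * pi * a\<^sup>2))"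
   by (intro always_eventually allI dheat_sq_le[OF a bb])
  show "case_prod (?kj j) \<in> borel_measurable (\<nu> \<Otimes>\<^sub>M borel)" by measurable
  show "ennreal (1 / (16 * pi * a\<^sup>2)) < \<infinity>" by simp
 qed
 define Bl where "Bl = ennreal (2 * (\<mu>\<^sup>2)\<^sup>2) * ennreal (1 / (8 * pi * a)) + ennreal 2 * ennreal ((6 / a)\<^sup>2 * (1 / (8 * pi * (2 * a))))"
 have Fl: "L2_family \<nu> ?kl Bl"
 proof (intro L2_family.intro L2_family_axioms.intro fin\<nu>)
  show "AE w in \<nu>. (\<integral>\<^sup>+y. ennreal ((?kl w y)\<^sup>2) \<partial>lborel) \<le> Bl"
  proof (intro always_eventually allI)
   fix w
   have "(\<integral>\<^sup>+y. ennreal ((?kl w y)\<^sup>2) \<partial>lborel) \<le>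
    (\<integral>\<^sup>+y. ennreal (2 * (\<mu>\<^sup>2)\<^sup>2) * ennreal ((heat (a + \<bar>snd w\<bar>) (y - fst w))\<^sup>2) + ennreal 2 * ennreal ((lheat (a + \<bar>snd w\<bar>) (y - fst w))\<^sup>2) \<partial>lborel)"
   proof (intro nn_integral_mono)
    fix y
    have "(p - q)\<^sup>2 \<le> 2 * p\<^sup>2 + 2 * q\<^sup>2" for p q :: real
     using zero_le_power2[of "p + q"] by (simp add: power2_eq_square algebra_simps)
    from this[of "\<mu>\<^sup>2 * heat (a + \<bar>snd w\<bar>) (y - fst w)" "lheat (a + \<bar>snd w\<bar>) (y - fst w)"]
    have "(?kl w y)\<^sup>2 \<le> 2 * (\<mu>\<^sup>2)\<^sup>2 * (heat (a + \<bar>snd w\<bar>) (y - fst w))\<^sup>2 + 2 * (lheat (a + \<bar>snd w\<bar>) (y - fst w))\<^sup>2"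
     by (simp add: power_mult_distrib)
    then have "ennreal ((?kl w y)\<^sup>2) \<le> ennreal (2 * (\<mu>\<^sup>2)\<^sup>2 * (heat (a + \<bar>snd w\<bar>) (y - fst w))\<^sup>2 + 2 * (lheat (a + \<bar>snd w\<bar>) (y - fst w))\<^sup>2)"
     by (rule ennreal_leI)
    also have "... = ennreal (2 * (\<mu>\<^sup>2)\<^sup>2) * ennreal ((heat (a + \<bar>snd w\<bar>) (y - fst w))\<^sup>2) + ennreal 2 * ennreal ((lheat (a + \<bar>snd w\<bar>) (y - fst w))\<^sup>2)"
     by (subst ennreal_plus, simp, simp, subst ennreal_mult, simp, simp, subst ennreal_mult) auto
    finally show "ennreal ((?kl w y)\<^sup>2) \<le> ennreal (2 * (\<mu>\<^sup>2)\<^sup>2) * ennreal ((heat (a + \<bar>snd w\<bar>) (y - fst w))\<^sup>2) + ennreal 2 * ennreal ((lheat (a + \<bar>snd w\<bar>) (y - fst w))\<^sup>2)" .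
   qed
   also have "... = ennreal (2 * (\<mu>\<^sup>2)\<^sup>2) * (\<integral>\<^sup>+y. ennreal ((heat (a + \<bar>snd w\<bar>) (y - fst w))\<^sup>2) \<partial>lborel) + ennreal 2 * (\<integral>\<^sup>+y. ennreal ((lheat (a + \<bar>snd w\<bar>) (y - fst w))\<^sup>2) \<partial>lborel)"
    by (subst nn_integral_add) (auto simp: nn_integral_cmult)
   also have "... \<le> Bl" unfolding Bl_def
    by (intro add_mono mult_left_mono heat_sq_le[OF a bb] lheat_sq_le[OF a bb]) auto
   finally show "(\<integral>\<^sup>+y. ennreal ((?kl w y)\<^sup>2) \<partial>lborel) \<le> Bl" .
  qed
  show "case_prod ?kl \<in> borel_measurable (\<nu> \<Otimes>\<^sub>M borel)" by measurable
  show "Bl < \<infinity>" by (simp add: Bl_def ennreal_mult_less_top)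
 qed
 have F\<rho>: "L2_family \<rho> (\<lambda>x y. heat a (y - x)) (ennreal (1 / (8 * pi * a)))"
 proof (intro L2_family.intro L2_family_axioms.intro fin)
  show "AE x in \<rho>. (\<integral>\<^sup>+y. ennreal ((heat a (y - x))\<^sup>2) \<partial>lborel) \<le> ennreal (1 / (8 * pi * a))"
   by (intro always_eventually allI heat_sq_le[OF a order_refl])
  show "case_prod (\<lambda>x y. heat a (y - x)) \<in> borel_measurable (\<rho> \<Otimes>\<^sub>M borel)" by measurable
  show "ennreal (1 / (8 * pi * a)) < \<infinity>" by simp
 qed
 define \<Psi>0 where "\<Psi>0 = L2_family.mix \<nu> ?k0"
 define \<Psi> where "\<Psi> j = L2_family.mix \<nu> (?kj j)" for j
 have \<Psi>0m [measurable]: "\<Psi>0 \<in> borel_measurable borel" unfolding \<Psi>0_def by (rule L2_family.mix_meas[OF F0])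
 have \<Psi>m [measurable]: "\<Psi> j \<in> borel_measurable borel" for j unfolding \<Psi>_def by (rule L2_family.mix_meas[OF Fj])
 have \<Psi>02: "(\<integral>\<^sup>+y. ennreal ((\<Psi>0 y)\<^sup>2) \<partial>lborel) < \<infinity>" unfolding \<Psi>0_def by (rule L2_family.mix_L2[OF F0])
 have \<Psi>2: "(\<integral>\<^sup>+y. ennreal ((\<Psi> j y)\<^sup>2) \<partial>lborel) < \<infinity>" for j unfolding \<Psi>_def by (rule L2_family.mix_L2[OF Fj])
 define C where "C = \<mu>\<^sup>2 * (1 / (4 * pi * a)) + 1 / a\<^sup>2"
 have Cb: "\<bar>\<mu>\<^sup>2 * heat b z - lheat b z\<bar> \<le> C" if "a \<le> b" for b z
 proof -
  have "\<bar>\<mu>\<^sup>2 * heat b z - lheat b z\<bar> \<le> \<bar>\<mu>\<^sup>2 * heat b z\<bar> + \<bar>lheat b z\<bar>" by (rule abs_triangle_ineq4)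
  also have "... \<le> C" unfolding C_def abs_mult using that a
   by (intro add_mono lheat_bound mult_mono heat_bound) auto
  finally show ?thesis .
 qed
 \<comment> \<open>Averaged in time, the resolvent integrand collapses to the heat kernel at time
   \<open>a\<close>.\<close>
 have mixl: "L2_family.mix \<nu> ?kl y = L2_family.mix \<rho> (\<lambda>x y. heat a (y - x)) y" for y
 proof -
  have "L2_family.mix \<nu> ?kl y = (LINT w|\<nu>. ?kl w y)" by (rule L2_family.mix_def[OF Fl])
  also have "... = (LINT x|\<rho>. LINT s|exp_time \<mu>. \<mu>\<^sup>2 * heat (a + \<bar>s\<bar>) (y - x) - lheat (a + \<bar>s\<bar>) (y - x))"
   unfolding \<nu>_def
  proof (rule bounded_pair_integral(1)[OF fin T.finite_measure_axioms])
   show "(\<lambda>(x, s). \<mu>\<^sup>2 * heat (a + \<bar>s\<bar>) (y - x) - lheat (a + \<bar>s\<bar>) (y - x)) \<in> borel_measurable (\<rho> \<Otimes>\<^sub>M exp_time \<mu>)"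
    by measurable
   show "\<bar>\<mu>\<^sup>2 * heat (a + \<bar>s\<bar>) (y - x) - lheat (a + \<bar>s\<bar>) (y - x)\<bar> \<le> C" for x s by (rule Cb) simp
  qed
  also have "... = (LINT x|\<rho>. heat a (y - x))" by (simp only: resolvent_heat[OF \<mu> a])
  finally show ?thesis by (simp add: L2_family.mix_def[OF F\<rho>])
 qed
 define T0 where "T0 = (LINT x|\<rho>. LINT y|lborel. f y * heat a (y - x))"
 have split: "(LINT y|lborel. f y * ?kl w y) = \<mu> * (LINT y|lborel. f y * ?k0 w y) + (\<Sum>j\<in>UNIV. LINT y|lborel. G j y * ?kj j w y)" for w
 proof -
  have i1: "integrable lborel (\<lambda>y. f y * heat (a + \<bar>snd w\<bar>) (y - fst w))"
   by (rule L2_product_integrable[OF _ _ f2 hs]) measurable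
  have i2: "integrable lborel (\<lambda>y. f y * lheat (a + \<bar>snd w\<bar>) (y - fst w))"
   by (rule L2_product_integrable[OF _ _ f2 ls]) measurable
  have "(LINT y|lborel. f y * ?kl w y) = (LINT y|lborel. \<mu>\<^sup>2 * (f y * heat (a + \<bar>snd w\<bar>) (y - fst w)) - f y * lheat (a + \<bar>snd w\<bar>) (y - fst w))"
   by (simp add: algebra_simps)
  also have "... = \<mu>\<^sup>2 * (LINT y|lborel. f y * heat (a + \<bar>snd w\<bar>) (y - fst w)) - (LINT y|lborel. f y * lheat (a + \<bar>snd w\<bar>) (y - fst w))"
   using i1 i2 by (subst Bochner_Integration.integral_diff) auto
  also have "(LINT y|lborel. f y * ?k0 w y) = \<mu> * (LINT y|lborel. f y * heat (a + \<bar>snd w\<bar>) (y - fst w))"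
   by (subst integral_mult_right_zero[symmetric]) (simp add: mult_ac)
  ultimately show ?thesis
   using weak[of "a + \<bar>snd w\<bar>" "fst w"] a by (simp add: power2_eq_square add_pos_nonneg)
 qed
 have T0: "T0 = (LINT y|lborel. (\<mu> * f y) * \<Psi>0 y) + (\<Sum>j\<in>UNIV. LINT y|lborel. G j y * \<Psi> j y)"
 proof -
  have "T0 = (LINT y|lborel. f y * L2_family.mix \<rho> (\<lambda>x y. heat a (y - x)) y)"
   unfolding T0_def by (rule L2_family.pairing_eq[OF F\<rho> f f2])
  also have "... = (LINT w|\<nu>. LINT y|lborel. f y * ?kl w y)"
   unfolding mixl[symmetric] by (rule L2_family.pairing_eq[OF Fl f f2, symmetric])
  also have "... = \<mu> * (LINT w|\<nu>. LINT y|lborel. f y * ?k0 w y) + (\<Sum>j\<in>UNIV. LINT w|\<nu>. LINT y|lborel. G j y * ?kj j w y)"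
   unfolding split
   using L2_family.pairing_integrable'[OF F0 f f2] L2_family.pairing_integrable'[OF Fj G G2]
   by (subst Bochner_Integration.integral_add; (subst Bochner_Integration.integral_sum)?) auto
  also have "(LINT w|\<nu>. LINT y|lborel. f y * ?k0 w y) = (LINT y|lborel. f y * \<Psi>0 y)"
   unfolding \<Psi>0_def by (rule L2_family.pairing_eq[OF F0 f f2])
  also have "(\<lambda>j. LINT w|\<nu>. LINT y|lborel. G j y * ?kj j w y) = (\<lambda>j. LINT y|lborel. G j y * \<Psi> j y)"
   unfolding \<Psi>_def using L2_family.pairing_eq[OF Fj G G2] by blast
  finally show ?thesis by (simp add: mult.assoc)
 qed
 \<comment> \<open>The squared energy norm of the potential. Its Gram kernel is again a resolvent
   integrand, now starting from the time \<open>2 * a + \<bar>s\<bar>\<close>.\<close>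
 define Q where "Q = (LINT y|lborel. (\<Psi>0 y)\<^sup>2) + (\<Sum>j\<in>UNIV. LINT y|lborel. (\<Psi> j y)\<^sup>2)"
 have Q0: "Q \<ge> 0" unfolding Q_def by (intro add_nonneg_nonneg sum_nonneg integral_nonneg_AE) auto
 let ?q = "\<lambda>x s. LINT x'|\<rho>. heat (2 * a + \<bar>s\<bar>) (x - x')"
 have Q: "Q = (LINT x|\<rho>. LINT s|exp_time \<mu>. ?q x s)"
 proof -
  let ?g0 = "\<lambda>w w'. LINT y|lborel. ?k0 w y * ?k0 w' y" and ?gj = "\<lambda>j w w'. LINT y|lborel. ?kj j w y * ?kj j w' y"
  have e0: "(LINT y|lborel. (\<Psi>0 y)\<^sup>2) = (LINT w|\<nu>. LINT w'|\<nu>. ?g0 w w')"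
   unfolding \<Psi>0_def by (rule L2_family.mix_gram[OF F0])
  have ej: "(LINT y|lborel. (\<Psi> j y)\<^sup>2) = (LINT w|\<nu>. LINT w'|\<nu>. ?gj j w w')" for j
   unfolding \<Psi>_def by (rule L2_family.mix_gram[OF Fj])
  have k0m: "?k0 w \<in> borel_measurable borel" and kjm: "?kj j w \<in> borel_measurable borel" for w j by measurable
  have k02: "(\<integral>\<^sup>+y. ennreal ((?k0 w y)\<^sup>2) \<partial>lborel) < \<infinity>" for w
  proof -
   have "(\<integral>\<^sup>+y. ennreal ((?k0 w y)\<^sup>2) \<partial>lborel) = ennreal (\<mu>\<^sup>2) * (\<integral>\<^sup>+y. ennreal ((heat (a + \<bar>snd w\<bar>) (y - fst w))\<^sup>2) \<partial>lborel)"
    by (subst nn_integral_cmult[symmetric]) (auto simp: power_mult_distrib ennreal_mult)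
   then show ?thesis using hs by (simp add: ennreal_mult_less_top)
  qed
  have kj2: "(\<integral>\<^sup>+y. ennreal ((?kj j w y)\<^sup>2) \<partial>lborel) < \<infinity>" for j w by (rule ds)
  have "Q = (LINT w|\<nu>. (LINT w'|\<nu>. ?g0 w w') + (\<Sum>j\<in>UNIV. LINT w'|\<nu>. ?gj j w w'))"
   unfolding Q_def e0 ej
   using L2_family.mix_gram_integrable[OF F0] L2_family.mix_gram_integrable[OF Fj]
   by (subst Bochner_Integration.integral_add; (subst Bochner_Integration.integral_sum)?) auto
  also have "... = (LINT w|\<nu>. ?q (fst w) (snd w))"
  proof (intro Bochner_Integration.integral_cong refl)
   fix w :: "(real^2) \<times> real"
   define x s where "x = fst w" and "s = snd w"
   have g: "?g0 w w' + (\<Sum>j\<in>UNIV. ?gj j w w') = \<mu>\<^sup>2 * heat ((2 * a + \<bar>s\<bar>) + \<bar>snd w'\<bar>) (x - fst w') - lheat ((2 * a + \<bar>s\<bar>) + \<bar>snd w'\<bar>) (x - fst w')" for w'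
   proof -
    have p: "a + \<bar>s\<bar> > 0" "a + \<bar>snd w'\<bar> > 0" using a by auto
    have s: "a + \<bar>s\<bar> + (a + \<bar>snd w'\<bar>) = (2 * a + \<bar>s\<bar>) + \<bar>snd w'\<bar>" by simp
    have "?g0 w w' = (LINT y|lborel. \<mu>\<^sup>2 * (heat (a + \<bar>s\<bar>) (y - x) * heat (a + \<bar>snd w'\<bar>) (y - fst w')))"
     by (simp add: x_def s_def power2_eq_square mult_ac)
    also have "... = \<mu>\<^sup>2 * heat ((2 * a + \<bar>s\<bar>) + \<bar>snd w'\<bar>) (x - fst w')"
     unfolding integral_mult_right_zero integral_heat_heat[OF p] s ..
    finally have 1: "?g0 w w' = \<mu>\<^sup>2 * heat ((2 * a + \<bar>s\<bar>) + \<bar>snd w'\<bar>) (x - fst w')" .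
    have "(\<Sum>j\<in>UNIV. ?gj j w w') = (LINT y|lborel. (\<Sum>j\<in>UNIV. ?kj j w y * ?kj j w' y))"
    proof (rule Bochner_Integration.integral_sum[symmetric])
     show "integrable lborel (\<lambda>y. ?kj j w y * ?kj j w' y)" for j
      by (rule L2_product_integrable[OF _ _ kj2 kj2]) measurable
    qed
    also have "... = - lheat ((2 * a + \<bar>s\<bar>) + \<bar>snd w'\<bar>) (x - fst w')"
     using dheat_gram(2)[OF p, of x "fst w'"] unfolding s by (simp add: x_def s_def)
    finally show ?thesis using 1 by simp
   qed
   have "(LINT w'|\<nu>. ?g0 w w') + (\<Sum>j\<in>UNIV. LINT w'|\<nu>. ?gj j w w') = (LINT w'|\<nu>. ?g0 w w' + (\<Sum>j\<in>UNIV. ?gj j w w'))"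
    using L2_family.pairing_integrable'[OF F0 k0m k02] L2_family.pairing_integrable'[OF Fj kjm kj2]
    by (subst Bochner_Integration.integral_add; (subst Bochner_Integration.integral_sum)?) auto
   also have "... = (LINT w'|\<nu>. \<mu>\<^sup>2 * heat ((2 * a + \<bar>s\<bar>) + \<bar>snd w'\<bar>) (x - fst w') - lheat ((2 * a + \<bar>s\<bar>) + \<bar>snd w'\<bar>) (x - fst w'))"
    unfolding g ..
   also have "... = (LINT x'|\<rho>. LINT s'|exp_time \<mu>. \<mu>\<^sup>2 * heat ((2 * a + \<bar>s\<bar>) + \<bar>s'\<bar>) (x - x') - lheat ((2 * a + \<bar>s\<bar>) + \<bar>s'\<bar>) (x - x'))"
    unfolding \<nu>_def
   proof (rule bounded_pair_integral(1)[OF fin T.finite_measure_axioms])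
    show "(\<lambda>(x', s'). \<mu>\<^sup>2 * heat ((2 * a + \<bar>s\<bar>) + \<bar>s'\<bar>) (x - x') - lheat ((2 * a + \<bar>s\<bar>) + \<bar>s'\<bar>) (x - x')) \<in> borel_measurable (\<rho> \<Otimes>\<^sub>M exp_time \<mu>)"
     by measurable
    show "\<bar>\<mu>\<^sup>2 * heat ((2 * a + \<bar>s\<bar>) + \<bar>s'\<bar>) (x - x') - lheat ((2 * a + \<bar>s\<bar>) + \<bar>s'\<bar>) (x - x')\<bar> \<le> C" for x' s' by (rule Cb) (use a in simp)
   qed
   also have "... = ?q x s" using a by (simp only: resolvent_heat[OF \<mu>, of "2 * a + \<bar>s\<bar>"] add_pos_nonneg abs_ge_zero mult_pos_pos zero_less_numeral)
   finally show "(LINT w'|\<nu>. ?g0 w w') + (\<Sum>j\<in>UNIV. LINT w'|\<nu>. ?gj j w w') = ?q (fst w) (snd w)"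
    by (simp add: x_def s_def)
  qed
  also have "... = (LINT x|\<rho>. LINT s|exp_time \<mu>. ?q x s)"
   unfolding \<nu>_def
  proof (rule bounded_pair_integral(1)[OF fin T.finite_measure_axioms])
   show "case_prod ?q \<in> borel_measurable (\<rho> \<Otimes>\<^sub>M exp_time \<mu>)" by measurable
   show "\<bar>?q x s\<bar> \<le> measure \<rho> (space \<rho>) * (1 / (4 * pi * a))" for x s
   proof -
    have h: "\<bar>heat (2 * a + \<bar>s\<bar>) (x - x')\<bar> \<le> 1 / (4 * pi * a)" for x' using a by (intro heat_bound) auto
    have "\<bar>?q x s\<bar> \<le> (LINT x'|\<rho>. norm (heat (2 * a + \<bar>s\<bar>) (x - x')))" using integral_norm_bound[of \<rho>] by simp
    also have "... \<le> (LINT x'|\<rho>. 1 / (4 * pi * a))"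
     using h a by (intro integral_mono R.integrable_const_bound[where B="1 / (4 * pi * a)"]) auto
    finally show ?thesis by simp
   qed
  qed
  finally show ?thesis .
 qed
 define S where "S = \<mu>\<^sup>2 * (LINT y|lborel. (f y)\<^sup>2) + (\<Sum>j\<in>UNIV. LINT y|lborel. (G j y)\<^sup>2)"
 have expand: "0 \<le> (LINT y|lborel. (u y)\<^sup>2) - 2 * \<tau> * (LINT y|lborel. u y * v y) + \<tau>\<^sup>2 * (LINT y|lborel. (v y)\<^sup>2)"
  if [measurable]: "u \<in> borel_measurable borel" "v \<in> borel_measurable borel"
   and u2: "(\<integral>\<^sup>+y. ennreal ((u y)\<^sup>2) \<partial>lborel) < \<infinity>" and v2: "(\<integral>\<^sup>+y. ennreal ((v y)\<^sup>2) \<partial>lborel) < \<infinity>" for u v :: "real^2 \<Rightarrow> real" and \<tau>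
 proof -
  have i: "integrable lborel (\<lambda>y. (u y)\<^sup>2)" "integrable lborel (\<lambda>y. u y * v y)" "integrable lborel (\<lambda>y. (v y)\<^sup>2)"
   by (auto intro!: L2_sq_integrable L2_product_integrable u2 v2)
  have "0 \<le> (LINT y|lborel. (u y - \<tau> * v y)\<^sup>2)" by simp
  also have "... = (LINT y|lborel. (u y)\<^sup>2 - 2 * \<tau> * (u y * v y) + \<tau>\<^sup>2 * (v y)\<^sup>2)"
   by (simp add: power2_eq_square algebra_simps)
  also have "... = (LINT y|lborel. (u y)\<^sup>2) - 2 * \<tau> * (LINT y|lborel. u y * v y) + \<tau>\<^sup>2 * (LINT y|lborel. (v y)\<^sup>2)"
   using i by simp
  finally show ?thesis .
 qed
 \<comment> \<open>Cauchy-Schwarz for the sum of the three L^2 pairings at once, through the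
   discriminant of a nonnegative quadratic in \<tau>.\<close>
 have "T0\<^sup>2 \<le> S * Q"
 proof (rule discriminant_le[OF _ Q0])
  fix \<tau> :: real
  have mf2: "(\<integral>\<^sup>+y. ennreal ((\<mu> * f y)\<^sup>2) \<partial>lborel) < \<infinity>"
   using f2 by (simp add: power_mult_distrib ennreal_mult nn_integral_cmult ennreal_mult_less_top)
  have "0 \<le> ((LINT y|lborel. (\<mu> * f y)\<^sup>2) - 2 * \<tau> * (LINT y|lborel. (\<mu> * f y) * \<Psi>0 y) + \<tau>\<^sup>2 * (LINT y|lborel. (\<Psi>0 y)\<^sup>2)) +
   (\<Sum>j\<in>UNIV. (LINT y|lborel. (G j y)\<^sup>2) - 2 * \<tau> * (LINT y|lborel. G j y * \<Psi> j y) + \<tau>\<^sup>2 * (LINT y|lborel. (\<Psi> j y)\<^sup>2))"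
   by (intro add_nonneg_nonneg sum_nonneg expand mf2 \<Psi>02 \<Psi>2 G2) measurable
  also have "... = S - 2 * \<tau> * T0 + \<tau>\<^sup>2 * Q"
   unfolding S_def T0 Q_def power_mult_distrib integral_mult_right_zero
   by (simp add: sum.distrib sum_subtractf sum_distrib_left algebra_simps)
  finally show "0 \<le> S - 2 * \<tau> * T0 + \<tau>\<^sup>2 * Q" .
 qed
 then show ?thesis unfolding T0_def S_def Q .
qed

text \<open>A non-integrable function has integral 0, so that case is covered by
  \<open>0 \<le> c\<close>.\<close>

lemma integral_le_of_nn:
 assumes "\<And>x. f x \<ge> 0" "(\<integral>\<^sup>+x. ennreal (f x) \<partial>M) \<le> ennreal c" "c \<ge> 0"
 shows "(LINT x|M. f x) \<le> c"
proof (cases "integrable M f")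
 case True
 then have "ennreal (LINT x|M. f x) \<le> ennreal c"
  using assms by (simp add: nn_integral_eq_integral)
 then show ?thesis using assms by simp
next
 case False then show ?thesis using assms by (simp add: not_integrable_integral_eq)
qed

lemma integral_exp_time_le:
 assumes [measurable]: "\<kappa> \<in> borel_measurable borel" and k: "\<And>s. \<kappa> s \<ge> 0"
  and le: "(\<integral>\<^sup>+s. ennreal (indicator {0..} s * exp (- \<mu>\<^sup>2 * s) * \<kappa> s) \<partial>lborel) \<le> ennreal c" "c \<ge> 0"
 shows "(LINT s|exp_time \<mu>. \<kappa> s) \<le> c"
 unfolding integral_exp_time[OF assms(1)] using le k by (intro integral_le_of_nn) auto

text \<open>The half line is cut at \<delta> and at 1: below \<delta> the minimum is at most 1, the
  middle range contributes the logarithm, and beyond 1 the exponential weight is integrable.\<close>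

lemma nn_integral_truncated_inverse:
 assumes \<mu>: "\<mu> > 0" and \<delta>: "\<delta> > 0"
 shows "(\<integral>\<^sup>+s. ennreal (indicator {0..} s * exp (- \<mu>\<^sup>2 * s) * min 1 (\<delta> / s)) \<partial>lborel) \<le> ennreal (\<delta> * (1 + max 0 (ln (1 / \<delta>)) + 1 / \<mu>\<^sup>2))"
proof -
 have I: "(\<integral>\<^sup>+s. ennreal (1 / s) * indicator {\<delta>..1} s \<partial>lborel) \<le> ennreal (max 0 (ln (1 / \<delta>)))"
 proof (cases "\<delta> \<le> 1")
  case True then show ?thesis using nn_integral_inverse[OF \<delta>, of 1] by (simp add: ennreal_leI)
 qed simp
 have "(\<integral>\<^sup>+s. ennreal (indicator {0..} s * exp (- \<mu>\<^sup>2 * s) * min 1 (\<delta> / s)) \<partial>lborel) \<le>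
  (\<integral>\<^sup>+s. indicator {0..\<delta>} s + (ennreal \<delta> * (ennreal (1 / s) * indicator {\<delta>..1} s) + ennreal \<delta> * ennreal (indicator {0..} s * exp (- \<mu>\<^sup>2 * s))) \<partial>lborel)"
 proof (intro nn_integral_mono)
  fix s :: real
  have e: "s \<ge> 0 ==> exp (- \<mu>\<^sup>2 * s) \<le> 1" by simp
  consider "s < 0" | "0 \<le> s" "s \<le> \<delta>" | "\<delta> < s" "s \<le> 1" | "\<delta> < s" "1 < s" by linarith
  then show "ennreal (indicator {0..} s * exp (- \<mu>\<^sup>2 * s) * min 1 (\<delta> / s)) \<le>
   indicator {0..\<delta>} s + (ennreal \<delta> * (ennreal (1 / s) * indicator {\<delta>..1} s) + ennreal \<delta> * ennreal (indicator {0..} s * exp (- \<mu>\<^sup>2 * s)))"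
  proof cases
   case 1 then show ?thesis by simp
  next
   case 2
   have "indicator {0..} s * exp (- \<mu>\<^sup>2 * s) * min 1 (\<delta> / s) \<le> 1 * 1 * 1"
    using 2 e \<delta> by (intro mult_mono) (auto simp: min_le_iff_disj)
   then have "ennreal (indicator {0..} s * exp (- \<mu>\<^sup>2 * s) * min 1 (\<delta> / s)) \<le> indicator {0..\<delta>} s"
    using 2 by (simp flip: ennreal_1 add: ennreal_leI)
   then show ?thesis by (rule order_trans) (rule add_increasing2, simp_all)
  next
   case 3
   have "indicator {0..} s * exp (- \<mu>\<^sup>2 * s) * min 1 (\<delta> / s) \<le> 1 * 1 * (\<delta> * (1 / s))"
    using 3 e \<delta> by (intro mult_mono) auto
   then have "ennreal (indicator {0..} s * exp (- \<mu>\<^sup>2 * s) * min 1 (\<delta> / s)) \<le> ennreal (\<delta> * (1 / s))"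
    by (intro ennreal_leI) simp
   also have "... = ennreal \<delta> * (ennreal (1 / s) * indicator {\<delta>..1} s)" using 3 \<delta> by (simp add: ennreal_mult'[symmetric])
   finally show ?thesis by (rule order_trans) (rule add_increasing, simp, rule add_increasing2, simp_all)
  next
   case 4
   have "\<delta> / s \<le> \<delta> / 1" using 4 \<delta> by (intro divide_left_mono) auto
   then have "exp (- \<mu>\<^sup>2 * s) * min 1 (\<delta> / s) \<le> exp (- \<mu>\<^sup>2 * s) * \<delta>"
    by (intro mult_left_mono) auto
   then have "ennreal (indicator {0..} s * exp (- \<mu>\<^sup>2 * s) * min 1 (\<delta> / s)) \<le> ennreal (\<delta> * (indicator {0..} s * exp (- \<mu>\<^sup>2 * s)))"
    using 4 \<delta> by (intro ennreal_leI) (simp add: mult.commute)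
   also have "... = ennreal \<delta> * ennreal (indicator {0..} s * exp (- \<mu>\<^sup>2 * s))" using \<delta> by (simp add: ennreal_mult')
   finally show ?thesis by (rule order_trans) (rule add_increasing, simp, rule add_increasing, simp_all)
  qed
 qed
 also have "... = ennreal \<delta> + (ennreal \<delta> * (\<integral>\<^sup>+s. ennreal (1 / s) * indicator {\<delta>..1} s \<partial>lborel) + ennreal \<delta> * ennreal (1 / \<mu>\<^sup>2))"
  using \<delta> nn_integral_exp_halfline[OF \<mu>] by (simp add: nn_integral_add nn_integral_cmult)
 also have "... \<le> ennreal \<delta> + (ennreal \<delta> * ennreal (max 0 (ln (1 / \<delta>))) + ennreal \<delta> * ennreal (1 / \<mu>\<^sup>2))"
  using I by (intro add_mono mult_left_mono) auto
 also have "... = ennreal (\<delta> + (\<delta> * max 0 (ln (1 / \<delta>)) + \<delta> * (1 / \<mu>\<^sup>2)))"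
  using \<delta> by (simp only: ennreal_mult'[symmetric] ennreal_plus[symmetric] less_imp_le max.cobounded1 mult_nonneg_nonneg add_nonneg_nonneg zero_le_divide_1_iff zero_le_power2)
 finally show ?thesis by (simp add: algebra_simps)
qed

text \<open>A function with values in \<open>L\<^sup>2\<close> together with its weak gradient, tested only against Gaussians.\<close>

locale weak_gradient =
 fixes f :: "real^2 \<Rightarrow> real" and G :: "2 \<Rightarrow> real^2 \<Rightarrow> real"
 assumes f [measurable]: "f \<in> borel_measurable borel" and f2: "(\<integral>\<^sup>+y. ennreal ((f y)\<^sup>2) \<partial>lborel) < \<infinity>"
  and G [measurable]: "\<And>j. G j \<in> borel_measurable borel" and G2: "\<And>j. (\<integral>\<^sup>+y. ennreal ((G j y)\<^sup>2) \<partial>lborel) < \<infinity>"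
  and weak: "\<And>b x. b > 0 ==> (\<Sum>j\<in>UNIV. LINT y|lborel. G j y * dheat j b (y - x)) = - (LINT y|lborel. f y * lheat b (y - x))"
begin

text \<open>The parameter \<mu> weights the mass against the gradient. A small \<mu> keeps the
  energy near its gradient part, hence the constant in the exponential near 4\<pi>, at the cost of
  terms \<open>1 / \<mu>\<^sup>2\<close> in the bounds.\<close>

definition energy :: "real \<Rightarrow> real" where
 "energy \<mu> = \<mu>\<^sup>2 * (LINT y|lborel. (f y)\<^sup>2) + (\<Sum>j\<in>UNIV. LINT y|lborel. (G j y)\<^sup>2)"

definition smooth :: "real \<Rightarrow> real^2 \<Rightarrow> real" where
 "smooth a x = (LINT y|lborel. f y * heat a (y - x))"

lemma smooth_meas [measurable]: "smooth a \<in> borel_measurable borel"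
 unfolding smooth_def by measurable

lemma energy_nonneg: "energy \<mu> \<ge> 0"
 unfolding energy_def by (intro add_nonneg_nonneg sum_nonneg mult_nonneg_nonneg integral_nonneg_AE) auto

lemmas smooth_pairing = energy_pairing[OF f f2 G G2 weak, folded energy_def smooth_def]

text \<open>For a point mass the duality leaves the resolvent kernel on the diagonal, an integral of
  \<open>1 / (4 * pi * (2 * a + s))\<close>. The part up to \<open>s = 1\<close> gives the
  logarithm; beyond it the exponential weight suffices.\<close>

lemma smooth_point:
 assumes \<mu>: "\<mu> > 0" and a: "a > 0"
 shows "(smooth a x)\<^sup>2 \<le> energy \<mu> * ((ln (1 + 1 / (2 * a)) + 1 / \<mu>\<^sup>2) / (4 * pi))"
proof -
 let ?\<rho> = "return borel x"
 have fin: "finite_measure ?\<rho>" by (intro prob_space.finite_measure prob_space_return) simp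
 have h0: "heat b 0 = 1 / (4 * pi * b)" for b by (simp add: heat_def)
 have "(LINT x|?\<rho>. smooth a x)\<^sup>2 \<le> energy \<mu> * (LINT x|?\<rho>. LINT s|exp_time \<mu>. LINT x'|?\<rho>. heat (2 * a + \<bar>s\<bar>) (x - x'))"
  by (rule smooth_pairing[OF _ fin _ \<mu> a]) auto
 then have "(smooth a x)\<^sup>2 \<le> energy \<mu> * (LINT s|exp_time \<mu>. heat (2 * a + \<bar>s\<bar>) 0)"
 proof -
  have [measurable]: "(\<lambda>xa. LINT s|exp_time \<mu>. heat (2 * a + \<bar>s\<bar>) (xa - x)) \<in> borel_measurable borel"
  proof -
   interpret T: finite_measure "exp_time \<mu>" by (rule finite_exp_time[OF \<mu>])
   show ?thesis by measurable
  qed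
  assume "(LINT x|?\<rho>. smooth a x)\<^sup>2 \<le> energy \<mu> * (LINT x|?\<rho>. LINT s|exp_time \<mu>. LINT x'|?\<rho>. heat (2 * a + \<bar>s\<bar>) (x - x'))"
  then show ?thesis by (simp add: integral_return)
 qed
 also have "... \<le> energy \<mu> * ((ln (1 + 1 / (2 * a)) + 1 / \<mu>\<^sup>2) / (4 * pi))"
 proof (intro mult_left_mono energy_nonneg integral_exp_time_le)
  have F: "(\<integral>\<^sup>+s. ennreal (1 / (2 * a + s)) * indicator {0..1} s \<partial>lborel) = ennreal (ln (2 * a + 1) - ln (2 * a + 0))"
   by (rule nn_integral_FTC_Icc) (use a in \<open>auto intro!: derivative_eq_intros simp: add_pos_nonneg\<close>)
  have L: "ln (2 * a + 1) - ln (2 * a + 0) = ln (1 + 1 / (2 * a))"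
  proof -
   have "1 + 1 / (2 * a) = (2 * a + 1) / (2 * a)" using a by (simp add: field_simps)
   then show ?thesis using a by (simp add: ln_div)
  qed
  have L0: "ln (1 + 1 / (2 * a)) \<ge> 0" using a by simp
  have "(\<integral>\<^sup>+s. ennreal (indicator {0..} s * exp (- \<mu>\<^sup>2 * s) * heat (2 * a + \<bar>s\<bar>) 0) \<partial>lborel) \<le>
   (\<integral>\<^sup>+s. ennreal (1 / (4 * pi)) * (ennreal (1 / (2 * a + s)) * indicator {0..1} s + ennreal (indicator {0..} s * exp (- \<mu>\<^sup>2 * s))) \<partial>lborel)"
  proof (intro nn_integral_mono)
   fix s :: real
   consider "s < 0" | "0 \<le> s" "s \<le> 1" | "1 < s" by linarith
   then show "ennreal (indicator {0..} s * exp (- \<mu>\<^sup>2 * s) * heat (2 * a + \<bar>s\<bar>) 0) \<le>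
    ennreal (1 / (4 * pi)) * (ennreal (1 / (2 * a + s)) * indicator {0..1} s + ennreal (indicator {0..} s * exp (- \<mu>\<^sup>2 * s)))"
   proof cases
    case 1 then show ?thesis by simp
   next
    case 2
    have "exp (- \<mu>\<^sup>2 * s) * heat (2 * a + s) 0 \<le> 1 * (1 / (4 * pi) * (1 / (2 * a + s)))"
     using 2 a unfolding h0 by (intro mult_mono) auto
    then have "ennreal (indicator {0..} s * exp (- \<mu>\<^sup>2 * s) * heat (2 * a + \<bar>s\<bar>) 0) \<le> ennreal (1 / (4 * pi) * (1 / (2 * a + s)))"
     using 2 by (intro ennreal_leI) simp
    also have "... = ennreal (1 / (4 * pi)) * (ennreal (1 / (2 * a + s)) * indicator {0..1} s)"
     using 2 by (subst ennreal_mult') auto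
    also have "... \<le> ennreal (1 / (4 * pi)) * (ennreal (1 / (2 * a + s)) * indicator {0..1} s + ennreal (indicator {0..} s * exp (- \<mu>\<^sup>2 * s)))"
     by (intro mult_left_mono) auto
    finally show ?thesis .
   next
    case 3
    have "1 / (2 * a + s) \<le> 1 / 1" using 3 a by (intro divide_left_mono) auto
    then have "exp (- \<mu>\<^sup>2 * s) * heat (2 * a + s) 0 \<le> exp (- \<mu>\<^sup>2 * s) * (1 / (4 * pi))"
    proof (intro mult_left_mono)
     have "heat (2 * a + s) 0 = 1 / (4 * pi) * (1 / (2 * a + s))" unfolding h0 by simp
     also have "... \<le> 1 / (4 * pi) * 1" using \<open>1 / (2 * a + s) \<le> 1 / 1\<close> by (intro mult_left_mono) auto
     finally show "heat (2 * a + s) 0 \<le> 1 / (4 * pi)" by simp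
    qed simp
    then have "ennreal (indicator {0..} s * exp (- \<mu>\<^sup>2 * s) * heat (2 * a + \<bar>s\<bar>) 0) \<le> ennreal (1 / (4 * pi) * (indicator {0..} s * exp (- \<mu>\<^sup>2 * s)))"
     using 3 by (intro ennreal_leI) (simp add: mult.commute)
    also have "... = ennreal (1 / (4 * pi)) * ennreal (indicator {0..} s * exp (- \<mu>\<^sup>2 * s))"
     by (subst ennreal_mult') auto
    also have "... \<le> ennreal (1 / (4 * pi)) * (ennreal (1 / (2 * a + s)) * indicator {0..1} s + ennreal (indicator {0..} s * exp (- \<mu>\<^sup>2 * s)))"
     by (intro mult_left_mono) auto
    finally show ?thesis .
   qed
  qed
  also have "... = ennreal (1 / (4 * pi)) * (ennreal (ln (1 + 1 / (2 * a))) + ennreal (1 / \<mu>\<^sup>2))"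
   using F L nn_integral_exp_halfline[OF \<mu>] by (simp add: nn_integral_add nn_integral_cmult)
  also have "... = ennreal (1 / (4 * pi) * (ln (1 + 1 / (2 * a)) + 1 / \<mu>\<^sup>2))"
   using L0 by (subst ennreal_mult') (auto simp: ennreal_plus)
  finally show "(\<integral>\<^sup>+s. ennreal (indicator {0..} s * exp (- \<mu>\<^sup>2 * s) * heat (2 * a + \<bar>s\<bar>) 0) \<partial>lborel) \<le> ennreal ((ln (1 + 1 / (2 * a)) + 1 / \<mu>\<^sup>2) / (4 * pi))"
   by simp
  show "0 \<le> (ln (1 + 1 / (2 * a)) + 1 / \<mu>\<^sup>2) / (4 * pi)" using L0 by simp
 qed (use a in \<open>auto intro!: heat_nonneg\<close>)
 finally show ?thesis .
qed

text \<open>The same duality with Lebesgue measure on \<open>E\<close>. The kernel integrated over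
  \<open>E\<close> is at most its mass 1 and at most its height times the measure of
  \<open>E\<close>. This truncation replaces the logarithm of the time \<open>a\<close> by a
  logarithm of the measure.\<close>

lemma smooth_set:
 assumes \<mu>: "\<mu> > 0" and a: "a > 0" and E [measurable]: "E \<in> sets borel" and e: "emeasure lborel E = ennreal e" "e > 0"
 shows "(LINT x|lborel. indicator E x * smooth a x)\<^sup>2 \<le> energy \<mu> * (e\<^sup>2 * ((1 + max 0 (ln (4 * pi / e)) + 1 / \<mu>\<^sup>2) / (4 * pi)))"
proof -
 let ?\<rho> = "density lborel (\<lambda>x. ennreal (indicator E x))"
 have em: "emeasure ?\<rho> UNIV = ennreal e"
  using e by (simp add: emeasure_density ennreal_indicator)
 have fin: "finite_measure ?\<rho>" by (rule finite_measureI) (simp add: em)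
 interpret R: finite_measure ?\<rho> by (rule fin)
 have int: "(LINT x|?\<rho>. u x) = (LINT x|lborel. indicator E x * u x)" if "u \<in> borel_measurable borel" for u :: "real^2 \<Rightarrow> real"
  using that by (subst integral_density) auto
 define \<delta> where "\<delta> = e / (4 * pi)"
 have \<delta>: "\<delta> > 0" using e by (simp add: \<delta>_def)
 let ?q = "\<lambda>x s. LINT x'|?\<rho>. heat (2 * a + \<bar>s\<bar>) (x - x')"
 have q0: "?q x s \<ge> 0" for x s using a by (intro integral_nonneg_AE always_eventually allI heat_nonneg) simp
 have q1: "?q x s \<le> min 1 (\<delta> / s)" if s: "s > 0" for x s
 proof -
  define b where "b = 2 * a + \<bar>s\<bar>"
  have b: "b > 0" "s \<le> b" using a s by (auto simp: b_def)
  have "(LINT x'|?\<rho>. heat b (x - x')) \<le> 1"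
  proof (rule integral_le_of_nn)
   have "(\<integral>\<^sup>+x'. ennreal (heat b (x - x')) \<partial>?\<rho>) = (\<integral>\<^sup>+x'. ennreal (indicator E x') * ennreal (heat b (x - x')) \<partial>lborel)"
    by (rule nn_integral_density) measurable
   also have "... \<le> (\<integral>\<^sup>+x'. ennreal (heat b (x - x')) \<partial>lborel)"
    by (intro nn_integral_mono) (auto split: split_indicator)
   also have "... = 1" using nn_integral_lborel_reflect[of "\<lambda>x. ennreal (heat b x)" x] nn_integral_heat[OF b(1)] by simp
   finally show "(\<integral>\<^sup>+x'. ennreal (heat b (x - x')) \<partial>?\<rho>) \<le> ennreal 1" by simp
  qed (use b in \<open>auto intro!: heat_nonneg\<close>)
  moreover have "(LINT x'|?\<rho>. heat b (x - x')) \<le> \<delta> / s"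
  proof (rule integral_le_of_nn)
   have "(\<integral>\<^sup>+x'. ennreal (heat b (x - x')) \<partial>?\<rho>) \<le> (\<integral>\<^sup>+x'. ennreal (1 / (4 * pi * b)) \<partial>?\<rho>)"
    using b by (intro nn_integral_mono ennreal_leI heat_le) auto
   also have "... = ennreal (1 / (4 * pi * b)) * ennreal e" using em by simp
   also have "... = ennreal (1 / (4 * pi * b) * e)" using b by (intro ennreal_mult'[symmetric]) simp
   also have "... \<le> ennreal (\<delta> / s)"
   proof (rule ennreal_leI)
    have "1 / (4 * pi * b) * e = \<delta> / b" by (simp add: \<delta>_def)
    also have "... \<le> \<delta> / s" using b s \<delta> by (intro divide_left_mono) auto
    finally show "1 / (4 * pi * b) * e \<le> \<delta> / s" .
   qed
   finally show "(\<integral>\<^sup>+x'. ennreal (heat b (x - x')) \<partial>?\<rho>) \<le> ennreal (\<delta> / s)" .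
  qed (use b \<delta> s in \<open>auto intro!: heat_nonneg\<close>)
  ultimately show ?thesis by (simp add: b_def)
 qed
 define c where "c = \<delta> * (1 + max 0 (ln (1 / \<delta>)) + 1 / \<mu>\<^sup>2)"
 have c: "c \<ge> 0" using \<delta> by (simp add: c_def)
 have q2: "(LINT s|exp_time \<mu>. ?q x s) \<le> c" for x
 proof (rule integral_exp_time_le)
  have "(\<integral>\<^sup>+s. ennreal (indicator {0..} s * exp (- \<mu>\<^sup>2 * s) * ?q x s) \<partial>lborel) \<le> (\<integral>\<^sup>+s. ennreal (indicator {0..} s * exp (- \<mu>\<^sup>2 * s) * min 1 (\<delta> / s)) \<partial>lborel)"
  proof (rule nn_integral_mono_AE)
   have "AE s in lborel. s \<noteq> (0::real)" by (rule AE_lborel_singleton)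
   then show "AE s in lborel. ennreal (indicator {0..} s * exp (- \<mu>\<^sup>2 * s) * ?q x s) \<le> ennreal (indicator {0..} s * exp (- \<mu>\<^sup>2 * s) * min 1 (\<delta> / s))"
   proof eventually_elim
    case (elim s)
    show ?case
    proof (cases "s > 0")
     case True
     then show ?thesis using q1[OF True, of x] by (intro ennreal_leI mult_left_mono) auto
    qed (use elim in simp)
   qed
  qed
  also have "... \<le> ennreal c" unfolding c_def by (rule nn_integral_truncated_inverse[OF \<mu> \<delta>])
  finally show "(\<integral>\<^sup>+s. ennreal (indicator {0..} s * exp (- \<mu>\<^sup>2 * s) * ?q x s) \<partial>lborel) \<le> ennreal c" .
  show "?q x \<in> borel_measurable borel" by measurable
 qed (use q0 c in auto)
 have "(LINT x|?\<rho>. smooth a x)\<^sup>2 \<le> energy \<mu> * (LINT x|?\<rho>. LINT s|exp_time \<mu>. ?q x s)"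
  by (rule smooth_pairing[OF _ fin _ \<mu> a]) auto
 also have "... \<le> energy \<mu> * (c * e)"
 proof (intro mult_left_mono energy_nonneg integral_le_of_nn)
  show "0 \<le> (LINT s|exp_time \<mu>. ?q x s)" for x using q0 by (intro integral_nonneg_AE) auto
  have "(\<integral>\<^sup>+x. ennreal (LINT s|exp_time \<mu>. ?q x s) \<partial>?\<rho>) \<le> (\<integral>\<^sup>+x. ennreal c \<partial>?\<rho>)"
   by (intro nn_integral_mono ennreal_leI q2)
  also have "... = ennreal (c * e)" using em c e by (simp add: ennreal_mult)
  finally show "(\<integral>\<^sup>+x. ennreal (LINT s|exp_time \<mu>. ?q x s) \<partial>?\<rho>) \<le> ennreal (c * e)" .
 qed (use c e in auto)
 also have "c * e = e\<^sup>2 * ((1 + max 0 (ln (4 * pi / e)) + 1 / \<mu>\<^sup>2) / (4 * pi))"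
  by (simp add: c_def \<delta>_def power2_eq_square)
 finally show ?thesis by (simp add: int)
qed

text \<open>Integrating the lower bound over \<open>E\<close> gives \<open>h * e\<close>; after
  division by \<open>e\<^sup>2\<close> the square of \<open>h\<close> stands against a logarithm of
  \<open>1 / e\<close>, and solving for \<open>e\<close> yields the Gaussian tail. The resulting
  bound is independent of \<open>a\<close>.\<close>

lemma smooth_level_set:
 assumes \<mu>: "\<mu> > 0" and a: "a > 0" and E [measurable]: "E \<in> sets borel" and e: "emeasure lborel E = ennreal e" "e \<le> M" "0 \<le> e"
  and h: "\<And>x. x \<in> E ==> h \<le> smooth a x" "h \<ge> 0" and \<sigma>: "energy \<mu> \<le> \<sigma>" "\<sigma> > 0"
 shows "e \<le> (4 * pi + M) * exp (1 + 1 / \<mu>\<^sup>2) * exp (- (4 * pi * h\<^sup>2 / \<sigma>))"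
proof (cases "e = 0")
 case True then show ?thesis using e by (simp add: add_nonneg_nonneg)
next
 case False
 then have e0: "e > 0" using e by simp
 define D where "D = 1 + 1 / \<mu>\<^sup>2"
 have b: "\<bar>smooth a x\<bar> \<le> sqrt (energy \<mu> * ((ln (1 + 1 / (2 * a)) + 1 / \<mu>\<^sup>2) / (4 * pi)))" for x
  using smooth_point[OF \<mu> a, of x] by (metis real_sqrt_abs real_sqrt_le_iff)
 have iE: "integrable lborel (\<lambda>x. indicator E x :: real)" using e by simp
 have i: "integrable lborel (\<lambda>x. indicator E x * smooth a x)"
 proof (rule Bochner_Integration.integrable_bound[OF integrable_mult_right[OF iE, of "sqrt (energy \<mu> * ((ln (1 + 1 / (2 * a)) + 1 / \<mu>\<^sup>2) / (4 * pi)))"]])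
  show "AE x in lborel. norm (indicator E x * smooth a x) \<le> norm (sqrt (energy \<mu> * ((ln (1 + 1 / (2 * a)) + 1 / \<mu>\<^sup>2) / (4 * pi))) * indicator E x)"
   using b by (intro always_eventually allI) (auto split: split_indicator intro: order_trans[OF _ abs_ge_self])
 qed measurable
 have "h * e = (LINT x|lborel. h * indicator E x)" using e by (simp add: measure_def)
 also have "... \<le> (LINT x|lborel. indicator E x * smooth a x)"
  using h by (intro integral_mono integrable_mult_right iE i) (auto split: split_indicator)
 finally have "(h * e)\<^sup>2 \<le> (LINT x|lborel. indicator E x * smooth a x)\<^sup>2"
  using h e by (intro power_mono) auto
 also have "... \<le> energy \<mu> * (e\<^sup>2 * ((1 + max 0 (ln (4 * pi / e)) + 1 / \<mu>\<^sup>2) / (4 * pi)))"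
  by (rule smooth_set[OF \<mu> a E e(1) e0])
 also have "... \<le> \<sigma> * (e\<^sup>2 * ((1 + max 0 (ln (4 * pi / e)) + 1 / \<mu>\<^sup>2) / (4 * pi)))"
  using \<sigma> by (intro mult_right_mono mult_nonneg_nonneg divide_nonneg_nonneg add_nonneg_nonneg) auto
 finally have "h\<^sup>2 * e\<^sup>2 \<le> (\<sigma> * ((1 + max 0 (ln (4 * pi / e)) + 1 / \<mu>\<^sup>2) / (4 * pi))) * e\<^sup>2"
  by (simp add: power_mult_distrib mult_ac)
 then have "h\<^sup>2 \<le> \<sigma> * ((1 + max 0 (ln (4 * pi / e)) + 1 / \<mu>\<^sup>2) / (4 * pi))"
  by (rule mult_right_le_imp_le) (use e0 in simp)
 then have key: "4 * pi * h\<^sup>2 / \<sigma> \<le> D + max 0 (ln (4 * pi / e))"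
  using \<sigma> by (simp add: field_simps D_def)
 show ?thesis
 proof (cases "4 * pi * h\<^sup>2 / \<sigma> \<le> D")
  \<comment> \<open>At low levels the total exponent is nonnegative, and the a priori bound
    \<open>e \<le> M\<close> suffices.\<close>
  case True
  have "e \<le> M * 1" using e by simp
  also have "... \<le> (4 * pi + M) * exp (D + - (4 * pi * h\<^sup>2 / \<sigma>))"
   using True e by (intro mult_mono) (auto simp: add_nonneg_nonneg)
  finally show ?thesis by (simp only: exp_add D_def mult.assoc)
 next
  case False
  then have "4 * pi * h\<^sup>2 / \<sigma> - D \<le> ln (4 * pi / e)" using key by (auto simp: max_def split: if_splits)
  then have "exp (4 * pi * h\<^sup>2 / \<sigma> - D) \<le> 4 * pi / e" using e0 by (simp add: ln_ge_iff)
  then have "e * exp (4 * pi * h\<^sup>2 / \<sigma> - D) \<le> 4 * pi" using e0 by (simp add: pos_le_divide_eq mult.commute)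
  then have "e * exp (4 * pi * h\<^sup>2 / \<sigma> - D) * exp (D + - (4 * pi * h\<^sup>2 / \<sigma>)) \<le> 4 * pi * exp (D + - (4 * pi * h\<^sup>2 / \<sigma>))"
   by (intro mult_right_mono) auto
  then have "e \<le> 4 * pi * exp (D + - (4 * pi * h\<^sup>2 / \<sigma>))" by (simp add: mult.assoc flip: exp_add)
  also have "... \<le> (4 * pi + M) * exp (D + - (4 * pi * h\<^sup>2 / \<sigma>))" using e by (intro mult_right_mono) auto
  finally show ?thesis by (simp only: exp_add D_def mult.assoc)
 qed
qed

end

section \<open>The multiplier as a superposition of heat kernels\<close>

text \<open>The norms concern Lebesgue measurable functions, whereas the product measures in the
  Fubini arguments call for Borel ones.\<close>

lemma lebesgue_borel_representative:
 fixes F :: "'a::euclidean_space \<Rightarrow> complex"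
 assumes [measurable]: "F \<in> borel_measurable lebesgue"
 obtains F' where "F' \<in> borel_measurable borel" "AE x in lborel. F x = F' x"
proof -
 obtain r where r [measurable]: "r \<in> borel_measurable lborel" and r': "AE x in lborel. Re (F x) = r x"
  using completion_ex_borel_measurable_real[of "\<lambda>x. Re (F x)" lborel] assms by auto
 obtain i where i [measurable]: "i \<in> borel_measurable lborel" and i': "AE x in lborel. Im (F x) = i x"
  using completion_ex_borel_measurable_real[of "\<lambda>x. Im (F x)" lborel] assms by auto
 show ?thesis
 proof (rule that[of "\<lambda>x. Complex (r x) (i x)"])
  show "(\<lambda>x. Complex (r x) (i x)) \<in> borel_measurable borel"
   using r i by (simp add: complex_eq[abs_def] Complex_eq)
  show "AE x in lborel. F x = Complex (r x) (i x)"
   using r' i' by eventually_elim (simp add: complex_eq_iff)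
 qed
qed

lemma integral_lebesgue_representative:
 fixes F F' \<phi> :: "'a::euclidean_space \<Rightarrow> complex"
 assumes [measurable]: "F' \<in> borel_measurable borel" "\<phi> \<in> borel_measurable borel"
  and F: "F \<in> borel_measurable lebesgue" and ae: "AE x in lborel. F x = F' x"
 shows "(LINT x|lebesgue. F x * \<phi> x) = (LINT x|lborel. F' x * \<phi> x)"
proof -
 have "(LINT x|lebesgue. F x * \<phi> x) = (LINT x|lebesgue. F' x * \<phi> x)"
  using F borel_imp_lebesgue[of \<phi>] borel_imp_lebesgue[of F'] ae
  by (intro integral_cong_AE) (auto simp: AE_completion elim!: eventually_mono intro!: AE_completion)
 then show ?thesis by (simp add: integral_lebesgue_eq)
qed

lemma gauss1_integral:
 fixes c :: real assumes "c > 0"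
 shows "integrable lborel (\<lambda>v::real. exp (- c * v\<^sup>2))" "(LINT v|lborel. exp (- c * v\<^sup>2)) = sqrt (pi / c)"
  "(\<integral>\<^sup>+v. ennreal (exp (- c * v\<^sup>2)) \<partial>lborel) = ennreal (sqrt (pi / c))"
proof -
 have a: "1 / (4 * c) > 0" using assms by simp
 have e: "- v\<^sup>2 / (4 * (1 / (4 * c))) = - c * v\<^sup>2" for v using assms by (simp add: field_simps)
 note * = gauss1_fourier[OF a, of 0, unfolded e]
 show i: "integrable lborel (\<lambda>v::real. exp (- c * v\<^sup>2))"
  using *(1) by (simp only: mult_zero_left cis_zero mult_1 complex_of_real_integrable_eq)
 have "complex_of_real (LINT v|lborel. exp (- c * v\<^sup>2)) = complex_of_real (sqrt (pi / c))"
  using *(2) by (simp only: mult_zero_left cis_zero mult_1 integral_complex_of_real) simp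
 then show v: "(LINT v|lborel. exp (- c * v\<^sup>2)) = sqrt (pi / c)" by (simp only: of_real_eq_iff)
 show "(\<integral>\<^sup>+v. ennreal (exp (- c * v\<^sup>2)) \<partial>lborel) = ennreal (sqrt (pi / c))"
  using nn_integral_eq_integral[OF i] v by simp
qed

text \<open>The kernel of \<open>\<langle>D\<rangle> e\<^bsup>b\<Delta>\<^esup>\<close>.\<close>

definition bracket_heat :: "real \<Rightarrow> real^2 \<Rightarrow> complex" where
 "bracket_heat b z = of_real (1 / (2*pi)^2) * (LINT \<xi>|lborel. cis (z \<bullet> \<xi>) * (bracket \<xi> * of_real (exp (- b * (norm \<xi>)\<^sup>2))))"

lemma bracket_heat_meas [measurable (raw)]:
 assumes [measurable]: "u \<in> borel_measurable M" "w \<in> borel_measurable M"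
 shows "(\<lambda>x. bracket_heat (u x) (w x)) \<in> borel_measurable M"
proof -
 have "(\<lambda>(b, z). bracket_heat b z) \<in> borel_measurable (borel \<Otimes>\<^sub>M borel)"
  unfolding bracket_heat_def by measurable
 from measurable_compose[OF measurable_Pair[OF assms] this] show ?thesis by (simp add: split_beta')
qed

lemma nn_integral_one_plus_sq_gauss:
 assumes c: "c > 0"
 shows "(\<integral>\<^sup>+\<xi>. ennreal ((1 + (norm (\<xi>::real^2))\<^sup>2) * exp (- c * (norm \<xi>)\<^sup>2)) \<partial>lborel) = ennreal (pi / c + pi / c\<^sup>2)"
proof -
 have "(\<integral>\<^sup>+\<xi>. ennreal ((1 + (norm (\<xi>::real^2))\<^sup>2) * exp (- c * (norm \<xi>)\<^sup>2)) \<partial>lborel) =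
  (\<integral>\<^sup>+\<xi>. ennreal (exp (- c * (norm (\<xi>::real^2))\<^sup>2)) + ennreal ((norm \<xi>)\<^sup>2 * exp (- c * (norm \<xi>)\<^sup>2)) \<partial>lborel)"
  by (simp add: distrib_right)
 also have "... = ennreal (pi / c) + ennreal (pi / c\<^sup>2)"
  using nn_integral_gauss[OF c] integral_norm_sq_gauss[OF c] by (simp add: nn_integral_add)
 finally show ?thesis using c by simp
qed

lemma nn_integral_bracket_gauss:
 assumes c: "c > 0"
 shows "(\<integral>\<^sup>+\<xi>. ennreal (norm (bracket (\<xi>::real^2) * of_real (exp (- c * (norm \<xi>)\<^sup>2)))) \<partial>lborel) \<le> ennreal (pi / c + pi / c\<^sup>2)"
 unfolding nn_integral_one_plus_sq_gauss[OF c, symmetric]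
proof (intro nn_integral_mono ennreal_leI)
 fix \<xi> :: "real^2"
 have "norm (bracket \<xi> * of_real (exp (- c * (norm \<xi>)\<^sup>2))) = norm (bracket \<xi>) * exp (- c * (norm \<xi>)\<^sup>2)"
  by (simp add: norm_mult)
 also have "... \<le> (1 + (norm \<xi>)\<^sup>2) * exp (- c * (norm \<xi>)\<^sup>2)" by (intro mult_right_mono norm_bracket_le) auto
 finally show "norm (bracket \<xi> * of_real (exp (- c * (norm \<xi>)\<^sup>2))) \<le> (1 + (norm \<xi>)\<^sup>2) * exp (- c * (norm \<xi>)\<^sup>2)" .
qed

text \<open>Crude in its constants but decreasing in \<open>b\<close>, which is what the integral
  over \<open>b = a + v\<^sup>2\<close> in \<open>representation\<close> asks for.\<close>

lemma bracket_heat_L2: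
 assumes b: "b > 0"
 shows "(\<integral>\<^sup>+z. ennreal ((norm (bracket_heat b z))\<^sup>2) \<partial>lborel) \<le> ennreal (1 / b + 1 / b\<^sup>2)"
proof -
 let ?H = "\<lambda>\<xi>::real^2. bracket \<xi> * complex_of_real (exp (- b * (norm \<xi>)\<^sup>2))"
 have i: "integrable lborel ?H"
  using nn_integral_bracket_gauss[OF b] by (intro integrableI_bounded) (auto simp: le_less_trans)
 have "(\<integral>\<^sup>+z. ennreal ((norm (bracket_heat b z))\<^sup>2) \<partial>lborel) =
  (\<integral>\<^sup>+z. ennreal ((1 / (2*pi)^2)\<^sup>2) * ennreal ((norm (LINT \<xi>|lborel. cis (z \<bullet> \<xi>) * ?H \<xi>))\<^sup>2) \<partial>lborel)"
  by (intro nn_integral_cong) (simp only: bracket_heat_def norm_mult norm_of_real power_mult_distrib power2_abs ennreal_mult'[symmetric] zero_le_power2)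
 also have "... = ennreal ((1 / (2*pi)^2)\<^sup>2) * (\<integral>\<^sup>+z. ennreal ((norm (LINT \<xi>|lborel. cis (z \<bullet> \<xi>) * ?H \<xi>))\<^sup>2) \<partial>lborel)"
  by (rule nn_integral_cmult) measurable
 also have "... \<le> ennreal ((1 / (2*pi)^2)\<^sup>2) * (ennreal (4 * pi\<^sup>2) * (\<integral>\<^sup>+\<xi>. ennreal ((norm (?H \<xi>))\<^sup>2) \<partial>lborel))"
  by (intro mult_left_mono plancherel_le i) auto
 also have "(\<integral>\<^sup>+\<xi>. ennreal ((norm (?H \<xi>))\<^sup>2) \<partial>lborel) = (\<integral>\<^sup>+\<xi>. ennreal ((1 + (norm (\<xi>::real^2))\<^sup>2) * exp (- (2 * b) * (norm \<xi>)\<^sup>2)) \<partial>lborel)"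
 proof (intro nn_integral_cong arg_cong[where f=ennreal])
  fix \<xi> :: "real^2"
  have "(exp (- b * (norm \<xi>)\<^sup>2))\<^sup>2 = exp (- (2 * b) * (norm \<xi>)\<^sup>2)"
   by (simp add: power2_eq_square flip: exp_add)
  then show "(norm (?H \<xi>))\<^sup>2 = (1 + (norm \<xi>)\<^sup>2) * exp (- (2 * b) * (norm \<xi>)\<^sup>2)"
   by (simp add: norm_mult power_mult_distrib norm_bracket)
 qed
 also have "... = ennreal (pi / (2 * b) + pi / (2 * b)\<^sup>2)" using b by (intro nn_integral_one_plus_sq_gauss) simp
 also have "ennreal ((1 / (2*pi)^2)\<^sup>2) * (ennreal (4 * pi\<^sup>2) * ennreal (pi / (2 * b) + pi / (2 * b)\<^sup>2)) =
  ennreal ((1 / (2*pi)^2)\<^sup>2 * (4 * pi\<^sup>2 * (pi / (2 * b) + pi / (2 * b)\<^sup>2)))"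
  by (subst ennreal_mult'[symmetric], simp, subst ennreal_mult'[symmetric]) auto
 also have "... \<le> ennreal (1 / b + 1 / b\<^sup>2)"
 proof (rule ennreal_leI)
  have "(1 / (2*pi)^2)\<^sup>2 * (4 * pi\<^sup>2 * (pi / (2 * b) + pi / (2 * b)\<^sup>2)) = 1 / (8 * pi) * (1 / b) + 1 / (16 * pi) * (1 / b\<^sup>2)"
   using b by (simp add: field_simps power2_eq_square)
  also have "... \<le> 1 * (1 / b) + 1 * (1 / b\<^sup>2)"
   using b pi_ge_two by (intro add_mono mult_right_mono) (auto simp: divide_le_eq_1)
  finally show "(1 / (2*pi)^2)\<^sup>2 * (4 * pi\<^sup>2 * (pi / (2 * b) + pi / (2 * b)\<^sup>2)) \<le> 1 / b + 1 / b\<^sup>2" by simp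
 qed
 finally show ?thesis .
qed

text \<open>A translation is a phase in frequency and commutes with the multiplier, so the result is
  a translate of one fixed kernel.\<close>

lemma mult_op_heat:
 assumes b: "b > 0"
 shows "mult_op (\<lambda>\<xi>. bracket (- \<xi>)) (\<lambda>y. complex_of_real (heat b (y - x))) = (\<lambda>y. bracket_heat b (y - x))"
proof -
 have four: "fourier (\<lambda>y. complex_of_real (heat b (y - x))) \<xi> = cis (- (x \<bullet> \<xi>)) * of_real (exp (- b * (norm \<xi>)\<^sup>2))" for \<xi>
 proof -
  have "fourier (\<lambda>y. complex_of_real (heat b (y - x))) \<xi> = (LINT y|lborel. cis (- (y \<bullet> \<xi>)) * of_real (heat b (y - x)))"
   by (rule fourier_lborel) measurable
  also have "... = (LINT y|lborel. cis (- ((x + y) \<bullet> \<xi>)) * of_real (heat b ((x + y) - x)))"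
   by (rule lborel_integral_shift(1)[symmetric]) measurable
  also have "... = (LINT y|lborel. cis (- (x \<bullet> \<xi>)) * (cis (y \<bullet> (- \<xi>)) * of_real (heat b y)))"
   by (simp add: inner_add_left cis_mult mult.assoc[symmetric])
  also have "... = cis (- (x \<bullet> \<xi>)) * of_real (exp (- b * (norm \<xi>)\<^sup>2))"
   by (simp only: integral_mult_right_zero integral_heat_cis[OF b] norm_minus_cancel)
  finally show ?thesis .
 qed
 show ?thesis
 proof
  fix y
  have *: "cis (y \<bullet> \<xi>) * (bracket \<xi> * (cis (- (x \<bullet> \<xi>)) * E)) = cis ((y - x) \<bullet> \<xi>) * (bracket \<xi> * E)" for \<xi> and E :: complex
  proof -
   have "cis ((y - x) \<bullet> \<xi>) = cis (y \<bullet> \<xi>) * cis (- (x \<bullet> \<xi>))" by (simp add: cis_mult inner_diff_left)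
   then show ?thesis by (simp add: mult_ac)
  qed
  show "mult_op (\<lambda>\<xi>. bracket (- \<xi>)) (\<lambda>y. complex_of_real (heat b (y - x))) y = bracket_heat b (y - x)"
   unfolding mult_op_bracket[OF heat_schwartz(1)[OF b]] four bracket_heat_def by (simp only: *)
 qed
qed

text \<open>\<open>\<langle>\<xi>\<rangle>\<^sup>-\<^sup>1\<close> is a superposition of Gaussians, so \<open>\<langle>D\<rangle>\<^sup>-\<^sup>1 \<langle>D\<rangle> = 1\<close> becomes an identity between heat kernels.\<close>

lemma bracket_heat_superposition:
 assumes a: "a > 0"
 shows "(LINT v|lborel. of_real (exp (- v\<^sup>2)) * bracket_heat (a + v\<^sup>2) z) = of_real (sqrt pi * heat a z)"
proof -
 let ?k = "\<lambda>v \<xi>. cis (z \<bullet> \<xi>) * (bracket \<xi> * complex_of_real (exp (- v\<^sup>2) * exp (- (a + v\<^sup>2) * (norm \<xi>)\<^sup>2)))"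
 have fin: "(\<integral>\<^sup>+(v::real). \<integral>\<^sup>+\<xi>. ennreal (norm (?k v \<xi>)) \<partial>lborel \<partial>lborel) < \<infinity>"
 proof -
  have "(\<integral>\<^sup>+(v::real). \<integral>\<^sup>+\<xi>. ennreal (norm (?k v \<xi>)) \<partial>lborel \<partial>lborel) \<le>
   (\<integral>\<^sup>+(v::real). ennreal (exp (- 1 * v\<^sup>2)) * ennreal (pi / a + pi / a\<^sup>2) \<partial>lborel)"
  proof (intro nn_integral_mono)
   fix v :: real
   have "(\<integral>\<^sup>+\<xi>. ennreal (norm (?k v \<xi>)) \<partial>lborel) \<le> (\<integral>\<^sup>+\<xi>. ennreal (exp (- 1 * v\<^sup>2)) * ennreal (norm (bracket (\<xi>::real^2) * of_real (exp (- a * (norm \<xi>)\<^sup>2)))) \<partial>lborel)"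
   proof (intro nn_integral_mono)
    fix \<xi> :: "real^2"
    have "exp (- (a + v\<^sup>2) * (norm \<xi>)\<^sup>2) \<le> exp (- a * (norm \<xi>)\<^sup>2)"
    proof -
     have "0 \<le> v\<^sup>2 * (norm \<xi>)\<^sup>2" by simp
     then show ?thesis by (simp add: algebra_simps)
    qed
    then have "norm (bracket \<xi>) * (exp (- v\<^sup>2) * exp (- (a + v\<^sup>2) * (norm \<xi>)\<^sup>2)) \<le> norm (bracket \<xi>) * (exp (- v\<^sup>2) * exp (- a * (norm \<xi>)\<^sup>2))"
     by (intro mult_left_mono) auto
    then have "norm (?k v \<xi>) \<le> exp (- 1 * v\<^sup>2) * norm (bracket \<xi> * of_real (exp (- a * (norm \<xi>)\<^sup>2)))"
     by (simp add: norm_mult mult_ac)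
    then show "ennreal (norm (?k v \<xi>)) \<le> ennreal (exp (- 1 * v\<^sup>2)) * ennreal (norm (bracket \<xi> * of_real (exp (- a * (norm \<xi>)\<^sup>2))))"
     by (simp only: ennreal_mult'[symmetric] exp_ge_zero ennreal_leI)
   qed
   also have "... = ennreal (exp (- 1 * v\<^sup>2)) * (\<integral>\<^sup>+\<xi>. ennreal (norm (bracket (\<xi>::real^2) * of_real (exp (- a * (norm \<xi>)\<^sup>2)))) \<partial>lborel)"
    by (rule nn_integral_cmult) measurable
   also have "... \<le> ennreal (exp (- 1 * v\<^sup>2)) * ennreal (pi / a + pi / a\<^sup>2)"
    by (intro mult_left_mono nn_integral_bracket_gauss a) simp
   finally show "(\<integral>\<^sup>+\<xi>. ennreal (norm (?k v \<xi>)) \<partial>lborel) \<le> ennreal (exp (- 1 * v\<^sup>2)) * ennreal (pi / a + pi / a\<^sup>2)" .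
  qed
  also have "... = ennreal (sqrt (pi / 1)) * ennreal (pi / a + pi / a\<^sup>2)"
   by (subst nn_integral_multc) (simp_all only: gauss1_integral(3) zero_less_one, measurable)
  also have "... < \<infinity>" by (simp add: ennreal_mult_less_top)
  finally show ?thesis .
 qed
 let ?c = "complex_of_real (1 / (2*pi)^2)"
 have "(LINT v|lborel. of_real (exp (- v\<^sup>2)) * bracket_heat (a + v\<^sup>2) z) = (LINT v|lborel. ?c * (LINT \<xi>|lborel. ?k v \<xi>))"
 proof (intro Bochner_Integration.integral_cong refl)
  fix v :: real
  have "(LINT \<xi>|lborel. ?k v \<xi>) = (LINT \<xi>|lborel. of_real (exp (- v\<^sup>2)) * (cis (z \<bullet> \<xi>) * (bracket \<xi> * of_real (exp (- (a + v\<^sup>2) * (norm \<xi>)\<^sup>2)))))"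
   by (simp add: mult_ac)
  also have "... = of_real (exp (- v\<^sup>2)) * (LINT \<xi>|lborel. cis (z \<bullet> \<xi>) * (bracket \<xi> * of_real (exp (- (a + v\<^sup>2) * (norm \<xi>)\<^sup>2))))"
   by (rule integral_mult_right_zero)
  finally show "of_real (exp (- v\<^sup>2)) * bracket_heat (a + v\<^sup>2) z = ?c * (LINT \<xi>|lborel. ?k v \<xi>)"
   unfolding bracket_heat_def by (simp only: mult.left_commute)
 qed
 also have "... = ?c * (LINT \<xi>|lborel. LINT v|lborel. ?k v \<xi>)"
 proof -
  have F: "(LINT v|lborel. LINT \<xi>|lborel. ?k v \<xi>) = (LINT \<xi>|lborel. LINT v|lborel. ?k v \<xi>)"
   by (rule Fubini_swap_eq[OF sigma_finite_lborel sigma_finite_lborel _ fin]) measurable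
  show ?thesis unfolding F[symmetric] by (rule integral_mult_right_zero)
 qed
 also have "(LINT \<xi>|lborel. LINT v|lborel. ?k v \<xi>) = (LINT \<xi>|lborel. of_real (sqrt pi) * (cis (z \<bullet> \<xi>) * of_real (exp (- a * (norm \<xi>)\<^sup>2))))"
 proof (intro Bochner_Integration.integral_cong refl)
  fix \<xi> :: "real^2"
  have c: "1 + (norm \<xi>)\<^sup>2 > 0" by (simp add: add_pos_nonneg)
  have "(LINT v|lborel. ?k v \<xi>) = (LINT v|lborel. (cis (z \<bullet> \<xi>) * bracket \<xi> * of_real (exp (- a * (norm \<xi>)\<^sup>2))) * complex_of_real (exp (- (1 + (norm \<xi>)\<^sup>2) * v\<^sup>2)))"
  proof (intro Bochner_Integration.integral_cong refl)
   fix v :: real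
   have "exp (- v\<^sup>2) * exp (- (a + v\<^sup>2) * (norm \<xi>)\<^sup>2) = exp (- a * (norm \<xi>)\<^sup>2) * exp (- (1 + (norm \<xi>)\<^sup>2) * v\<^sup>2)"
    by (simp add: algebra_simps flip: exp_add)
   then show "?k v \<xi> = (cis (z \<bullet> \<xi>) * bracket \<xi> * of_real (exp (- a * (norm \<xi>)\<^sup>2))) * complex_of_real (exp (- (1 + (norm \<xi>)\<^sup>2) * v\<^sup>2))"
    by (simp only: of_real_mult mult.assoc)
  qed
  also have "... = (cis (z \<bullet> \<xi>) * bracket \<xi> * of_real (exp (- a * (norm \<xi>)\<^sup>2))) * of_real (sqrt (pi / (1 + (norm \<xi>)\<^sup>2)))"
   by (simp only: integral_mult_right_zero integral_complex_of_real gauss1_integral(2)[OF c])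
  also have "... = of_real (sqrt pi) * (cis (z \<bullet> \<xi>) * of_real (exp (- a * (norm \<xi>)\<^sup>2)))"
  proof -
   have "sqrt (1 + (norm \<xi>)\<^sup>2) \<noteq> 0" using c by simp
   then have "bracket \<xi> * of_real (sqrt (pi / (1 + (norm \<xi>)\<^sup>2))) = of_real (sqrt pi)"
   proof -
    have "sqrt (1 + (norm \<xi>)\<^sup>2) * sqrt (pi / (1 + (norm \<xi>)\<^sup>2)) = sqrt pi"
     using c by (simp flip: real_sqrt_mult)
    then show ?thesis unfolding bracket_def by (simp only: of_real_mult[symmetric])
   qed
   moreover have "(c * b * E) * S = (b * S) * (c * E)" for c b E S :: complex by (simp add: mult_ac)
   ultimately show ?thesis by (simp only:)
  qed
  finally show "(LINT v|lborel. ?k v \<xi>) = of_real (sqrt pi) * (cis (z \<bullet> \<xi>) * of_real (exp (- a * (norm \<xi>)\<^sup>2)))" .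
 qed
 also have "... = of_real (sqrt pi) * of_real (4 * pi\<^sup>2 * heat a z)"
  by (simp only: integral_mult_right_zero integral_gauss_cis[OF a])
 also have "?c * ... = of_real (sqrt pi * heat a z)"
  by (simp add: power2_eq_square)
 finally show ?thesis .
qed

section \<open>Heat averages of functions in L^4\<close>

lemma ennreal_le_powrI: "x \<ge> 0 ==> n > 0 ==> (ennreal x) ^ n \<le> (ennreal y) ^ n ==> y \<ge> 0 ==> x \<le> y"
 by (simp add: ennreal_power power_mono_iff)

text \<open>Jensen's inequality for the probability density \<open>heat b\<close>, obtained by
  splitting the kernel into two square roots for Cauchy-Schwarz.\<close>

lemma heat_average_sq:
 fixes F :: "real^2 \<Rightarrow> ennreal"
 assumes [measurable]: "F \<in> borel_measurable borel" and b: "b > 0"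
 shows "(\<integral>\<^sup>+y. ennreal (heat b (y - x)) * F y \<partial>lborel)\<^sup>2 \<le> (\<integral>\<^sup>+y. ennreal (heat b (y - x)) * (F y)\<^sup>2 \<partial>lborel)"
proof -
 let ?s = "\<lambda>y. ennreal (sqrt (heat b (y - x)))"
 have sq: "?s y * ?s y = ennreal (heat b (y - x))" for y
  using b by (simp add: heat_nonneg flip: ennreal_mult)
 have "(\<integral>\<^sup>+y. ennreal (heat b (y - x)) * F y \<partial>lborel)\<^sup>2 = (\<integral>\<^sup>+y. ?s y * (?s y * F y) \<partial>lborel)\<^sup>2"
  by (simp only: mult.assoc[symmetric] sq)
 also have "... \<le> (\<integral>\<^sup>+y. (?s y)\<^sup>2 \<partial>lborel) * (\<integral>\<^sup>+y. (?s y * F y)\<^sup>2 \<partial>lborel)"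
  by (rule Cauchy_Schwarz_nn_integral) measurable
 also have "(\<integral>\<^sup>+y. (?s y)\<^sup>2 \<partial>lborel) = 1"
  using nn_integral_lborel_diff[of "\<lambda>y. ennreal (heat b y)" x] nn_integral_heat[OF b] by (simp add: power2_eq_square sq)
 also have "(\<integral>\<^sup>+y. (?s y * F y)\<^sup>2 \<partial>lborel) = (\<integral>\<^sup>+y. ennreal (heat b (y - x)) * (F y)\<^sup>2 \<partial>lborel)"
  by (simp add: power2_eq_square sq[symmetric] mult_ac)
 finally show ?thesis by simp
qed

text \<open>Jensen first, then Cauchy-Schwarz with the L^2 norm of the kernel. This is the smoothing
  bound from L^4 to bounded functions, with loss \<open>b powr (-1/4)\<close>.\<close>

lemma heat_average_pow4:
 fixes F :: "real^2 \<Rightarrow> ennreal"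
 assumes F [measurable]: "F \<in> borel_measurable borel" and b: "b > 0"
 shows "(\<integral>\<^sup>+y. ennreal (heat b (y - x)) * F y \<partial>lborel) ^ 4 \<le> ennreal (1 / (8 * pi * b)) * (\<integral>\<^sup>+y. (F y) ^ 4 \<partial>lborel)"
proof -
 have "(\<integral>\<^sup>+y. ennreal (heat b (y - x)) * F y \<partial>lborel) ^ 4 = ((\<integral>\<^sup>+y. ennreal (heat b (y - x)) * F y \<partial>lborel)\<^sup>2)\<^sup>2"
  by (simp flip: power_mult)
 also have "... \<le> (\<integral>\<^sup>+y. ennreal (heat b (y - x)) * (F y)\<^sup>2 \<partial>lborel)\<^sup>2"
  by (intro power_mono heat_average_sq F b) simp
 also have "... \<le> (\<integral>\<^sup>+y. (ennreal (heat b (y - x)))\<^sup>2 \<partial>lborel) * (\<integral>\<^sup>+y. ((F y)\<^sup>2)\<^sup>2 \<partial>lborel)"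
  by (rule Cauchy_Schwarz_nn_integral) measurable
 also have "(\<integral>\<^sup>+y. (ennreal (heat b (y - x)))\<^sup>2 \<partial>lborel) = ennreal (1 / (8 * pi * b))"
  using heat_sq[OF b, of x] b by (simp add: ennreal_power heat_nonneg)
 finally show ?thesis by (simp flip: power_mult)
qed

definition heat_conv :: "real \<Rightarrow> (real^2 \<Rightarrow> complex) \<Rightarrow> real^2 \<Rightarrow> complex" where
 "heat_conv b F x = (LINT y|lborel. F y * of_real (heat b (y - x)))"

lemma heat_conv_meas [measurable]:
 assumes [measurable]: "F \<in> borel_measurable borel"
 shows "heat_conv b F \<in> borel_measurable borel" "(\<lambda>(b, x). heat_conv b F x) \<in> borel_measurable (borel \<Otimes>\<^sub>M borel)"
 unfolding heat_conv_def by measurable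

lemma heat_conv_le_nn:
 assumes "b > 0"
 shows "ennreal (norm (heat_conv b F x)) \<le> (\<integral>\<^sup>+y. ennreal (heat b (y - x)) * ennreal (norm (F y)) \<partial>lborel)"
 unfolding heat_conv_def
 by (rule order_trans[OF norm_integral_le_nn_integral])
  (use assms in \<open>simp add: norm_mult heat_nonneg ennreal_mult mult.commute\<close>)

lemma heat_mono_time:
 assumes "0 < b" "b \<le> c"
 shows "heat b z \<le> c / b * heat c z"
proof -
 have "- (norm z)\<^sup>2 / (4 * b) \<le> - (norm z)\<^sup>2 / (4 * c)"
  using assms by (simp add: divide_left_mono)
 then have "exp (- (norm z)\<^sup>2 / (4 * b)) / (4 * pi * b) \<le> exp (- (norm z)\<^sup>2 / (4 * c)) / (4 * pi * b)"
  using assms by (intro divide_right_mono) auto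
 moreover have "E / (4 * pi * b) = c / b * (E / (4 * pi * c))" for E using assms by simp
 ultimately show ?thesis unfolding heat_def by metis
qed

text \<open>The mean value theorem in time together with the heat equation. The unknown intermediate
  time is removed by comparing with the single kernel at time \<open>2 * c\<close>, which can be
  integrated against \<open>g\<close>.\<close>

lemma heat_time_difference:
 assumes b: "0 < b" "b \<le> c"
 shows "\<bar>heat c z - heat b z\<bar> \<le> (c - b) * (6 * c / b\<^sup>2) * heat (2 * c) z"
proof (cases "b = c")
 case False
 then have bc: "b < c" using b by simp
 obtain t where t: "b < t" "t < c" "heat c z - heat b z = (c - b) * lheat t z"
  using MVT2[OF bc, of "\<lambda>t. heat t z" "\<lambda>t. lheat t z"] heat_time_derivative b by (metis less_le_trans)
 have "\<bar>lheat t z\<bar> \<le> 6 / t * heat (2 * t) z" using t b by (intro lheat_abs_le) simp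
 also have "... \<le> 6 / t * ((2 * c) / (2 * t) * heat (2 * c) z)"
  using t b by (intro mult_left_mono heat_mono_time) auto
 also have "... = 6 * c / t\<^sup>2 * heat (2 * c) z" by (simp add: power2_eq_square)
 also have "... \<le> 6 * c / b\<^sup>2 * heat (2 * c) z"
  using t b by (intro mult_right_mono divide_left_mono power_mono heat_nonneg) auto
 finally have l: "\<bar>lheat t z\<bar> \<le> 6 * c / b\<^sup>2 * heat (2 * c) z" .
 have "\<bar>heat c z - heat b z\<bar> = (c - b) * \<bar>lheat t z\<bar>" using t bc by (simp add: abs_mult)
 also have "... \<le> (c - b) * (6 * c / b\<^sup>2 * heat (2 * c) z)" using bc by (intro mult_left_mono l) simp
 finally show ?thesis by (simp only: mult.assoc)
qed simp

text \<open>The scale-free constant of \<open>heat_conv_difference\<close>: the power -1/2 comes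
  from the L^4 smoothing at time \<open>v\<^sup>2\<close>, the minimum from cancellation at times
  beyond \<open>a\<close>. The integral converges at 0 and at infinity.\<close>

definition kernel_const :: real where
 "kernel_const = enn2real (\<integral>\<^sup>+w. ennreal (min 1 (1 / w\<^sup>2) * \<bar>w\<bar> powr (-1/2)) \<partial>lborel)"

lemma nn_integral_abs_powr:
 "(\<integral>\<^sup>+w. indicator {-1..1} w * ennreal (\<bar>w\<bar> powr (-1/2)) \<partial>lborel) < \<infinity>"
 "(\<integral>\<^sup>+w. indicator {w. 1 \<le> \<bar>w\<bar>} w * ennreal (1 / w\<^sup>2) \<partial>lborel) < \<infinity>"
proof -
 have 1: "(\<integral>\<^sup>+w. indicator {0..1} w * ennreal (w powr (-1/2)) \<partial>lborel) = ennreal (1 powr (-1/2 + 1) / (-1/2 + 1))"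
 proof -
  have "(\<integral>\<^sup>+w. ennreal (w powr (-1/2)) * indicator {0..1} w \<partial>lborel) = ennreal (1 powr (-1/2 + 1) / (-1/2 + 1))"
   by (rule nn_integral_has_integral_lebesgue'[OF _ has_integral_powr_from_0]) auto
  then show ?thesis by (simp only: mult.commute)
 qed
 have "(\<integral>\<^sup>+w. ennreal (1 / w\<^sup>2) * indicator {1..} w \<partial>lborel) = ennreal (0 - (- 1 / 1))"
 proof (rule nn_integral_FTC_atLeast[where F="\<lambda>w. - 1 / w" and T=0 and a=1])
  show "((\<lambda>w. - 1 / w) has_real_derivative 1 / x\<^sup>2) (at x)" if "1 \<le> x" for x :: real
   using that by (auto intro!: derivative_eq_intros simp: power2_eq_square)
  show "((\<lambda>w. - 1 / w :: real) \<longlongrightarrow> 0) at_top"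
   by (intro tendsto_divide_0[OF tendsto_const] filterlim_at_top_imp_at_infinity filterlim_ident)
 qed auto
 then have 2: "(\<integral>\<^sup>+w. indicator {1..} w * ennreal (1 / w\<^sup>2) \<partial>lborel) = ennreal 1" by (simp add: mult.commute)
 have refl: "(\<integral>\<^sup>+w. u (- w) \<partial>lborel) = (\<integral>\<^sup>+w. u w \<partial>lborel)" if "u \<in> borel_measurable borel" for u :: "real \<Rightarrow> ennreal"
  using nn_integral_lborel_reflect[OF that, of 0] by simp
 have "(\<integral>\<^sup>+w. indicator {-1..1} w * ennreal (\<bar>w\<bar> powr (-1/2)) \<partial>lborel) \<le>
  (\<integral>\<^sup>+w. indicator {0..1} w * ennreal (w powr (-1/2)) + indicator {0..1} (- w) * ennreal ((- w) powr (-1/2)) \<partial>lborel)"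
  by (intro nn_integral_mono) (auto split: split_indicator simp: abs_if)
 also have "... < \<infinity>"
  using refl[of "\<lambda>w. indicator {0..1} w * ennreal (w powr (-1/2))"] 1 by (subst nn_integral_add) auto
 finally show "(\<integral>\<^sup>+w. indicator {-1..1} w * ennreal (\<bar>w\<bar> powr (-1/2)) \<partial>lborel) < \<infinity>" .
 have "(\<integral>\<^sup>+w. indicator {w. 1 \<le> \<bar>w\<bar>} w * ennreal (1 / w\<^sup>2) \<partial>lborel) \<le>
  (\<integral>\<^sup>+w. indicator {1..} w * ennreal (1 / w\<^sup>2) + indicator {1..} (- w) * ennreal (1 / (- w)\<^sup>2) \<partial>lborel)"
  by (intro nn_integral_mono) (auto split: split_indicator simp: abs_if)
 also have "... < \<infinity>"
  using refl[of "\<lambda>w. indicator {1..} w * ennreal (1 / w\<^sup>2)"] 2 by (subst nn_integral_add) auto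
 finally show "(\<integral>\<^sup>+w. indicator {w. 1 \<le> \<bar>w\<bar>} w * ennreal (1 / w\<^sup>2) \<partial>lborel) < \<infinity>" .
qed

lemma kernel_const_finite: "(\<integral>\<^sup>+w. ennreal (min 1 (1 / w\<^sup>2) * \<bar>w\<bar> powr (-1/2)) \<partial>lborel) = ennreal kernel_const"
proof -
 have "(\<integral>\<^sup>+w. ennreal (min 1 (1 / w\<^sup>2) * \<bar>w\<bar> powr (-1/2)) \<partial>lborel) \<le>
  (\<integral>\<^sup>+w. indicator {-1..1} w * ennreal (\<bar>w\<bar> powr (-1/2)) + indicator {w. 1 \<le> \<bar>w\<bar>} w * ennreal (1 / w\<^sup>2) \<partial>lborel)"
 proof (intro nn_integral_mono)
  fix w :: real
  show "ennreal (min 1 (1 / w\<^sup>2) * \<bar>w\<bar> powr (-1/2)) \<le> indicator {-1..1} w * ennreal (\<bar>w\<bar> powr (-1/2)) + indicator {w. 1 \<le> \<bar>w\<bar>} w * ennreal (1 / w\<^sup>2)"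
  proof (cases "\<bar>w\<bar> < 1")
   case True
   have "min 1 (1 / w\<^sup>2) * \<bar>w\<bar> powr (-1/2) \<le> 1 * \<bar>w\<bar> powr (-1/2)" by (intro mult_right_mono) auto
   then show ?thesis using True by (auto simp: indicator_def abs_less_iff intro: ennreal_leI)
  next
   case False
   then have "\<bar>w\<bar> powr (-1/2) \<le> 1" using ge_one_powr_ge_zero[of "\<bar>w\<bar>" "1/2"] by (simp add: powr_minus field_simps)
   then have "min 1 (1 / w\<^sup>2) * \<bar>w\<bar> powr (-1/2) \<le> (1 / w\<^sup>2) * 1" by (intro mult_mono) auto
   then have "ennreal (min 1 (1 / w\<^sup>2) * \<bar>w\<bar> powr (-1/2)) \<le> indicator {w. 1 \<le> \<bar>w\<bar>} w * ennreal (1 / w\<^sup>2)"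
    using False by (auto intro: ennreal_leI)
   then show ?thesis by (rule order_trans) simp
  qed
 qed
 also have "... = (\<integral>\<^sup>+w. indicator {-1..1} w * ennreal (\<bar>w\<bar> powr (-1/2)) \<partial>lborel) + (\<integral>\<^sup>+w. indicator {w. 1 \<le> \<bar>w\<bar>} w * ennreal (1 / w\<^sup>2) \<partial>lborel)"
  by (rule nn_integral_add) measurable
 also have "... < \<infinity>" using nn_integral_abs_powr by simp
 finally show ?thesis by (simp add: kernel_const_def ennreal_enn2real)
qed

lemma kernel_const_nonneg: "kernel_const \<ge> 0" by (simp add: kernel_const_def)

text \<open>Under \<open>v = sqrt a * w\<close> the measure contributes the power 1/2 of
  \<open>a\<close> and the singular factor takes back 1/4.\<close>

lemma kernel_scaled:
 assumes a: "a > 0"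
 shows "(\<integral>\<^sup>+v. ennreal (min 1 (a / v\<^sup>2) * \<bar>v\<bar> powr (-1/2)) \<partial>lborel) = ennreal (kernel_const * a powr (1/4))"
proof -
 define r where "r = sqrt a"
 have r: "r > 0" "r\<^sup>2 = a" using a by (auto simp: r_def)
 have "(\<integral>\<^sup>+v. ennreal (min 1 (a / v\<^sup>2) * \<bar>v\<bar> powr (-1/2)) \<partial>lborel) =
  ennreal r * (\<integral>\<^sup>+w. ennreal (min 1 (a / (0 + r * w)\<^sup>2) * \<bar>0 + r * w\<bar> powr (-1/2)) \<partial>lborel)"
  using r by (subst nn_integral_real_affine[of _ r 0]) auto
 also have "... = ennreal r * (\<integral>\<^sup>+w. ennreal (r powr (-1/2)) * ennreal (min 1 (1 / w\<^sup>2) * \<bar>w\<bar> powr (-1/2)) \<partial>lborel)"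
 proof (intro arg_cong[where f="(*) (ennreal r)"] nn_integral_cong)
  fix w :: real
  have "a / (0 + r * w)\<^sup>2 = 1 / w\<^sup>2" using r a by (simp add: power_mult_distrib)
  moreover have "\<bar>0 + r * w\<bar> powr (-1/2) = r powr (-1/2) * \<bar>w\<bar> powr (-1/2)" using r by (simp add: abs_mult powr_mult)
  ultimately have "min 1 (a / (0 + r * w)\<^sup>2) * \<bar>0 + r * w\<bar> powr (-1/2) = r powr (-1/2) * (min 1 (1 / w\<^sup>2) * \<bar>w\<bar> powr (-1/2))"
   by (simp only: mult_ac)
  then show "ennreal (min 1 (a / (0 + r * w)\<^sup>2) * \<bar>0 + r * w\<bar> powr (-1/2)) = ennreal (r powr (-1/2)) * ennreal (min 1 (1 / w\<^sup>2) * \<bar>w\<bar> powr (-1/2))"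
   by (simp only: ennreal_mult' powr_ge_zero)
 qed
 also have "... = ennreal r * (ennreal (r powr (-1/2)) * ennreal kernel_const)"
  unfolding kernel_const_finite[symmetric] by (subst nn_integral_cmult) auto
 also have "... = ennreal (r * (r powr (-1/2) * kernel_const))"
  using r kernel_const_nonneg by (simp add: ennreal_mult)
 also have "r * (r powr (-1/2) * kernel_const) = kernel_const * a powr (1/4)"
 proof -
  have "r * r powr (-1/2) = r powr (1 + (-1/2))" using r by (subst powr_add) auto
  also have "... = a powr (1/4)" using a by (simp add: r_def powr_half_sqrt[symmetric] powr_powr)
  finally show ?thesis by (simp add: mult_ac)
 qed
 finally show ?thesis .
qed

text \<open>The data at one time: \<open>f\<close> of mass \<open>M\<close>, its gradient
  \<open>G\<close>, and its image \<open>g\<close> under the bracket, of L^4 norm \<gamma>. The two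
  distributional identities are retained for heat kernels only. \<open>N\<close> bounds the squared
  gradient norm and is allowed to exceed 1, because \<open>H1dot_norm\<close> is an infimum.\<close>

locale sobolev_pair =
 fixes f g :: "real^2 \<Rightarrow> complex" and G :: "2 \<Rightarrow> real^2 \<Rightarrow> complex" and M N \<gamma> :: real
 assumes f [measurable]: "f \<in> borel_measurable borel" and g [measurable]: "g \<in> borel_measurable borel"
  and G [measurable]: "\<And>j. G j \<in> borel_measurable borel"
  and f2: "(\<integral>\<^sup>+y. ennreal ((norm (f y))\<^sup>2) \<partial>lborel) = ennreal M" and M: "M \<ge> 0"
  and G2: "(\<Sum>j\<in>UNIV. \<integral>\<^sup>+y. ennreal ((norm (G j y))\<^sup>2) \<partial>lborel) \<le> ennreal N" and N: "N \<ge> 0"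
  and g4: "(\<integral>\<^sup>+y. ennreal (norm (g y) ^ 4) \<partial>lborel) = ennreal (\<gamma> ^ 4)" and \<gamma>: "\<gamma> \<ge> 0"
  and grad: "\<And>b x. b > 0 ==> (\<Sum>j\<in>UNIV. LINT y|lborel. G j y * of_real (dheat j b (y - x))) = - (LINT y|lborel. f y * of_real (lheat b (y - x)))"
  and mult: "\<And>b x. b > 0 ==> heat_conv b g x = (LINT y|lborel. f y * bracket_heat b (y - x))"
begin

lemma heat_average_g:
 assumes b: "b > 0"
 shows "(\<integral>\<^sup>+y. ennreal (heat b (y - x)) * ennreal (norm (g y)) \<partial>lborel) \<le> ennreal (\<gamma> * (8 * pi * b) powr (-1/4))"
proof -
 let ?I = "\<integral>\<^sup>+y. ennreal (heat b (y - x)) * ennreal (norm (g y)) \<partial>lborel"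
 have p: "((8 * pi * b) powr (-1/4)) ^ 4 = 1 / (8 * pi * b)"
 proof -
  have "((8 * pi * b) powr (-1/4)) ^ 4 = ((8 * pi * b) powr (-1/4)) powr (real 4)" using b by (simp add: powr_realpow)
  also have "... = (8 * pi * b) powr (-1)" using b by (simp only: powr_powr) simp
  finally show ?thesis using b by (simp add: powr_minus inverse_eq_divide)
 qed
 have le: "?I ^ 4 \<le> (ennreal (\<gamma> * (8 * pi * b) powr (-1/4))) ^ 4"
 proof -
  have "?I ^ 4 \<le> ennreal (1 / (8 * pi * b)) * (\<integral>\<^sup>+y. (ennreal (norm (g y))) ^ 4 \<partial>lborel)"
   by (intro heat_average_pow4 b) measurable
  also have "... = ennreal (1 / (8 * pi * b)) * ennreal (\<gamma> ^ 4)" using g4 by (simp add: ennreal_power)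
  also have "... = (ennreal (\<gamma> * (8 * pi * b) powr (-1/4))) ^ 4"
  proof -
   have "ennreal (1 / (8 * pi * b)) * ennreal (\<gamma> ^ 4) = ennreal (1 / (8 * pi * b) * \<gamma> ^ 4)"
    using b by (intro ennreal_mult'[symmetric]) simp
   also have "1 / (8 * pi * b) * \<gamma> ^ 4 = (\<gamma> * (8 * pi * b) powr (-1/4)) ^ 4"
    unfolding power_mult_distrib p by (rule mult.commute)
   also have "ennreal ... = (ennreal (\<gamma> * (8 * pi * b) powr (-1/4))) ^ 4"
    using \<gamma> by (intro ennreal_power[symmetric]) simp
   finally show ?thesis .
  qed
  finally show ?thesis .
 qed
 show ?thesis
 proof (cases ?I)
  case (real r)
  then have "r \<le> \<gamma> * (8 * pi * b) powr (-1/4)"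
   using le \<gamma> by (intro ennreal_le_powrI[of r 4]) auto
  then show ?thesis using real by (simp add: ennreal_leI)
 next
  case top
  then show ?thesis using le by (simp add: ennreal_power \<gamma> top_unique)
 qed
qed

lemma heat_conv_g_le: "b > 0 ==> norm (heat_conv b g x) \<le> \<gamma> * (8 * pi * b) powr (-1/4)"
 using order_trans[OF heat_conv_le_nn heat_average_g] \<gamma> by (subst (asm) ennreal_le_iff) auto

lemma integrable_heat_g: "b > 0 ==> integrable lborel (\<lambda>y. g y * of_real (heat b (y - x)))"
proof (rule integrableI_bounded)
 assume b: "b > 0"
 have "(\<integral>\<^sup>+y. ennreal (norm (g y * of_real (heat b (y - x)))) \<partial>lborel) = (\<integral>\<^sup>+y. ennreal (heat b (y - x)) * ennreal (norm (g y)) \<partial>lborel)"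
  using b by (simp add: norm_mult heat_nonneg ennreal_mult mult.commute)
 also have "... < \<infinity>" using heat_average_g[OF b] by (rule le_less_trans) simp
 finally show "(\<integral>\<^sup>+y. ennreal (norm (g y * of_real (heat b (y - x)))) \<partial>lborel) < \<infinity>" .
qed measurable

lemma heat_conv_g_difference:
 assumes b: "0 < b" "b \<le> c"
 shows "norm (heat_conv c g x - heat_conv b g x) \<le> (c - b) * (6 * c / b\<^sup>2) * (\<gamma> * (8 * pi * (2 * c)) powr (-1/4))"
proof -
 let ?K = "(c - b) * (6 * c / b\<^sup>2)"
 have K: "?K \<ge> 0" using b by simp
 have "heat_conv c g x - heat_conv b g x = (LINT y|lborel. g y * of_real (heat c (y - x)) - g y * of_real (heat b (y - x)))"
  unfolding heat_conv_def using b integrable_heat_g by (subst Bochner_Integration.integral_diff) auto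
 also have "... = (LINT y|lborel. g y * of_real (heat c (y - x) - heat b (y - x)))" by (simp add: right_diff_distrib)
 finally have "ennreal (norm (heat_conv c g x - heat_conv b g x)) \<le> (\<integral>\<^sup>+y. ennreal (norm (g y * of_real (heat c (y - x) - heat b (y - x)))) \<partial>lborel)"
  using norm_integral_le_nn_integral[of lborel "\<lambda>y. g y * of_real (heat c (y - x) - heat b (y - x))"] by simp
 also have "... \<le> (\<integral>\<^sup>+y. ennreal ?K * (ennreal (heat (2 * c) (y - x)) * ennreal (norm (g y))) \<partial>lborel)"
 proof (intro nn_integral_mono)
  fix y
  have "norm (g y) * \<bar>heat c (y - x) - heat b (y - x)\<bar> \<le> norm (g y) * (?K * heat (2 * c) (y - x))"
   by (intro mult_left_mono heat_time_difference b) auto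
  then have "ennreal (norm (g y * of_real (heat c (y - x) - heat b (y - x)))) \<le> ennreal (?K * (heat (2 * c) (y - x) * norm (g y)))"
   by (intro ennreal_leI) (simp only: norm_mult norm_of_real mult_ac)
  also have "... = ennreal ?K * (ennreal (heat (2 * c) (y - x)) * ennreal (norm (g y)))"
   using b by (simp only: ennreal_mult'[OF K] ennreal_mult'[OF heat_nonneg])
  finally show "ennreal (norm (g y * of_real (heat c (y - x) - heat b (y - x)))) \<le> ennreal ?K * (ennreal (heat (2 * c) (y - x)) * ennreal (norm (g y)))" .
 qed
 also have "... = ennreal ?K * (\<integral>\<^sup>+y. ennreal (heat (2 * c) (y - x)) * ennreal (norm (g y)) \<partial>lborel)"
  by (rule nn_integral_cmult) measurable
 also have "... \<le> ennreal ?K * ennreal (\<gamma> * (8 * pi * (2 * c)) powr (-1/4))"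
  using b by (intro mult_left_mono heat_average_g) auto
 also have "... = ennreal (?K * (\<gamma> * (8 * pi * (2 * c)) powr (-1/4)))"
  by (rule ennreal_mult'[OF K, symmetric])
 finally have "ennreal (norm (heat_conv c g x - heat_conv b g x)) \<le> ennreal (?K * (\<gamma> * (8 * pi * (2 * c)) powr (-1/4)))" .
 moreover have "0 \<le> ?K * (\<gamma> * (8 * pi * (2 * c)) powr (-1/4))"
  by (intro mult_nonneg_nonneg[OF K] mult_nonneg_nonneg[OF \<gamma>]) simp
 ultimately show ?thesis using ennreal_le_iff by blast
qed

text \<open>The relation \<open>mult\<close> at time \<open>a + v\<^sup>2\<close> is integrated
  against \<open>exp (- v\<^sup>2)\<close>. Fubini lets the integral act on the kernel, where
  \<open>bracket_heat_superposition\<close> undoes the bracket. The smoothed \<open>f\<close>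
  thereby becomes an average of heat averages of \<open>g\<close>.\<close>

lemma representation:
 assumes a: "a > 0"
 shows "of_real (sqrt pi) * heat_conv a f x = (LINT v|lborel. of_real (exp (- v\<^sup>2)) * heat_conv (a + v\<^sup>2) g x)"
  and "integrable lborel (\<lambda>v. of_real (exp (- v\<^sup>2)) * heat_conv (a + v\<^sup>2) g x)"
proof -
 let ?k = "\<lambda>v y. f y * (complex_of_real (exp (- v\<^sup>2)) * bracket_heat (a + v\<^sup>2) (y - x))"
 have av: "a + v\<^sup>2 > 0" for v :: real using a by (simp add: add_pos_nonneg)
 have fin: "(\<integral>\<^sup>+(v::real). \<integral>\<^sup>+y. ennreal (norm (?k v y)) \<partial>lborel \<partial>lborel) < \<infinity>"
 proof -
  \<comment> \<open>The pairing of \<open>f\<close> with the kernel is bounded through their L^2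
    norms; replacing the time \<open>a + v\<^sup>2\<close> by \<open>a\<close> makes the bound
    uniform in \<open>v\<close>.\<close>
  define B where "B = ennreal M + ennreal (1 / a + 1 / a\<^sup>2)"
  have "(\<integral>\<^sup>+(v::real). \<integral>\<^sup>+y. ennreal (norm (?k v y)) \<partial>lborel \<partial>lborel) \<le> (\<integral>\<^sup>+(v::real). ennreal (exp (- 1 * v\<^sup>2)) * B \<partial>lborel)"
  proof (intro nn_integral_mono)
   fix v :: real
   have "(\<integral>\<^sup>+y. ennreal (norm (?k v y)) \<partial>lborel) = (\<integral>\<^sup>+y. ennreal (exp (- 1 * v\<^sup>2)) * ennreal \<bar>norm (f y) * norm (bracket_heat (a + v\<^sup>2) (y - x))\<bar> \<partial>lborel)"
    by (intro nn_integral_cong) (simp add: norm_mult mult_ac flip: ennreal_mult)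
   also have "... = ennreal (exp (- 1 * v\<^sup>2)) * (\<integral>\<^sup>+y. ennreal \<bar>norm (f y) * norm (bracket_heat (a + v\<^sup>2) (y - x))\<bar> \<partial>lborel)"
    by (rule nn_integral_cmult) measurable
   also have "... \<le> ennreal (exp (- 1 * v\<^sup>2)) * B"
   proof (rule mult_left_mono)
    have "(\<integral>\<^sup>+y. ennreal \<bar>norm (f y) * norm (bracket_heat (a + v\<^sup>2) (y - x))\<bar> \<partial>lborel) \<le>
     (\<integral>\<^sup>+y. ennreal ((norm (f y))\<^sup>2) \<partial>lborel) + (\<integral>\<^sup>+y. ennreal ((norm (bracket_heat (a + v\<^sup>2) (y - x)))\<^sup>2) \<partial>lborel)"
     by (rule nn_integral_product_le) measurable
    also have "(\<integral>\<^sup>+y. ennreal ((norm (bracket_heat (a + v\<^sup>2) (y - x)))\<^sup>2) \<partial>lborel) = (\<integral>\<^sup>+y. ennreal ((norm (bracket_heat (a + v\<^sup>2) y))\<^sup>2) \<partial>lborel)"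
     by (rule nn_integral_lborel_diff) measurable
    also have "... \<le> ennreal (1 / (a + v\<^sup>2) + 1 / (a + v\<^sup>2)\<^sup>2)" by (rule bracket_heat_L2[OF av])
    also have "... \<le> ennreal (1 / a + 1 / a\<^sup>2)"
    proof (intro ennreal_leI add_mono divide_left_mono power_mono)
     show "0 < (a + v\<^sup>2) * a" "0 < (a + v\<^sup>2)\<^sup>2 * a\<^sup>2" using a av[of v] by auto
    qed (use a in auto)
    finally show "(\<integral>\<^sup>+y. ennreal \<bar>norm (f y) * norm (bracket_heat (a + v\<^sup>2) (y - x))\<bar> \<partial>lborel) \<le> B"
     unfolding f2 B_def by (simp add: add_left_mono)
   qed simp
   finally show "(\<integral>\<^sup>+y. ennreal (norm (?k v y)) \<partial>lborel) \<le> ennreal (exp (- 1 * v\<^sup>2)) * B" .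
  qed
  also have "... = ennreal (sqrt (pi / 1)) * B"
   by (subst nn_integral_multc) (simp_all only: gauss1_integral(3) zero_less_one, measurable)
  also have "... < \<infinity>" by (simp add: ennreal_mult_less_top B_def)
  finally show ?thesis .
 qed
 have e: "(LINT y|lborel. ?k v y) = of_real (exp (- v\<^sup>2)) * heat_conv (a + v\<^sup>2) g x" for v :: real
 proof -
  have "(LINT y|lborel. ?k v y) = (LINT y|lborel. of_real (exp (- v\<^sup>2)) * (f y * bracket_heat (a + v\<^sup>2) (y - x)))"
   by (simp only: mult.left_commute)
  then show ?thesis unfolding mult[OF av] by simp
 qed
 have m: "case_prod ?k \<in> borel_measurable (lborel \<Otimes>\<^sub>M lborel)" by measurable
 note F = Fubini_swap[OF sigma_finite_lborel sigma_finite_lborel m fin]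
 show "integrable lborel (\<lambda>v. of_real (exp (- v\<^sup>2)) * heat_conv (a + v\<^sup>2) g x)" using F(2) unfolding e .
 have "(LINT v|lborel. of_real (exp (- v\<^sup>2)) * heat_conv (a + v\<^sup>2) g x) = (LINT y|lborel. LINT v|lborel. ?k v y)"
  using F(1) unfolding e .
 also have "... = (LINT y|lborel. f y * of_real (sqrt pi * heat a (y - x)))"
  by (simp only: integral_mult_right_zero bracket_heat_superposition[OF a])
 also have "... = (LINT y|lborel. of_real (sqrt pi) * (f y * of_real (heat a (y - x))))" by (simp add: mult_ac)
 also have "... = of_real (sqrt pi) * heat_conv a f x" unfolding heat_conv_def by (rule integral_mult_right_zero)
 finally show "of_real (sqrt pi) * heat_conv a f x = (LINT v|lborel. of_real (exp (- v\<^sup>2)) * heat_conv (a + v\<^sup>2) g x)" ..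
qed

end

section \<open>Bounds for the heat evolution of a Sobolev function\<close>

lemma nn_integral_weighted_sq:
 fixes w F :: "'a \<Rightarrow> ennreal"
 assumes [measurable]: "w \<in> borel_measurable M" "F \<in> borel_measurable M" and w: "\<And>x. w x < \<infinity>" "(\<integral>\<^sup>+x. w x \<partial>M) = 1"
 shows "(\<integral>\<^sup>+x. w x * F x \<partial>M)\<^sup>2 \<le> (\<integral>\<^sup>+x. w x * (F x)\<^sup>2 \<partial>M)"
proof -
 let ?s = "\<lambda>x. ennreal (sqrt (enn2real (w x)))"
 have sq: "?s x * ?s x = w x" for x
  using w(1)[of x] by (simp flip: ennreal_mult add: ennreal_enn2real)
 have "(\<integral>\<^sup>+x. w x * F x \<partial>M)\<^sup>2 = (\<integral>\<^sup>+x. ?s x * (?s x * F x) \<partial>M)\<^sup>2"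
  by (simp only: mult.assoc[symmetric] sq)
 also have "... \<le> (\<integral>\<^sup>+x. (?s x)\<^sup>2 \<partial>M) * (\<integral>\<^sup>+x. (?s x * F x)\<^sup>2 \<partial>M)"
  by (rule Cauchy_Schwarz_nn_integral) measurable
 also have "(\<integral>\<^sup>+x. (?s x)\<^sup>2 \<partial>M) = 1" using w(2) by (simp add: power2_eq_square sq)
 also have "(\<integral>\<^sup>+x. (?s x * F x)\<^sup>2 \<partial>M) = (\<integral>\<^sup>+x. w x * (F x)\<^sup>2 \<partial>M)"
 proof (rule nn_integral_cong)
  fix x
  have "(?s x * F x)\<^sup>2 = (?s x * ?s x) * (F x)\<^sup>2" by (simp add: power2_eq_square mult_ac)
  then show "(?s x * F x)\<^sup>2 = w x * (F x)\<^sup>2" by (simp only: sq)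
 qed
 finally show ?thesis by simp
qed

lemma complex_L2_product_integrable:
 fixes F :: "'a \<Rightarrow> complex" and k :: "'a \<Rightarrow> real"
 assumes [measurable]: "F \<in> borel_measurable M" "k \<in> borel_measurable M"
  and "(\<integral>\<^sup>+y. ennreal ((norm (F y))\<^sup>2) \<partial>M) < \<infinity>" "(\<integral>\<^sup>+y. ennreal ((k y)\<^sup>2) \<partial>M) < \<infinity>"
 shows "integrable M (\<lambda>y. F y * of_real (k y))"
proof -
 have "integrable M (\<lambda>y. norm (F y) * k y)"
  by (rule L2_product_integrable) (use assms in auto)
 then show ?thesis
  by (rule Bochner_Integration.integrable_bound) (auto simp: norm_mult abs_mult)
qed

text \<open>Compactness of the unit circle. The real bounds apply to real parts of rotations of a
  complex function, and finitely many rotations detect the modulus up to the factor \<eta>.\<close>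

lemma finite_direction_net:
 assumes "\<eta> < 1"
 obtains \<Omega> :: "complex set" where "finite \<Omega>" "\<And>w. w \<in> \<Omega> ==> norm w = 1" "\<And>z. \<exists>w\<in>\<Omega>. \<eta> * norm z \<le> Re (w * z)"
proof -
 let ?S = "sphere (0::complex) 1"
 have op: "open {z. \<eta> < Re (w * z)}" for w :: complex
  by (intro open_Collect_less continuous_intros)
 have cov: "?S \<subseteq> (\<Union>w\<in>?S. {z. \<eta> < Re (w * z)})"
 proof
  fix z assume z: "z \<in> ?S"
  then have "Re (cnj z * z) = 1" by (simp add: complex_norm_square[symmetric] mult.commute[of "cnj z"] flip: of_real_power)
  then show "z \<in> (\<Union>w\<in>?S. {z. \<eta> < Re (w * z)})" using z assms by (intro UN_I[of "cnj z"]) auto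
 qed
 obtain \<Omega> where \<Omega>: "\<Omega> \<subseteq> ?S" "finite \<Omega>" "?S \<subseteq> (\<Union>w\<in>\<Omega>. {z. \<eta> < Re (w * z)})"
  using compactE_image[OF compact_sphere op cov] by metis
 show ?thesis
 proof (rule that[of \<Omega>])
  fix z :: complex
  show "\<exists>w\<in>\<Omega>. \<eta> * norm z \<le> Re (w * z)"
  proof (cases "z = 0")
   case True
   have "(1::complex) \<in> ?S" by simp
   then obtain w where "w \<in> \<Omega>" using \<Omega>(3) by blast
   then show ?thesis using True by auto
  next
   case False
   then have "sgn z \<in> ?S" by (simp add: norm_sgn)
   then obtain w where w: "w \<in> \<Omega>" "\<eta> < Re (w * sgn z)" using \<Omega>(3) by blast
   have "w * z = of_real (norm z) * (w * sgn z)" using False by (simp add: sgn_eq)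
   then have "Re (w * z) = Re (of_real (norm z) * (w * sgn z))" by (rule arg_cong)
   also have "... = norm z * Re (w * sgn z)" using Re_divide_of_real by simp
   finally have "Re (w * z) = norm z * Re (w * sgn z)" .
   moreover have "norm z * \<eta> \<le> norm z * Re (w * sgn z)" using w(2) by (intro mult_left_mono) auto
   ultimately have "\<eta> * norm z \<le> Re (w * z)" by (simp only: mult.commute)
   then show ?thesis using w by blast
  qed
 qed (use \<Omega> in auto)
qed

context sobolev_pair
begin

lemma powr_quarter_le:
 assumes "v \<noteq> 0" "v\<^sup>2 \<le> s"
 shows "(8 * pi * s) powr (-1/4) \<le> \<bar>v\<bar> powr (-1/2)"
proof -
 have "1 * s \<le> (8 * pi) * s" using assms pi_ge_two by (intro mult_right_mono) (auto intro: order_trans[OF zero_le_power2])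
 then have "(8 * pi * s) powr (-1/4) \<le> (v\<^sup>2) powr (-1/4)"
  using assms by (intro powr_mono2') auto
 also have "v\<^sup>2 = \<bar>v\<bar> powr 2" using assms by (simp add: powr_numeral)
 also have "(\<bar>v\<bar> powr 2) powr (-1/4) = \<bar>v\<bar> powr (-1/2)" unfolding powr_powr by simp
 finally show ?thesis .
qed

text \<open>The averages of \<open>g\<close> in \<open>representation\<close> are compared for each
  \<open>v\<close>. If \<open>v\<^sup>2 < a\<close>, their sizes are used; otherwise the times
  \<open>a + v\<^sup>2\<close> and \<open>a' + v\<^sup>2\<close> are comparable and cancellation
  gains \<open>a / v\<^sup>2\<close>. Uniformity in \<open>a'\<close> makes the evolution Cauchy as
  the time tends to 0.\<close>

lemma heat_conv_difference:
 assumes a: "0 < a'" "a' < a"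
 shows "norm (heat_conv a f x - heat_conv a' f x) \<le> 12 * kernel_const * \<gamma> * a powr (1/4)"
proof -
 let ?d = "\<lambda>v. heat_conv (a + v\<^sup>2) g x - heat_conv (a' + v\<^sup>2) g x"
 have a0: "a > 0" using a by simp
 have pt: "norm (?d v) \<le> 12 * \<gamma> * (min 1 (a / v\<^sup>2) * \<bar>v\<bar> powr (-1/2))" if v: "v \<noteq> 0" for v
 proof -
  define p where "p = \<bar>v\<bar> powr (-1/2)"
  have p0: "p \<ge> 0" by (simp add: p_def)
  have v2: "v\<^sup>2 > 0" using v by simp
  have b: "a' + v\<^sup>2 > 0" "a' + v\<^sup>2 \<le> a + v\<^sup>2" "v\<^sup>2 \<le> a' + v\<^sup>2" "v\<^sup>2 \<le> a + v\<^sup>2" "v\<^sup>2 \<le> 2 * (a + v\<^sup>2)"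
   using a v2 by (auto simp: add_pos_pos)
  show ?thesis
  proof (cases "v\<^sup>2 < a")
   case True
   have "norm (?d v) \<le> norm (heat_conv (a + v\<^sup>2) g x) + norm (heat_conv (a' + v\<^sup>2) g x)" by (rule norm_triangle_ineq4)
   also have "... \<le> \<gamma> * p + \<gamma> * p"
   proof (intro add_mono)
    show "norm (heat_conv (a + v\<^sup>2) g x) \<le> \<gamma> * p"
     using heat_conv_g_le[of "a + v\<^sup>2" x] b powr_quarter_le[OF v b(4)] \<gamma> unfolding p_def
     by (meson mult_left_mono order_trans less_le_trans)
    show "norm (heat_conv (a' + v\<^sup>2) g x) \<le> \<gamma> * p"
     using heat_conv_g_le[of "a' + v\<^sup>2" x] b powr_quarter_le[OF v b(3)] \<gamma> unfolding p_def
     by (meson mult_left_mono order_trans less_le_trans)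
   qed
   also have "... \<le> 12 * \<gamma> * p" using \<gamma> p0 by simp
   also have "min 1 (a / v\<^sup>2) = 1" using True v2 by (simp add: min_def field_simps)
   then have "12 * \<gamma> * p = 12 * \<gamma> * (min 1 (a / v\<^sup>2) * p)" by simp
   finally show ?thesis by (simp add: p_def)
  next
   case False
   have m: "min 1 (a / v\<^sup>2) = a / v\<^sup>2" using False v2 by (simp add: min_def field_simps)
   have "norm (?d v) \<le> ((a + v\<^sup>2) - (a' + v\<^sup>2)) * (6 * (a + v\<^sup>2) / (a' + v\<^sup>2)\<^sup>2) * (\<gamma> * (8 * pi * (2 * (a + v\<^sup>2))) powr (-1/4))"
    by (rule heat_conv_g_difference[OF b(1,2)])
   also have "... \<le> a * (6 * (2 * v\<^sup>2) / (v\<^sup>2)\<^sup>2) * (\<gamma> * p)"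
   proof (intro mult_mono)
    show "6 * (a + v\<^sup>2) / (a' + v\<^sup>2)\<^sup>2 \<le> 6 * (2 * v\<^sup>2) / (v\<^sup>2)\<^sup>2"
     using False b v2 a by (intro frac_le power_mono) auto
    show "(8 * pi * (2 * (a + v\<^sup>2))) powr (-1/4) \<le> p" unfolding p_def by (rule powr_quarter_le[OF v b(5)])
   qed (use a \<gamma> b p0 in auto)
   also have "... = 12 * \<gamma> * (a / v\<^sup>2 * p)" using v2 by (simp add: power2_eq_square)
   finally show ?thesis unfolding m p_def .
  qed
 qed
 note ra = representation[OF a0, of x] and ra' = representation[OF a(1), of x]
 have "of_real (sqrt pi) * (heat_conv a f x - heat_conv a' f x) = (LINT v|lborel. of_real (exp (- v\<^sup>2)) * ?d v)"
  unfolding right_diff_distrib using ra ra' by (simp add: Bochner_Integration.integral_diff)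
 then have "ennreal (sqrt pi * norm (heat_conv a f x - heat_conv a' f x)) = ennreal (norm (LINT v|lborel. of_real (exp (- v\<^sup>2)) * ?d v))"
  by (metis norm_mult norm_of_real abs_of_nonneg real_sqrt_ge_zero pi_ge_zero)
 also have "... \<le> (\<integral>\<^sup>+v. ennreal (norm (of_real (exp (- v\<^sup>2)) * ?d v)) \<partial>lborel)" by (rule norm_integral_le_nn_integral)
 also have "... \<le> (\<integral>\<^sup>+v. ennreal (12 * \<gamma>) * ennreal (min 1 (a / v\<^sup>2) * \<bar>v\<bar> powr (-1/2)) \<partial>lborel)"
 proof (rule nn_integral_mono_AE)
  have "AE v in lborel. v \<noteq> (0::real)" by (rule AE_lborel_singleton)
  then show "AE v in lborel. ennreal (norm (of_real (exp (- v\<^sup>2)) * ?d v)) \<le> ennreal (12 * \<gamma>) * ennreal (min 1 (a / v\<^sup>2) * \<bar>v\<bar> powr (-1/2))"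
  proof eventually_elim
   case (elim v)
   have "norm (of_real (exp (- v\<^sup>2)) * ?d v) \<le> 1 * norm (?d v)" unfolding norm_mult by (intro mult_right_mono) auto
   also have "... \<le> 12 * \<gamma> * (min 1 (a / v\<^sup>2) * \<bar>v\<bar> powr (-1/2))" using pt[OF elim] by simp
   finally have "ennreal (norm (of_real (exp (- v\<^sup>2)) * ?d v)) \<le> ennreal (12 * \<gamma> * (min 1 (a / v\<^sup>2) * \<bar>v\<bar> powr (-1/2)))" by (rule ennreal_leI)
   also have "... = ennreal (12 * \<gamma>) * ennreal (min 1 (a / v\<^sup>2) * \<bar>v\<bar> powr (-1/2))" using \<gamma> by (intro ennreal_mult') simp
   finally show ?case .
  qed
 qed
 also have "... = ennreal (12 * \<gamma>) * ennreal (kernel_const * a powr (1/4))"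
  unfolding kernel_scaled[OF a0, symmetric] by (rule nn_integral_cmult) measurable
 also have "... = ennreal (12 * \<gamma> * (kernel_const * a powr (1/4)))" using \<gamma> by (intro ennreal_mult'[symmetric]) simp
 finally have "sqrt pi * norm (heat_conv a f x - heat_conv a' f x) \<le> 12 * \<gamma> * (kernel_const * a powr (1/4))"
  using \<gamma> kernel_const_nonneg by (subst (asm) ennreal_le_iff) auto
 moreover have "1 * norm (heat_conv a f x - heat_conv a' f x) \<le> sqrt pi * norm (heat_conv a f x - heat_conv a' f x)"
  using pi_ge_two by (intro mult_right_mono) auto
 ultimately show ?thesis by (simp add: mult_ac)
qed

lemma heat_conv_sup:
 assumes a: "0 < a"
 shows "norm (heat_conv a f x) \<le> (kernel_const + sqrt pi) * \<gamma>"
proof -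
 have "ennreal (sqrt pi * norm (heat_conv a f x)) = ennreal (norm (LINT v|lborel. of_real (exp (- v\<^sup>2)) * heat_conv (a + v\<^sup>2) g x))"
  unfolding representation(1)[OF a, symmetric] by (simp add: norm_mult)
 also have "... \<le> (\<integral>\<^sup>+v. ennreal (norm (of_real (exp (- v\<^sup>2)) * heat_conv (a + v\<^sup>2) g x)) \<partial>lborel)" by (rule norm_integral_le_nn_integral)
 also have "... \<le> (\<integral>\<^sup>+v. ennreal \<gamma> * (ennreal (min 1 (1 / v\<^sup>2) * \<bar>v\<bar> powr (-1/2)) + ennreal (exp (- 1 * v\<^sup>2))) \<partial>lborel)"
 proof (rule nn_integral_mono_AE)
  have "AE v in lborel. v \<noteq> (0::real)" by (rule AE_lborel_singleton)
  then show "AE v in lborel. ennreal (norm (of_real (exp (- v\<^sup>2)) * heat_conv (a + v\<^sup>2) g x)) \<le> ennreal \<gamma> * (ennreal (min 1 (1 / v\<^sup>2) * \<bar>v\<bar> powr (-1/2)) + ennreal (exp (- 1 * v\<^sup>2)))"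
  proof eventually_elim
   case (elim v)
   have av: "a + v\<^sup>2 > 0" using a by (simp add: add_pos_nonneg)
   have "norm (heat_conv (a + v\<^sup>2) g x) \<le> \<gamma> * (8 * pi * (a + v\<^sup>2)) powr (-1/4)" by (rule heat_conv_g_le[OF av])
   also have "... \<le> \<gamma> * \<bar>v\<bar> powr (-1/2)" using a \<gamma> by (intro mult_left_mono powr_quarter_le elim) auto
   finally have "norm (of_real (exp (- v\<^sup>2)) * heat_conv (a + v\<^sup>2) g x) \<le> exp (- v\<^sup>2) * (\<gamma> * \<bar>v\<bar> powr (-1/2))"
    unfolding norm_mult by (simp add: mult_left_mono)
   also have "... \<le> \<gamma> * (min 1 (1 / v\<^sup>2) * \<bar>v\<bar> powr (-1/2) + exp (- 1 * v\<^sup>2))"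
   proof -
    have "exp (- v\<^sup>2) * \<bar>v\<bar> powr (-1/2) \<le> min 1 (1 / v\<^sup>2) * \<bar>v\<bar> powr (-1/2) + exp (- 1 * v\<^sup>2)"
    proof (cases "\<bar>v\<bar> \<le> 1")
     case True
     then have "v\<^sup>2 \<le> 1" by (simp add: abs_square_le_1)
     then have "min 1 (1 / v\<^sup>2) = 1" using elim by (simp add: min_def field_simps)
     moreover have "exp (- v\<^sup>2) * \<bar>v\<bar> powr (-1/2) \<le> 1 * \<bar>v\<bar> powr (-1/2)" by (intro mult_right_mono) auto
     ultimately show ?thesis by (simp add: add_increasing2)
    next
     case False
     then have "\<bar>v\<bar> powr (-1/2) \<le> 1" using ge_one_powr_ge_zero[of "\<bar>v\<bar>" "1/2"] by (simp add: powr_minus field_simps)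
     then have "exp (- v\<^sup>2) * \<bar>v\<bar> powr (-1/2) \<le> exp (- v\<^sup>2) * 1" by (intro mult_left_mono) auto
     then show ?thesis by (simp add: add_increasing)
    qed
    then have "\<gamma> * (exp (- v\<^sup>2) * \<bar>v\<bar> powr (-1/2)) \<le> \<gamma> * (min 1 (1 / v\<^sup>2) * \<bar>v\<bar> powr (-1/2) + exp (- 1 * v\<^sup>2))"
     by (rule mult_left_mono[OF _ \<gamma>])
    then show ?thesis by (simp only: mult.left_commute)
   qed
   finally have "ennreal (norm (of_real (exp (- v\<^sup>2)) * heat_conv (a + v\<^sup>2) g x)) \<le> ennreal (\<gamma> * (min 1 (1 / v\<^sup>2) * \<bar>v\<bar> powr (-1/2) + exp (- 1 * v\<^sup>2)))" by (rule ennreal_leI)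
   also have "... = ennreal \<gamma> * (ennreal (min 1 (1 / v\<^sup>2) * \<bar>v\<bar> powr (-1/2)) + ennreal (exp (- 1 * v\<^sup>2)))"
    using \<gamma> by (subst ennreal_mult'; (subst ennreal_plus)?) auto
   finally show ?case .
  qed
 qed
 also have "... = ennreal \<gamma> * (ennreal kernel_const + ennreal (sqrt (pi / 1)))"
  unfolding kernel_const_finite[symmetric] gauss1_integral(3)[OF zero_less_one, symmetric]
  by (subst nn_integral_cmult, measurable, subst nn_integral_add) auto
 also have "... = ennreal (\<gamma> * (kernel_const + sqrt pi))"
  using \<gamma> kernel_const_nonneg by (subst ennreal_mult'; (subst ennreal_plus)?) auto
 finally have "sqrt pi * norm (heat_conv a f x) \<le> \<gamma> * (kernel_const + sqrt pi)"
  using \<gamma> kernel_const_nonneg by (subst (asm) ennreal_le_iff) auto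
 moreover have "1 * norm (heat_conv a f x) \<le> sqrt pi * norm (heat_conv a f x)"
  using pi_ge_two by (intro mult_right_mono) auto
 ultimately show ?thesis by (simp add: mult_ac)
qed

lemma heat_average_integral:
 assumes [measurable]: "F \<in> borel_measurable borel" and b: "b > 0"
 shows "(\<integral>\<^sup>+x. \<integral>\<^sup>+y. ennreal (heat b (y - x)) * F y \<partial>lborel \<partial>lborel) = (\<integral>\<^sup>+y. F y \<partial>lborel)"
proof -
 have "(\<integral>\<^sup>+x. \<integral>\<^sup>+y. ennreal (heat b (y - x)) * F y \<partial>lborel \<partial>lborel) = (\<integral>\<^sup>+y. \<integral>\<^sup>+x. ennreal (heat b (y - x)) * F y \<partial>lborel \<partial>lborel)"
  by (rule lborel_pair.Fubini') measurable
 also have "... = (\<integral>\<^sup>+y. F y \<partial>lborel)"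
  using nn_integral_lborel_reflect[of "\<lambda>x. ennreal (heat b x)"] nn_integral_heat[OF b] by (simp add: nn_integral_multc)
 finally show ?thesis .
qed

lemma heat_conv_L2:
 assumes a: "0 < a"
 shows "(\<integral>\<^sup>+x. ennreal ((norm (heat_conv a f x))\<^sup>2) \<partial>lborel) \<le> ennreal M"
proof -
 have "(\<integral>\<^sup>+x. ennreal ((norm (heat_conv a f x))\<^sup>2) \<partial>lborel) \<le> (\<integral>\<^sup>+x. \<integral>\<^sup>+y. ennreal (heat a (y - x)) * (ennreal (norm (f y)))\<^sup>2 \<partial>lborel \<partial>lborel)"
 proof (intro nn_integral_mono)
  fix x
  have "ennreal ((norm (heat_conv a f x))\<^sup>2) = (ennreal (norm (heat_conv a f x)))\<^sup>2" by (simp add: ennreal_power)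
  also have "... \<le> (\<integral>\<^sup>+y. ennreal (heat a (y - x)) * ennreal (norm (f y)) \<partial>lborel)\<^sup>2"
   by (intro power_mono heat_conv_le_nn a) simp
  also have "... \<le> (\<integral>\<^sup>+y. ennreal (heat a (y - x)) * (ennreal (norm (f y)))\<^sup>2 \<partial>lborel)"
   by (intro heat_average_sq a) measurable
  finally show "ennreal ((norm (heat_conv a f x))\<^sup>2) \<le> (\<integral>\<^sup>+y. ennreal (heat a (y - x)) * (ennreal (norm (f y)))\<^sup>2 \<partial>lborel)" .
 qed
 also have "... = (\<integral>\<^sup>+y. (ennreal (norm (f y)))\<^sup>2 \<partial>lborel)" by (rule heat_average_integral[OF _ a]) measurable
 also have "... = ennreal M" using f2 by (simp add: ennreal_power)
 finally show ?thesis .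
qed

text \<open>By \<open>representation\<close> the smoothed \<open>f\<close> arises from
  \<open>g\<close> by averaging against a probability measure, Gaussian in \<open>v\<close> and a
  heat kernel in \<open>y\<close>. Jensen, applied twice in each variable, yields the fourth power
  with constant one.\<close>

lemma heat_conv_L4:
 assumes a: "0 < a"
 shows "(\<integral>\<^sup>+x. ennreal (norm (heat_conv a f x) ^ 4) \<partial>lborel) \<le> ennreal (\<gamma> ^ 4)"
proof -
 define w where "w v = ennreal (exp (- 1 * v\<^sup>2) / sqrt pi)" for v :: real
 have [measurable]: "w \<in> borel_measurable borel" unfolding w_def by measurable
 have w1: "(\<integral>\<^sup>+v. w v \<partial>lborel) = 1"
 proof -
  have "(\<integral>\<^sup>+v. w v \<partial>lborel) = (\<integral>\<^sup>+v. ennreal (1 / sqrt pi) * ennreal (exp (- 1 * v\<^sup>2)) \<partial>lborel)"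
   unfolding w_def by (intro nn_integral_cong) (simp flip: ennreal_mult)
  also have "... = ennreal (1 / sqrt pi) * ennreal (sqrt (pi / 1))"
   unfolding gauss1_integral(3)[OF zero_less_one, symmetric] by (rule nn_integral_cmult) measurable
  also have "... = 1" by (simp flip: ennreal_mult)
  finally show ?thesis .
 qed
 let ?U = "\<lambda>v x k. \<integral>\<^sup>+y. ennreal (heat (a + v\<^sup>2) (y - x)) * (ennreal (norm (g y))) ^ k \<partial>lborel"
 have av: "a + v\<^sup>2 > 0" for v :: real using a by (simp add: add_pos_nonneg)
 have pt: "ennreal (norm (heat_conv a f x) ^ 4) \<le> (\<integral>\<^sup>+v. w v * ?U v x 4 \<partial>lborel)" for x
 proof -
  have "ennreal (norm (heat_conv a f x)) = ennreal (norm (of_real (1 / sqrt pi) * (LINT v|lborel. of_real (exp (- v\<^sup>2)) * heat_conv (a + v\<^sup>2) g x)))"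
   unfolding representation(1)[OF a, symmetric] by (simp add: norm_mult)
  also have "... = ennreal (norm (LINT v|lborel. of_real (1 / sqrt pi) * (of_real (exp (- v\<^sup>2)) * heat_conv (a + v\<^sup>2) g x)))"
   by (simp only: integral_mult_right_zero)
  also have "... \<le> (\<integral>\<^sup>+v. ennreal (norm (of_real (1 / sqrt pi) * (of_real (exp (- v\<^sup>2)) * heat_conv (a + v\<^sup>2) g x))) \<partial>lborel)"
   by (rule norm_integral_le_nn_integral)
  also have "... \<le> (\<integral>\<^sup>+v. w v * ?U v x 1 \<partial>lborel)"
  proof (intro nn_integral_mono)
   fix v :: real
   have "norm (of_real (1 / sqrt pi) * (of_real (exp (- v\<^sup>2)) * heat_conv (a + v\<^sup>2) g x)) = exp (- 1 * v\<^sup>2) / sqrt pi * norm (heat_conv (a + v\<^sup>2) g x)"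
    by (simp add: norm_mult norm_divide)
   then have "ennreal (norm (of_real (1 / sqrt pi) * (of_real (exp (- v\<^sup>2)) * heat_conv (a + v\<^sup>2) g x))) = w v * ennreal (norm (heat_conv (a + v\<^sup>2) g x))"
    unfolding w_def by (simp only: ennreal_mult' divide_nonneg_nonneg exp_ge_zero real_sqrt_ge_zero pi_ge_zero)
   also have "... \<le> w v * ?U v x 1" using heat_conv_le_nn[OF av] by (intro mult_left_mono) auto
   finally show "ennreal (norm (of_real (1 / sqrt pi) * (of_real (exp (- v\<^sup>2)) * heat_conv (a + v\<^sup>2) g x))) \<le> w v * ?U v x 1" .
  qed
  finally have 1: "ennreal (norm (heat_conv a f x)) \<le> (\<integral>\<^sup>+v. w v * ?U v x 1 \<partial>lborel)" .
  have "ennreal (norm (heat_conv a f x) ^ 4) = ((ennreal (norm (heat_conv a f x)))\<^sup>2)\<^sup>2" by (simp add: ennreal_power flip: power_mult)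
  also have "... \<le> ((\<integral>\<^sup>+v. w v * ?U v x 1 \<partial>lborel)\<^sup>2)\<^sup>2" by (intro power_mono 1) auto
  also have "... \<le> (\<integral>\<^sup>+v. w v * (?U v x 1)\<^sup>2 \<partial>lborel)\<^sup>2"
   by (intro power_mono nn_integral_weighted_sq) (use w1 in \<open>auto simp: w_def\<close>)
  also have "... \<le> (\<integral>\<^sup>+v. w v * ?U v x 2 \<partial>lborel)\<^sup>2"
   using heat_average_sq[OF _ av, of "\<lambda>y. ennreal (norm (g y))"]
   by (intro power_mono nn_integral_mono mult_left_mono) auto
  also have "... \<le> (\<integral>\<^sup>+v. w v * (?U v x 2)\<^sup>2 \<partial>lborel)"
   by (intro nn_integral_weighted_sq) (use w1 in \<open>auto simp: w_def\<close>)
  also have "... \<le> (\<integral>\<^sup>+v. w v * ?U v x 4 \<partial>lborel)"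
  proof (intro nn_integral_mono mult_left_mono)
   fix v :: real
   have "(?U v x 2)\<^sup>2 \<le> (\<integral>\<^sup>+y. ennreal (heat (a + v\<^sup>2) (y - x)) * ((ennreal (norm (g y)))\<^sup>2)\<^sup>2 \<partial>lborel)"
    by (intro heat_average_sq av) measurable
   then show "(?U v x 2)\<^sup>2 \<le> ?U v x 4" by (simp flip: power_mult)
  qed simp
  finally show ?thesis .
 qed
 have "(\<integral>\<^sup>+x. ennreal (norm (heat_conv a f x) ^ 4) \<partial>lborel) \<le> (\<integral>\<^sup>+x. \<integral>\<^sup>+v. w v * ?U v x 4 \<partial>lborel \<partial>lborel)"
  by (intro nn_integral_mono pt)
 also have "... = (\<integral>\<^sup>+v. \<integral>\<^sup>+x. w v * ?U v x 4 \<partial>lborel \<partial>lborel)"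
  by (rule lborel_pair.Fubini') measurable
 also have "... = (\<integral>\<^sup>+v. w v * ennreal (\<gamma> ^ 4) \<partial>lborel)"
 proof (intro nn_integral_cong)
  fix v :: real
  have "(\<integral>\<^sup>+x. w v * ?U v x 4 \<partial>lborel) = w v * (\<integral>\<^sup>+x. ?U v x 4 \<partial>lborel)" by (rule nn_integral_cmult) measurable
  also have "(\<integral>\<^sup>+x. ?U v x 4 \<partial>lborel) = (\<integral>\<^sup>+y. (ennreal (norm (g y))) ^ 4 \<partial>lborel)" by (rule heat_average_integral[OF _ av]) measurable
  finally show "(\<integral>\<^sup>+x. w v * ?U v x 4 \<partial>lborel) = w v * ennreal (\<gamma> ^ 4)" using g4 by (simp add: ennreal_power)
 qed
 also have "... = ennreal (\<gamma> ^ 4)" using w1 by (simp add: nn_integral_multc)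
 finally show ?thesis .
qed

section \<open>Reduction of the complex case to real parts\<close>

lemma heat_L2: "b > 0 ==> (\<integral>\<^sup>+y. ennreal ((heat b (y - x))\<^sup>2) \<partial>lborel) < \<infinity>"
 by (rule le_less_trans[OF heat_sq_le[OF _ order_refl]]) auto

lemma G2': "(\<integral>\<^sup>+y. ennreal ((norm (G j y))\<^sup>2) \<partial>lborel) < \<infinity>"
proof -
 have "(\<integral>\<^sup>+y. ennreal ((norm (G j y))\<^sup>2) \<partial>lborel) \<le> (\<Sum>j\<in>UNIV. \<integral>\<^sup>+y. ennreal ((norm (G j y))\<^sup>2) \<partial>lborel)"
  by (rule member_le_sum) auto
 also have "... \<le> ennreal N" by (rule G2)
 finally show ?thesis by (rule le_less_trans) simp
qed

lemma Re_le: "norm w = 1 ==> (Re (w * z))\<^sup>2 \<le> (norm z)\<^sup>2"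
 using abs_Re_le_cmod[of "w * z"] by (simp add: norm_mult power2_le_iff_abs_le)

text \<open>Multiplication by a unimodular \<open>w\<close> and taking real parts commute with
  pairings against real kernels and do not increase norms, so the real theory is available in every
  direction.\<close>

lemma weak_gradient_Re:
 assumes w: "norm w = 1"
 shows "weak_gradient (\<lambda>y. Re (w * f y)) (\<lambda>j y. Re (w * G j y))"
proof
 show "(\<lambda>y. Re (w * f y)) \<in> borel_measurable borel" "\<And>j. (\<lambda>y. Re (w * G j y)) \<in> borel_measurable borel" by measurable
 show "(\<integral>\<^sup>+y. ennreal ((Re (w * f y))\<^sup>2) \<partial>lborel) < \<infinity>"
  by (rule le_less_trans[OF nn_integral_mono[OF ennreal_leI[OF Re_le[OF w]]]]) (simp add: f2)
 show "(\<integral>\<^sup>+y. ennreal ((Re (w * G j y))\<^sup>2) \<partial>lborel) < \<infinity>" for j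
  by (rule le_less_trans[OF nn_integral_mono[OF ennreal_leI[OF Re_le[OF w]]] G2'])
 fix b :: real and x :: "real^2" assume b: "b > 0"
 have Re_int: "(LINT y|lborel. Re (w * F y) * k y) = Re (w * (LINT y|lborel. F y * of_real (k y)))"
  if "integrable lborel (\<lambda>y. F y * of_real (k y))" for F :: "real^2 \<Rightarrow> complex" and k :: "real^2 \<Rightarrow> real"
 proof -
  have i: "integrable lborel (\<lambda>y. w * (F y * of_real (k y)))" using that by simp
  have "(LINT y|lborel. Re (w * F y) * k y) = (LINT y|lborel. Re (w * (F y * of_real (k y))))"
   by (simp add: algebra_simps)
  also have "... = Re (LINT y|lborel. w * (F y * of_real (k y)))" by (rule integral_Re[OF i])
  finally show ?thesis by simp
 qed
 have iG: "integrable lborel (\<lambda>y. G j y * of_real (dheat j b (y - x)))" for j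
  by (rule complex_L2_product_integrable[OF _ _ G2' le_less_trans[OF dheat_sq_le[OF b order_refl]]]) auto
 have iF: "integrable lborel (\<lambda>y. f y * of_real (lheat b (y - x)))"
  by (rule complex_L2_product_integrable[OF _ _ _ le_less_trans[OF lheat_sq_le[OF b order_refl]]]) (auto simp: f2)
 have "(\<Sum>j\<in>UNIV. LINT y|lborel. Re (w * G j y) * dheat j b (y - x)) = Re (w * (\<Sum>j\<in>UNIV. LINT y|lborel. G j y * of_real (dheat j b (y - x))))"
  by (simp only: Re_int[OF iG] sum_distrib_left Re_sum)
 also have "... = - (LINT y|lborel. Re (w * f y) * lheat b (y - x))"
  unfolding grad[OF b] Re_int[OF iF] by simp
 finally show "(\<Sum>j\<in>UNIV. LINT y|lborel. Re (w * G j y) * dheat j b (y - x)) = - (LINT y|lborel. Re (w * f y) * lheat b (y - x))" .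
qed

lemma energy_Re:
 assumes w: "norm w = 1"
 shows "weak_gradient.energy (\<lambda>y. Re (w * f y)) (\<lambda>j y. Re (w * G j y)) \<mu> \<le> \<mu>\<^sup>2 * M + N"
proof -
 have fM: "(LINT y|lborel. (Re (w * f y))\<^sup>2) \<le> M"
 proof (rule integral_le_of_nn)
  have "(\<integral>\<^sup>+y. ennreal ((Re (w * f y))\<^sup>2) \<partial>lborel) \<le> (\<integral>\<^sup>+y. ennreal ((norm (f y))\<^sup>2) \<partial>lborel)"
   by (intro nn_integral_mono ennreal_leI Re_le w)
  then show "(\<integral>\<^sup>+y. ennreal ((Re (w * f y))\<^sup>2) \<partial>lborel) \<le> ennreal M" unfolding f2 .
 qed (use M in auto)
 define n where "n j = enn2real (\<integral>\<^sup>+y. ennreal ((norm (G j y))\<^sup>2) \<partial>lborel)" for j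
 have n: "(\<integral>\<^sup>+y. ennreal ((norm (G j y))\<^sup>2) \<partial>lborel) = ennreal (n j)" "n j \<ge> 0" for j
  using G2'[of j] by (auto simp: n_def ennreal_enn2real)
 have gN: "(LINT y|lborel. (Re (w * G j y))\<^sup>2) \<le> n j" for j
 proof (rule integral_le_of_nn)
  show "(\<integral>\<^sup>+y. ennreal ((Re (w * G j y))\<^sup>2) \<partial>lborel) \<le> ennreal (n j)"
   unfolding n(1)[symmetric] by (intro nn_integral_mono ennreal_leI Re_le w)
 qed (use n in auto)
 have "ennreal (\<Sum>j\<in>UNIV. n j) \<le> ennreal N" using G2 n(2) unfolding n(1) by (simp add: sum_ennreal)
 then have "(\<Sum>j\<in>UNIV. n j) \<le> N" using N by simp
 moreover have "(\<Sum>j\<in>UNIV. LINT y|lborel. (Re (w * G j y))\<^sup>2) \<le> (\<Sum>j\<in>UNIV. n j)" by (intro sum_mono gN)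
 moreover have "\<mu>\<^sup>2 * (LINT y|lborel. (Re (w * f y))\<^sup>2) \<le> \<mu>\<^sup>2 * M" using fM by (intro mult_left_mono) auto
 ultimately show ?thesis unfolding weak_gradient.energy_def[OF weak_gradient_Re[OF w]] by linarith
qed

lemma smooth_Re:
 assumes w: "norm w = 1" and a: "a > 0"
 shows "weak_gradient.smooth (\<lambda>y. Re (w * f y)) a x = Re (w * heat_conv a f x)"
proof -
 have i: "integrable lborel (\<lambda>y. f y * of_real (heat a (y - x)))"
  by (rule complex_L2_product_integrable[OF _ _ _ heat_L2[OF a]]) (auto simp: f2)
 then have i': "integrable lborel (\<lambda>y. w * (f y * of_real (heat a (y - x))))" by simp
 have "weak_gradient.smooth (\<lambda>y. Re (w * f y)) a x = (LINT y|lborel. Re (w * f y) * heat a (y - x))"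
  by (rule weak_gradient.smooth_def[OF weak_gradient_Re[OF w]])
 also have "... = (LINT y|lborel. Re (w * (f y * of_real (heat a (y - x)))))" by (simp add: algebra_simps)
 also have "... = Re (LINT y|lborel. w * (f y * of_real (heat a (y - x))))" by (rule integral_Re[OF i'])
 finally show ?thesis by (simp add: heat_conv_def)
qed

text \<open>Here the rotation may depend on the point: \<open>w\<close> is the phase that makes
  \<open>w * heat_conv a f x\<close> real and nonnegative, so nothing is lost.\<close>

lemma heat_conv_point:
 assumes \<mu>: "\<mu> > 0" and a: "a > 0" and \<sigma>: "\<mu>\<^sup>2 * M + N \<le> \<sigma>"
 shows "(norm (heat_conv a f x))\<^sup>2 \<le> \<sigma> * ((ln (1 + 1 / (2 * a)) + 1 / \<mu>\<^sup>2) / (4 * pi))"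
proof -
 define z where "z = heat_conv a f x"
 define w where "w = (if z = 0 then 1 else cnj (sgn z))"
 have w: "norm w = 1" by (simp add: w_def norm_sgn)
 have "w * z = of_real (norm z)"
 proof (cases "z = 0")
  case False
  have "cnj (sgn z) * z = of_real ((norm z)\<^sup>2) / of_real (norm z)"
   unfolding complex_norm_square by (simp add: sgn_eq mult.commute)
  then show ?thesis using False by (simp add: w_def power2_eq_square)
 qed simp
 then have "(norm z)\<^sup>2 = (weak_gradient.smooth (\<lambda>y. Re (w * f y)) a x)\<^sup>2"
  unfolding smooth_Re[OF w a] z_def[symmetric] by simp
 also have "... \<le> weak_gradient.energy (\<lambda>y. Re (w * f y)) (\<lambda>j y. Re (w * G j y)) \<mu> * ((ln (1 + 1 / (2 * a)) + 1 / \<mu>\<^sup>2) / (4 * pi))"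
  by (rule weak_gradient.smooth_point[OF weak_gradient_Re[OF w] \<mu> a])
 also have "... \<le> \<sigma> * ((ln (1 + 1 / (2 * a)) + 1 / \<mu>\<^sup>2) / (4 * pi))"
  using energy_Re[OF w, of \<mu>] \<sigma> a by (intro mult_right_mono divide_nonneg_nonneg add_nonneg_nonneg) auto
 finally show ?thesis by (simp add: z_def)
qed

text \<open>A level set needs rotations that do not depend on the point. It is covered by finitely
  many sets on each of which one rotated real part reaches \<open>\<eta> * h\<close>, and each of
  them obeys \<open>smooth_level_set\<close>. The condition \<open>h \<ge> 1\<close> lets Chebyshev
  bound their measures by \<open>M\<close>.\<close>

lemma heat_conv_level_set:
 assumes \<mu>: "\<mu> > 0" and a: "a > 0" and \<sigma>: "\<mu>\<^sup>2 * M + N \<le> \<sigma>" "\<sigma> > 0" and h: "h \<ge> 1" and \<eta>: "\<eta> \<ge> 0"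
  and \<Omega>: "finite \<Omega>" "\<And>w. w \<in> \<Omega> ==> norm w = 1" "\<And>z. \<exists>w\<in>\<Omega>. \<eta> * norm z \<le> Re (w * z)"
 shows "emeasure lborel {x. h \<le> norm (heat_conv a f x)} \<le>
  ennreal (real (card \<Omega>) * ((4 * pi + M) * exp (1 + 1 / \<mu>\<^sup>2) * exp (- (4 * pi * (\<eta> * h)\<^sup>2 / \<sigma>))))"
proof -
 let ?E = "{x. h \<le> norm (heat_conv a f x)}"
 let ?B = "(4 * pi + M) * exp (1 + 1 / \<mu>\<^sup>2) * exp (- (4 * pi * (\<eta> * h)\<^sup>2 / \<sigma>))"
 have [measurable]: "?E \<in> sets borel" by measurable
 have EM: "emeasure lborel ?E \<le> ennreal M"
 proof -
  have "emeasure lborel ?E = (\<integral>\<^sup>+x. indicator ?E x \<partial>lborel)" by simp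
  also have "... \<le> (\<integral>\<^sup>+x. ennreal ((norm (heat_conv a f x))\<^sup>2) \<partial>lborel)"
  proof (intro nn_integral_mono)
   fix x
   have "h \<le> norm (heat_conv a f x) ==> 1 \<le> (norm (heat_conv a f x))\<^sup>2" using h by (simp add: one_le_power)
   then show "indicator ?E x \<le> ennreal ((norm (heat_conv a f x))\<^sup>2)"
    by (auto split: split_indicator simp flip: ennreal_1 intro: ennreal_leI)
  qed
  also have "... \<le> ennreal M" by (rule heat_conv_L2[OF a])
  finally show ?thesis .
 qed
 let ?Ew = "\<lambda>w. {x. h \<le> norm (heat_conv a f x) \<and> \<eta> * h \<le> Re (w * heat_conv a f x)}"
 have [measurable]: "?Ew w \<in> sets borel" for w by measurable
 have each: "emeasure lborel (?Ew w) \<le> ennreal ?B" if w: "w \<in> \<Omega>" for w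
 proof -
  have "emeasure lborel (?Ew w) \<le> emeasure lborel ?E" by (intro emeasure_mono) auto
  then have le: "emeasure lborel (?Ew w) \<le> ennreal M" using EM by simp
  then obtain e where e: "emeasure lborel (?Ew w) = ennreal e" "e \<ge> 0" "e \<le> M"
   using M by (cases "emeasure lborel (?Ew w)") (auto simp: top_unique)
  have "e \<le> ?B"
  proof (rule weak_gradient.smooth_level_set[OF weak_gradient_Re[OF \<Omega>(2)[OF w]] \<mu> a _ e(1,3,2)])
   show "\<eta> * h \<le> weak_gradient.smooth (\<lambda>y. Re (w * f y)) a x" if "x \<in> ?Ew w" for x
    using that unfolding smooth_Re[OF \<Omega>(2)[OF w] a] by blast
   show "weak_gradient.energy (\<lambda>y. Re (w * f y)) (\<lambda>j y. Re (w * G j y)) \<mu> \<le> \<sigma>"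
    using energy_Re[OF \<Omega>(2)[OF w], of \<mu>] \<sigma> by simp
  qed (use \<sigma> h \<eta> in auto)
  then show ?thesis using e by (simp add: ennreal_leI)
 qed
 have "?E \<subseteq> (\<Union>w\<in>\<Omega>. ?Ew w)"
 proof
  fix x assume x: "x \<in> ?E"
  obtain w where w: "w \<in> \<Omega>" "\<eta> * norm (heat_conv a f x) \<le> Re (w * heat_conv a f x)" using \<Omega>(3) by blast
  have "\<eta> * h \<le> \<eta> * norm (heat_conv a f x)" using x \<eta> by (intro mult_left_mono) auto
  then have "x \<in> ?Ew w" using w(2) x by (intro CollectI conjI) (simp, rule order_trans)
  then show "x \<in> (\<Union>w\<in>\<Omega>. ?Ew w)" using w(1) by (rule UN_I[rotated])
 qed
 then have "emeasure lborel ?E \<le> emeasure lborel (\<Union>w\<in>\<Omega>. ?Ew w)" using \<Omega>(1) by (intro emeasure_mono) auto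
 also have "... \<le> (\<Sum>w\<in>\<Omega>. emeasure lborel (?Ew w))" using \<Omega>(1) by (intro emeasure_subadditive_finite) auto
 also have "... \<le> (\<Sum>w\<in>\<Omega>. ennreal ?B)" by (intro sum_mono each)
 also have "... = ennreal (real (card \<Omega>) * ?B)"
  using M by (simp add: ennreal_mult ennreal_of_nat_eq_real_of_nat)
 finally show ?thesis .
qed

end

section \<open>Almost everywhere convergence of the heat evolution\<close>

text \<open>Boxes form an intersection-stable generator, so the integrals vanish over every Borel
  subset of a box; the set where \<open>h\<close> is positive supplies such subsets.\<close>

lemma AE_nonpos_of_box_integrals:
 fixes h :: "'a::euclidean_space \<Rightarrow> real"
 assumes [measurable]: "h \<in> borel_measurable borel"
  and int: "\<And>a b. set_integrable lborel (box a b) h" and zero: "\<And>a b. (LINT x:box a b|lborel. h x) = 0"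
 shows "AE x in lborel. h x \<le> 0"
proof -
 have "AE x in lborel. x \<in> box a b --> h x \<le> 0" for a b
 proof -
  have all: "(LINT x:(A \<inter> box a b)|lborel. h x) = 0" if A: "A \<in> sets borel" for A
  proof -
   have "Int_stable (range (\<lambda>(a, b). box a b :: 'a set))" by (auto simp: Int_stable_def box_Int_box)
   moreover have "range (\<lambda>(a, b). box a b :: 'a set) \<subseteq> Pow UNIV" by auto
   moreover have "A \<in> sigma_sets UNIV (range (\<lambda>(a, b). box a b))" using A unfolding borel_eq_box by simp
   ultimately show ?thesis
   proof (induction rule: sigma_sets_induct_disjoint)
    case (basic A)
    then show ?case using zero by (auto simp: box_Int_box)
   next
    case empty
    then show ?case by (simp add: set_lebesgue_integral_def)
   next
    case (compl A)
    have [measurable]: "A \<in> sets borel" using compl by (simp add: borel_eq_box)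
    have i: "set_integrable lborel (A \<inter> box a b) h" "set_integrable lborel ((UNIV - A) \<inter> box a b) h"
     by (rule set_integrable_subset[OF int[of a b]]; auto)+
    have "(LINT x:(A \<inter> box a b) \<union> ((UNIV - A) \<inter> box a b)|lborel. h x) = (LINT x:(A \<inter> box a b)|lborel. h x) + (LINT x:((UNIV - A) \<inter> box a b)|lborel. h x)"
     by (rule set_integral_Un[OF _ i]) auto
    moreover have "(A \<inter> box a b) \<union> ((UNIV - A) \<inter> box a b) = box a b" by auto
    ultimately show ?case using zero compl.IH by simp
   next
    case (union F)
    have [measurable]: "F i \<in> sets borel" for i using union by (auto simp: borel_eq_box)
    have i: "set_integrable lborel (\<Union>i. F i \<inter> box a b) h"
     by (rule set_integrable_subset[OF int[of a b]]) auto
    have "(LINT x:(\<Union>i. F i \<inter> box a b)|lborel. h x) = (\<Sum>i. LINT x:(F i \<inter> box a b)|lborel. h x)"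
     using union by (intro lebesgue_integral_countable_add i) (auto simp: disjoint_family_on_def)
    then show ?case using union.IH by simp
   qed
  qed
  let ?A = "{x. 0 < h x}"
  have [measurable]: "?A \<in> sets borel" by measurable
  have i: "set_integrable lborel (?A \<inter> box a b) h" by (rule set_integrable_subset[OF int[of a b]]) auto
  have "AE x in lborel. indicator (?A \<inter> box a b) x *\<^sub>R h x = 0"
   using all[of ?A] i integral_nonneg_eq_0_iff_AE[of lborel "\<lambda>x. indicator (?A \<inter> box a b) x *\<^sub>R h x"]
   by (auto simp: set_lebesgue_integral_def set_integrable_def indicator_def)
  then show ?thesis by eventually_elim (auto simp: indicator_def split: if_splits)
 qed
 then have "AE x in lborel. \<forall>n::nat. x \<in> box (- (real n *\<^sub>R One)) (real n *\<^sub>R One) --> h x \<le> 0"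
  by (subst AE_all_countable) auto
 then show ?thesis
 proof eventually_elim
  case (elim x)
  have "x \<in> (\<Union>i::nat. box (- (real i *\<^sub>R One)) (real i *\<^sub>R One))" unfolding UN_box_eq_UNIV by simp
  then show ?case using elim by blast
 qed
qed

text \<open>The one-sided real statement is applied to plus and minus the real and imaginary
  parts.\<close>

lemma AE_zero_of_box_integrals:
 fixes h :: "'a::euclidean_space \<Rightarrow> complex"
 assumes [measurable]: "h \<in> borel_measurable borel"
  and int: "\<And>a b. set_integrable lborel (box a b) h" and zero: "\<And>a b. (LINT x:box a b|lborel. h x) = 0"
 shows "AE x in lborel. h x = 0"
proof -
 have le: "AE x in lborel. L (h x) \<le> 0" if L: "bounded_linear L" for L :: "complex \<Rightarrow> real"
 proof (rule AE_nonpos_of_box_integrals)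
  show "(\<lambda>x. L (h x)) \<in> borel_measurable borel"
   by (intro borel_measurable_continuous_on[OF linear_continuous_on[OF L]]) simp
  fix a b :: 'a
  have i: "integrable lborel (\<lambda>x. indicator (box a b) x *\<^sub>R h x)" using int by (simp add: set_integrable_def)
  show "set_integrable lborel (box a b) (\<lambda>x. L (h x))"
   using integrable_bounded_linear[OF L i] unfolding set_integrable_def by (simp add: linear_simps(5)[OF L])
  show "(LINT x:box a b|lborel. L (h x)) = 0"
   using integral_bounded_linear[OF L i] zero[of a b] unfolding set_lebesgue_integral_def
   by (simp add: linear_simps(5)[OF L] linear_simps(3)[OF L])
 qed
 have "AE x in lborel. Re (h x) \<le> 0" "AE x in lborel. - Re (h x) \<le> 0" "AE x in lborel. Im (h x) \<le> 0" "AE x in lborel. - Im (h x) \<le> 0"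
  by (intro le bounded_linear_minus bounded_linear_Re bounded_linear_Im)+
 then show ?thesis by eventually_elim (simp add: complex_eq_iff)
qed

section \<open>The heat flow on indicators of bounded sets\<close>

lemma heat_le_inverse_square:
 assumes "a > 0" "z \<noteq> 0"
 shows "heat a z \<le> 1 / (pi * (norm z)\<^sup>2)"
proof -
 define u where "u = (norm z)\<^sup>2 / (4 * a)"
 have u: "u > 0" using assms by (simp add: u_def)
 have "u \<le> exp u" using exp_ge_add_one_self[of u] by linarith
 then have "exp (- u) \<le> 1 / u" using u by (simp add: exp_minus field_simps)
 then have "exp (- u) / (4 * pi * a) \<le> (1 / u) / (4 * pi * a)" using assms by (intro divide_right_mono) auto
 also have "... = 1 / (pi * (norm z)\<^sup>2)" using assms by (simp add: u_def field_simps)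
 finally show ?thesis by (simp add: heat_def u_def)
qed

text \<open>The bound must not depend on the time. Far from \<open>U\<close> the kernel is at most
  \<open>1 / (pi * (norm z)\<^sup>2)\<close> at all times; near \<open>U\<close> its mass 1
  suffices. As a function of \<open>y\<close> the right side is in L^2, so it gives a dominating
  function when paired with \<open>f\<close>.\<close>

lemma heat_mass_le_decay:
 assumes a: "a > 0" and [measurable]: "U \<in> sets borel" and U: "emeasure lborel U = ennreal m" "m \<ge> 0" "\<And>x. x \<in> U ==> norm x \<le> R" "R \<ge> 0"
 shows "(LINT x|lborel. indicator U x * heat a (y - x)) \<le> (2 + 4 * R\<^sup>2 + 8 * m) * sqrt (decay y)"
  and "integrable lborel (\<lambda>x. indicator U x * heat a (y - x))"
  and "0 \<le> (LINT x|lborel. indicator U x * heat a (y - x))"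
proof -
 let ?W = "LINT x|lborel. indicator U x * heat a (y - x)"
 have ih: "integrable lborel (\<lambda>x. heat a (y - x))" and h1: "(LINT x|lborel. heat a (y - x)) = 1"
  using lborel_integral_reflect[of "heat a" y] integrable_heat[OF a] integral_heat[OF a] by auto
 show i: "integrable lborel (\<lambda>x. indicator U x * heat a (y - x))"
  by (rule Bochner_Integration.integrable_bound[OF ih]) (auto simp: indicator_def)
 show "0 \<le> ?W" using heat_nonneg a by (intro Bochner_Integration.integral_nonneg) auto
 have W1: "?W \<le> 1"
  unfolding h1[symmetric] using heat_nonneg a by (intro integral_mono i ih) (auto simp: indicator_def)
 have sd: "sqrt (decay y) = 1 / (1 + (norm y)\<^sup>2)" by (simp add: decay_def real_sqrt_divide add_nonneg_nonneg)
 have pos: "1 + (norm y)\<^sup>2 > 0" by (simp add: add_pos_nonneg)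
 have "?W * (1 + (norm y)\<^sup>2) \<le> 2 + 4 * R\<^sup>2 + 8 * m"
 proof (cases "norm y \<le> 2 * R \<or> norm y \<le> 1")
  case True
  then have "(norm y)\<^sup>2 \<le> (2 * R)\<^sup>2 \<or> (norm y)\<^sup>2 \<le> 1\<^sup>2" using power_mono[of "norm y" "2 * R" 2] power_mono[of "norm y" 1 2] by fastforce
  then have "(norm y)\<^sup>2 \<le> 4 * R\<^sup>2 \<or> (norm y)\<^sup>2 \<le> 1" by (simp add: power_mult_distrib)
  then have "1 + (norm y)\<^sup>2 \<le> 2 + 4 * R\<^sup>2"
   using zero_le_power2[of R] by linarith
  then have "1 * (1 + (norm y)\<^sup>2) \<le> 2 + 4 * R\<^sup>2 + 8 * m" using U(2) by (simp add: add_increasing2)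
  moreover have "?W * (1 + (norm y)\<^sup>2) \<le> 1 * (1 + (norm y)\<^sup>2)" using W1 pos by (intro mult_right_mono) auto
  ultimately show ?thesis by (rule order_trans[rotated])
 next
  case False
  then have y: "norm y > 2 * R" "norm y > 1" by auto
  then have y0: "norm y > 0" by linarith
  have "?W \<le> (LINT x|lborel. indicator U x * (4 / (pi * (norm y)\<^sup>2)))"
  proof (rule integral_mono[OF i])
   show "integrable lborel (\<lambda>x. indicator U x * (4 / (pi * (norm y)\<^sup>2)))" using U by simp
   fix x
   show "indicator U x * heat a (y - x) \<le> indicator U x * (4 / (pi * (norm y)\<^sup>2))"
   proof (cases "x \<in> U")
    case x: True
    have "norm y \<le> norm (y - x) + norm x" using norm_triangle_ineq[of "y - x" x] by simp
    then have 2: "norm y / 2 \<le> norm (y - x)" using U(3)[OF x] y by linarith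
    then have "norm (y - x) > 0" using y by linarith
    then have "y - x \<noteq> 0" by simp
    then have "heat a (y - x) \<le> 1 / (pi * (norm (y - x))\<^sup>2)" by (rule heat_le_inverse_square[OF a])
    also have "... \<le> 1 / (pi * (norm y / 2)\<^sup>2)"
    proof (rule divide_left_mono)
     show "pi * (norm y / 2)\<^sup>2 \<le> pi * (norm (y - x))\<^sup>2" using 2 by (intro mult_left_mono power_mono) auto
     show "0 < pi * (norm (y - x))\<^sup>2 * (pi * (norm y / 2)\<^sup>2)" by (intro mult_pos_pos zero_less_power divide_pos_pos pi_gt_zero y0 \<open>norm (y - x) > 0\<close> zero_less_numeral)
    qed simp
    also have "... = 4 / (pi * (norm y)\<^sup>2)" by (simp add: power_divide)
    finally show ?thesis using x by simp
   qed simp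
  qed
  also have "... = m * (4 / (pi * (norm y)\<^sup>2))" using U by (simp add: measure_def)
  finally have "?W * (1 + (norm y)\<^sup>2) \<le> m * (4 / (pi * (norm y)\<^sup>2)) * (1 + (norm y)\<^sup>2)" using pos by (intro mult_right_mono) auto
  also have "... \<le> m * (4 / (pi * (norm y)\<^sup>2)) * (2 * (norm y)\<^sup>2)"
  proof (rule mult_left_mono)
   have "1 \<le> (norm y)\<^sup>2" using y by (intro one_le_power) simp
   then show "1 + (norm y)\<^sup>2 \<le> 2 * (norm y)\<^sup>2" by linarith
  qed (use U(2) in simp)
  also have "... = m * (8 / pi)"
  proof -
   have "norm y \<noteq> 0" using y0 by linarith
   then show ?thesis by (simp add: divide_simps)
  qed
  also have "m * (8 / pi) \<le> m * (8 / 1)" using U(2) pi_ge_two by (intro mult_left_mono divide_left_mono) auto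
  also have "m * (8 / 1) = m * 8" by simp
  also have "m * 8 \<le> 2 + 4 * R\<^sup>2 + 8 * m" by (simp add: add_increasing)
  finally show ?thesis .
 qed
 then show "?W \<le> (2 + 4 * R\<^sup>2 + 8 * m) * sqrt (decay y)" unfolding sd using pos by (simp only: pos_le_divide_eq[OF pos] mult_1_right times_divide_eq_right)
qed

text \<open>Off the frontier the indicator is constant near \<open>y\<close>, and the mass that the
  kernel puts at distance at least \<open>r\<close> is controlled by its second moment
  \<open>4 * a n\<close>.\<close>

lemma heat_mass_tendsto:
 assumes [measurable]: "U \<in> sets borel" and y: "y \<notin> frontier U" and a: "\<And>n. a n > 0" "a \<longlonglongrightarrow> 0"
 shows "(\<lambda>n. LINT x|lborel. indicator U x * heat (a n) (y - x)) \<longlonglongrightarrow> indicator U y"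
proof -
 obtain r where r: "r > 0" "\<And>x. norm (y - x) < r ==> indicator U x = (indicator U y :: real)"
 proof (cases "y \<in> U")
  case True
  then have "y \<in> interior U" using y by (auto simp: frontier_def closure_subset[THEN subsetD])
  then obtain r where "r > 0" "ball y r \<subseteq> U" using mem_interior by blast
  then show ?thesis using True by (intro that[of r]) (auto simp: dist_norm subset_eq)
 next
  case False
  then have "y \<in> - closure U" using y interior_subset[of U] by (auto simp: frontier_def)
  then obtain r where "r > 0" "ball y r \<subseteq> - closure U" using open_contains_ball[of "- closure U"] by (auto simp: open_Compl)
  then have "\<And>x. norm (y - x) < r ==> x \<notin> U" using closure_subset[of U] by (auto simp: subset_eq dist_norm)
  then show ?thesis using False \<open>r > 0\<close> by (intro that[of r]) auto
 qed
 have "norm ((LINT x|lborel. indicator U x * heat (a n) (y - x)) - indicator U y) \<le> 4 * a n / r\<^sup>2" for n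
 proof -
  have ih: "integrable lborel (\<lambda>x. heat (a n) (y - x))" and h1: "(LINT x|lborel. heat (a n) (y - x)) = 1"
   using lborel_integral_reflect[of "heat (a n)" y] integrable_heat[OF a(1)] integral_heat[OF a(1)] by auto
  have im: "integrable lborel (\<lambda>x. (norm (y - x))\<^sup>2 * heat (a n) (y - x))" and h2: "(LINT x|lborel. (norm (y - x))\<^sup>2 * heat (a n) (y - x)) = 4 * a n"
   using lborel_integral_reflect[of "\<lambda>z. (norm z)\<^sup>2 * heat (a n) z" y] heat_moments(1,2)[OF a(1)] by auto
  have i: "integrable lborel (\<lambda>x. indicator U x * heat (a n) (y - x))"
   by (rule Bochner_Integration.integrable_bound[OF ih]) (auto simp: indicator_def)
  have i2: "integrable lborel (\<lambda>x. indicator U y * heat (a n) (y - x))" using ih by simp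
  have "(LINT x|lborel. indicator U x * heat (a n) (y - x)) - indicator U y
   = (LINT x|lborel. indicator U x * heat (a n) (y - x)) - (LINT x|lborel. indicator U y * heat (a n) (y - x))" by (simp add: h1)
  also have "... = (LINT x|lborel. indicator U x * heat (a n) (y - x) - indicator U y * heat (a n) (y - x))"
   by (rule Bochner_Integration.integral_diff[OF i i2, symmetric])
  also have "norm ... \<le> (LINT x|lborel. norm (indicator U x * heat (a n) (y - x) - indicator U y * heat (a n) (y - x)))"
   by (rule integral_norm_bound)
  also have "... \<le> (LINT x|lborel. (norm (y - x))\<^sup>2 * heat (a n) (y - x) / r\<^sup>2)"
  proof (rule integral_mono)
   fix x
   have "norm (indicator U x - indicator U y :: real) \<le> (norm (y - x))\<^sup>2 / r\<^sup>2"
   proof (cases "norm (y - x) < r")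
    case True show ?thesis unfolding r(2)[OF True] by simp
   next
    case False
    then have "r\<^sup>2 \<le> (norm (y - x))\<^sup>2" using r(1) by (intro power_mono) auto
    then have "1 \<le> (norm (y - x))\<^sup>2 / r\<^sup>2" using r(1) by simp
    then show ?thesis by (auto simp: indicator_def)
   qed
   then have "norm (indicator U x - indicator U y :: real) * heat (a n) (y - x) \<le> (norm (y - x))\<^sup>2 / r\<^sup>2 * heat (a n) (y - x)"
    using heat_nonneg a(1) by (intro mult_right_mono) (auto simp: less_imp_le)
   moreover have "norm (indicator U x * heat (a n) (y - x) - indicator U y * heat (a n) (y - x)) = norm (indicator U x - indicator U y :: real) * heat (a n) (y - x)"
    unfolding left_diff_distrib[symmetric] norm_mult using heat_nonneg[of "a n"] a(1)[of n] by simp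
   ultimately show "norm (indicator U x * heat (a n) (y - x) - indicator U y * heat (a n) (y - x)) \<le> (norm (y - x))\<^sup>2 * heat (a n) (y - x) / r\<^sup>2"
    by simp
  qed (use i i2 im in auto)
  also have "... = 4 * a n / r\<^sup>2" using h2 by simp
  finally show ?thesis .
 qed
 then have le: "\<forall>\<^sub>F n in sequentially. norm ((LINT x|lborel. indicator U x * heat (a n) (y - x)) - indicator U y) \<le> 4 * a n / r\<^sup>2"
  by (rule always_eventually[OF allI])
 have "(\<lambda>n. 4 * a n / r\<^sup>2) \<longlonglongrightarrow> 4 * 0 / r\<^sup>2" by (intro tendsto_divide tendsto_mult tendsto_const a(2)) (use r(1) in simp)
 then have "(\<lambda>n. 4 * a n / r\<^sup>2) \<longlonglongrightarrow> 0" by (simp only: mult_zero_right div_0)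
 from Lim_null_comparison[OF le this] show ?thesis by (rule LIM_zero_cancel)
qed

context sobolev_pair
begin

text \<open>Fubini moves the heat flow from \<open>f\<close> onto the indicator of the box, where
  the pointwise limit and a dominating function are known.\<close>

lemma heat_conv_box_tendsto:
 assumes a: "\<And>n. a n > 0" "a \<longlonglongrightarrow> 0"
 shows "(\<lambda>n. LINT x:box c d|lborel. heat_conv (a n) f x) \<longlonglongrightarrow> (LINT x:box c d|lborel. f x)"
proof -
 let ?U = "box c d :: (real^2) set"
 let ?W = "\<lambda>n y. LINT x|lborel. indicator ?U x * heat (a n) (y - x)"
 obtain R where R: "R \<ge> 0" "\<And>x. x \<in> ?U ==> norm x \<le> R"
  using bounded_box[of c d] unfolding bounded_pos by (auto intro: less_imp_le)
 define m where "m = measure lborel ?U"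
 have m: "emeasure lborel ?U = ennreal m" "m \<ge> 0"
  using emeasure_lborel_box_finite[of c d] by (simp_all add: m_def emeasure_eq_ennreal_measure less_top)
 have Um: "?U \<in> sets borel" by simp
 note W = heat_mass_le_decay[OF a(1) Um m R(2,1)]
 have eq: "(LINT x:?U|lborel. heat_conv (a n) f x) = (LINT y|lborel. f y * of_real (?W n y))" for n
 proof -
  have meas: "(\<lambda>(x, y). indicator ?U x *\<^sub>R (f y * of_real (heat (a n) (y - x)))) \<in> borel_measurable (lborel \<Otimes>\<^sub>M lborel)" by measurable
  have fin: "(\<integral>\<^sup>+x. \<integral>\<^sup>+y. ennreal (norm (indicator ?U x *\<^sub>R (f y * of_real (heat (a n) (y - x))))) \<partial>lborel \<partial>lborel) < \<infinity>"
  proof -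
   have b: "(\<integral>\<^sup>+y. ennreal (norm (indicator ?U x *\<^sub>R (f y * of_real (heat (a n) (y - x))))) \<partial>lborel) \<le> (ennreal M + ennreal (1 / (8 * pi * a n))) * indicator ?U x" for x
   proof (cases "x \<in> ?U")
    case True
    have "(\<integral>\<^sup>+y. ennreal (norm (indicator ?U x *\<^sub>R (f y * of_real (heat (a n) (y - x))))) \<partial>lborel)
     \<le> (\<integral>\<^sup>+y. ennreal ((norm (f y))\<^sup>2) + ennreal ((heat (a n) (y - x))\<^sup>2) \<partial>lborel)"
    proof (intro nn_integral_mono)
     fix y
     let ?p = "norm (f y)" and ?q = "heat (a n) (y - x)"
     have "?p * \<bar>?q\<bar> \<le> ?p\<^sup>2 + ?q\<^sup>2"
     proof -
      have "2 * (?p * \<bar>?q\<bar>) \<le> ?p\<^sup>2 + ?q\<^sup>2" using sum_squares_bound[of ?p "\<bar>?q\<bar>"] by (simp add: mult.assoc)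
      moreover have "0 \<le> ?p * \<bar>?q\<bar>" by simp
      ultimately show ?thesis by linarith
     qed
     then show "ennreal (norm (indicator ?U x *\<^sub>R (f y * of_real ?q))) \<le> ennreal (?p\<^sup>2) + ennreal (?q\<^sup>2)"
      using True by (simp add: norm_mult ennreal_leI flip: ennreal_plus)
    qed
    also have "... = ennreal M + (\<integral>\<^sup>+y. ennreal ((heat (a n) (y - x))\<^sup>2) \<partial>lborel)"
     by (subst nn_integral_add) (auto simp: f2)
    also have "... \<le> ennreal M + ennreal (1 / (8 * pi * a n))"
     using heat_sq_le[OF a(1) order_refl] by (intro add_left_mono)
    finally show ?thesis using True by simp
   qed simp
   have "(\<integral>\<^sup>+x. \<integral>\<^sup>+y. ennreal (norm (indicator ?U x *\<^sub>R (f y * of_real (heat (a n) (y - x))))) \<partial>lborel \<partial>lborel) \<le> (ennreal M + ennreal (1 / (8 * pi * a n))) * emeasure lborel ?U"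
    by (rule order_trans[OF nn_integral_mono[OF b]]) (simp add: nn_integral_cmult_indicator)
   also have "... < \<infinity>" unfolding m by (simp add: ennreal_mult_less_top)
   finally show ?thesis .
  qed
  have "(LINT x:?U|lborel. heat_conv (a n) f x) = (LINT x|lborel. LINT y|lborel. indicator ?U x *\<^sub>R (f y * of_real (heat (a n) (y - x))))"
   by (simp add: set_lebesgue_integral_def heat_conv_def)
  also have "... = (LINT y|lborel. LINT x|lborel. indicator ?U x *\<^sub>R (f y * of_real (heat (a n) (y - x))))"
   by (rule Fubini_swap_eq[OF _ _ meas fin]) (auto intro: lborel.sigma_finite_measure_axioms)
  also have "... = (LINT y|lborel. f y * of_real (?W n y))"
  proof (intro Bochner_Integration.integral_cong refl)
   fix y
   have "(LINT x|lborel. indicator ?U x *\<^sub>R (f y * of_real (heat (a n) (y - x)))) = (LINT x|lborel. f y * of_real (indicator ?U x * heat (a n) (y - x)))"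
    by (intro Bochner_Integration.integral_cong refl) (auto simp: indicator_def)
   then show "(LINT x|lborel. indicator ?U x *\<^sub>R (f y * of_real (heat (a n) (y - x)))) = f y * of_real (?W n y)"
    by (simp only: integral_mult_right_zero integral_complex_of_real)
  qed
  finally show ?thesis .
 qed
 let ?C = "2 + 4 * R\<^sup>2 + 8 * m"
 have "(\<lambda>n. LINT y|lborel. f y * of_real (?W n y)) \<longlonglongrightarrow> (LINT y|lborel. f y * of_real (indicator ?U y))"
 proof (rule integral_dominated_convergence[where w="\<lambda>y. norm (f y) * (?C * sqrt (decay y))"])
  show "integrable lborel (\<lambda>y. norm (f y) * (?C * sqrt (decay y)))"
  proof (rule L2_product_integrable)
   have "(\<integral>\<^sup>+y. ennreal ((?C * sqrt (decay y))\<^sup>2) \<partial>lborel) = (\<integral>\<^sup>+y. ennreal (norm (?C\<^sup>2 * decay y)) \<partial>lborel)"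
    using decay_pos by (intro nn_integral_cong) (simp add: power_mult_distrib less_imp_le)
   also have "... < \<infinity>"
   proof -
    have "integrable lborel (\<lambda>y. ?C\<^sup>2 * decay y)" by (intro integrable_mult_right integrable_decay)
    then show ?thesis by (simp only: integrable_iff_bounded)
   qed
   finally show "(\<integral>\<^sup>+y. ennreal ((?C * sqrt (decay y))\<^sup>2) \<partial>lborel) < \<infinity>" .
  qed (auto simp: f2)
  \<comment> \<open>A box is convex, so its frontier is negligible and the pointwise limit holds
    almost everywhere.\<close>
  have "frontier ?U \<in> null_sets lebesgue" using negligible_convex_frontier[OF convex_box(2)[of c d]] by (simp add: negligible_iff_null_sets)
  then have "AE y in lborel. y \<notin> frontier ?U"
   using AE_not_in[of "frontier ?U" lebesgue] by (simp add: AE_completion_iff)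
  then show "AE y in lborel. (\<lambda>n. f y * of_real (?W n y)) \<longlonglongrightarrow> f y * of_real (indicator ?U y)"
   by eventually_elim (intro tendsto_intros heat_mass_tendsto Um a)
  show "AE y in lborel. norm (f y * of_real (?W n y)) \<le> norm (f y) * (?C * sqrt (decay y))" for n
   using W(1,3)[of n] by (intro always_eventually allI) (simp add: norm_mult mult_left_mono)
 qed measurable
 moreover have "(LINT y|lborel. f y * of_real (indicator ?U y)) = (LINT x:?U|lborel. f x)"
  unfolding set_lebesgue_integral_def by (intro Bochner_Integration.integral_cong) (auto simp: indicator_def)
 ultimately show ?thesis unfolding eq by simp
qed

text \<open>\<open>heat_conv_difference\<close> makes the sequence Cauchy at every point, so only
  the limit has to be identified; integrals over boxes show that it is \<open>f\<close>.\<close>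

lemma heat_conv_tendsto_AE:
 "AE x in lborel. (\<lambda>n. heat_conv (1 / Suc n) f x) \<longlonglongrightarrow> f x"
proof -
 define a where "a n = 1 / real (Suc n)" for n
 have a: "a n > 0" "a \<longlonglongrightarrow> 0" for n
  unfolding a_def using LIMSEQ_Suc[OF lim_1_over_n] by (auto simp: inverse_eq_divide)
 let ?K = "12 * kernel_const * \<gamma>"
 have K: "?K \<ge> 0" using kernel_const_nonneg \<gamma> by simp
 define F0 where "F0 x = lim (\<lambda>n. heat_conv (a n) f x)" for x
 have conv: "(\<lambda>n. heat_conv (a n) f x) \<longlonglongrightarrow> F0 x" for x
 proof -
  have diff: "norm (heat_conv (a m) f x - heat_conv (a n) f x) \<le> ?K * a m powr (1/4)" if "m < n" for m n
   by (rule heat_conv_difference) (use that a in \<open>auto simp: a_def frac_less2\<close>)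
  have t0: "(\<lambda>n. ?K * a n powr (1/4)) \<longlonglongrightarrow> 0"
   by (rule tendsto_mult_right_zero, rule tendsto_zero_powrI[OF a(2) tendsto_const]) (use a(1) in \<open>auto intro!: always_eventually less_imp_le\<close>)
  have "Cauchy (\<lambda>n. heat_conv (a n) f x)"
  proof (rule metric_CauchyI)
   fix e :: real assume e: "e > 0"
   from order_tendstoD(2)[OF t0, of "e / 2"] e obtain k where k: "\<And>n. n \<ge> k ==> ?K * a n powr (1/4) < e / 2"
    by (auto simp: eventually_sequentially)
   have "norm (heat_conv (a k) f x - heat_conv (a n) f x) < e / 2" if "n \<ge> k" for n
    using diff[of k n] k[of k] that e by (cases "n = k") auto
   then have *: "dist (heat_conv (a k) f x) (heat_conv (a n) f x) < e / 2" if "n \<ge> k" for n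
    using that by (simp add: dist_norm)
   show "\<exists>k. \<forall>m\<ge>k. \<forall>n\<ge>k. dist (heat_conv (a m) f x) (heat_conv (a n) f x) < e"
    using dist_triangle_half_r[OF * *] by blast
  qed
  then show ?thesis unfolding F0_def by (simp add: Cauchy_convergent_iff convergent_LIMSEQ_iff)
 qed
 have [measurable]: "F0 \<in> borel_measurable borel"
  by (rule borel_measurable_LIMSEQ_metric[OF _ conv]) measurable
 let ?B = "(kernel_const + sqrt pi) * \<gamma>"
 have F0B: "norm (F0 x) \<le> ?B" for x
  by (rule Lim_bounded[OF tendsto_norm[OF conv], of 0]) (simp add: heat_conv_sup a)
 have "AE x in lborel. F0 x - f x = 0"
 proof (rule AE_zero_of_box_integrals)
  fix c d :: "real^2"
  have ib: "integrable lborel (\<lambda>x. indicator (box c d) x * B :: real)" for B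
   by (simp add: emeasure_lborel_box_eq)
  have i0: "set_integrable lborel (box c d) F0"
   unfolding set_integrable_def
   by (rule Bochner_Integration.integrable_bound[OF ib[of ?B]]) (use F0B in \<open>auto simp: indicator_def abs_of_nonneg[OF order_trans[OF norm_ge_zero F0B]]\<close>)
  have i1: "set_integrable lborel (box c d) f"
  proof -
   have "integrable lborel (\<lambda>y. f y * of_real (indicator (box c d) y))"
   proof (rule complex_L2_product_integrable)
    have "(\<integral>\<^sup>+y. ennreal ((indicator (box c d) y)\<^sup>2) \<partial>lborel) = (\<integral>\<^sup>+y. indicator (box c d) y \<partial>lborel)"
     by (intro nn_integral_cong) (auto simp: indicator_def)
    then show "(\<integral>\<^sup>+y. ennreal ((indicator (box c d) y)\<^sup>2) \<partial>lborel) < \<infinity>" by (simp add: emeasure_lborel_box_eq)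
   qed (auto simp: f2)
   moreover have "(\<lambda>y. f y * of_real (indicator (box c d) y)) = (\<lambda>y. indicator (box c d) y *\<^sub>R f y)" by (auto simp: indicator_def)
   ultimately show ?thesis by (simp add: set_integrable_def)
  qed
  show "set_integrable lborel (box c d) (\<lambda>x. F0 x - f x)" using i0 i1 by simp
  have "(\<lambda>n. LINT x:box c d|lborel. heat_conv (a n) f x) \<longlonglongrightarrow> (LINT x:box c d|lborel. F0 x)"
   unfolding set_lebesgue_integral_def
  proof (rule integral_dominated_convergence[where w="\<lambda>x. indicator (box c d) x * ?B"])
   show "AE x in lborel. (\<lambda>n. indicator (box c d) x *\<^sub>R heat_conv (a n) f x) \<longlonglongrightarrow> indicator (box c d) x *\<^sub>R F0 x"
    by (intro always_eventually allI tendsto_intros conv)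
   show "AE x in lborel. norm (indicator (box c d) x *\<^sub>R heat_conv (a n) f x) \<le> indicator (box c d) x * ?B" for n
    by (intro always_eventually allI) (simp add: heat_conv_sup a mult_left_mono)
  qed (use ib in \<open>auto\<close>)
  moreover have "(\<lambda>n. LINT x:box c d|lborel. heat_conv (a n) f x) \<longlonglongrightarrow> (LINT x:box c d|lborel. f x)"
   by (rule heat_conv_box_tendsto) (rule a)+
  ultimately have "(LINT x:box c d|lborel. F0 x) = (LINT x:box c d|lborel. f x)" by (rule LIMSEQ_unique)
  then show "(LINT x:box c d|lborel. F0 x - f x) = 0" using i0 i1 by simp
 qed measurable
 then show ?thesis
 proof eventually_elim
  case (elim x)
  then show ?case using conv[of x] by (simp add: a_def)
 qed
qed

end

section \<open>The estimate at a fixed time\<close>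

text \<open>The inequality \<open>ln y \<le> y\<close> at \<open>y = F\<^sup>2 * k\<close> with
  \<open>k = 2 * c / r\<close>. It trades a power of the modulus for an arbitrarily small share of
  the exponential.\<close>

lemma powr_le_exp_square:
 fixes F r c :: real
 assumes "F > 0" "r > 0" "c > 0"
 shows "F powr r \<le> exp (- (r / 2) * ln (2 * c / r)) * exp (c * F\<^sup>2)"
proof -
 define k where "k = 2 * c / r"
 have k: "k > 0" "r / 2 * k = c" using assms by (auto simp: k_def)
 have "ln (F\<^sup>2 * k) \<le> F\<^sup>2 * k" using ln_le_minus_one[of "F\<^sup>2 * k"] assms k by simp
 moreover have "ln (F\<^sup>2 * k) = 2 * ln F + ln k" using assms k by (simp add: ln_mult ln_realpow)
 ultimately have "r / 2 * (2 * ln F) \<le> r / 2 * (F\<^sup>2 * k - ln k)" using assms by (intro mult_left_mono) auto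
 also have "... = - (r / 2) * ln k + (r / 2 * k) * F\<^sup>2" by (simp add: algebra_simps)
 finally have "r * ln F \<le> - (r / 2) * ln k + c * F\<^sup>2" unfolding k(2) by simp
 then have "exp (r * ln F) \<le> exp (- (r / 2) * ln k + c * F\<^sup>2)" by (subst exp_le_cancel_iff)
 then show ?thesis using assms(1) unfolding exp_add k_def powr_def by simp
qed

context sobolev_pair
begin

text \<open>A sum over the levels \<open>sqrt (k + 1)\<close>. In units of 4\<pi>, the integrand
  carries the exponent \<open>1 - \<delta>\<close>, the power costs a further
  \<open>\<delta> / 2\<close>, and the tail supplies \<open>1 - \<delta> / 4\<close>. The surplus
  \<open>\<delta> / 4\<close> leaves a geometric series of ratio
  \<open>exp (- (pi * \<delta>))\<close>. Below level 1 the mass is enough because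
  \<open>r \<ge> 2\<close>.\<close>

lemma heat_conv_exp_integral:
 assumes \<mu>: "\<mu> > 0" and a: "a > 0" and \<delta>: "0 < \<delta>" "\<delta> < 1" and \<sigma>: "\<mu>\<^sup>2 * M + N \<le> 1 + \<delta> / 8"
  and \<Omega>: "finite \<Omega>" "\<And>w. w \<in> \<Omega> ==> norm w = 1" "\<And>z. \<exists>w\<in>\<Omega>. (1 - \<delta> / 16) * norm z \<le> Re (w * z)" and r: "r \<ge> 2"
 shows "(\<integral>\<^sup>+x. ennreal (norm (heat_conv a f x) powr r * exp (4 * pi * (1 - \<delta>) * (norm (heat_conv a f x))\<^sup>2)) \<partial>lborel)
  \<le> ennreal (exp (4 * pi) * M + exp (- (r / 2) * ln (2 * (2 * pi * \<delta>) / r)) * (real (card \<Omega>) * ((4 * pi + M) * exp (1 + 1 / \<mu>\<^sup>2))) * exp (4 * pi) / (1 - exp (- (pi * \<delta>))))"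
proof -
 define F where "F x = norm (heat_conv a f x)" for x
 have F0: "F x \<ge> 0" for x by (simp add: F_def)
 have [measurable]: "F \<in> borel_measurable borel" unfolding F_def by measurable
 define R where "R = exp (- (r / 2) * ln (2 * (2 * pi * \<delta>) / r))"
 define D where "D = real (card \<Omega>) * ((4 * pi + M) * exp (1 + 1 / \<mu>\<^sup>2))"
 define \<nu> where "\<nu> = 1 - \<delta> / 2"
 define q where "q = exp (- (pi * \<delta>))"
 define T where "T k = R * exp (4 * pi * \<nu> * (real k + 2))" for k :: nat
 have R: "R \<ge> 0" and D: "D \<ge> 0" using M by (auto simp: R_def D_def)
 have T: "T k \<ge> 0" for k using R by (simp add: T_def)
 have q: "0 \<le> q" "q < 1" using \<delta> by (auto simp: q_def)
 have \<nu>: "0 \<le> \<nu>" "\<nu> \<le> 1" using \<delta> by (auto simp: \<nu>_def)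
 let ?S = "\<lambda>k::nat. {x. sqrt (real (Suc k)) \<le> F x}"
 have [measurable]: "?S k \<in> sets borel" for k by measurable
 have pt: "ennreal (F x powr r * exp (4 * pi * (1 - \<delta>) * (F x)\<^sup>2)) \<le> ennreal (exp (4 * pi)) * ennreal ((F x)\<^sup>2) + (\<Sum>k. ennreal (T k) * indicator (?S k) x)" for x
 proof (cases "F x < 1")
  case True
  have "F x powr r \<le> (F x)\<^sup>2"
  proof (cases "F x = 0")
   case False
   then have "F x powr r \<le> F x powr 2" using True F0[of x] r by (intro powr_mono') auto
   then show ?thesis using F0[of x] False by simp
  qed simp
  moreover have "exp (4 * pi * (1 - \<delta>) * (F x)\<^sup>2) \<le> exp (4 * pi)"
  proof -
   have "(1 - \<delta>) * (F x)\<^sup>2 \<le> 1 * 1" using \<delta> True F0[of x] by (intro mult_mono power_le_one) auto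
   then have "4 * pi * ((1 - \<delta>) * (F x)\<^sup>2) \<le> 4 * pi * 1" by (intro mult_left_mono) auto
   then show ?thesis by (simp add: mult.assoc)
  qed
  ultimately have "F x powr r * exp (4 * pi * (1 - \<delta>) * (F x)\<^sup>2) \<le> (F x)\<^sup>2 * exp (4 * pi)" by (intro mult_mono) auto
  then have "ennreal (F x powr r * exp (4 * pi * (1 - \<delta>) * (F x)\<^sup>2)) \<le> ennreal (exp (4 * pi)) * ennreal ((F x)\<^sup>2)"
   by (subst ennreal_mult[symmetric]) (auto intro: ennreal_leI simp: mult.commute)
  then show ?thesis by (rule order_trans) simp
 next
  case False
  then have F1: "1 \<le> F x" by simp
  \<comment> \<open>Shifted by one so that the lowest level is 1; the squared modulus then lies
    between \<open>k + 1\<close> and \<open>k + 2\<close>.\<close>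
  define k where "k = nat \<lfloor>(F x)\<^sup>2\<rfloor> - 1"
  have "1 \<le> (F x)\<^sup>2" using F1 by (simp add: one_le_power)
  then have k: "real (Suc k) \<le> (F x)\<^sup>2" "(F x)\<^sup>2 \<le> real k + 2" unfolding k_def by linarith+
  have "F x powr r * exp (4 * pi * (1 - \<delta>) * (F x)\<^sup>2) \<le> (R * exp (2 * pi * \<delta> * (F x)\<^sup>2)) * exp (4 * pi * (1 - \<delta>) * (F x)\<^sup>2)"
   unfolding R_def using F1 r \<delta> by (intro mult_right_mono powr_le_exp_square) auto
  also have "... = R * exp (4 * pi * \<nu> * (F x)\<^sup>2)"
   by (simp add: mult_exp_exp \<nu>_def mult.assoc algebra_simps)
  also have "... \<le> T k"
   unfolding T_def using k(2) \<nu> R by (intro mult_left_mono) (auto intro!: mult_left_mono)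
  finally have "ennreal (F x powr r * exp (4 * pi * (1 - \<delta>) * (F x)\<^sup>2)) \<le> ennreal (T k)" by (rule ennreal_leI)
  also have "... = ennreal (T k) * indicator (?S k) x"
  proof -
   have "sqrt (real (Suc k)) \<le> F x" using k(1) F0[of x] real_le_lsqrt[of "F x" "real (Suc k)"] by (simp add: real_le_lsqrt)
   then show ?thesis by simp
  qed
  also have "... \<le> (\<Sum>k. ennreal (T k) * indicator (?S k) x)"
  proof -
   have "u k \<le> (\<Sum>k. u k)" for u :: "nat \<Rightarrow> ennreal" using sum_le_suminf[of u "{k}"] by simp
   then show ?thesis .
  qed
  finally show ?thesis by (rule order_trans) simp
 qed
 have lev: "ennreal (T k) * emeasure lborel (?S k) \<le> ennreal (R * D * exp (4 * pi) * q ^ k)" for k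
 proof -
  have "emeasure lborel (?S k) \<le> ennreal (real (card \<Omega>) * ((4 * pi + M) * exp (1 + 1 / \<mu>\<^sup>2) * exp (- (4 * pi * ((1 - \<delta> / 16) * sqrt (real (Suc k)))\<^sup>2 / (1 + \<delta> / 8)))))"
   unfolding F_def by (rule heat_conv_level_set[OF \<mu> a \<sigma> _ _ _ \<Omega>]) (use \<delta> in auto)
  also have "... = ennreal (D * exp (- (4 * pi * ((1 - \<delta> / 16)\<^sup>2 * real (Suc k)) / (1 + \<delta> / 8))))"
   by (simp add: D_def power_mult_distrib mult.assoc)
  also have "... \<le> ennreal (D * exp (- ((4 * pi * \<nu> + pi * \<delta>) * real (Suc k))))"
  proof (intro ennreal_leI mult_left_mono D, subst exp_le_cancel_iff)
   \<comment> \<open>The finite set of directions costs the square of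
     \<open>1 - \<delta> / 16\<close> and the energy a factor \<open>1 + \<delta> / 8\<close>;
     together they take at most \<open>\<delta> / 4\<close> from the exponent.\<close>
   have "(1 - \<delta> / 4) * (1 + \<delta> / 8) \<le> (1 - \<delta> / 16)\<^sup>2"
    using \<delta> by (simp add: power2_eq_square algebra_simps)
   then have "(1 - \<delta> / 4) \<le> (1 - \<delta> / 16)\<^sup>2 / (1 + \<delta> / 8)" using \<delta> by (simp add: pos_le_divide_eq)
   then have "4 * pi * real (Suc k) * (1 - \<delta> / 4) \<le> 4 * pi * real (Suc k) * ((1 - \<delta> / 16)\<^sup>2 / (1 + \<delta> / 8))"
    by (intro mult_left_mono) auto
   moreover have "(4 * pi * \<nu> + pi * \<delta>) * real (Suc k) = 4 * pi * real (Suc k) * (1 - \<delta> / 4)"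
    by (simp add: \<nu>_def algebra_simps)
   moreover have "4 * pi * ((1 - \<delta> / 16)\<^sup>2 * real (Suc k)) / (1 + \<delta> / 8) = 4 * pi * real (Suc k) * ((1 - \<delta> / 16)\<^sup>2 / (1 + \<delta> / 8))"
    by (simp only: times_divide_eq_right mult_ac)
   ultimately show "- (4 * pi * ((1 - \<delta> / 16)\<^sup>2 * real (Suc k)) / (1 + \<delta> / 8)) \<le> - ((4 * pi * \<nu> + pi * \<delta>) * real (Suc k))"
    by (simp only: neg_le_iff_le)
  qed
  finally have "ennreal (T k) * emeasure lborel (?S k) \<le> ennreal (T k) * ennreal (D * exp (- ((4 * pi * \<nu> + pi * \<delta>) * real (Suc k))))"
   by (intro mult_left_mono) auto
  also have "... = ennreal (T k * (D * exp (- ((4 * pi * \<nu> + pi * \<delta>) * real (Suc k)))))"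
   using T by (intro ennreal_mult'[symmetric])
  also have "... \<le> ennreal (R * D * exp (4 * pi) * q ^ k)"
  proof (rule ennreal_leI)
   have "T k * (D * exp (- ((4 * pi * \<nu> + pi * \<delta>) * real (Suc k)))) = R * D * exp (4 * pi * \<nu> * (real k + 2) - (4 * pi * \<nu> + pi * \<delta>) * real (Suc k))"
    by (simp add: T_def exp_diff exp_minus divide_inverse mult_ac)
   also have "... \<le> R * D * exp (4 * pi + real k * (- (pi * \<delta>)))"
   proof (intro mult_left_mono, subst exp_le_cancel_iff)
    have "4 * pi * \<nu> * (real k + 2) - (4 * pi * \<nu> + pi * \<delta>) * real (Suc k) = 4 * (pi * \<nu>) - pi * \<delta> + real k * (- (pi * \<delta>))"
     by (simp add: algebra_simps)
    moreover have "pi * \<nu> \<le> pi * 1" using \<nu> by (intro mult_left_mono) auto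
    moreover have "0 \<le> pi * \<delta>" using \<delta> by simp
    ultimately show "4 * pi * \<nu> * (real k + 2) - (4 * pi * \<nu> + pi * \<delta>) * real (Suc k) \<le> 4 * pi + real k * (- (pi * \<delta>))"
     by linarith
   qed (use R D in simp)
   also have "... = R * D * exp (4 * pi) * q ^ k"
    unfolding q_def exp_add exp_of_nat_mult by (simp add: mult.assoc)
   finally show "T k * (D * exp (- ((4 * pi * \<nu> + pi * \<delta>) * real (Suc k)))) \<le> R * D * exp (4 * pi) * q ^ k" .
  qed
  finally show ?thesis .
 qed
 have "(\<integral>\<^sup>+x. ennreal (F x powr r * exp (4 * pi * (1 - \<delta>) * (F x)\<^sup>2)) \<partial>lborel)
  \<le> (\<integral>\<^sup>+x. ennreal (exp (4 * pi)) * ennreal ((F x)\<^sup>2) + (\<Sum>k. ennreal (T k) * indicator (?S k) x) \<partial>lborel)"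
  by (intro nn_integral_mono pt)
 also have "... = ennreal (exp (4 * pi)) * (\<integral>\<^sup>+x. ennreal ((F x)\<^sup>2) \<partial>lborel) + (\<Sum>k. \<integral>\<^sup>+x. ennreal (T k) * indicator (?S k) x \<partial>lborel)"
  by (subst nn_integral_add, measurable) (subst nn_integral_cmult, measurable, subst nn_integral_suminf, auto)
 also have "... \<le> ennreal (exp (4 * pi)) * ennreal M + (\<Sum>k. ennreal (R * D * exp (4 * pi) * q ^ k))"
 proof (intro add_mono mult_left_mono suminf_le)
  show "(\<integral>\<^sup>+x. ennreal ((F x)\<^sup>2) \<partial>lborel) \<le> ennreal M" unfolding F_def by (rule heat_conv_L2[OF a])
  show "(\<integral>\<^sup>+x. ennreal (T k) * indicator (?S k) x \<partial>lborel) \<le> ennreal (R * D * exp (4 * pi) * q ^ k)" for k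
   using lev[of k] by (subst nn_integral_cmult_indicator) auto
 qed auto
 also have "(\<Sum>k. ennreal (R * D * exp (4 * pi) * q ^ k)) = ennreal (R * D * exp (4 * pi) * (1 / (1 - q)))"
  using R D q by (intro suminf_ennreal_eq sums_mult geometric_sums) auto
 also have "ennreal (exp (4 * pi)) * ennreal M + ennreal (R * D * exp (4 * pi) * (1 / (1 - q))) = ennreal (exp (4 * pi) * M + R * D * exp (4 * pi) / (1 - q))"
  using R D q M by (simp add: ennreal_mult[symmetric] flip: ennreal_plus)
 finally show ?thesis unfolding F_def R_def D_def q_def .
qed

text \<open>For \<open>\<gamma> \<le> 1\<close> the exponential is bounded. Four powers of the
  modulus go into the L^4 bound and the others into the sup bound \<open>K * \<gamma>\<close>, which
  gives \<gamma> to the power \<open>s * Q\<close>. As \<open>s \<ge> 4\<close> this exponent is at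
  least \<open>4 * Q / P\<close>, and lowering it is allowed because
  \<open>\<gamma> \<le> 1\<close>.\<close>

lemma heat_conv_estimate_small:
 assumes a: "a > 0" and s: "s \<ge> 4" and P: "P \<ge> 1" and Q: "Q \<ge> 1" and \<gamma>1: "\<gamma> \<le> 1"
 shows "(\<integral>\<^sup>+x. ennreal (norm (heat_conv a f x) powr (s * Q) * exp (4 * pi * Q * (norm (heat_conv a f x))\<^sup>2)) \<partial>lborel)
  \<le> ennreal ((kernel_const + sqrt pi) powr (s * Q - 4) * exp (4 * pi * Q * (kernel_const + sqrt pi)\<^sup>2) * \<gamma> powr (4 * Q / P))"
proof -
 define F where "F x = norm (heat_conv a f x)" for x
 define K where "K = kernel_const + sqrt pi"
 have F0: "F x \<ge> 0" for x by (simp add: F_def)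
 have [measurable]: "F \<in> borel_measurable borel" unfolding F_def by measurable
 have K: "K > 0" using kernel_const_nonneg by (simp add: K_def add_nonneg_pos)
 have FK: "F x \<le> K * \<gamma>" for x unfolding F_def K_def by (rule heat_conv_sup[OF a])
 have "4 * 1 \<le> s * Q" using s Q by (intro mult_mono) auto
 then have sQ: "s * Q \<ge> 4" by simp
 have "4 * Q / P \<le> 4 * Q / 1" using P Q by (intro divide_left_mono) auto
 also have "... \<le> s * Q" using s Q by simp
 finally have PQ: "4 * Q / P \<le> s * Q" .
 let ?c = "(K * \<gamma>) powr (s * Q - 4) * exp (4 * pi * Q * K\<^sup>2)"
 have pt: "F x powr (s * Q) * exp (4 * pi * Q * (F x)\<^sup>2) \<le> ?c * F x ^ 4" for x
 proof (cases "F x = 0")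
  case False
  then have Fx: "F x > 0" using F0[of x] by simp
  have "F x powr (s * Q) = F x powr ((s * Q - 4) + 4)" by simp
  also have "... = F x powr (s * Q - 4) * F x ^ 4" using Fx unfolding powr_add by simp
  also have "F x powr (s * Q - 4) * F x ^ 4 \<le> (K * \<gamma>) powr (s * Q - 4) * F x ^ 4"
   using FK[of x] F0[of x] sQ by (intro mult_right_mono powr_mono2) auto
  finally have 1: "F x powr (s * Q) \<le> (K * \<gamma>) powr (s * Q - 4) * F x ^ 4" .
  have "F x \<le> K" using FK[of x] K mult_left_mono[OF \<gamma>1, of K] by linarith
  then have "4 * pi * Q * (F x)\<^sup>2 \<le> 4 * pi * Q * K\<^sup>2" using F0[of x] Q by (intro mult_left_mono power_mono) auto
  then have 2: "exp (4 * pi * Q * (F x)\<^sup>2) \<le> exp (4 * pi * Q * K\<^sup>2)" by simp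
  have "F x powr (s * Q) * exp (4 * pi * Q * (F x)\<^sup>2) \<le> ((K * \<gamma>) powr (s * Q - 4) * F x ^ 4) * exp (4 * pi * Q * K\<^sup>2)"
   using F0[of x] by (intro mult_mono 1 2) auto
  then show ?thesis by (simp only: mult_ac)
 qed simp
 have "(\<integral>\<^sup>+x. ennreal (F x powr (s * Q) * exp (4 * pi * Q * (F x)\<^sup>2)) \<partial>lborel) \<le> (\<integral>\<^sup>+x. ennreal ?c * ennreal (F x ^ 4) \<partial>lborel)"
 proof (intro nn_integral_mono)
  fix x
  show "ennreal (F x powr (s * Q) * exp (4 * pi * Q * (F x)\<^sup>2)) \<le> ennreal ?c * ennreal (F x ^ 4)"
   using ennreal_leI[OF pt[of x]] by (simp add: ennreal_mult')
 qed
 also have "... = ennreal ?c * (\<integral>\<^sup>+x. ennreal (F x ^ 4) \<partial>lborel)" by (rule nn_integral_cmult) measurable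
 also have "... \<le> ennreal ?c * ennreal (\<gamma> ^ 4)" unfolding F_def by (intro mult_left_mono heat_conv_L4[OF a]) simp
 also have "... = ennreal (?c * \<gamma> ^ 4)" by (intro ennreal_mult'[symmetric]) simp
 also have "... \<le> ennreal (K powr (s * Q - 4) * exp (4 * pi * Q * K\<^sup>2) * \<gamma> powr (4 * Q / P))"
 proof (cases "\<gamma> = 0")
  case False
  then have g0: "\<gamma> > 0" using \<gamma> by simp
  have "?c * \<gamma> ^ 4 = K powr (s * Q - 4) * exp (4 * pi * Q * K\<^sup>2) * (\<gamma> powr (s * Q - 4) * \<gamma> powr 4)"
   using K g0 by (simp add: powr_mult mult_ac)
  also have "\<gamma> powr (s * Q - 4) * \<gamma> powr 4 = \<gamma> powr (s * Q)" unfolding powr_add[symmetric] by simp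
  also have "K powr (s * Q - 4) * exp (4 * pi * Q * K\<^sup>2) * \<gamma> powr (s * Q) \<le> K powr (s * Q - 4) * exp (4 * pi * Q * K\<^sup>2) * \<gamma> powr (4 * Q / P)"
   using PQ g0 \<gamma>1 by (intro mult_left_mono powr_mono') auto
  finally show ?thesis by (rule ennreal_leI)
 qed simp
 finally show ?thesis by (simp only: F_def K_def)
qed

text \<open>The square \<open>(1 + \<delta>)\<^sup>2\<close> in the hypothesis on \<open>e\<close>
  collects two losses: the energy is bounded only by \<open>1 + \<delta> / 8\<close>, and separating
  the smoothing error costs another factor. The time \<open>a\<close> is arbitrary below
  \<open>1 / \<gamma> ^ 4\<close>, so the bound survives the limit of small times.\<close>

lemma heat_conv_estimate_large:
 assumes a: "a > 0" "a * \<gamma> ^ 4 < 1" and Q: "Q \<ge> 1" and \<gamma>1: "\<gamma> \<ge> 1" and \<mu>: "\<mu> > 0" and \<delta>: "0 < \<delta>" "\<delta> < 1"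
  and \<sigma>: "\<mu>\<^sup>2 * M + N \<le> 1 + \<delta> / 8" and PQ: "(1 + \<delta>)\<^sup>2 * (Q - 1 + \<delta>) \<le> e"
  and B: "(\<integral>\<^sup>+x. ennreal (norm (heat_conv a f x) powr r * exp (4 * pi * (1 - \<delta>) * (norm (heat_conv a f x))\<^sup>2)) \<partial>lborel) \<le> ennreal B"
 shows "(\<integral>\<^sup>+x. ennreal (norm (heat_conv a f x) powr r * exp (4 * pi * Q * (norm (heat_conv a f x))\<^sup>2)) \<partial>lborel)
  \<le> ennreal (exp ((Q - 1 + \<delta>) * (4 * (1 + 1 / \<mu>\<^sup>2) + 4 * pi * (1 + 1 / \<delta>) * (12 * kernel_const)\<^sup>2)) * B * \<gamma> powr (4 * e))"
proof -
 define F where "F x = norm (heat_conv a f x)" for x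
 define c where "c = 12 * kernel_const"
 define L where "L = 1 + 1 / \<mu>\<^sup>2"
 have F0: "F x \<ge> 0" for x by (simp add: F_def)
 have [measurable]: "F \<in> borel_measurable borel" unfolding F_def by measurable
 \<comment> \<open>The reference time at which \<open>\<gamma> * a0 powr (1/4) = 1\<close>, so that
   the smoothing error is a constant independent of \<gamma>.\<close>
 define a0 where "a0 = 1 / \<gamma> ^ 4"
 have g4: "\<gamma> ^ 4 \<ge> 1" using \<gamma>1 by (simp add: one_le_power)
 have a0: "a0 > 0" "a < a0" using \<gamma>1 a by (auto simp: a0_def field_simps)
 have lg: "ln \<gamma> \<ge> 0" using \<gamma>1 by simp
 have sup: "4 * pi * (F x)\<^sup>2 \<le> (1 + \<delta>)\<^sup>2 * (4 * ln \<gamma>) + (4 * L + 4 * pi * (1 + 1 / \<delta>) * c\<^sup>2)" for x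
 proof -
  define A where "A = norm (heat_conv a0 f x)"
  have "A\<^sup>2 \<le> (1 + \<delta> / 8) * ((ln (1 + 1 / (2 * a0)) + 1 / \<mu>\<^sup>2) / (4 * pi))"
   unfolding A_def by (rule heat_conv_point[OF \<mu> a0(1) \<sigma>])
  also have "... \<le> (1 + \<delta>) * ((4 * ln \<gamma> + L) / (4 * pi))"
  proof (intro mult_mono divide_right_mono)
   have "1 + 1 / (2 * a0) \<le> 2 * \<gamma> ^ 4" using g4 by (simp add: a0_def)
   moreover have "0 < 1 + 1 / (2 * a0)" using a0 by (intro add_pos_pos) auto
   ultimately have "ln (1 + 1 / (2 * a0)) \<le> ln (2 * \<gamma> ^ 4)" using g4 by (subst ln_le_cancel_iff) linarith+
   also have "... = ln 2 + 4 * ln \<gamma>" using \<gamma>1 by (simp add: ln_mult ln_realpow)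
   also have "ln 2 \<le> (1::real)" using ln_le_minus_one[of 2] by simp
   finally show "ln (1 + 1 / (2 * a0)) + 1 / \<mu>\<^sup>2 \<le> 4 * ln \<gamma> + L" by (simp add: L_def)
   show "0 \<le> (ln (1 + 1 / (2 * a0)) + 1 / \<mu>\<^sup>2) / (4 * pi)" using a0 by (intro divide_nonneg_nonneg add_nonneg_nonneg) auto
  qed (use \<delta> in auto)
  finally have A: "4 * pi * A\<^sup>2 \<le> (1 + \<delta>) * (4 * ln \<gamma> + L)" by (simp add: field_simps)
  have "\<gamma> * a0 powr (1/4) = 1"
  proof -
   have "a0 = (1 / \<gamma>) powr 4" using \<gamma>1 by (simp add: a0_def power_divide)
   then have "a0 powr (1/4) = 1 / \<gamma>" using \<gamma>1 by (simp only: powr_powr) simp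
   then show ?thesis using \<gamma>1 by simp
  qed
  then have "c * \<gamma> * a0 powr (1/4) = c" by (simp add: mult.assoc)
  then have "norm (heat_conv a0 f x - heat_conv a f x) \<le> c"
   using heat_conv_difference[OF a(1) a0(2), of x] unfolding c_def[symmetric] by (simp only:)
  then have "F x \<le> A + c"
   using norm_triangle_ineq2[of "heat_conv a f x" "heat_conv a0 f x"] by (simp add: F_def A_def norm_minus_commute)
  then have "(F x)\<^sup>2 \<le> (A + c)\<^sup>2" using F0[of x] by (intro power_mono)
  \<comment> \<open>Young's inequality with parameter \<delta>: the main term is inflated by
    \<open>1 + \<delta>\<close> only, the error term carries the large constant.\<close>
  also have "... \<le> (1 + \<delta>) * A\<^sup>2 + (1 + 1 / \<delta>) * c\<^sup>2"
  proof -
   have "0 \<le> (\<delta> * A - c)\<^sup>2 / \<delta>" using \<delta> by simp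
   also have "... = \<delta> * A\<^sup>2 + c\<^sup>2 / \<delta> - 2 * A * c" using \<delta> by (simp add: power2_eq_square field_simps)
   finally show ?thesis by (simp add: power2_eq_square algebra_simps)
  qed
  finally have "4 * pi * (F x)\<^sup>2 \<le> 4 * pi * ((1 + \<delta>) * A\<^sup>2 + (1 + 1 / \<delta>) * c\<^sup>2)" by (intro mult_left_mono) auto
  also have "... = (1 + \<delta>) * (4 * pi * A\<^sup>2) + 4 * pi * (1 + 1 / \<delta>) * c\<^sup>2" by (simp add: algebra_simps)
  also have "(1 + \<delta>) * (4 * pi * A\<^sup>2) \<le> (1 + \<delta>) * ((1 + \<delta>) * (4 * ln \<gamma> + L))" using A \<delta> by (intro mult_left_mono) auto
  also have "... = (1 + \<delta>)\<^sup>2 * (4 * ln \<gamma>) + (1 + \<delta>)\<^sup>2 * L" by (simp add: power2_eq_square algebra_simps)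
  also have "(1 + \<delta>)\<^sup>2 * L \<le> 4 * L"
  proof (intro mult_right_mono)
   have "(1 + \<delta>)\<^sup>2 \<le> 2\<^sup>2" using \<delta> by (intro power_mono) auto
   then show "(1 + \<delta>)\<^sup>2 \<le> 4" by simp
  qed (simp add: L_def add_nonneg_nonneg)
  finally show ?thesis by simp
 qed
 let ?E = "exp ((Q - 1 + \<delta>) * (4 * L + 4 * pi * (1 + 1 / \<delta>) * c\<^sup>2)) * \<gamma> powr (4 * e)"
 have big: "exp (4 * pi * Q * (F x)\<^sup>2) \<le> ?E * exp (4 * pi * (1 - \<delta>) * (F x)\<^sup>2)" for x
 proof -
  have "exp (4 * pi * Q * (F x)\<^sup>2) = exp ((Q - 1 + \<delta>) * (4 * pi * (F x)\<^sup>2)) * exp (4 * pi * (1 - \<delta>) * (F x)\<^sup>2)"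
   unfolding exp_add[symmetric] by (simp add: algebra_simps)
  also have "... \<le> ?E * exp (4 * pi * (1 - \<delta>) * (F x)\<^sup>2)"
  proof (intro mult_right_mono)
   have "(Q - 1 + \<delta>) * (4 * pi * (F x)\<^sup>2) \<le> (Q - 1 + \<delta>) * ((1 + \<delta>)\<^sup>2 * (4 * ln \<gamma>) + (4 * L + 4 * pi * (1 + 1 / \<delta>) * c\<^sup>2))"
    using sup[of x] Q \<delta> by (intro mult_left_mono) auto
   also have "... = ((1 + \<delta>)\<^sup>2 * (Q - 1 + \<delta>)) * (4 * ln \<gamma>) + (Q - 1 + \<delta>) * (4 * L + 4 * pi * (1 + 1 / \<delta>) * c\<^sup>2)"
    by (simp add: distrib_left mult_ac)
   also have "... \<le> e * (4 * ln \<gamma>) + (Q - 1 + \<delta>) * (4 * L + 4 * pi * (1 + 1 / \<delta>) * c\<^sup>2)"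
    using PQ lg by (intro add_right_mono mult_right_mono) auto
   finally have "exp ((Q - 1 + \<delta>) * (4 * pi * (F x)\<^sup>2)) \<le> exp (e * (4 * ln \<gamma>) + (Q - 1 + \<delta>) * (4 * L + 4 * pi * (1 + 1 / \<delta>) * c\<^sup>2))"
    by (subst exp_le_cancel_iff)
   also have "... = ?E" using \<gamma>1 unfolding exp_add powr_def by (simp add: mult_ac)
   finally show "exp ((Q - 1 + \<delta>) * (4 * pi * (F x)\<^sup>2)) \<le> ?E" .
  qed simp
  finally show ?thesis .
 qed
 have "(\<integral>\<^sup>+x. ennreal (F x powr r * exp (4 * pi * Q * (F x)\<^sup>2)) \<partial>lborel)
  \<le> (\<integral>\<^sup>+x. ennreal ?E * ennreal (F x powr r * exp (4 * pi * (1 - \<delta>) * (F x)\<^sup>2)) \<partial>lborel)"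
 proof (intro nn_integral_mono)
  fix x
  have "F x powr r * exp (4 * pi * Q * (F x)\<^sup>2) \<le> F x powr r * (?E * exp (4 * pi * (1 - \<delta>) * (F x)\<^sup>2))"
   by (intro mult_left_mono big) simp
  then have "ennreal (F x powr r * exp (4 * pi * Q * (F x)\<^sup>2)) \<le> ennreal (?E * (F x powr r * exp (4 * pi * (1 - \<delta>) * (F x)\<^sup>2)))"
   by (intro ennreal_leI) (simp only: mult_ac)
  also have "... = ennreal ?E * ennreal (F x powr r * exp (4 * pi * (1 - \<delta>) * (F x)\<^sup>2))" by (rule ennreal_mult) auto
  finally show "ennreal (F x powr r * exp (4 * pi * Q * (F x)\<^sup>2)) \<le> ennreal ?E * ennreal (F x powr r * exp (4 * pi * (1 - \<delta>) * (F x)\<^sup>2))" .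
 qed
 also have "... = ennreal ?E * (\<integral>\<^sup>+x. ennreal (F x powr r * exp (4 * pi * (1 - \<delta>) * (F x)\<^sup>2)) \<partial>lborel)"
  by (rule nn_integral_cmult) measurable
 also have "... \<le> ennreal ?E * ennreal B" unfolding F_def by (intro mult_left_mono B) simp
 also have "... = ennreal (?E * B)" by (intro ennreal_mult'[symmetric]) simp
 finally show ?thesis unfolding F_def c_def L_def by (simp only: mult_ac)
qed

text \<open>Fatou's lemma along the times \<open>1 / Suc n\<close>, which eventually lie below
  \<open>a0\<close>.\<close>

lemma estimate_passes_to_limit:
 assumes a0: "a0 > 0" and s: "r > 0"
  and b: "\<And>a. 0 < a ==> a < a0 ==> (\<integral>\<^sup>+x. ennreal (norm (heat_conv a f x) powr r * exp (c * (norm (heat_conv a f x))\<^sup>2)) \<partial>lborel) \<le> B"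
 shows "(\<integral>\<^sup>+x. ennreal (norm (f x) powr r * exp (c * (norm (f x))\<^sup>2)) \<partial>lborel) \<le> B"
proof -
 let ?u = "\<lambda>n x. ennreal (norm (heat_conv (1 / Suc n) f x) powr r * exp (c * (norm (heat_conv (1 / Suc n) f x))\<^sup>2))"
 have "(\<integral>\<^sup>+x. ennreal (norm (f x) powr r * exp (c * (norm (f x))\<^sup>2)) \<partial>lborel) = (\<integral>\<^sup>+x. liminf (\<lambda>n. ?u n x) \<partial>lborel)"
 proof (rule nn_integral_cong_AE)
  show "AE x in lborel. ennreal (norm (f x) powr r * exp (c * (norm (f x))\<^sup>2)) = liminf (\<lambda>n. ?u n x)"
   using heat_conv_tendsto_AE
  proof eventually_elim
   case (elim x)
   have p: "(\<lambda>n. norm (heat_conv (1 / Suc n) f x) powr r) \<longlonglongrightarrow> norm (f x) powr r"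
    by (rule tendsto_powr'[OF tendsto_norm[OF elim] tendsto_const]) (use s in auto)
   have "(\<lambda>n. ?u n x) \<longlonglongrightarrow> ennreal (norm (f x) powr r * exp (c * (norm (f x))\<^sup>2))"
    by (intro tendsto_ennrealI tendsto_mult p tendsto_exp tendsto_const tendsto_power tendsto_norm elim)
   then show ?case by (rule lim_imp_Liminf[OF trivial_limit_sequentially, symmetric])
  qed
 qed
 also have "... \<le> liminf (\<lambda>n. \<integral>\<^sup>+x. ?u n x \<partial>lborel)" by (rule nn_integral_liminf) measurable
 also have "... \<le> B"
 proof (rule Liminf_le)
  have "(\<lambda>n. 1 / real (Suc n)) \<longlonglongrightarrow> 0" using LIMSEQ_Suc[OF lim_1_over_n] by (simp add: inverse_eq_divide)
  then have "\<forall>\<^sub>F n in sequentially. 1 / real (Suc n) < a0" using a0 by (rule order_tendstoD(2))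
  then show "\<forall>\<^sub>F n in sequentially. (\<integral>\<^sup>+x. ?u n x \<partial>lborel) \<le> B" by eventually_elim (rule b, simp_all)
 qed simp
 finally show ?thesis .
qed

end

section \<open>From the defining norms to the fixed time estimate\<close>

lemma norm_vec_sq: "(norm (v :: 'a::real_normed_vector ^ 'n))\<^sup>2 = (\<Sum>j\<in>UNIV. (norm (v $ j))\<^sup>2)"
 by (simp add: norm_vec_def L2_set_def sum_nonneg)

text \<open>The two distributional identities are tested with translates of \<open>dheat\<close> and
  \<open>heat\<close>, and all functions are replaced by Borel representatives. Strictness of
  \<open>N > 1\<close> is what extracts an actual gradient from the infimum.\<close>

lemma obtain_sobolev_pair:
 assumes f: "f \<in> borel_measurable lebesgue" and fM: "(Lnorm 2 f)\<^sup>2 = ennreal M" "M \<ge> 0"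
  and H1: "H1dot_norm f \<le> 1" and N: "N > 1"
  and g: "is_multiplier bracket f g" and \<gamma>: "Lnorm 4 g = ennreal \<gamma>" "\<gamma> \<ge> 0"
 obtains f' g' G' where "sobolev_pair f' g' G' M N \<gamma>" "AE x in lborel. f x = f' x"
proof -
 have "1 < sqrt N" using N by simp
 then have "(1::ennreal) < ennreal (sqrt N)" by (simp flip: ennreal_1 add: ennreal_less_iff)
 then have "H1dot_norm f < ennreal (sqrt N)" using H1 by (rule le_less_trans[rotated])
 then obtain G where G: "is_gradient f G" "Lnorm 2 G < ennreal (sqrt N)"
  unfolding H1dot_norm_def Inf_less_iff by auto
 have Gm: "G \<in> borel_measurable lebesgue" and Gt: "\<And>j. tempered_eq (\<lambda>x. G x $ j) f (\<lambda>\<phi> x. - partial j \<phi> x)"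
  using G(1) by (auto simp: is_gradient_def)
 have gm: "g \<in> borel_measurable lebesgue" and gt: "tempered_eq g f (mult_op (\<lambda>\<xi>. bracket (- \<xi>)))"
  using g by (auto simp: is_multiplier_def)
 have Gj: "(\<lambda>x. G x $ j) \<in> borel_measurable lebesgue" for j
  by (rule borel_measurable_continuous_on[OF _ Gm]) (intro continuous_intros)
 obtain f' where f' [measurable]: "f' \<in> borel_measurable borel" and fe: "AE x in lborel. f x = f' x"
  using lebesgue_borel_representative[OF f] .
 obtain g' where g' [measurable]: "g' \<in> borel_measurable borel" and ge: "AE x in lborel. g x = g' x"
  using lebesgue_borel_representative[OF gm] .
 have "\<forall>j. \<exists>G'. G' \<in> borel_measurable borel \<and> (AE x in lborel. G x $ j = G' x)"
  using lebesgue_borel_representative[OF Gj] by metis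
 then obtain G' where G' [measurable]: "\<And>j. G' j \<in> borel_measurable borel" and Ge: "\<And>j. AE x in lborel. G x $ j = G' j x"
  by metis
 have "sobolev_pair f' g' G' M N \<gamma>"
 proof
  have "(\<integral>\<^sup>+y. ennreal ((norm (f' y))\<^sup>2) \<partial>lborel) = (\<integral>\<^sup>+y. ennreal ((norm (f y))\<^sup>2) \<partial>lborel)"
   by (rule nn_integral_cong_AE) (use fe in \<open>auto elim!: eventually_mono\<close>)
  also have "... = (Lnorm 2 f)\<^sup>2" by (rule Lnorm_numeral_pow[symmetric])
  finally show "(\<integral>\<^sup>+y. ennreal ((norm (f' y))\<^sup>2) \<partial>lborel) = ennreal M" using fM by simp
  have "(\<integral>\<^sup>+y. ennreal (norm (g' y) ^ 4) \<partial>lborel) = (\<integral>\<^sup>+y. ennreal (norm (g y) ^ 4) \<partial>lborel)"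
   by (rule nn_integral_cong_AE) (use ge in \<open>auto elim!: eventually_mono\<close>)
  also have "... = (Lnorm 4 g) ^ 4" by (rule Lnorm_numeral_pow[symmetric])
  finally show "(\<integral>\<^sup>+y. ennreal (norm (g' y) ^ 4) \<partial>lborel) = ennreal (\<gamma> ^ 4)" using \<gamma> by (simp add: ennreal_power)
  have "(\<Sum>j\<in>UNIV. \<integral>\<^sup>+y. ennreal ((norm (G' j y))\<^sup>2) \<partial>lborel) = (\<integral>\<^sup>+y. (\<Sum>j\<in>UNIV. ennreal ((norm (G' j y))\<^sup>2)) \<partial>lborel)"
   by (rule nn_integral_sum[symmetric]) measurable
  also have "... = (\<integral>\<^sup>+y. ennreal ((norm (G y))\<^sup>2) \<partial>lborel)"
  proof (rule nn_integral_cong_AE)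
   have "AE y in lborel. \<forall>j. G y $ j = G' j y" using Ge by (simp add: AE_all_countable)
   then show "AE y in lborel. (\<Sum>j\<in>UNIV. ennreal ((norm (G' j y))\<^sup>2)) = ennreal ((norm (G y))\<^sup>2)"
    by eventually_elim (simp add: norm_vec_sq)
  qed
  also have "... = (Lnorm 2 G)\<^sup>2" by (rule Lnorm_numeral_pow[symmetric])
  also have "... \<le> (ennreal (sqrt N))\<^sup>2" using G(2) by (intro power_mono) auto
  also have "... = ennreal N" using N by (simp add: ennreal_power)
  finally show "(\<Sum>j\<in>UNIV. \<integral>\<^sup>+y. ennreal ((norm (G' j y))\<^sup>2) \<partial>lborel) \<le> ennreal N" .
  fix b :: real and x :: "real^2" assume b: "b > 0"
  let ?\<phi> = "\<lambda>j y. complex_of_real (dheat j b (y - x))"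
  have t: "integrable lebesgue (\<lambda>y. f y * - partial j (?\<phi> j) y)" "(LINT y|lebesgue. G y $ j * ?\<phi> j y) = (LINT y|lebesgue. f y * - partial j (?\<phi> j) y)" for j
   by (rule bspec[OF Gt[of j, unfolded tempered_eq_def] heat_schwartz(2)[OF b], THEN conjunct2, THEN conjunct1]
    bspec[OF Gt[of j, unfolded tempered_eq_def] heat_schwartz(2)[OF b], THEN conjunct2, THEN conjunct2])+
  have "(\<Sum>j\<in>UNIV. LINT y|lborel. G' j y * ?\<phi> j y) = (\<Sum>j\<in>UNIV. LINT y|lebesgue. G y $ j * ?\<phi> j y)"
   by (intro sum.cong refl integral_lebesgue_representative[symmetric] Gj Ge) measurable
  also have "... = (\<Sum>j\<in>UNIV. LINT y|lebesgue. f y * - partial j (?\<phi> j) y)" by (simp only: t)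
  also have "... = (LINT y|lebesgue. (\<Sum>j\<in>UNIV. f y * - partial j (?\<phi> j) y))"
   by (rule Bochner_Integration.integral_sum[symmetric]) (rule t)
  also have "... = (LINT y|lebesgue. f y * complex_of_real (- lheat b (y - x)))"
   unfolding sum_distrib_left[symmetric] sum_negf heat_schwartz(4)[OF b] by simp
  also have "... = (LINT y|lborel. f' y * complex_of_real (- lheat b (y - x)))"
   by (intro integral_lebesgue_representative f fe) measurable
  also have "... = - (LINT y|lborel. f' y * complex_of_real (lheat b (y - x)))" by simp
  finally show "(\<Sum>j\<in>UNIV. LINT y|lborel. G' j y * ?\<phi> j y) = - (LINT y|lborel. f' y * complex_of_real (lheat b (y - x)))" .
  let ?h = "\<lambda>y. complex_of_real (heat b (y - x))"
  have "heat_conv b g' x = (LINT y|lebesgue. g y * ?h y)"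
   unfolding heat_conv_def by (intro integral_lebesgue_representative[symmetric] gm ge) measurable
  also have "... = (LINT y|lebesgue. f y * mult_op (\<lambda>\<xi>. bracket (- \<xi>)) ?h y)"
   by (rule bspec[OF gt[unfolded tempered_eq_def] heat_schwartz(1)[OF b], THEN conjunct2, THEN conjunct2])
  also have "... = (LINT y|lebesgue. f y * bracket_heat b (y - x))" unfolding mult_op_heat[OF b] ..
  also have "... = (LINT y|lborel. f' y * bracket_heat b (y - x))"
   by (intro integral_lebesgue_representative f fe) measurable
  finally show "heat_conv b g' x = (LINT y|lborel. f' y * bracket_heat b (y - x))" .
 qed (use N fM \<gamma> in auto)
 then show ?thesis using fe by (rule that)
qed

text \<open>The constant has to be fixed before the function: \<delta>, \<mu>, \<open>N\<close> and
  the directions \<Omega> depend on \<open>M\<close>, \<open>P\<close> and \<open>Q\<close> only.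
  The cases of small and of large \<gamma> use different exponent counts and are merged by a
  maximum.\<close>

lemma fixed_time_estimate:
 assumes M: "M > 0" and s: "s \<ge> 4" and P: "P \<ge> 1" and Q: "Q \<ge> 1" and PQ: "Q - 1 < Q / P"
 shows "\<exists>C>0. \<forall>(f :: real^2 \<Rightarrow> complex) g \<gamma>. f \<in> borel_measurable lebesgue --> H1dot_norm f \<le> 1 --> (Lnorm 2 f)\<^sup>2 = ennreal M -->
  is_multiplier bracket f g --> Lnorm 4 g = ennreal \<gamma> --> \<gamma> \<ge> 0 -->
  (\<integral>\<^sup>+x. ennreal (norm (f x) powr (s * Q) * exp (4 * pi * Q * (norm (f x))\<^sup>2)) \<partial>lborel) \<le> ennreal (C * \<gamma> powr (4 * Q / P))"
proof -
 \<comment> \<open>By continuity at 0 the strict inequality \<open>Q - 1 < Q / P\<close> tolerates a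
   small positive \<delta>.\<close>
 have "\<forall>\<^sub>F \<delta> in at_right 0. (1 + \<delta>)\<^sup>2 * (Q - 1 + \<delta>) < Q / P"
  by (rule order_tendstoD(2)[OF _ PQ]) (auto intro!: tendsto_eq_intros)
 moreover have "\<forall>\<^sub>F \<delta> in at_right 0. \<delta> \<in> {0<..<1::real}" by (rule eventually_at_right_real) simp
 ultimately have "\<forall>\<^sub>F \<delta> in at_right 0. (1 + \<delta>)\<^sup>2 * (Q - 1 + \<delta>) < Q / P \<and> \<delta> \<in> {0<..<1::real}" by (rule eventually_conj)
 then have "\<exists>\<delta>. (1 + \<delta>)\<^sup>2 * (Q - 1 + \<delta>) < Q / P \<and> \<delta> \<in> {0<..<1::real}"
  by (rule eventually_happens'[OF trivial_limit_at_right_real])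
 then obtain \<delta> :: real where "(1 + \<delta>)\<^sup>2 * (Q - 1 + \<delta>) < Q / P" "\<delta> \<in> {0<..<1}" by blast
 then have \<delta>: "(1 + \<delta>)\<^sup>2 * (Q - 1 + \<delta>) \<le> Q / P" "0 < \<delta>" "\<delta> < 1" by auto
 \<comment> \<open>Mass term and gradient bound each take \<open>\<delta> / 16\<close> of the energy
   budget \<open>1 + \<delta> / 8\<close>.\<close>
 define \<mu> where "\<mu> = sqrt (\<delta> / (16 * M))"
 define N where "N = 1 + \<delta> / 16"
 have \<mu>: "\<mu> > 0" and N: "N > 1" using M \<delta> by (auto simp: \<mu>_def N_def)
 have "\<mu>\<^sup>2 * M = \<delta> / 16" using M \<delta> by (simp add: \<mu>_def)
 then have \<sigma>: "\<mu>\<^sup>2 * M + N \<le> 1 + \<delta> / 8" by (simp add: N_def)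
 obtain \<Omega> :: "complex set" where \<Omega>: "finite \<Omega>" "\<And>w. w \<in> \<Omega> ==> norm w = 1" "\<And>z. \<exists>w\<in>\<Omega>. (1 - \<delta> / 16) * norm z \<le> Re (w * z)"
 proof -
  have "1 - \<delta> / 16 < 1" using \<delta> by simp
  then show ?thesis using finite_direction_net that by blast
 qed
 have "4 * 1 \<le> s * Q" using s Q by (intro mult_mono) auto
 then have sQ: "2 \<le> s * Q" "0 < s * Q" by auto
 define r where "r = s * Q"
 define B where "B = exp (4 * pi) * M + exp (- (r / 2) * ln (2 * (2 * pi * \<delta>) / r)) * (real (card \<Omega>) * ((4 * pi + M) * exp (1 + 1 / \<mu>\<^sup>2))) * exp (4 * pi) / (1 - exp (- (pi * \<delta>)))"
 define C1 where "C1 = (kernel_const + sqrt pi) powr (s * Q - 4) * exp (4 * pi * Q * (kernel_const + sqrt pi)\<^sup>2)"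
 define C2 where "C2 = exp ((Q - 1 + \<delta>) * (4 * (1 + 1 / \<mu>\<^sup>2) + 4 * pi * (1 + 1 / \<delta>) * (12 * kernel_const)\<^sup>2)) * B"
 define C where "C = max 1 (max C1 C2)"
 show ?thesis
 proof (intro exI[of _ C] conjI allI impI)
  show "C > 0" by (simp add: C_def)
  fix f :: "real^2 \<Rightarrow> complex" and g \<gamma>
  assume f: "f \<in> borel_measurable lebesgue" "H1dot_norm f \<le> 1" "(Lnorm 2 f)\<^sup>2 = ennreal M"
   and g: "is_multiplier bracket f g" "Lnorm 4 g = ennreal \<gamma>" "\<gamma> \<ge> 0"
  obtain f' g' G' where sp: "sobolev_pair f' g' G' M N \<gamma>" and fe: "AE x in lborel. f x = f' x"
   using obtain_sobolev_pair[OF f(1,3) less_imp_le[OF M] f(2) N g] .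
  have le: "C' \<le> C ==> ennreal (C' * \<gamma> powr (4 * Q / P)) \<le> ennreal (C * \<gamma> powr (4 * Q / P))" for C'
   by (intro ennreal_leI mult_right_mono) auto
  have "(\<integral>\<^sup>+x. ennreal (norm (f x) powr (s * Q) * exp (4 * pi * Q * (norm (f x))\<^sup>2)) \<partial>lborel)
   = (\<integral>\<^sup>+x. ennreal (norm (f' x) powr (s * Q) * exp (4 * pi * Q * (norm (f' x))\<^sup>2)) \<partial>lborel)"
   by (rule nn_integral_cong_AE) (use fe in \<open>auto elim!: eventually_mono\<close>)
  also have "... \<le> ennreal (C * \<gamma> powr (4 * Q / P))"
  proof (cases "\<gamma> \<le> 1")
   case True
   show ?thesis
   proof (rule sobolev_pair.estimate_passes_to_limit[OF sp zero_less_one sQ(2)])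
    fix a :: real assume a: "0 < a"
    have C1: "C1 \<le> C" by (simp add: C_def)
    show "(\<integral>\<^sup>+x. ennreal (norm (heat_conv a f' x) powr (s * Q) * exp (4 * pi * Q * (norm (heat_conv a f' x))\<^sup>2)) \<partial>lborel) \<le> ennreal (C * \<gamma> powr (4 * Q / P))"
     by (rule order_trans[OF sobolev_pair.heat_conv_estimate_small[OF sp a s P Q True, folded C1_def] le[OF C1]])
   qed
  next
   case False
   then have \<gamma>1: "\<gamma> \<ge> 1" by simp
   then have g4: "\<gamma> ^ 4 > 0" by simp
   show ?thesis
   proof (rule sobolev_pair.estimate_passes_to_limit[OF sp _ sQ(2)])
    show "0 < 1 / \<gamma> ^ 4" using g4 by simp
    fix a :: real assume a: "0 < a" "a < 1 / \<gamma> ^ 4"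
    then have a2: "a * \<gamma> ^ 4 < 1" using g4 by (simp add: field_simps)
    have "(\<integral>\<^sup>+x. ennreal (norm (heat_conv a f' x) powr (s * Q) * exp (4 * pi * Q * (norm (heat_conv a f' x))\<^sup>2)) \<partial>lborel) \<le> ennreal (C2 * \<gamma> powr (4 * (Q / P)))"
     unfolding C2_def B_def r_def
     by (rule sobolev_pair.heat_conv_estimate_large[OF sp a(1) a2 Q \<gamma>1 \<mu> \<delta>(2,3) \<sigma> \<delta>(1)
      sobolev_pair.heat_conv_exp_integral[OF sp \<mu> a(1) \<delta>(2,3) \<sigma> \<Omega> sQ(1)]])
    also have "... \<le> ennreal (C * \<gamma> powr (4 * Q / P))" using le[of C2] by (simp add: C_def)
    finally show "(\<integral>\<^sup>+x. ennreal (norm (heat_conv a f' x) powr (s * Q) * exp (4 * pi * Q * (norm (heat_conv a f' x))\<^sup>2)) \<partial>lborel) \<le> ennreal (C * \<gamma> powr (4 * Q / P))" .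
   qed
  qed
  finally show "(\<integral>\<^sup>+x. ennreal (norm (f x) powr (s * Q) * exp (4 * pi * Q * (norm (f x))\<^sup>2)) \<partial>lborel) \<le> ennreal (C * \<gamma> powr (4 * Q / P))" .
 qed
qed

lemma ennreal_cancel_mult: "c > 0 ==> ennreal c * (ennreal (1 / c) * x) = x"
 by (simp add: mult.assoc[symmetric] ennreal_mult[symmetric])

text \<open>Raised to the power \<open>P / (4 * Q)\<close> the estimate is linear in \<gamma>, so
  the infimum over all \<open>g\<close> in \<open>H1_norm\<close> can be taken; if there is no
  \<open>g\<close> the right side is \<open>\<infinity>\<close>. The fourth power then has the form
  that integrates in time.\<close>

lemma fixed_time_norm_estimate:
 assumes M: "M > 0" and s: "s \<ge> 4" and P: "P \<ge> 1" and Q: "Q \<ge> 1" and PQ: "Q - 1 < Q / P"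
 shows "\<exists>C>0. \<forall>f :: real^2 \<Rightarrow> complex. f \<in> borel_measurable lebesgue --> H1dot_norm f \<le> 1 --> (Lnorm 2 f)\<^sup>2 = ennreal M -->
  ennreal_pow (Lnorm (ennreal Q) (\<lambda>x. norm (f x) powr s * exp (4 * pi * (norm (f x))\<^sup>2))) P \<le> ennreal C * (H1_norm 4 f) ^ 4"
proof -
 from fixed_time_estimate[OF assms] obtain C where C: "C > 0" and
  all: "\<forall>(f :: real^2 \<Rightarrow> complex) g \<gamma>. f \<in> borel_measurable lebesgue --> H1dot_norm f \<le> 1 --> (Lnorm 2 f)\<^sup>2 = ennreal M -->
  is_multiplier bracket f g --> Lnorm 4 g = ennreal \<gamma> --> \<gamma> \<ge> 0 -->
  (\<integral>\<^sup>+x. ennreal (norm (f x) powr (s * Q) * exp (4 * pi * Q * (norm (f x))\<^sup>2)) \<partial>lborel) \<le> ennreal (C * \<gamma> powr (4 * Q / P))"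
  by (elim exE conjE) (rule that)
 note est = all[rule_format]
 define c where "c = C powr (P / (4 * Q))"
 have c: "c > 0" using C by (simp add: c_def)
 show ?thesis
 proof (intro exI[of _ "c ^ 4"] conjI allI impI)
  show "c ^ 4 > 0" using c by simp
  fix f :: "real^2 \<Rightarrow> complex"
  assume f: "f \<in> borel_measurable lebesgue" "H1dot_norm f \<le> 1" "(Lnorm 2 f)\<^sup>2 = ennreal M"
  let ?X = "\<integral>\<^sup>+x. ennreal (norm (f x) powr (s * Q) * exp (4 * pi * Q * (norm (f x))\<^sup>2)) \<partial>lborel"
  let ?L = "Lnorm (ennreal Q) (\<lambda>x. norm (f x) powr s * exp (4 * pi * (norm (f x))\<^sup>2))"
  define Y where "Y = ennreal_pow ?X (P / (4 * Q))"
  have X: "ennreal_pow ?L Q = ?X"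
  proof -
   have "ennreal_pow ?L Q = (\<integral>\<^sup>+x. ennreal_pow (ennreal (norm (norm (f x) powr s * exp (4 * pi * (norm (f x))\<^sup>2)))) Q \<partial>lborel)"
    using Q by (subst Lp_norm_pow) (auto simp: nn_integral_lebesgue)
   also have "... = ?X"
    using Q by (intro nn_integral_cong) (simp add: ennreal_pow_ennreal abs_mult powr_mult powr_powr exp_powr_real mult_ac)
   finally show ?thesis .
  qed
  have "ennreal (1 / c) * Y \<le> Lnorm 4 g" if g: "is_multiplier bracket f g" for g
  proof (cases "Lnorm 4 g")
   case (real \<gamma>)
   have "Y \<le> ennreal_pow (ennreal (C * \<gamma> powr (4 * Q / P))) (P / (4 * Q))"
    unfolding Y_def using P Q real by (intro ennreal_pow_mono est[OF f g]) auto
   also have "... = ennreal ((C * \<gamma> powr (4 * Q / P)) powr (P / (4 * Q)))"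
    using P Q C by (intro ennreal_pow_ennreal) auto
   also have "(C * \<gamma> powr (4 * Q / P)) powr (P / (4 * Q)) = c * \<gamma>"
    using P Q C real by (simp add: powr_mult powr_powr c_def)
   finally have "ennreal (1 / c) * Y \<le> ennreal (1 / c) * ennreal (c * \<gamma>)" by (intro mult_left_mono) auto
   also have "... = ennreal \<gamma>" using c real by (simp add: ennreal_mult[symmetric])
   finally show ?thesis using real by simp
  qed simp
  then have "ennreal (1 / c) * Y \<le> H1_norm 4 f" unfolding H1_norm_def by (intro Inf_greatest) auto
  then have "ennreal c * (ennreal (1 / c) * Y) \<le> ennreal c * H1_norm 4 f" by (rule mult_left_mono) simp
  then have "Y \<le> ennreal c * H1_norm 4 f" unfolding ennreal_cancel_mult[OF c] .
  then have "Y ^ 4 \<le> (ennreal c * H1_norm 4 f) ^ 4" by (rule power_mono) simp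
  moreover have "Y ^ 4 = ennreal_pow ?L P"
  proof -
   have "ennreal_pow ?L P = ennreal_pow ?L (Q * (P / Q))" using Q by simp
   also have "... = ennreal_pow ?X (P / Q)" unfolding X[symmetric] using P Q by (intro ennreal_pow_pow[symmetric]) auto
   also have "... = ennreal_pow ?X (P / (4 * Q) * 4)" by simp
   also have "... = ennreal_pow Y 4" unfolding Y_def using P Q by (intro ennreal_pow_pow[symmetric]) auto
   finally show ?thesis by (simp only: ennreal_pow_numeral)
  qed
  ultimately show "ennreal_pow ?L P \<le> ennreal (c ^ 4) * (H1_norm 4 f) ^ 4"
   using c by (simp add: power_mult_distrib ennreal_power)
 qed
qed

text \<open>The integrand will be a power of \<open>H1_norm\<close> as a function of time, whose
  measurability is not established. One inequality comes from the supremum over simple functions,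
  and applying it with \<open>1 / c\<close> gives the other.\<close>

lemma nn_integral_cmult_le:
 fixes h :: "'a \<Rightarrow> ennreal"
 assumes c: "c > 0"
 shows "(\<integral>\<^sup>+x. ennreal c * h x \<partial>N) \<le> ennreal c * (\<integral>\<^sup>+x. h x \<partial>N)"
proof -
 have ge: "ennreal d * (\<integral>\<^sup>+x. k x \<partial>N) \<le> (\<integral>\<^sup>+x. ennreal d * k x \<partial>N)" for d and k :: "'a \<Rightarrow> ennreal"
 proof -
  have "ennreal d * (\<integral>\<^sup>+x. k x \<partial>N) = (SUP g\<in>{g. simple_function N g \<and> g \<le> k}. ennreal d * integral\<^sup>S N g)"
   unfolding nn_integral_def by (rule SUP_mult_left_ennreal)
  also have "... \<le> (\<integral>\<^sup>+x. ennreal d * k x \<partial>N)"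
  proof (rule SUP_least)
   fix g assume g: "g \<in> {g. simple_function N g \<and> g \<le> k}"
   then have "ennreal d * integral\<^sup>S N g = ennreal d * (\<integral>\<^sup>+x. g x \<partial>N)" by (simp add: nn_integral_eq_simple_integral)
   also have "... = (\<integral>\<^sup>+x. ennreal d * g x \<partial>N)"
    using g by (intro nn_integral_cmult[symmetric]) (auto intro: borel_measurable_simple_function)
   also have "... \<le> (\<integral>\<^sup>+x. ennreal d * k x \<partial>N)"
    using g by (intro nn_integral_mono mult_left_mono) (auto simp: le_fun_def)
   finally show "ennreal d * integral\<^sup>S N g \<le> (\<integral>\<^sup>+x. ennreal d * k x \<partial>N)" .
  qed
  finally show ?thesis .
 qed
 have c': "1 / c > 0" using c by simp
 have "ennreal (1 / c) * (\<integral>\<^sup>+x. ennreal c * h x \<partial>N) \<le> (\<integral>\<^sup>+x. h x \<partial>N)"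
  using ge[of "1 / c" "\<lambda>x. ennreal c * h x"] ennreal_cancel_mult[OF c'] by simp
 then have "ennreal c * (ennreal (1 / c) * (\<integral>\<^sup>+x. ennreal c * h x \<partial>N)) \<le> ennreal c * (\<integral>\<^sup>+x. h x \<partial>N)"
  by (rule mult_left_mono) simp
 then show ?thesis unfolding ennreal_cancel_mult[OF c] .
qed

text \<open>An infinite exponent would make one reciprocal 0 and leave the other at most 1, so both
  exponents are finite and the fixed time bound can be integrated.\<close>

lemma estimate_holds:
 fixes M s :: real and p q :: ennreal
 assumes M: "M > 0" and s: "s \<ge> 4" and p: "1 \<le> p" and q: "1 \<le> q"
  and pq: "enn2real (inverse p) + enn2real (inverse q) > 1"
 shows "\<exists>C>0. \<forall>u. admissible M u -->
  mixed_norm p q (\<lambda>t x. norm (u t x) powr s * exp (4 * pi * (norm (u t x))\<^sup>2))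
   \<le> ennreal C * ennreal_pow (Lp_norm 4 lebesgue (\<lambda>t::real. H1_norm 4 (u t))) (enn2real (4 / p))"
 using p
proof (cases p rule: ennreal_ge_one_cases)
 case top
 note p = this
 show ?thesis using q
 proof (cases q rule: ennreal_ge_one_cases)
  case top
  then show ?thesis using pq p by simp
 next
  case (real Q)
  then have "1 / Q \<le> 1" by simp
  then show ?thesis using pq p real by simp
 qed
next
 case (real P)
 note P = this
 show ?thesis using q
 proof (cases q rule: ennreal_ge_one_cases)
  case top
  then show ?thesis using pq P by auto
 next
  case (real Q)
  note Q = this
  have "1 / P + 1 / Q > 1" using pq P Q by simp
  then have "Q * 1 < Q * (1 / P + 1 / Q)" using Q by (intro mult_strict_left_mono) auto
  \<comment> \<open>The condition on the exponents after multiplication by \<open>Q\<close>; in this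
    form it provides the margin for \<delta>.\<close>
  then have "Q - 1 < Q / P" using Q by (simp add: distrib_left)
  from fixed_time_norm_estimate[OF M s P(1) Q(1) this] obtain C where C: "C > 0" and
   all: "\<forall>f :: real^2 \<Rightarrow> complex. f \<in> borel_measurable lebesgue --> H1dot_norm f \<le> 1 --> (Lnorm 2 f)\<^sup>2 = ennreal M -->
   ennreal_pow (Lnorm (ennreal Q) (\<lambda>x. norm (f x) powr s * exp (4 * pi * (norm (f x))\<^sup>2))) P \<le> ennreal C * (H1_norm 4 f) ^ 4"
   by (elim exE conjE) (rule that)
  note est = all[rule_format]
  show ?thesis
  proof (intro exI[of _ "C powr (1 / P)"] conjI allI impI)
   show "C powr (1 / P) > 0" using C by simp
   fix u :: "real \<Rightarrow> real^2 \<Rightarrow> complex"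
   assume u: "admissible M u"
   let ?I = "\<integral>\<^sup>+t. (H1_norm 4 (u t)) ^ 4 \<partial>lebesgue"
   have "mixed_norm p q (\<lambda>t x. norm (u t x) powr s * exp (4 * pi * (norm (u t x))\<^sup>2))
    = ennreal_pow (\<integral>\<^sup>+t. ennreal_pow (Lnorm (ennreal Q) (\<lambda>x. norm (u t x) powr s * exp (4 * pi * (norm (u t x))\<^sup>2))) P \<partial>lebesgue) (1 / P)"
    using P Q by (simp add: mixed_norm_def Lp_norm_def)
   also have "... \<le> ennreal_pow (\<integral>\<^sup>+t. ennreal C * (H1_norm 4 (u t)) ^ 4 \<partial>lebesgue) (1 / P)"
    using u P by (intro ennreal_pow_mono nn_integral_mono est) (auto simp: admissible_def)
   also have "... \<le> ennreal_pow (ennreal C * ?I) (1 / P)"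
    using P by (intro ennreal_pow_mono nn_integral_cmult_le C) auto
   also have "... = ennreal (C powr (1 / P)) * ennreal_pow ?I (1 / P)" using C P by (intro ennreal_pow_cmult) auto
   also have "ennreal_pow ?I (1 / P) = ennreal_pow (Lp_norm 4 lebesgue (\<lambda>t. H1_norm 4 (u t))) (enn2real (4 / p))"
   proof -
    have "4 / p = ennreal (4 / P)" unfolding P(2) ennreal_numeral[symmetric] using P(1) by (intro divide_ennreal) auto
    then have e: "enn2real (4 / p) = 4 / P" using P by simp
    have "Lp_norm 4 lebesgue (\<lambda>t. H1_norm 4 (u t)) = ennreal_pow ?I (1 / 4)"
     by (simp add: Lp_norm_def ennreal_pow_numeral)
    then show ?thesis unfolding e using P by (simp add: ennreal_pow_pow)
   qed
   finally show "mixed_norm p q (\<lambda>t x. norm (u t x) powr s * exp (4 * pi * (norm (u t x))\<^sup>2))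
    \<le> ennreal (C powr (1 / P)) * ennreal_pow (Lp_norm 4 lebesgue (\<lambda>t::real. H1_norm 4 (u t))) (enn2real (4 / p))" .
  qed
 qed
qed

theorem theorem1p4:
  fixes M s :: real and p q :: ennreal
  assumes "M > 0" and "s \<ge> 4" and "1 \<le> p" and "1 \<le> q"
  shows "(holder_conj q / p > 1 \<longrightarrow>
           (\<exists>C>0. \<forall>u. admissible M u \<longrightarrow>
              mixed_norm p q (\<lambda>t x. norm (u t x) powr s * exp (4 * pi * (norm (u t x))\<^sup>2))
                \<le> ennreal C * ennreal_pow (Lp_norm 4 lebesgue (\<lambda>t::real. H1_norm 4 (u t)))
                                           (enn2real (4 / p)))) \<and>
         ((\<exists>C>0. \<forall>u. admissible M u \<longrightarrow>
              mixed_norm p q (\<lambda>t x. norm (u t x) powr s * exp (4 * pi * (norm (u t x))\<^sup>2))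
                \<le> ennreal C * ennreal_pow (Lp_norm 4 lebesgue (\<lambda>t::real. H1_norm 4 (u t)))
                                           (enn2real (4 / p))) \<longrightarrow>
           holder_conj q / p > 1)"
proof (intro conjI impI)
 assume "holder_conj q / p > 1"
 then have "enn2real (inverse p) + enn2real (inverse q) > 1" using holder_conj_iff[OF assms(3,4)] by simp
 then show "\<exists>C>0. \<forall>u. admissible M u \<longrightarrow>
   mixed_norm p q (\<lambda>t x. norm (u t x) powr s * exp (4 * pi * (norm (u t x))\<^sup>2))
    \<le> ennreal C * ennreal_pow (Lp_norm 4 lebesgue (\<lambda>t::real. H1_norm 4 (u t))) (enn2real (4 / p))"
  by (rule estimate_holds[OF assms])
next
 assume "\<exists>C>0. \<forall>u. admissible M u \<longrightarrow>
   mixed_norm p q (\<lambda>t x. norm (u t x) powr s * exp (4 * pi * (norm (u t x))\<^sup>2))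
    \<le> ennreal C * ennreal_pow (Lp_norm 4 lebesgue (\<lambda>t::real. H1_norm 4 (u t))) (enn2real (4 / p))"
 then obtain C where C: "C > 0" and bound: "\<And>u. admissible M u \<Longrightarrow>
   mixed_norm p q (\<lambda>t x. norm (u t x) powr s * exp (4 * pi * (norm (u t x))\<^sup>2))
    \<le> ennreal C * ennreal_pow (Lp_norm 4 lebesgue (\<lambda>t::real. H1_norm 4 (u t))) (enn2real (4 / p))"
  by auto
 have "s > 0" using assms(2) by simp
 show "holder_conj q / p > 1"
 proof (rule ccontr)
  assume "\<not> holder_conj q / p > 1"
  then have "enn2real (inverse p) + enn2real (inverse q) \<le> 1" using holder_conj_iff[OF assms(3,4)] by simp
  from estimate_fails[OF assms(1) \<open>s > 0\<close> assms(3,4) C this bound] show False .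
 qed
qed

end
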